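(* Let $P$ be a non-empty set of prime numbers, $G$ a pro-$P$ group, $\Omega\cong\mathbb Z_P=\prod_{p\in P}\mathbb Z_p$ with a fixed topological generator $\omega$, and $d:G\to\Omega$ a surjective continuous homomorphism. Let $\mathfrak E=\mathrm{Sp}(G)^{\mathrm f}$, $\mathfrak M=\mathrm{Grp}(G)^{\mathrm f}$, $C:\mathfrak M\to\mathsf{Ab}$ a cohomological Mackey functor and $v\in\mathrm{Val}_d^{\langle\omega\rangle,\omega}(C)$. Suppose that: (i) $C$ satisfies the class field axiom for all pairs $(H,U)$ with $H$ an open subgroup of $G$ and $U$ an open normal subgroup of $H$ with $I_H\le U$, and for all such pairs of open subgroups $U\lhd H$ with $H/U$ cyclic of prime order and $f_{H|U}=1$; (ii) $C$ has $(H,U)$-Galois descent for all pairs $(H,U)$ with $H$ open in $G$ and $U$ open normal in $H$ with $I_H\le U$; (iii) $\Upsilon_{(H,U)}$ is injective for all pairs of open subgroups $U\lhd H$ of $G$ with $H/U$ cyclic of prime order and $f_{H|U}=1$ (where $\Upsilon$ is the Fesenko--Neukirch morphism of $(C,v)$, which is defined by the first part of the conclusion). Then $(C,v)$ is a Fesenko--Neukirch datum on $\mathfrak E$, and $\Upsilon:\pi_{\mathfrak K}\to\widehat{\mathrm H}^0_{\mathfrak E}(C)$ is a $\mathfrak K$-class field theory for $\mathfrak K=\mathfrak K(G)^{\mathrm f}_{\mathrm{ab}}$.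
   Context: ${}^gH=gHg^{-1}$, $H^g=g^{-1}Hg$; $\langle h\rangle_{\mathrm c}$ is the closure of $\langle h\rangle$; $\langle\omega\rangle\cong\mathbb Z$ is the abstract subgroup of $\Omega$ generated by $\omega$. Cohomological Mackey functors on $\mathfrak M=\mathrm{Grp}(G)^{\mathrm f}$. Such a functor $C$ assigns to each open subgroup $H\le G$ an abelian group $C(H)$ (written multiplicatively), and to open subgroups $I\le H$ and $g\in G$ homomorphisms $\mathrm{res}_{I,H}:C(H)\to C(I)$, $\mathrm{ind}_{H,I}:C(I)\to C(H)$, $\mathrm{con}_{g,H}:C(H)\to C({}^gH)$ such that: $\mathrm{res}_{H,H}=\mathrm{ind}_{H,H}=\mathrm{con}_{h,H}=\mathrm{id}$ for $h\in H$; res and ind are transitive, $\mathrm{con}_{g',{}^gH}\mathrm{con}_{g,H}=\mathrm{con}_{g'g,H}$; con commutes with res and ind ($\mathrm{con}_{g,I}\mathrm{res}_{I,H}=\mathrm{res}_{{}^gI,{}^gH}\mathrm{con}_{g,H}$, $\mathrm{con}_{g,H}\mathrm{ind}_{H,I}=\mathrm{ind}_{{}^gH,{}^gI}\mathrm{con}_{g,I}$); the Mackey formula $\mathrm{res}_{I,H}\mathrm{ind}_{H,J}=\prod_{h\in I\backslash H/J}\mathrm{ind}_{I,I\cap{}^hJ}\,\mathrm{con}_{h,I^h\cap J}\,\mathrm{res}_{I^h\cap J,J}$ holds; and $\mathrm{ind}_{H,I}\mathrm{res}_{I,H}$ is the $[H:I]$-th power map. Galois descent and class field axiom. For $U\lhd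 H$ open, $C$ has $(H,U)$-Galois descent if $\mathrm{res}_{U,H}$ is an isomorphism of $C(H)$ onto $C(U)^{H/U}$ ($H/U$ acting on $C(U)$ by con). $C$ satisfies the class field axiom for $(H,U)$ if $|C(H)/\mathrm{ind}_{H,U}C(U)|=[H:U]$ and $\ker(\mathrm{ind}_{H,U})$ is generated by the elements $\mathrm{con}_{h,U}(x)x^{-1}$, $h\in H$, $x\in C(U)$. The spectrum $\mathfrak E=\mathrm{Sp}(G)^{\mathrm f}$. $\mathfrak E_{\mathrm b}$ = pairs $(H,U)$ with $H$ an open subgroup of $G$ and $U$ an open normal subgroup of $H$; $\mathfrak E_{\mathrm r}(H,U)$ = pairs $(I,U)\in\mathfrak E_{\mathrm b}$ with $I\le H$; $\mathfrak E_{\mathrm i}(H,U)$ = pairs $(I,V)\in\mathfrak E_{\mathrm b}$ with $I\le H$, $V\le U$. $\mathsf{Fct}(\mathfrak E,\mathsf{Ab})$ is the category of families of abelian groups $\Phi(H,U)$ with transitive, mutually equivariant restriction ($\mathfrak E_{\mathrm r}$), induction ($\mathfrak E_{\mathrm i}$) and conjugation maps; morphisms are families of homomorphisms commuting with these. $\pi_{\mathfrak K}(H,U)=(H/U)^{\mathrm{ab}}$ with con induced by conjugation, ind induced by inclusion, res the group-theoretic transfer; $\widehat{\mathrm H}^0_{\mathfrak E}(C)(H,U)=C(H)/\mathrm{ind}_{H,U}C(U)$ with maps induced by those of $C$. A morphism $\Upsilon:\pi_{\mathfrak K}\to\widehat{\mathrm H}^0_{\mathfrak E}(C)$ is a $\mathfrak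 K(G)^{\mathrm f}_{\mathrm{ab}}$-class field theory if it is an isomorphism in $\mathsf{Fct}(\mathfrak E,\mathsf{Ab})$ (objects discrete) and for every open $H\le G$ and every set $\mathcal L$ of open normal subgroups $U$ of $H$ with $H/U$ abelian, closed under products and intersections, $U\mapsto\mathrm{ind}_{H,U}C(U)$ is an injective lattice morphism from $\mathcal L$ into the subgroups of $C(H)$. Ramification and valuations. For closed subgroups $K\le H$ of $G$: $I_H=H\cap\ker d$, $f_{H|K}=[d(H):d(K)]$, $f_H=f_{G|H}$, $e_{H|K}=[I_H:I_K]$. For $H$ open, $d_H=\frac1{f_H}d|_H:H\to\Omega$ is surjective with kernel $I_H$. For $U$ open normal in $H$ with $I_H\le U$ the Frobenius element $\varphi_{H|U}\in H/U$ is the image of any $h\in H$ with $d_H(h)=\omega$. $\mathrm{Val}_d^{\langle\omega\rangle,\omega}(C)$ (resp. $\mathrm{Val}_d^{\Omega,\omega}(C)$) is the set of families $v=(v_H)$ of homomorphisms $v_H:C(H)\to\langle\omega\rangle$ (resp. $\Omega$), $H$ open, with $\omega\in\mathrm{im}(v_H)$, $v_{{}^gH}\mathrm{con}_{g,H}=v_H$, $v_K\mathrm{res}_{K,H}=e_{H|K}v_H$, $v_H\mathrm{ind}_{H,K}=f_{H|K}v_K$. A prime element of $C(H)$ is $\pi$ with $v_H(\pi)=\omega$. Fesenko--Neukirch datum on $\mathrm{Sp}(G)^{\mathrm f}$: a pair $(C,v)$, $C$ a cohomological Mackey functor $\mathrm{Grp}(G)^{\mathrm f}\to\mathsf{Ab}$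 (that is, abelian groups $C(H)$ for $H$ open in $G$ with homomorphisms res, ind, con satisfying triviality, transitivity, equivariance, the Mackey formula, and $\mathrm{ind}_{H,I}\mathrm{res}_{I,H}=$ the $[H:I]$-th power map), $v\in\mathrm{Val}_d^{\Omega,\omega}(C)$, such that for all open $H\le G$ and all open normal $U\lhd H$ with $I_H\le U$: (1) $\mathrm{im}(v_H)/[H:U]\,\mathrm{im}(v_U)$ has order $[H:U]$ and is generated by the image of $\omega$; $\mathrm{ind}_{H,U}:\ker v_U\to\ker v_H$ is surjective; $|C(H)/\mathrm{ind}_{H,U}C(U)|\le[H:U]$; (2) the sequence $1\to\ker v_H\xrightarrow{\mathrm{res}_{U,H}}\ker v_U\xrightarrow{x\mapsto\mathrm{con}_{\varphi,U}(x)x^{-1}}\ker v_U\xrightarrow{\mathrm{ind}_{H,U}}\ker v_H\to1$ is exact, with $\varphi$ a representative of $\varphi_{H|U}$. Fesenko--Neukirch morphism. $\Omega^+=\{n\omega:n\in\mathbb N_{>0}\}$, $\mathrm{mult}(n\omega)=n$; for $n=\prod_pp^{n(p)}$, $P'(n)=\prod_{p\notin P}p^{n(p)}$. $\mathrm{Frob}_H=\{h\in H:d_H(h)\in\Omega^+\}$; for $h\in\mathrm{Frob}_H$, $\Sigma_{h,H|U}=\langle h\rangle_{\mathrm c}I_U$, an open subgroup of $H$. For a Fesenko--Neukirch datum, $\Upsilon_{(H,U)}:(H/U)^{\mathrm{ab}}\to C(H)/\mathrm{ind}_{H,U}C(U)$ sends the class of $\bar h\in H/U$ to the class of $\mathrm{ind}_{H,\Sigma_{h,H|U}}(\pi_h)^{P'(\mathrm{mult}(d_H(h)))}$,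 where $h\in\mathrm{Frob}_H$ lifts $\bar h$ and $\pi_h\in C(\Sigma_{h,H|U})$ is a prime element; this is a well-defined homomorphism independent of choices, and $\Upsilon=(\Upsilon_{(H,U)})$ is a morphism $\pi_{\mathfrak K}\to\widehat{\mathrm H}^0_{\mathfrak E}(C)$. *)

theory Defs
  imports
    "HOL-Computational_Algebra.Primes"
    "HOL-Algebra.FiniteProduct"
    "HOL-Algebra.Product_Groups"
    "HOL-Algebra.Exact_Sequence"
    "HOL-Analysis.Function_Topology"
    "HOL-Analysis.Abstract_Topological_Spaces"
begin

section \<open>Subgroups, indices and conjugates\<close>

abbreviation subgrp :: "'a monoid \<Rightarrow> 'a set \<Rightarrow> 'a monoid" where
  "subgrp A H \<equiv> A\<lparr>carrier := H\<rparr>"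

text \<open>The index \<open>[H : K]\<close> of a subgroup \<open>K\<close> of \<open>H\<close>, as a number (\<open>0\<close> if it is infinite; it is
  only used below for finite indices).\<close>

definition grp_index :: "'a monoid \<Rightarrow> 'a set \<Rightarrow> 'a set \<Rightarrow> nat" where
  "grp_index A H K = card (rcosets\<^bsub>subgrp A H\<^esub> K)"

text \<open>The conjugate \<open>g H g\<^sup>-\<^sup>1\<close>; accordingly \<open>g\<^sup>-\<^sup>1 H g\<close> is \<open>conj_set G (inv g) H\<close>.\<close>

definition conj_set :: "'a monoid \<Rightarrow> 'a \<Rightarrow> 'a set \<Rightarrow> 'a set" where
  "conj_set G g H = (\<lambda>h. g \<otimes>\<^bsub>G\<^esub> h \<otimes>\<^bsub>G\<^esub> inv\<^bsub>G\<^esub> g) ` H"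

text \<open>\<open>R\<close> is a system of representatives of the double cosets \<open>I h J\<close> in \<open>H\<close>.\<close>

definition double_coset_reps ::
  "'a monoid \<Rightarrow> 'a set \<Rightarrow> 'a set \<Rightarrow> 'a set \<Rightarrow> 'a set \<Rightarrow> bool" where
  "double_coset_reps G I H J R \<longleftrightarrow>
     R \<subseteq> H \<and> (\<forall>x\<in>H. \<exists>!r. r \<in> R \<and> x \<in> (I #>\<^bsub>G\<^esub> r) <#>\<^bsub>G\<^esub> J)"


section \<open>Topological groups\<close>

definition topological_group :: "'a monoid \<Rightarrow> 'a topology \<Rightarrow> bool" where
  "topological_group G T \<longleftrightarrow>
     group G \<and> topspace T = carrier G \<and>
     continuous_map (prod_topology T T) T (\<lambda>(x, y). x \<otimes>\<^bsub>G\<^esub> y) \<and>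
     continuous_map T T (\<lambda>x. inv\<^bsub>G\<^esub> x)"

definition topologically_isomorphic ::
  "'a monoid \<Rightarrow> 'a topology \<Rightarrow> 'b monoid \<Rightarrow> 'b topology \<Rightarrow> bool" where
  "topologically_isomorphic A T B S \<longleftrightarrow> (\<exists>f. f \<in> iso A B \<and> homeomorphic_map T S f)"

definition profinite_group :: "'a monoid \<Rightarrow> 'a topology \<Rightarrow> bool" where
  "profinite_group G T \<longleftrightarrow>
     topological_group G T \<and> compact_space T \<and> Hausdorff_space T \<and>
     (\<forall>S. connectedin T S \<longrightarrow> (\<exists>a. S \<subseteq> {a}))"

definition open_subgroup :: "'a monoid \<Rightarrow> 'a topology \<Rightarrow> 'a set \<Rightarrow> bool" where
  "open_subgroup G T H \<longleftrightarrow> subgroup H G \<and> openin T H"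

text \<open>Open subgroups of a profinite group have finite index, so the orders below are genuine.\<close>

definition pro_P_group :: "nat set \<Rightarrow> 'a monoid \<Rightarrow> 'a topology \<Rightarrow> bool" where
  "pro_P_group P G T \<longleftrightarrow>
     profinite_group G T \<and>
     (\<forall>U. open_subgroup G T U \<and> U \<lhd> G \<longrightarrow> prime_factors (order (G Mod U)) \<subseteq> P)"

text \<open>The additive group of \<open>p\<close>-adic integers as the inverse limit of the discrete groups
  \<open>\<int>/p\<^sup>n\<close>, with its topology; \<open>\<int>\<^sub>P\<close> is the product over \<open>p \<in> P\<close>.\<close>

definition padic_carrier :: "nat \<Rightarrow> (nat \<Rightarrow> int) set" where
  "padic_carrier p =
     {x \<in> carrier (product_group UNIV (\<lambda>n. integer_mod_group (p ^ n))).
        \<forall>n. x (Suc n) mod int (p ^ n) = x n}"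

definition padic_group :: "nat \<Rightarrow> (nat \<Rightarrow> int) monoid" where
  "padic_group p =
     subgrp (product_group UNIV (\<lambda>n. integer_mod_group (p ^ n))) (padic_carrier p)"

definition padic_topology :: "nat \<Rightarrow> (nat \<Rightarrow> int) topology" where
  "padic_topology p =
     subtopology
       (product_topology (\<lambda>n. discrete_topology (carrier (integer_mod_group (p ^ n)))) UNIV)
       (padic_carrier p)"

definition ZP_group :: "nat set \<Rightarrow> (nat \<Rightarrow> nat \<Rightarrow> int) monoid" where
  "ZP_group P = product_group P padic_group"

definition ZP_topology :: "nat set \<Rightarrow> (nat \<Rightarrow> nat \<Rightarrow> int) topology" where
  "ZP_topology P = product_topology padic_topology P"

definition topological_generator :: "'w monoid \<Rightarrow> 'w topology \<Rightarrow> 'w \<Rightarrow> bool" where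
  "topological_generator W S \<omega> \<longleftrightarrow>
     \<omega> \<in> carrier W \<and> S closure_of (generate W {\<omega>}) = carrier W"


section \<open>Cohomological Mackey functors\<close>

text \<open>\<open>mres C I H : C(H) \<rightarrow> C(I)\<close>, \<open>mind C H I : C(I) \<rightarrow> C(H)\<close> and
  \<open>mcon C g H : C(H) \<rightarrow> C(g H g\<^sup>-\<^sup>1)\<close>. All groups \<open>C(H)\<close> have their elements in one type.\<close>

record ('g, 'c) mackey =
  mobj :: "'g set \<Rightarrow> 'c monoid"
  mres :: "'g set \<Rightarrow> 'g set \<Rightarrow> 'c \<Rightarrow> 'c"
  mind :: "'g set \<Rightarrow> 'g set \<Rightarrow> 'c \<Rightarrow> 'c"
  mcon :: "'g \<Rightarrow> 'g set \<Rightarrow> 'c \<Rightarrow> 'c"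

locale cohomological_mackey_functor =
  fixes G :: "'g monoid" (structure) and T :: "'g topology" and C :: "('g, 'c) mackey"
  assumes comm_group_mobj: "open_subgroup G T H \<Longrightarrow> comm_group (mobj C H)"
    and mres_hom: "\<lbrakk>open_subgroup G T H; open_subgroup G T I; I \<subseteq> H\<rbrakk>
      \<Longrightarrow> mres C I H \<in> hom (mobj C H) (mobj C I)"
    and mind_hom: "\<lbrakk>open_subgroup G T H; open_subgroup G T I; I \<subseteq> H\<rbrakk>
      \<Longrightarrow> mind C H I \<in> hom (mobj C I) (mobj C H)"
    and mcon_hom: "\<lbrakk>open_subgroup G T H; g \<in> carrier G\<rbrakk>
      \<Longrightarrow> mcon C g H \<in> hom (mobj C H) (mobj C (conj_set G g H))"
    and mres_refl: "\<lbrakk>open_subgroup G T H; x \<in> carrier (mobj C H)\<rbrakk> \<Longrightarrow> mres C H H x = x"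
    and mind_refl: "\<lbrakk>open_subgroup G T H; x \<in> carrier (mobj C H)\<rbrakk> \<Longrightarrow> mind C H H x = x"
    and mcon_refl: "\<lbrakk>open_subgroup G T H; h \<in> H; x \<in> carrier (mobj C H)\<rbrakk> \<Longrightarrow> mcon C h H x = x"
    and mres_trans: "\<lbrakk>open_subgroup G T H; open_subgroup G T I; open_subgroup G T J;
        J \<subseteq> I; I \<subseteq> H; x \<in> carrier (mobj C H)\<rbrakk>
      \<Longrightarrow> mres C J I (mres C I H x) = mres C J H x"
    and mind_trans: "\<lbrakk>open_subgroup G T H; open_subgroup G T I; open_subgroup G T J;
        J \<subseteq> I; I \<subseteq> H; x \<in> carrier (mobj C J)\<rbrakk>
      \<Longrightarrow> mind C H I (mind C I J x) = mind C H J x"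
    and mcon_trans: "\<lbrakk>open_subgroup G T H; g \<in> carrier G; g' \<in> carrier G;
        x \<in> carrier (mobj C H)\<rbrakk>
      \<Longrightarrow> mcon C g' (conj_set G g H) (mcon C g H x) = mcon C (g' \<otimes> g) H x"
    and mcon_mres: "\<lbrakk>open_subgroup G T H; open_subgroup G T I; I \<subseteq> H; g \<in> carrier G;
        x \<in> carrier (mobj C H)\<rbrakk>
      \<Longrightarrow> mcon C g I (mres C I H x) = mres C (conj_set G g I) (conj_set G g H) (mcon C g H x)"
    and mcon_mind: "\<lbrakk>open_subgroup G T H; open_subgroup G T I; I \<subseteq> H; g \<in> carrier G;
        x \<in> carrier (mobj C I)\<rbrakk>
      \<Longrightarrow> mcon C g H (mind C H I x) = mind C (conj_set G g H) (conj_set G g I) (mcon C g I x)"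
    and mackey_formula: "\<lbrakk>open_subgroup G T H; open_subgroup G T I; open_subgroup G T J;
        I \<subseteq> H; J \<subseteq> H; double_coset_reps G I H J R; x \<in> carrier (mobj C J)\<rbrakk>
      \<Longrightarrow> mres C I H (mind C H J x) =
          (\<Otimes>\<^bsub>mobj C I\<^esub>h\<in>R.
             mind C I (I \<inter> conj_set G h J)
               (mcon C h (conj_set G (inv h) I \<inter> J)
                 (mres C (conj_set G (inv h) I \<inter> J) J x)))"
    and mind_mres: "\<lbrakk>open_subgroup G T H; open_subgroup G T I; I \<subseteq> H; x \<in> carrier (mobj C H)\<rbrakk>
      \<Longrightarrow> mind C H I (mres C I H x) = x [^]\<^bsub>mobj C H\<^esub> grp_index G H I"

text \<open>The pairs in \<open>\<EE>\<^sub>b\<close>.\<close>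

definition spectrum_pair :: "'g monoid \<Rightarrow> 'g topology \<Rightarrow> 'g set \<Rightarrow> 'g set \<Rightarrow> bool" where
  "spectrum_pair G T H U \<longleftrightarrow>
     open_subgroup G T H \<and> open_subgroup G T U \<and> U \<lhd> subgrp G H"

text \<open>The subgroup \<open>ind\<^sub>H\<^sub>,\<^sub>U C(U)\<close> of \<open>C(H)\<close>.\<close>

definition norm_group :: "('g, 'c) mackey \<Rightarrow> 'g set \<Rightarrow> 'g set \<Rightarrow> 'c set" where
  "norm_group C H U = mind C H U ` carrier (mobj C U)"

definition galois_descent :: "('g, 'c) mackey \<Rightarrow> 'g set \<Rightarrow> 'g set \<Rightarrow> bool" where
  "galois_descent C H U \<longleftrightarrow>
     mres C U H \<in> iso (mobj C H)
       (subgrp (mobj C U) {x \<in> carrier (mobj C U). \<forall>h\<in>H. mcon C h U x = x})"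

definition class_field_axiom :: "'g monoid \<Rightarrow> ('g, 'c) mackey \<Rightarrow> 'g set \<Rightarrow> 'g set \<Rightarrow> bool" where
  "class_field_axiom G C H U \<longleftrightarrow>
     order (mobj C H Mod norm_group C H U) = grp_index G H U \<and>
     kernel (mobj C U) (mobj C H) (mind C H U) =
       generate (mobj C U)
         {mcon C h U x \<otimes>\<^bsub>mobj C U\<^esub> inv\<^bsub>mobj C U\<^esub> x | h x. h \<in> H \<and> x \<in> carrier (mobj C U)}"


section \<open>The category of abelian-group-valued functors on the spectrum\<close>

text \<open>\<open>sres \<Phi> I H U : \<Phi>(H,U) \<rightarrow> \<Phi>(I,U)\<close>, \<open>sind \<Phi> H U I V : \<Phi>(I,V) \<rightarrow> \<Phi>(H,U)\<close> and
  \<open>scon \<Phi> g H U : \<Phi>(H,U) \<rightarrow> \<Phi>(g H g\<^sup>-\<^sup>1, g U g\<^sup>-\<^sup>1)\<close>.\<close>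

record ('g, 'a) spectrum_data =
  sobj :: "'g set \<Rightarrow> 'g set \<Rightarrow> 'a monoid"
  sres :: "'g set \<Rightarrow> 'g set \<Rightarrow> 'g set \<Rightarrow> 'a \<Rightarrow> 'a"
  sind :: "'g set \<Rightarrow> 'g set \<Rightarrow> 'g set \<Rightarrow> 'g set \<Rightarrow> 'a \<Rightarrow> 'a"
  scon :: "'g \<Rightarrow> 'g set \<Rightarrow> 'g set \<Rightarrow> 'a \<Rightarrow> 'a"

locale spectrum_functor =
  fixes G :: "'g monoid" (structure) and T :: "'g topology" and \<Phi> :: "('g, 'a) spectrum_data"
  assumes comm_group_sobj: "spectrum_pair G T H U \<Longrightarrow> comm_group (sobj \<Phi> H U)"
    and sres_hom: "\<lbrakk>spectrum_pair G T H U; spectrum_pair G T I U; I \<subseteq> H\<rbrakk>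
      \<Longrightarrow> sres \<Phi> I H U \<in> hom (sobj \<Phi> H U) (sobj \<Phi> I U)"
    and sind_hom: "\<lbrakk>spectrum_pair G T H U; spectrum_pair G T I V; I \<subseteq> H; V \<subseteq> U\<rbrakk>
      \<Longrightarrow> sind \<Phi> H U I V \<in> hom (sobj \<Phi> I V) (sobj \<Phi> H U)"
    and scon_hom: "\<lbrakk>spectrum_pair G T H U; g \<in> carrier G\<rbrakk>
      \<Longrightarrow> scon \<Phi> g H U \<in> hom (sobj \<Phi> H U) (sobj \<Phi> (conj_set G g H) (conj_set G g U))"
    and sres_refl: "\<lbrakk>spectrum_pair G T H U; x \<in> carrier (sobj \<Phi> H U)\<rbrakk> \<Longrightarrow> sres \<Phi> H H U x = x"
    and sind_refl: "\<lbrakk>spectrum_pair G T H U; x \<in> carrier (sobj \<Phi> H U)\<rbrakk> \<Longrightarrow> sind \<Phi> H U H U x = x"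
    and scon_refl: "\<lbrakk>spectrum_pair G T H U; h \<in> H; x \<in> carrier (sobj \<Phi> H U)\<rbrakk>
      \<Longrightarrow> scon \<Phi> h H U x = x"
    and sres_trans: "\<lbrakk>spectrum_pair G T H U; spectrum_pair G T I U; spectrum_pair G T J U;
        J \<subseteq> I; I \<subseteq> H; x \<in> carrier (sobj \<Phi> H U)\<rbrakk>
      \<Longrightarrow> sres \<Phi> J I U (sres \<Phi> I H U x) = sres \<Phi> J H U x"
    and sind_trans: "\<lbrakk>spectrum_pair G T H U; spectrum_pair G T I V; spectrum_pair G T J W;
        J \<subseteq> I; I \<subseteq> H; W \<subseteq> V; V \<subseteq> U; x \<in> carrier (sobj \<Phi> J W)\<rbrakk>
      \<Longrightarrow> sind \<Phi> H U I V (sind \<Phi> I V J W x) = sind \<Phi> H U J W x"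
    and scon_trans: "\<lbrakk>spectrum_pair G T H U; g \<in> carrier G; g' \<in> carrier G;
        x \<in> carrier (sobj \<Phi> H U)\<rbrakk>
      \<Longrightarrow> scon \<Phi> g' (conj_set G g H) (conj_set G g U) (scon \<Phi> g H U x) = scon \<Phi> (g' \<otimes> g) H U x"
    and scon_sres: "\<lbrakk>spectrum_pair G T H U; spectrum_pair G T I U; I \<subseteq> H; g \<in> carrier G;
        x \<in> carrier (sobj \<Phi> H U)\<rbrakk>
      \<Longrightarrow> scon \<Phi> g I U (sres \<Phi> I H U x) =
          sres \<Phi> (conj_set G g I) (conj_set G g H) (conj_set G g U) (scon \<Phi> g H U x)"
    and scon_sind: "\<lbrakk>spectrum_pair G T H U; spectrum_pair G T I V; I \<subseteq> H; V \<subseteq> U; g \<in> carrier G;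
        x \<in> carrier (sobj \<Phi> I V)\<rbrakk>
      \<Longrightarrow> scon \<Phi> g H U (sind \<Phi> H U I V x) =
          sind \<Phi> (conj_set G g H) (conj_set G g U) (conj_set G g I) (conj_set G g V)
            (scon \<Phi> g I V x)"

definition spectrum_morphism ::
  "'g monoid \<Rightarrow> 'g topology \<Rightarrow> ('g, 'a) spectrum_data \<Rightarrow> ('g, 'b) spectrum_data \<Rightarrow>
   ('g set \<Rightarrow> 'g set \<Rightarrow> 'a \<Rightarrow> 'b) \<Rightarrow> bool" where
  "spectrum_morphism G T \<Phi> \<Psi> \<eta> \<longleftrightarrow>
     spectrum_functor G T \<Phi> \<and> spectrum_functor G T \<Psi> \<and>
     (\<forall>H U. spectrum_pair G T H U \<longrightarrow> \<eta> H U \<in> hom (sobj \<Phi> H U) (sobj \<Psi> H U)) \<and>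
     (\<forall>H U I. spectrum_pair G T H U \<and> spectrum_pair G T I U \<and> I \<subseteq> H \<longrightarrow>
        (\<forall>x\<in>carrier (sobj \<Phi> H U). \<eta> I U (sres \<Phi> I H U x) = sres \<Psi> I H U (\<eta> H U x))) \<and>
     (\<forall>H U I V. spectrum_pair G T H U \<and> spectrum_pair G T I V \<and> I \<subseteq> H \<and> V \<subseteq> U \<longrightarrow>
        (\<forall>x\<in>carrier (sobj \<Phi> I V). \<eta> H U (sind \<Phi> H U I V x) = sind \<Psi> H U I V (\<eta> I V x))) \<and>
     (\<forall>H U g. spectrum_pair G T H U \<and> g \<in> carrier G \<longrightarrow>
        (\<forall>x\<in>carrier (sobj \<Phi> H U).
           \<eta> (conj_set G g H) (conj_set G g U) (scon \<Phi> g H U x) = scon \<Psi> g H U (\<eta> H U x)))"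

definition spectrum_isomorphism ::
  "'g monoid \<Rightarrow> 'g topology \<Rightarrow> ('g, 'a) spectrum_data \<Rightarrow> ('g, 'b) spectrum_data \<Rightarrow>
   ('g set \<Rightarrow> 'g set \<Rightarrow> 'a \<Rightarrow> 'b) \<Rightarrow> bool" where
  "spectrum_isomorphism G T \<Phi> \<Psi> \<eta> \<longleftrightarrow>
     spectrum_morphism G T \<Phi> \<Psi> \<eta> \<and>
     (\<exists>\<theta>. spectrum_morphism G T \<Psi> \<Phi> \<theta> \<and>
        (\<forall>H U. spectrum_pair G T H U \<longrightarrow>
           (\<forall>x\<in>carrier (sobj \<Phi> H U). \<theta> H U (\<eta> H U x) = x) \<and>
           (\<forall>y\<in>carrier (sobj \<Psi> H U). \<eta> H U (\<theta> H U y) = y)))"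


section \<open>The functors \<open>\<pi>\<close> and \<open>H\<^sup>0\<close>\<close>

definition abelianization :: "'a monoid \<Rightarrow> 'a set monoid" where
  "abelianization A = A Mod derived A (carrier A)"

definition ab_proj :: "'a monoid \<Rightarrow> 'a \<Rightarrow> 'a set" where
  "ab_proj A a = derived A (carrier A) #>\<^bsub>A\<^esub> a"

text \<open>The transfer \<open>A \<rightarrow> B\<^sup>a\<^sup>b\<close> for a subgroup \<open>B\<close> of finite index: if \<open>s\<close> picks a representative
  of each coset \<open>B x\<close>, then \<open>a\<close> is sent to the class of \<open>\<Prod>\<^bsub>M\<^esub> s(M) a s(M a)\<^sup>-\<^sup>1\<close>. The value does not
  depend on \<open>s\<close>; here \<open>s\<close> is given by Hilbert choice.\<close>

definition group_transfer :: "'a monoid \<Rightarrow> 'a set \<Rightarrow> 'a \<Rightarrow> 'a set" where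
  "group_transfer A B a =
     (\<Otimes>\<^bsub>abelianization (subgrp A B)\<^esub>M\<in>rcosets\<^bsub>A\<^esub> B.
        ab_proj (subgrp A B)
          ((SOME x. x \<in> M) \<otimes>\<^bsub>A\<^esub> a \<otimes>\<^bsub>A\<^esub> inv\<^bsub>A\<^esub> (SOME y. y \<in> M #>\<^bsub>A\<^esub> a)))"

text \<open>The class in \<open>(H/U)\<^sup>a\<^sup>b\<close> of \<open>h \<in> H\<close>. An element of \<open>(H/U)\<^sup>a\<^sup>b\<close> is a set \<open>X\<close> of cosets of \<open>U\<close>,
  and \<open>\<Union>X\<close> is the set of all \<open>h \<in> H\<close> with class \<open>X\<close>.\<close>

definition pi_class :: "'g monoid \<Rightarrow> 'g set \<Rightarrow> 'g set \<Rightarrow> 'g \<Rightarrow> 'g set set" where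
  "pi_class G H U h = ab_proj (subgrp G H Mod U) (U #>\<^bsub>G\<^esub> h)"

text \<open>Induced maps on quotients are given, as in the library, by \<^const>\<open>the_elem\<close> of the image of
  a class.\<close>

definition pi_functor :: "'g monoid \<Rightarrow> ('g, 'g set set) spectrum_data" where
  "pi_functor G = \<lparr>
     sobj = (\<lambda>H U. abelianization (subgrp G H Mod U)),
     sres = (\<lambda>I H U X.
       the_elem (group_transfer (subgrp G H Mod U) (carrier (subgrp G I Mod U)) ` X)),
     sind = (\<lambda>H U I V X. the_elem (pi_class G H U ` \<Union>X)),
     scon = (\<lambda>g H U X.
       the_elem ((\<lambda>h. pi_class G (conj_set G g H) (conj_set G g U)
                    (g \<otimes>\<^bsub>G\<^esub> h \<otimes>\<^bsub>G\<^esub> inv\<^bsub>G\<^esub> g)) ` \<Union>X))\<rparr>"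

definition norm_class :: "('g, 'c) mackey \<Rightarrow> 'g set \<Rightarrow> 'g set \<Rightarrow> 'c \<Rightarrow> 'c set" where
  "norm_class C H U x = norm_group C H U #>\<^bsub>mobj C H\<^esub> x"

definition tate_functor :: "'g monoid \<Rightarrow> ('g, 'c) mackey \<Rightarrow> ('g, 'c set) spectrum_data" where
  "tate_functor G C = \<lparr>
     sobj = (\<lambda>H U. mobj C H Mod norm_group C H U),
     sres = (\<lambda>I H U X. the_elem ((\<lambda>x. norm_class C I U (mres C I H x)) ` X)),
     sind = (\<lambda>H U I V X. the_elem ((\<lambda>x. norm_class C H U (mind C H I x)) ` X)),
     scon = (\<lambda>g H U X.
       the_elem ((\<lambda>x. norm_class C (conj_set G g H) (conj_set G g U) (mcon C g H x)) ` X))\<rparr>"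

definition class_field_theory ::
  "'g monoid \<Rightarrow> 'g topology \<Rightarrow> ('g, 'c) mackey \<Rightarrow> ('g set \<Rightarrow> 'g set \<Rightarrow> 'g set set \<Rightarrow> 'c set) \<Rightarrow> bool"
  where
  "class_field_theory G T C \<Upsilon> \<longleftrightarrow>
     spectrum_isomorphism G T (pi_functor G) (tate_functor G C) \<Upsilon> \<and>
     (\<forall>H L. open_subgroup G T H \<and>
        (\<forall>U\<in>L. spectrum_pair G T H U \<and> comm_group (subgrp G H Mod U)) \<and>
        (\<forall>U\<in>L. \<forall>V\<in>L. U <#>\<^bsub>G\<^esub> V \<in> L \<and> U \<inter> V \<in> L) \<longrightarrow>
        inj_on (norm_group C H) L \<and>
        (\<forall>U\<in>L. subgroup (norm_group C H U) (mobj C H)) \<and>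
        (\<forall>U\<in>L. \<forall>V\<in>L.
           norm_group C H (U <#>\<^bsub>G\<^esub> V) = norm_group C H U <#>\<^bsub>mobj C H\<^esub> norm_group C H V \<and>
           norm_group C H (U \<inter> V) = norm_group C H U \<inter> norm_group C H V))"


section \<open>Ramification and valuations\<close>

text \<open>The group \<open>\<Omega>\<close> (here \<open>W\<close>) is written multiplicatively, so that \<open>n \<omega>\<close> becomes \<open>\<omega> [^] n\<close>.\<close>

definition inertia :: "'g monoid \<Rightarrow> 'w monoid \<Rightarrow> ('g \<Rightarrow> 'w) \<Rightarrow> 'g set \<Rightarrow> 'g set" where
  "inertia G W d H = H \<inter> kernel G W d"

text \<open>\<open>ram_index G W d H K\<close> is \<open>e\<^bsub>H|K\<^esub>\<close> and \<open>res_degree W d H K\<close> is \<open>f\<^bsub>H|K\<^esub>\<close>.\<close>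

definition ram_index :: "'g monoid \<Rightarrow> 'w monoid \<Rightarrow> ('g \<Rightarrow> 'w) \<Rightarrow> 'g set \<Rightarrow> 'g set \<Rightarrow> nat" where
  "ram_index G W d H K = grp_index G (inertia G W d H) (inertia G W d K)"

definition res_degree :: "'w monoid \<Rightarrow> ('g \<Rightarrow> 'w) \<Rightarrow> 'g set \<Rightarrow> 'g set \<Rightarrow> nat" where
  "res_degree W d H K = grp_index W (d ` H) (d ` K)"

text \<open>\<open>d\<^sub>H(h) = d(h) / f\<^sub>H\<close>; the quotient is unique because \<open>\<Omega> \<cong> \<int>\<^sub>P\<close> is torsion-free.\<close>

definition norm_degree :: "'g monoid \<Rightarrow> 'w monoid \<Rightarrow> ('g \<Rightarrow> 'w) \<Rightarrow> 'g set \<Rightarrow> 'g \<Rightarrow> 'w" where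
  "norm_degree G W d H h =
     (THE x. x \<in> carrier W \<and> x [^]\<^bsub>W\<^esub> res_degree W d (carrier G) H = d h)"

definition frobenius_elem ::
  "'g monoid \<Rightarrow> 'w monoid \<Rightarrow> 'w \<Rightarrow> ('g \<Rightarrow> 'w) \<Rightarrow> 'g set \<Rightarrow> 'g set \<Rightarrow> 'g set" where
  "frobenius_elem G W \<omega> d H U =
     (THE X. \<exists>h\<in>H. norm_degree G W d H h = \<omega> \<and> X = U #>\<^bsub>G\<^esub> h)"

text \<open>The valuations with values in the subgroup \<open>B\<close> of \<open>\<Omega>\<close>.\<close>

definition valuations ::
  "'g monoid \<Rightarrow> 'g topology \<Rightarrow> 'w monoid \<Rightarrow> 'w \<Rightarrow> ('g \<Rightarrow> 'w) \<Rightarrow> ('g, 'c) mackey \<Rightarrow> 'w set \<Rightarrow>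
   ('g set \<Rightarrow> 'c \<Rightarrow> 'w) set" where
  "valuations G T W \<omega> d C B = {v. \<forall>H. open_subgroup G T H \<longrightarrow>
     v H \<in> hom (mobj C H) (subgrp W B) \<and>
     \<omega> \<in> v H ` carrier (mobj C H) \<and>
     (\<forall>g\<in>carrier G. \<forall>x\<in>carrier (mobj C H). v (conj_set G g H) (mcon C g H x) = v H x) \<and>
     (\<forall>K. open_subgroup G T K \<and> K \<subseteq> H \<longrightarrow>
        (\<forall>x\<in>carrier (mobj C H). v K (mres C K H x) = v H x [^]\<^bsub>W\<^esub> ram_index G W d H K) \<and>
        (\<forall>x\<in>carrier (mobj C K). v H (mind C H K x) = v K x [^]\<^bsub>W\<^esub> res_degree W d H K))}"

definition prime_elements :: "'w \<Rightarrow> ('g, 'c) mackey \<Rightarrow> ('g set \<Rightarrow> 'c \<Rightarrow> 'w) \<Rightarrow> 'g set \<Rightarrow> 'c set" where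
  "prime_elements \<omega> C v H = {x \<in> carrier (mobj C H). v H x = \<omega>}"

text \<open>The group \<open>ker v\<^sub>H\<close>.\<close>

definition unit_group ::
  "'w monoid \<Rightarrow> ('g, 'c) mackey \<Rightarrow> ('g set \<Rightarrow> 'c \<Rightarrow> 'w) \<Rightarrow> 'g set \<Rightarrow> 'c monoid" where
  "unit_group W C v H = subgrp (mobj C H) (kernel (mobj C H) W (v H))"


section \<open>Fesenko--Neukirch data and the Fesenko--Neukirch morphism\<close>

text \<open>The library writes exact sequences from right to left, the last group coming first.\<close>

definition fesenko_neukirch_datum ::
  "'g monoid \<Rightarrow> 'g topology \<Rightarrow> 'w monoid \<Rightarrow> 'w \<Rightarrow> ('g \<Rightarrow> 'w) \<Rightarrow> ('g, 'c) mackey \<Rightarrow>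
   ('g set \<Rightarrow> 'c \<Rightarrow> 'w) \<Rightarrow> bool" where
  "fesenko_neukirch_datum G T W \<omega> d C v \<longleftrightarrow>
     cohomological_mackey_functor G T C \<and>
     v \<in> valuations G T W \<omega> d C (carrier W) \<and>
     (\<forall>H U. spectrum_pair G T H U \<and> inertia G W d H \<subseteq> U \<longrightarrow>
        (let n = grp_index G H U;
             M = v H ` carrier (mobj C H);
             N = (\<lambda>y. y [^]\<^bsub>W\<^esub> n) ` (v U ` carrier (mobj C U));
             Q = subgrp W M Mod N
         in order Q = n \<and> generate Q {N #>\<^bsub>W\<^esub> \<omega>} = carrier Q) \<and>
        mind C H U ` carrier (unit_group W C v U) = carrier (unit_group W C v H) \<and>
        finite (carrier (mobj C H Mod norm_group C H U)) \<and>
        order (mobj C H Mod norm_group C H U) \<le> grp_index G H U \<and>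
        (\<forall>\<phi>\<in>frobenius_elem G W \<omega> d H U.
           exact_seq
             ([singleton_group \<one>\<^bsub>mobj C H\<^esub>, unit_group W C v H, unit_group W C v U,
               unit_group W C v U, unit_group W C v H, singleton_group \<one>\<^bsub>mobj C H\<^esub>],
              [\<lambda>_. \<one>\<^bsub>mobj C H\<^esub>, mind C H U,
               \<lambda>x. mcon C \<phi> U x \<otimes>\<^bsub>mobj C U\<^esub> inv\<^bsub>mobj C U\<^esub> x,
               mres C U H, \<lambda>_. \<one>\<^bsub>mobj C H\<^esub>])))"

definition frobenius_set :: "'g monoid \<Rightarrow> 'w monoid \<Rightarrow> 'w \<Rightarrow> ('g \<Rightarrow> 'w) \<Rightarrow> 'g set \<Rightarrow> 'g set" where
  "frobenius_set G W \<omega> d H =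
     {h \<in> H. norm_degree G W d H h \<in> {\<omega> [^]\<^bsub>W\<^esub> n | n::nat. n > 0}}"

definition mult_of :: "'w monoid \<Rightarrow> 'w \<Rightarrow> 'w \<Rightarrow> nat" where
  "mult_of W \<omega> x = (THE n. n > 0 \<and> x = \<omega> [^]\<^bsub>W\<^esub> n)"

text \<open>The prime-to-\<open>P\<close> part \<open>P'(n)\<close> of \<open>n\<close>.\<close>

definition prime_to_part :: "nat set \<Rightarrow> nat \<Rightarrow> nat" where
  "prime_to_part P n = (\<Prod>p\<in>prime_factors n - P. p ^ multiplicity p n)"

definition frobenius_subgroup ::
  "'g monoid \<Rightarrow> 'g topology \<Rightarrow> 'w monoid \<Rightarrow> ('g \<Rightarrow> 'w) \<Rightarrow> 'g set \<Rightarrow> 'g \<Rightarrow> 'g set" where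
  "frobenius_subgroup G T W d U h = (T closure_of (generate G {h})) <#>\<^bsub>G\<^esub> inertia G W d U"

text \<open>The value of \<open>\<Upsilon>\<^bsub>(H,U)\<^esub>\<close> at a class \<open>X \<in> (H/U)\<^sup>a\<^sup>b\<close>; for a Fesenko--Neukirch datum the element
  \<open>Y\<close> exists and does not depend on the choices of \<open>h\<close> and \<open>x\<close>.\<close>

definition fesenko_neukirch_morphism ::
  "nat set \<Rightarrow> 'g monoid \<Rightarrow> 'g topology \<Rightarrow> 'w monoid \<Rightarrow> 'w \<Rightarrow> ('g \<Rightarrow> 'w) \<Rightarrow> ('g, 'c) mackey \<Rightarrow>
   ('g set \<Rightarrow> 'c \<Rightarrow> 'w) \<Rightarrow> 'g set \<Rightarrow> 'g set \<Rightarrow> 'g set set \<Rightarrow> 'c set" where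
  "fesenko_neukirch_morphism P G T W \<omega> d C v H U X =
     (THE Y. \<exists>h\<in>frobenius_set G W \<omega> d H.
        \<exists>x\<in>prime_elements \<omega> C v (frobenius_subgroup G T W d U h).
          pi_class G H U h = X \<and>
          Y = norm_class C H U
                (mind C H (frobenius_subgroup G T W d U h) x
                  [^]\<^bsub>mobj C H\<^esub> prime_to_part P (mult_of W \<omega> (norm_degree G W d H h))))"

end

(* Neukirch's argument, carried out with finite levels only. Let h be a Frobenius lift of degree n and
   L = Sigma_h the attached subgroup. For V <= L normal in H with I_V = I_L, and M the subgroup of H of
   elements whose degree lies in d(V), restriction to M is injective by Galois descent, and the Mackey
   formula turns the restriction to M of the representative ind_{H,L}(pi)^{P'(n)} into the twisted power
   (1 + phi + ... + phi^(n-1)) of ind_{M,V}(res pi). Hence the representatives y1, y2, y3 for lifts h1, h2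
   and h1 h2 satisfy res(y1 y2 / y3) = ind_{M,V}(u) with a unit u of C(V); after conjugating h2 by phi^n1,
   phi u / u is a product of quotients tau a / a with a unit a and tau in the inertia group. Lifting u and
   these units along an unramified norm of degree [H:U] and applying Hilbert 90 shows that y1 y2 / y3 is the
   product of an [H:U]-th power and an element of ind_{H,U} C(U), so Upsilon is multiplicative.

   Bijectivity: for prime index either I_H <= U, where the valuation gives injectivity, or f_{H|U} = 1,
   where injectivity is a hypothesis, and the class field axiom counts. The abelian case follows by
   induction on the index, since the kernel of ind_{H,K} is generated by con_h(x)/x; surjectivity in general
   follows from Sylow subgroups, and the kernel is detected on the abelianization. *)

theory Submission
  imports Defs "HOL-Algebra.Sylow" "HOL-Algebra.Multiplicative_Group"
begin

section \<open>Subgroups, conjugates and indices\<close>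

text \<open>The classical argument runs over the maximal unramified extension, but \<open>C\<close>
  lives on open subgroups only. Each limit is therefore replaced by a level chosen after the
  elements in question are known; it keeps the inertia group of \<open>U\<close>, so that primes
  stay primes under restriction. The degree [H:U] of the auxiliary norm is dictated by the end of
  the argument: what Hilbert 90 leaves undetermined is fixed by the Frobenius, descends to
  \<open>C(H)\<close>, and its norm along a step of degree [H:U] is its [H:U]-th power, which is a
  norm from \<open>U\<close> because \<open>ind res\<close> is that power. The exponent P'(n) arises
  because integers prime to \<open>P\<close> are invertible on the value group: a lift of degree n
  generates a subgroup whose residue degree over \<open>H\<close> is only the P-part of n. The
  Mackey formula thus yields too few conjugates, and the exponent fills them up to n. Working with a
  relation between elements of \<open>H\<close> and \<open>C(H)\<close> also spares separate
  computations for the source functor: its induced maps are well defined since reciprocity values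
  separate classes.\<close>

locale grp = group G for G :: "'a monoid" (structure)
begin

lemma inv_cancel [simp]:
  assumes "x \<in> carrier G" "y \<in> carrier G"
  shows "inv x \<otimes> (x \<otimes> y) = y" "x \<otimes> (inv x \<otimes> y) = y"
  using assms by (simp_all add: m_assoc[symmetric])

lemmas word_simps = m_assoc inv_mult_group

lemma rcosets_subgrp: "rcosets\<^bsub>subgrp G H\<^esub> K = (\<lambda>x. K #> x) ` H"
  by (auto simp: RCOSETS_def)

lemma grp_index_eq: "grp_index G H K = card ((\<lambda>x. K #> x) ` H)"
  by (simp add: grp_index_def rcosets_subgrp)

lemma order_Mod: "order (subgrp G H Mod U) = grp_index G H U"
  by (simp add: order_def FactGroup_def grp_index_def)

lemma rcos_eq_iff:
  assumes "subgroup K G" "x \<in> carrier G" "y \<in> carrier G"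
  shows "K #> x = K #> y \<longleftrightarrow> x \<otimes> inv y \<in> K"
proof
  assume "K #> x = K #> y"
  then have "x \<in> K #> y" using rcos_self[OF assms(2,1)] by simp
  then obtain k where "k \<in> K" "x = k \<otimes> y" by (auto simp: r_coset_def)
  then show "x \<otimes> inv y \<in> K" using assms subgroup.mem_carrier[OF assms(1)] by (simp add: word_simps)
next
  assume k: "x \<otimes> inv y \<in> K"
  then have "x = (x \<otimes> inv y) \<otimes> y" using assms by (simp add: word_simps)
  then have "x \<in> K #> y" using k by (auto simp: r_coset_def)
  then show "K #> x = K #> y" using repr_independence[OF _ assms(3,1)] by simp
qed

lemma rcos_mem_iff:
  assumes "K \<subseteq> carrier G" "x \<in> carrier G" "y \<in> carrier G"
  shows "x \<in> K #> y \<longleftrightarrow> x \<otimes> inv y \<in> K"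
proof
  assume "x \<in> K #> y"
  then obtain k where "k \<in> K" "x = k \<otimes> y" by (auto simp: r_coset_def)
  then show "x \<otimes> inv y \<in> K" using assms by (auto simp: word_simps subset_iff)
next
  assume k: "x \<otimes> inv y \<in> K"
  then have "x = (x \<otimes> inv y) \<otimes> y" using assms by (simp add: word_simps)
  then show "x \<in> K #> y" using k by (auto simp: r_coset_def)
qed

text \<open>The \<open>m\<close> cosets of the powers \<open>g [^] i\<close> with
  \<open>i < m\<close> are distinct by \<open>dv\<close> and exhaust \<open>H\<close> by
  \<open>cov\<close>. Only natural exponents and membership in \<open>K\<close> enter, so the same
  count serves the value group, \<open>H\<close> modulo an unramified subgroup, and the integral
  valuations.\<close>

lemma grp_index_cyclic:
  assumes K: "subgroup K G" and g: "g \<in> carrier G" and m: "m > 0"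
    and H: "H \<subseteq> carrier G" "\<And>i::nat. g [^] i \<in> H"
    and cov: "\<And>x. x \<in> H \<Longrightarrow> \<exists>i::nat. x \<otimes> inv (g [^] i) \<in> K"
    and dv: "\<And>i::nat. g [^] i \<in> K \<longleftrightarrow> m dvd i"
  shows "grp_index G H K = m"
proof -
  have eq: "K #> g [^] i = K #> g [^] j \<longleftrightarrow> m dvd i - j" if "j \<le> i" for i j :: nat
  proof -
    have "g [^] i = g [^] (i - j) \<otimes> g [^] j" using that g by (simp add: nat_pow_mult)
    then have "g [^] i \<otimes> inv (g [^] j) = g [^] (i - j)" using g by (simp add: word_simps)
    then show ?thesis using rcos_eq_iff[OF K, of "g [^] i" "g [^] j"] g dv by simp
  qed
  have "(\<lambda>x. K #> x) ` H = (\<lambda>i. K #> g [^] i) ` {..<m}"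
  proof (intro equalityI subsetI)
    fix X assume "X \<in> (\<lambda>x. K #> x) ` H"
    then obtain x where x: "x \<in> H" "X = K #> x" by auto
    obtain i :: nat where i: "x \<otimes> inv (g [^] i) \<in> K" using cov[OF x(1)] by blast
    have "X = K #> g [^] i" using rcos_eq_iff[OF K, of x "g [^] i"] x i H g by auto
    also have "\<dots> = K #> g [^] (i mod m)" using eq[of "i mod m" i]
      by (simp add: minus_mod_eq_mult_div)
    finally show "X \<in> (\<lambda>i. K #> g [^] i) ` {..<m}" using m by auto
  qed (use H in auto)
  moreover have "inj_on (\<lambda>i. K #> g [^] i) {..<m}"
  proof (rule linorder_inj_onI')
    fix i j assume "i \<in> {..<m}" "j \<in> {..<m}" "i < j"
    then have "\<not> m dvd j - i" by (simp add: nat_dvd_not_less less_imp_diff_less)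
    then show "K #> g [^] i \<noteq> K #> g [^] j" using eq[of i j] \<open>i < j\<close> by auto
  qed
  ultimately show ?thesis by (simp add: grp_index_eq card_image)
qed

text \<open>With a chosen representative \<open>s M\<close> of each coset \<open>M\<close> of
  \<open>L\<close>, a coset of \<open>K\<close> in \<open>H\<close> is uniquely a coset of
  \<open>K\<close> in \<open>L\<close> translated by \<open>s M\<close>. The count comes from this
  bijection, so it agrees with the value 0 of \<open>card\<close> on infinite sets.\<close>

lemma grp_index_mult:
  assumes H: "subgroup H G" and L: "subgroup L G" and K: "subgroup K G"
    and sub: "K \<subseteq> L" "L \<subseteq> H"
  shows "grp_index G H K = grp_index G H L * grp_index G L K"
proof -
  note cH = subgroup.mem_carrier[OF H]
  note cL = subgroup.mem_carrier[OF L]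
  define s where "s M = (SOME x. x \<in> H \<and> M = L #> x)" for M
  have s: "s M \<in> H \<and> M = L #> s M" if "M \<in> (\<lambda>x. L #> x) ` H" for M
    unfolding s_def by (rule someI_ex) (use that in auto)
  let ?F = "\<lambda>(M, N). N #> s M"
  have "bij_betw ?F (((\<lambda>x. L #> x) ` H) \<times> ((\<lambda>x. K #> x) ` L)) ((\<lambda>x. K #> x) ` H)"
    unfolding bij_betw_def
  proof
    show "inj_on ?F (((\<lambda>x. L #> x) ` H) \<times> ((\<lambda>x. K #> x) ` L))"
    proof (rule inj_onI, clarify)
      fix x l x' l' assume x: "x \<in> H" "x' \<in> H" and l: "l \<in> L" "l' \<in> L"
        and eq: "K #> l #> s (L #> x) = K #> l' #> s (L #> x')"
      let ?s = "s (L #> x)" and ?s' = "s (L #> x')"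
      have s1: "?s \<in> H" "L #> x = L #> ?s" "?s' \<in> H" "L #> x' = L #> ?s'" using s x by auto
      have kl: "K #> (l \<otimes> ?s) = K #> (l' \<otimes> ?s')"
        using eq K l s1 cL cH by (simp add: coset_mult_assoc subgroup.subset)
      then have "(l \<otimes> ?s) \<otimes> inv (l' \<otimes> ?s') \<in> K" using rcos_eq_iff[OF K] s1 l cL cH by simp
      then have "(l \<otimes> ?s) \<otimes> inv (l' \<otimes> ?s') \<in> L" using sub by auto
      then have "inv l \<otimes> ((l \<otimes> ?s) \<otimes> inv (l' \<otimes> ?s')) \<otimes> l' \<in> L"
        using l L by (simp add: subgroup.m_closed subgroup.m_inv_closed)
      then have "?s \<otimes> inv ?s' \<in> L" using s1 l cL cH by (simp add: word_simps)
      then have LL: "L #> x = L #> x'" using rcos_eq_iff[OF L, of ?s ?s'] s1 cH by metis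
      then have "(l \<otimes> ?s) \<otimes> inv (l' \<otimes> ?s) \<in> K"
        using rcos_eq_iff[OF K, of "l \<otimes> ?s" "l' \<otimes> ?s'"] kl s1 l cL cH by simp
      then have "K #> l = K #> l'"
        using rcos_eq_iff[OF K] s1 l cL cH by (simp add: word_simps)
      then show "L #> x = L #> x' \<and> K #> l = K #> l'" using LL by simp
    qed
    show "?F ` (((\<lambda>x. L #> x) ` H) \<times> ((\<lambda>x. K #> x) ` L)) = (\<lambda>x. K #> x) ` H"
    proof (intro equalityI subsetI)
      fix X assume "X \<in> (\<lambda>x. K #> x) ` H"
      then obtain x where x: "x \<in> H" "X = K #> x" by auto
      let ?s = "s (L #> x)"
      have s1: "?s \<in> H" "L #> x = L #> ?s" using s x by auto
      then have "x \<otimes> inv ?s \<in> L" using rcos_eq_iff[OF L] x cH by simp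
      moreover have "K #> (x \<otimes> inv ?s) #> ?s = X" using x s1 cH K
        by (simp add: coset_mult_assoc subgroup.subset word_simps)
      ultimately show "X \<in> ?F ` (((\<lambda>x. L #> x) ` H) \<times> ((\<lambda>x. K #> x) ` L))"
        using x by force
    next
      fix X assume "X \<in> ?F ` (((\<lambda>x. L #> x) ` H) \<times> ((\<lambda>x. K #> x) ` L))"
      then obtain x l where x: "x \<in> H" "l \<in> L" "X = K #> l #> s (L #> x)" by auto
      have s1: "s (L #> x) \<in> H" using s x by auto
      then have "X = K #> (l \<otimes> s (L #> x))" "l \<otimes> s (L #> x) \<in> H"
        using x cL cH K H sub by (auto simp: coset_mult_assoc subgroup.subset subgroup.m_closed)
      then show "X \<in> (\<lambda>x. K #> x) ` H" by auto
    qed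
  qed
  then show ?thesis
    by (simp add: grp_index_eq bij_betw_same_card[symmetric] card_cartesian_product)
qed

lemma grp_index_self:
  assumes "subgroup H G" shows "grp_index G H H = 1"
proof -
  have "(\<lambda>x. H #> x) ` H = {H}"
    using assms by (auto simp: subgroup.rcos_const[OF assms] subgroup_def intro!: image_eqI[of _ _ \<one>])
  then show ?thesis by (simp add: grp_index_eq)
qed

lemma grp_index_eq_1:
  assumes K: "subgroup K G" and H: "subgroup H G" and sub: "K \<subseteq> H" and 1: "grp_index G H K = 1"
  shows "K = H"
proof
  show "H \<subseteq> K"
  proof
    fix x assume x: "x \<in> H"
    obtain Y where Y: "(\<lambda>x. K #> x) ` H = {Y}" using 1 by (auto simp: grp_index_eq card_1_singleton_iff)
    have "K #> x = K #> \<one>" using Y x subgroup.one_closed[OF H] by (metis imageI singletonD)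
    then show "x \<in> K" using rcos_eq_iff[OF K, of x \<one>] x subgroup.mem_carrier[OF H x] by simp
  qed
qed (rule sub)

lemma conj_set_subgroup:
  assumes "subgroup H G" "g \<in> carrier G"
  shows "subgroup (conj_set G g H) G"
proof (rule subgroupI)
  note c = subgroup.mem_carrier[OF assms(1)]
  show "conj_set G g H \<subseteq> carrier G" using c assms by (auto simp: conj_set_def)
  show "conj_set G g H \<noteq> {}" using subgroup.one_closed[OF assms(1)] by (auto simp: conj_set_def)
  show "inv a \<in> conj_set G g H" if "a \<in> conj_set G g H" for a
  proof -
    obtain h where "h \<in> H" "a = g \<otimes> h \<otimes> inv g" using \<open>a \<in> _\<close> by (auto simp: conj_set_def)
    then have "inv a = g \<otimes> inv h \<otimes> inv g" "inv h \<in> H" using assms c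
      by (simp_all add: word_simps subgroup.m_inv_closed)
    then show "inv a \<in> conj_set G g H" by (auto simp: conj_set_def)
  qed
  show "a \<otimes> b \<in> conj_set G g H" if ab: "a \<in> conj_set G g H" "b \<in> conj_set G g H" for a b
  proof -
    obtain h where h: "h \<in> H" "a = g \<otimes> h \<otimes> inv g" using ab(1) by (auto simp: conj_set_def)
    obtain k where k: "k \<in> H" "b = g \<otimes> k \<otimes> inv g" using ab(2) by (auto simp: conj_set_def)
    have "a \<otimes> b = g \<otimes> (h \<otimes> k) \<otimes> inv g" "h \<otimes> k \<in> H" using h k assms c
      by (simp_all add: word_simps subgroup.m_closed)
    then show "a \<otimes> b \<in> conj_set G g H" by (auto simp: conj_set_def)
  qed
qed

lemma mem_conj_set:
  assumes "H \<subseteq> carrier G" "g \<in> carrier G"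
  shows "x \<in> conj_set G g H \<longleftrightarrow> x \<in> carrier G \<and> inv g \<otimes> x \<otimes> g \<in> H"
proof
  assume "x \<in> conj_set G g H"
  then obtain h where "h \<in> H" "x = g \<otimes> h \<otimes> inv g" by (auto simp: conj_set_def)
  then show "x \<in> carrier G \<and> inv g \<otimes> x \<otimes> g \<in> H" using assms by (auto simp: word_simps subset_iff)
next
  assume "x \<in> carrier G \<and> inv g \<otimes> x \<otimes> g \<in> H"
  moreover then have "x = g \<otimes> (inv g \<otimes> x \<otimes> g) \<otimes> inv g" using assms by (simp add: word_simps)
  ultimately show "x \<in> conj_set G g H" unfolding conj_set_def by blast
qed

lemma conj_setI: "h \<in> H \<Longrightarrow> g \<otimes> h \<otimes> inv g \<in> conj_set G g H"
  by (auto simp: conj_set_def)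

lemma conj_set_conj_set:
  assumes "H \<subseteq> carrier G" "g \<in> carrier G" "g' \<in> carrier G"
  shows "conj_set G g (conj_set G g' H) = conj_set G (g \<otimes> g') H"
  unfolding conj_set_def image_image
  by (rule image_cong) (use assms in \<open>auto simp: word_simps subset_iff\<close>)

lemma conj_set_one [simp]: "H \<subseteq> carrier G \<Longrightarrow> conj_set G \<one> H = H"
  by (auto simp: conj_set_def subset_iff image_iff)

lemma conj_set_mono: "A \<subseteq> B \<Longrightarrow> conj_set G g A \<subseteq> conj_set G g B"
  by (auto simp: conj_set_def)

lemma conj_set_Int:
  assumes "A \<subseteq> carrier G" "B \<subseteq> carrier G" "g \<in> carrier G"
  shows "conj_set G g (A \<inter> B) = conj_set G g A \<inter> conj_set G g B"
  using assms by (auto simp: mem_conj_set le_infI1)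

lemma normal_subgrp_iff:
  assumes "subgroup H G"
  shows "K \<lhd> subgrp G H \<longleftrightarrow>
    subgroup K G \<and> K \<subseteq> H \<and> (\<forall>h\<in>H. \<forall>k\<in>K. h \<otimes> k \<otimes> inv h \<in> K)"
proof -
  have gH: "group (subgrp G H)" using subgroup.subgroup_is_group[OF assms] by simp
  have "subgroup K (subgrp G H) \<longleftrightarrow> subgroup K G \<and> K \<subseteq> H"
    using incl_subgroup[OF assms] subgroup_incl[OF _ assms] subgroup.subset[of K "subgrp G H"] by auto
  then show ?thesis
    using group.normal_inv_iff[OF gH, of K] assms m_inv_consistent[OF assms] by auto
qed

lemma conj_set_normal:
  assumes "subgroup H G" "K \<lhd> subgrp G H" "h \<in> H"
  shows "conj_set G h K = K"
proof -
  have K: "subgroup K G" "K \<subseteq> H" "\<forall>h\<in>H. \<forall>k\<in>K. h \<otimes> k \<otimes> inv h \<in> K"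
    using assms normal_subgrp_iff by auto
  note cH = subgroup.mem_carrier[OF assms(1)]
  have "k \<in> conj_set G h K" if "k \<in> K" for k
  proof -
    have "inv h \<otimes> k \<otimes> inv (inv h) \<in> K" using K that assms subgroup.m_inv_closed by metis
    then show ?thesis using mem_conj_set[OF subgroup.subset[OF K(1)], of h] K that cH assms by auto
  qed
  then show ?thesis using K assms by (auto simp: conj_set_def)
qed

lemma conj_set_self: "subgroup H G \<Longrightarrow> h \<in> H \<Longrightarrow> conj_set G h H = H"
  by (rule conj_set_normal[of H])
    (auto simp: normal_subgrp_iff subgroup.m_closed subgroup.m_inv_closed)

lemma double_coset_mem:
  "x \<in> (I #> r) <#> J \<longleftrightarrow> (\<exists>i\<in>I. \<exists>j\<in>J. x = i \<otimes> r \<otimes> j)"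
  by (auto simp: r_coset_def set_mult_def)

text \<open>\<open>mackey_formula\<close> speaks about a given system \<open>R\<close>; this
  supplies one. The sets \<open>D x\<close> partition \<open>H\<close>, and \<open>rp\<close> picks
  one element of each.\<close>

lemma double_coset_reps_exist:
  assumes I: "subgroup I G" and J: "subgroup J G" and H: "subgroup H G" and sub: "I \<subseteq> H" "J \<subseteq> H"
  shows "\<exists>R. double_coset_reps G I H J R"
proof -
  define D where "D x = (I #> x) <#> J" for x
  note cH = subgroup.mem_carrier[OF H]
  note cI = subgroup.mem_carrier[OF I] and cJ = subgroup.mem_carrier[OF J]
  have Dmem: "y \<in> D x \<longleftrightarrow> (\<exists>i\<in>I. \<exists>j\<in>J. y = i \<otimes> x \<otimes> j)" for x y
    unfolding D_def by (rule double_coset_mem)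
  have Dself: "x \<in> D x" if "x \<in> H" for x
  proof -
    have "x = \<one> \<otimes> x \<otimes> \<one>" using cH[OF that] by simp
    then show ?thesis unfolding Dmem using subgroup.one_closed[OF I] subgroup.one_closed[OF J] by blast
  qed
  have Dsub: "D y \<subseteq> D x" if xy: "x \<in> H" "y \<in> D x" for x y
  proof
    fix z assume "z \<in> D y"
    then obtain i j where z: "i \<in> I" "j \<in> J" "z = i \<otimes> y \<otimes> j" by (auto simp: Dmem)
    obtain i' j' where y: "i' \<in> I" "j' \<in> J" "y = i' \<otimes> x \<otimes> j'" using xy(2) by (auto simp: Dmem)
    have "z = (i \<otimes> i') \<otimes> x \<otimes> (j' \<otimes> j)" using z y cI cJ cH xy(1) by (simp add: word_simps)
    then show "z \<in> D x" unfolding Dmem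
      using subgroup.m_closed[OF I z(1) y(1)] subgroup.m_closed[OF J y(2) z(2)] by blast
  qed
  have Dsym: "x \<in> D y" if xy: "x \<in> H" "y \<in> D x" for x y
  proof -
    obtain i j where y: "i \<in> I" "j \<in> J" "y = i \<otimes> x \<otimes> j" using xy(2) by (auto simp: Dmem)
    then have "x = inv i \<otimes> y \<otimes> inv j" using cI cJ cH xy(1) by (simp add: word_simps)
    then show ?thesis unfolding Dmem
      using subgroup.m_inv_closed[OF I y(1)] subgroup.m_inv_closed[OF J y(2)] by blast
  qed
  have DH: "D x \<subseteq> H" if "x \<in> H" for x
    using that sub H unfolding subset_iff Dmem by (blast intro: subgroup.m_closed)
  have Deq: "D y = D x" if "x \<in> H" "y \<in> D x" for x y
  proof
    have "y \<in> H" using DH that by blast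
    then show "D x \<subseteq> D y" using Dsub[of y x] Dsym that by blast
    show "D y \<subseteq> D x" using Dsub that by blast
  qed
  define rp where "rp X = (SOME y. y \<in> X)" for X :: "'a set"
  have rp: "rp (D x) \<in> D x" if "x \<in> H" for x
    unfolding rp_def by (rule someI[of _ x]) (rule Dself[OF that])
  have "double_coset_reps G I H J ((\<lambda>x. rp (D x)) ` H)"
    unfolding double_coset_reps_def D_def[symmetric]
  proof (intro conjI ballI)
    show "(\<lambda>x. rp (D x)) ` H \<subseteq> H" using rp DH by blast
    fix x assume x: "x \<in> H"
    show "\<exists>!r. r \<in> (\<lambda>x. rp (D x)) ` H \<and> x \<in> D r"
    proof (rule ex1I[of _ "rp (D x)"])
      show "rp (D x) \<in> (\<lambda>x. rp (D x)) ` H \<and> x \<in> D (rp (D x))"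
        using x rp Dsym by auto
      fix r assume r: "r \<in> (\<lambda>x. rp (D x)) ` H \<and> x \<in> D r"
      then obtain y where y: "y \<in> H" "r = rp (D y)" by auto
      then have "D r = D y" using rp Deq by blast
      moreover have "r \<in> H" using y rp DH by blast
      ultimately have "D x = D y" using r Deq[of r x] by simp
      then show "r = rp (D x)" using y by simp
    qed
  qed
  then show ?thesis by blast
qed

end

section \<open>Topological groups\<close>

locale topo_group = grp G for G :: "'a monoid" (structure) +
  fixes T :: "'a topology"
  assumes top: "topological_group G T"
begin

lemma topspace [simp]: "topspace T = carrier G"
  using top by (simp add: topological_group_def)

lemma cont_inv: "continuous_map T T (\<lambda>x. inv x)"
  using top by (simp add: topological_group_def)

lemma cont_mult:
  assumes "continuous_map X T f" "continuous_map X T g"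
  shows "continuous_map X T (\<lambda>x. f x \<otimes> g x)"
proof -
  have "continuous_map (prod_topology T T) T (\<lambda>(x, y). x \<otimes> y)"
    using top by (simp add: topological_group_def)
  moreover have "continuous_map X (prod_topology T T) (\<lambda>x. (f x, g x))"
    using assms by (simp add: continuous_map_paired)
  ultimately have "continuous_map X T ((\<lambda>(x, y). x \<otimes> y) \<circ> (\<lambda>x. (f x, g x)))"
    by (rule continuous_map_compose[rotated])
  then show ?thesis by (simp add: o_def)
qed

lemma cont_transl:
  assumes "a \<in> carrier G"
  shows "continuous_map T T (\<lambda>x. x \<otimes> a)" "continuous_map T T (\<lambda>x. a \<otimes> x)"
  using assms by (auto intro!: cont_mult simp: continuous_map_id[unfolded id_def])

lemma cont_pow: "continuous_map T T (\<lambda>x. x [^] (n::nat))"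
  by (induction n) (auto intro!: cont_mult simp: continuous_map_id[unfolded id_def])

text \<open>Cosets as preimages under translations: that cosets of open or closed subgroups are open
  or closed then follows from continuity.\<close>

lemma rcos_preimage:
  assumes "K \<subseteq> carrier G" "a \<in> carrier G"
  shows "K #> a = {x \<in> topspace T. x \<otimes> inv a \<in> K}"
  using rcos_mem_iff[OF assms(1) _ assms(2)] r_coset_subset_G[OF assms] by auto

lemma openin_rcos: "openin T K \<Longrightarrow> a \<in> carrier G \<Longrightarrow> openin T (K #> a)"
  using openin_subset[of T K] openin_continuous_map_preimage[OF cont_transl(1)[of "inv a"], of K]
  by (simp add: rcos_preimage)

lemma closedin_rcos: "closedin T K \<Longrightarrow> a \<in> carrier G \<Longrightarrow> closedin T (K #> a)"
  using closedin_subset[of T K] closedin_continuous_map_preimage[OF cont_transl(1)[of "inv a"], of K]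
  by (simp add: rcos_preimage)

lemma openin_supergroup:
  assumes "subgroup K G" "openin T K" "subgroup H G" "K \<subseteq> H"
  shows "openin T H"
proof -
  have "H = (\<Union>h\<in>H. K #> h)"
  proof
    show "H \<subseteq> (\<Union>h\<in>H. K #> h)" using rcos_self[OF subgroup.mem_carrier[OF assms(3)] assms(1)] by blast
    show "(\<Union>h\<in>H. K #> h) \<subseteq> H" using assms by (auto simp: r_coset_def subgroup.m_closed subset_iff)
  qed
  moreover have "openin T (\<Union>h\<in>H. K #> h)"
    using openin_rcos[OF assms(2)] subgroup.mem_carrier[OF assms(3)] by blast
  ultimately show ?thesis by simp
qed

lemma rcos_compl:
  assumes "subgroup K G"
  shows "carrier G - K = (\<Union>a\<in>carrier G - K. K #> a)"
proof
  show "carrier G - K \<subseteq> (\<Union>a\<in>carrier G - K. K #> a)" using rcos_self[OF _ assms] by blast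
  show "(\<Union>a\<in>carrier G - K. K #> a) \<subseteq> carrier G - K"
  proof clarify
    fix x a assume a: "a \<in> carrier G" "a \<notin> K" "x \<in> K #> a"
    then have x: "x \<in> carrier G" "x \<otimes> inv a \<in> K"
      using rcos_preimage[OF subgroup.subset[OF assms] a(1)] by auto
    have "x \<notin> K"
    proof
      assume "x \<in> K"
      then have "inv (inv x \<otimes> (x \<otimes> inv a)) \<in> K"
        using x assms by (meson subgroup.m_closed subgroup.m_inv_closed)
      then show False using x a by simp
    qed
    then show "x \<in> carrier G - K" using x by simp
  qed
qed

lemma closedin_open_subgroup:
  assumes "subgroup K G" "openin T K" shows "closedin T K"
proof -
  have "openin T (\<Union>a\<in>carrier G - K. K #> a)" using openin_rcos[OF assms(2)] by blast
  then show ?thesis using rcos_compl[OF assms(1)] subgroup.subset[OF assms(1)]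
    by (simp add: closedin_def)
qed

text \<open>The complement is the union of the finitely many other cosets, each of them
  closed.\<close>

lemma openin_closed_finite_cover:
  assumes K: "subgroup K G" "closedin T K" and R: "finite R" "R \<subseteq> carrier G"
    and cov: "carrier G \<subseteq> (\<Union>r\<in>R. K #> r)"
  shows "openin T K"
proof -
  have "carrier G - K = (\<Union>r\<in>R - K. K #> r)"
  proof
    show "carrier G - K \<subseteq> (\<Union>r\<in>R - K. K #> r)"
    proof
      fix x assume x: "x \<in> carrier G - K"
      then obtain r where r: "r \<in> R" "x \<in> K #> r" using cov by blast
      have "r \<notin> K" using r x subgroup.rcos_const[OF K(1) is_group] by auto
      then show "x \<in> (\<Union>r\<in>R - K. K #> r)" using r by auto
    qed
    show "(\<Union>r\<in>R - K. K #> r) \<subseteq> carrier G - K" using rcos_compl[OF K(1)] R by auto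
  qed
  moreover have "closedin T (\<Union>r\<in>R - K. K #> r)"
    using R closedin_rcos[OF K(2)] by (intro closedin_Union) auto
  ultimately show ?thesis using subgroup.subset[OF K(1)]
    by (simp add: openin_closedin_eq)
qed

text \<open>Closedness under products is extended to the closure one factor at a time: for
  \<open>x\<close> in \<open>B\<close> the \<open>y\<close> with \<open>x \<otimes> y\<close> in the
  closure form a closed set containing \<open>B\<close>; then the roles of the factors are
  exchanged.\<close>

lemma closure_generate_subgroup:
  assumes B: "subgroup B G"
  shows "subgroup (T closure_of B) G"
proof -
  define A where "A = T closure_of B"
  have cl: "closedin T A" by (simp add: A_def)
  have BA: "B \<subseteq> A" unfolding A_def using subgroup.subset[OF B] by (intro closure_of_subset) simp
  have AG: "A \<subseteq> carrier G" using closedin_subset[OF cl] by simp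
  have min: "A \<subseteq> F" if "closedin T F" "B \<subseteq> F" for F
    unfolding A_def using that by (rule closure_of_minimal[rotated])
  have 1: "x \<otimes> y \<in> A" if "x \<in> B" "y \<in> A" for x y
  proof -
    have "x \<in> carrier G" using that subgroup.mem_carrier[OF B] by simp
    then have "closedin T {y \<in> topspace T. x \<otimes> y \<in> A}"
      using cl by (intro closedin_continuous_map_preimage[OF cont_transl(2)])
    moreover have "B \<subseteq> {y \<in> topspace T. x \<otimes> y \<in> A}"
      using that(1) BA B subgroup.mem_carrier[OF B] by (auto simp: subgroup.m_closed subset_iff)
    ultimately show ?thesis using min that by blast
  qed
  have 2: "x \<otimes> y \<in> A" if "x \<in> A" "y \<in> A" for x y
  proof -
    have "y \<in> carrier G" using that AG by auto
    then have "closedin T {x \<in> topspace T. x \<otimes> y \<in> A}"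
      using cl by (intro closedin_continuous_map_preimage[OF cont_transl(1)])
    moreover have "B \<subseteq> {x \<in> topspace T. x \<otimes> y \<in> A}"
      using 1 that(2) subgroup.mem_carrier[OF B] by auto
    ultimately show ?thesis using min that by blast
  qed
  have 3: "inv x \<in> A" if "x \<in> A" for x
  proof -
    have "closedin T {x \<in> topspace T. inv x \<in> A}"
      using cl by (intro closedin_continuous_map_preimage[OF cont_inv])
    moreover have "B \<subseteq> {x \<in> topspace T. inv x \<in> A}"
      using BA B subgroup.mem_carrier[OF B] by (auto simp: subgroup.m_inv_closed subset_iff)
    ultimately show ?thesis using min that by blast
  qed
  show ?thesis unfolding A_def[symmetric]
    using AG BA subgroup.one_closed[OF B] 2 3 by (intro subgroupI) auto
qed

end

locale compact_group = topo_group +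
  assumes compact: "compact_space T"
begin

text \<open>Cosets are disjoint, so a finite subcover of the cover by all cosets already contains
  every one of them.\<close>

lemma open_subgroup_finite_rcosets:
  assumes "subgroup K G" "openin T K"
  shows "finite ((\<lambda>x. K #> x) ` carrier G)"
proof -
  have "compactin T (topspace T)" using compact by (simp add: compact_space_def)
  moreover have "\<forall>U\<in>(\<lambda>x. K #> x) ` carrier G. openin T U" using openin_rcos[OF assms(2)] by auto
  moreover have "topspace T \<subseteq> \<Union> ((\<lambda>x. K #> x) ` carrier G)" using rcos_self[OF _ assms(1)] by auto
  ultimately obtain F where F: "finite F" "F \<subseteq> (\<lambda>x. K #> x) ` carrier G" "topspace T \<subseteq> \<Union>F"
    unfolding compactin_def by meson
  have "(\<lambda>x. K #> x) ` carrier G \<subseteq> F"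
  proof clarify
    fix x assume x: "x \<in> carrier G"
    then obtain X where X: "X \<in> F" "x \<in> X" using F by auto
    then obtain y where y: "y \<in> carrier G" "X = K #> y" using F by auto
    then show "K #> x \<in> F" using X repr_independence[OF _ y(1) assms(1)] by simp
  qed
  then show ?thesis using F(1) by (rule finite_subset)
qed

text \<open>\<open>N\<close> is the intersection of all conjugates of \<open>K\<close>. It is open
  because the condition imposed by \<open>g\<close> depends only on the coset \<open>K #> g\<close>,
  and compactness leaves finitely many of these.\<close>

lemma open_normal_core:
  assumes "subgroup K G" "openin T K"
  shows "\<exists>N. subgroup N G \<and> openin T N \<and> N \<subseteq> K \<and> (\<forall>g\<in>carrier G. \<forall>n\<in>N. g \<otimes> n \<otimes> inv g \<in> N)"
proof -
  define N where "N = {x \<in> carrier G. \<forall>g\<in>carrier G. g \<otimes> x \<otimes> inv g \<in> K}"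
  note cK = subgroup.mem_carrier[OF assms(1)]
  have sub: "subgroup N G"
  proof (rule subgroupI)
    show "N \<subseteq> carrier G" by (auto simp: N_def)
    show "N \<noteq> {}" using subgroup.one_closed[OF assms(1)] by (auto simp: N_def intro!: exI[of _ \<one>])
    show "inv a \<in> N" if "a \<in> N" for a
    proof -
      have "inv (g \<otimes> a \<otimes> inv g) \<in> K" if "g \<in> carrier G" for g
        using that \<open>a \<in> N\<close> assms(1) by (auto simp: N_def intro: subgroup.m_inv_closed)
      then show ?thesis using that by (auto simp: N_def word_simps)
    qed
    show "a \<otimes> b \<in> N" if "a \<in> N" "b \<in> N" for a b
    proof -
      have "(g \<otimes> a \<otimes> inv g) \<otimes> (g \<otimes> b \<otimes> inv g) \<in> K" if "g \<in> carrier G" for g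
        using that \<open>a \<in> N\<close> \<open>b \<in> N\<close> assms(1) by (auto simp: N_def intro: subgroup.m_closed)
      then show ?thesis using that by (auto simp: N_def word_simps)
    qed
  qed
  have "N \<subseteq> K" using cK by (force simp: N_def dest: bspec[of _ _ \<one>])
  have nrm: "g \<otimes> n \<otimes> inv g \<in> N" if "g \<in> carrier G" "n \<in> N" for g n
  proof -
    have "(k \<otimes> g) \<otimes> n \<otimes> inv (k \<otimes> g) \<in> K" if "k \<in> carrier G" for k
      using that \<open>g \<in> _\<close> \<open>n \<in> N\<close> by (auto simp: N_def)
    then show ?thesis using that by (auto simp: N_def word_simps)
  qed
  have "openin T N"
  proof -
    define \<C> where "\<C> = (\<lambda>x. K #> x) ` carrier G"
    \<comment> \<open>\<open>SOME\<close> picks one representative \<open>g\<close> per coset;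
      \<open>g \<otimes> x\<close> lying in \<open>K #> g\<close> says the same as
      \<open>g \<otimes> x \<otimes> inv g\<close> lying in \<open>K\<close>, and is visibly an open
      condition on \<open>x\<close>.\<close>
    have eq: "N = topspace T \<inter> (\<Inter>X\<in>\<C>. {x \<in> topspace T. (SOME g. g \<in> X) \<otimes> x \<in> X})"
      (is "_ = ?R")
    proof -
      have s: "(SOME g. g \<in> K #> g') \<in> K #> g'" if "g' \<in> carrier G" for g'
        by (rule someI[of _ g']) (rule rcos_self[OF that assms(1)])
      have "(\<forall>g\<in>carrier G. g \<otimes> x \<otimes> inv g \<in> K) \<longleftrightarrow> (\<forall>g'\<in>carrier G. (SOME g. g \<in> K #> g') \<otimes> x \<in> K #> g')"
        if x: "x \<in> carrier G" for x
      proof -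
        have "g' \<otimes> x \<otimes> inv g' \<in> K \<longleftrightarrow> (SOME g. g \<in> K #> g') \<otimes> x \<in> K #> g'" if g': "g' \<in> carrier G" for g'
        proof -
          define g where "g = (SOME g. g \<in> K #> g')"
          have gK: "g \<in> K #> g'" using s[OF g'] by (simp add: g_def)
          then obtain k where k: "k \<in> K" "g = k \<otimes> g'" by (auto simp: r_coset_def)
          have gc: "g \<in> carrier G" using k g' cK by simp
          have "g \<otimes> x \<in> K #> g' \<longleftrightarrow> k \<otimes> (g' \<otimes> x \<otimes> inv g') \<in> K"
            using rcos_mem_iff[OF subgroup.subset[OF assms(1)] _ g'] x gc k g' cK by (simp add: word_simps)
          also have "\<dots> \<longleftrightarrow> g' \<otimes> x \<otimes> inv g' \<in> K"
          proof
            assume "k \<otimes> (g' \<otimes> x \<otimes> inv g') \<in> K"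
            then have "inv k \<otimes> (k \<otimes> (g' \<otimes> x \<otimes> inv g')) \<in> K"
              using k assms(1) by (meson subgroup.m_closed subgroup.m_inv_closed)
            then show "g' \<otimes> x \<otimes> inv g' \<in> K" using k g' x cK by simp
          qed (use k assms(1) in \<open>auto intro: subgroup.m_closed\<close>)
          finally show ?thesis by (simp add: g_def)
        qed
        then show ?thesis by blast
      qed
      then show ?thesis unfolding N_def \<C>_def by auto
    qed
    have "finite \<C>" unfolding \<C>_def by (rule open_subgroup_finite_rcosets[OF assms])
    moreover have "openin T {x \<in> topspace T. (SOME g. g \<in> X) \<otimes> x \<in> X}" if XC: "X \<in> \<C>" for X
    proof -
      obtain g' where g': "g' \<in> carrier G" "X = K #> g'" using XC by (auto simp: \<C>_def)
      have "(SOME g. g \<in> X) \<in> X" unfolding g' by (rule someI[of _ g']) (rule rcos_self[OF g'(1) assms(1)])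
      then have "(SOME g. g \<in> X) \<in> carrier G" using g' cK by (auto simp: r_coset_def)
      then show ?thesis using openin_rcos[OF assms(2) g'(1)] g'(2)
        by (intro openin_continuous_map_preimage[OF cont_transl(2)]) auto
    qed
    ultimately have "openin T (topspace T \<inter> \<Inter> ((\<lambda>X. {x \<in> topspace T. (SOME g. g \<in> X) \<otimes> x \<in> X}) ` \<C>))"
      by (intro openin_Int_Inter openin_topspace) auto
    then show ?thesis using eq by simp
  qed
  then show ?thesis using sub \<open>N \<subseteq> K\<close> nrm by blast
qed

end

section \<open>The degree map\<close>

context compact_group
begin

lemma pow_mem_open_subgroup:
  assumes "subgroup K G" "openin T K" "x \<in> carrier G"
  shows "\<exists>n>0. x [^] (n::nat) \<in> K"
proof -
  have "\<not> inj_on (\<lambda>i::nat. K #> x [^] i) UNIV"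
  proof
    assume "inj_on (\<lambda>i::nat. K #> x [^] i) UNIV"
    moreover have "finite ((\<lambda>i::nat. K #> x [^] i) ` UNIV)"
      by (rule finite_subset[OF _ open_subgroup_finite_rcosets[OF assms(1,2)]]) (use assms in auto)
    ultimately show False using finite_imageD by blast
  qed
  then obtain i j :: nat where ij: "i < j" "K #> x [^] i = K #> x [^] j"
    unfolding inj_on_def by (metis linorder_neqE_nat)
  have "x [^] j \<otimes> inv (x [^] i) \<in> K" using ij assms rcos_eq_iff[OF assms(1)] by (metis nat_pow_closed)
  moreover have "x [^] j = x [^] (j - i) \<otimes> x [^] i" using ij assms by (simp add: nat_pow_mult)
  ultimately show ?thesis using ij assms by (intro exI[of _ "j - i"]) (simp add: word_simps)
qed

end

text \<open>Division with remainder by the least positive element. It is applied to the exponents of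
  \<open>\<omega>\<close> in a subgroup, to the return times of an orbit on cosets, and to the
  exponents for which a power is a reciprocity value.\<close>

lemma least_exponent:
  fixes A :: "nat set"
  assumes "n \<in> A" "n > 0" and "\<And>i j. i \<in> A \<Longrightarrow> j \<in> A \<Longrightarrow> i + j \<in> A"
    and "\<And>i j. i \<in> A \<Longrightarrow> j \<in> A \<Longrightarrow> i \<le> j \<Longrightarrow> j - i \<in> A"
  obtains k where "k > 0" "\<And>i. i \<in> A \<longleftrightarrow> k dvd i"
proof -
  define k where "k = (LEAST i. i > 0 \<and> i \<in> A)"
  have k: "k > 0" "k \<in> A" using LeastI[of "\<lambda>i. i > 0 \<and> i \<in> A" n] assms by (auto simp: k_def)
  have le: "k \<le> i" if "i > 0" "i \<in> A" for i unfolding k_def by (rule Least_le) (use that in auto)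
  have 0: "0 \<in> A" using assms(4)[OF k(2) k(2)] by simp
  have mult: "k * q \<in> A" for q by (induction q) (use 0 k assms(3) in auto)
  have "i \<in> A \<longleftrightarrow> k dvd i" for i
  proof
    assume i: "i \<in> A"
    have "i - k * (i div k) \<in> A" by (rule assms(4)[OF mult i]) simp
    then have "i mod k \<in> A" by (simp add: minus_mult_div_eq_mod)
    then have "i mod k = 0" using le[of "i mod k"] k(1) mod_less_divisor[of k i] by linarith
    then show "k dvd i" by auto
  qed (auto simp: mult)
  then show ?thesis using that k(1) by blast
qed

text \<open>Of the isomorphism with the \<open>P\<close>-adic integers only the following properties of the value group are used.\<close>

locale degree_map = compact_group G T + W: topo_group W S
  for G :: "'g monoid" (structure) and T :: "'g topology" and W :: "'w monoid" and S :: "'w topology" +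
  fixes P :: "nat set" and \<omega> :: 'w and d :: "'g \<Rightarrow> 'w"
  assumes P_prime: "p \<in> P \<Longrightarrow> prime p"
    and P_nonempty: "P \<noteq> {}"
    and pro_P: "open_subgroup G T U \<Longrightarrow> U \<lhd> G \<Longrightarrow> prime_factors (order (G Mod U)) \<subseteq> P"
    and W_comm: "comm_group W"
    and W_Hausdorff: "Hausdorff_space S"
    and W_torsion_free: "x \<in> carrier W \<Longrightarrow> n > 0 \<Longrightarrow> x [^]\<^bsub>W\<^esub> (n::nat) = \<one>\<^bsub>W\<^esub> \<Longrightarrow> x = \<one>\<^bsub>W\<^esub>"
    and W_not_divisible: "p \<in> P \<Longrightarrow> (\<lambda>x. x [^]\<^bsub>W\<^esub> p) ` carrier W \<noteq> carrier W"
    and generator: "topological_generator W S \<omega>"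
    and d_hom: "d \<in> hom G W"
    and d_surj: "d ` carrier G = carrier W"
    and d_cont: "continuous_map T S d"
begin

sublocale W: comm_group W by (rule W_comm)
sublocale d: group_hom G W d
  by (simp add: group_hom_def group_hom_axioms_def d_hom is_group W.is_group)

abbreviation "opn \<equiv> open_subgroup G T"
abbreviation "\<I> \<equiv> inertia G W d"
abbreviation "f H \<equiv> res_degree W d (carrier G) H"

text \<open>As the value group is a copy of the \<open>P\<close>-adic integers, \<open>ix n\<close> is the \<open>P\<close>-part of \<open>n\<close>,
  and \<open>ix n = n\<close> expresses that all prime factors of \<open>n\<close> lie in \<open>P\<close>.\<close>

definition Dg :: "nat \<Rightarrow> 'w set" where "Dg n = (\<lambda>x. x [^]\<^bsub>W\<^esub> n) ` carrier W"
definition ix :: "nat \<Rightarrow> nat" where "ix n = grp_index W (carrier W) (Dg n)"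

lemma opnD: "opn H \<Longrightarrow> subgroup H G" "opn H \<Longrightarrow> openin T H"
  by (auto simp: open_subgroup_def)

lemma opn_carrier: "opn H \<Longrightarrow> x \<in> H \<Longrightarrow> x \<in> carrier G"
  using opnD subgroup.mem_carrier by metis

lemma opn_subset: "opn H \<Longrightarrow> H \<subseteq> carrier G"
  using opnD subgroup.subset by metis

lemma opn_closed [simp]:
  assumes "opn H"
  shows "\<one> \<in> H" "x \<in> H \<Longrightarrow> y \<in> H \<Longrightarrow> x \<otimes> y \<in> H" "x \<in> H \<Longrightarrow> inv x \<in> H"
  using opnD[OF assms] by (auto intro: subgroup.one_closed subgroup.m_closed subgroup.m_inv_closed)

lemma opn_pow [simp]: "opn H \<Longrightarrow> x \<in> H \<Longrightarrow> x [^] (n::nat) \<in> H"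
  by (induction n) auto

lemma opn_UNIV: "opn (carrier G)"
  using openin_topspace[of T] by (auto simp: open_subgroup_def subgroup_self)

lemma opn_Int: "opn H \<Longrightarrow> opn K \<Longrightarrow> opn (H \<inter> K)"
  by (auto simp: open_subgroup_def subgroups_Inter_pair)

lemma \<omega>_carrier [simp]: "\<omega> \<in> carrier W"
  using generator by (simp add: topological_generator_def)

lemma \<omega>_dense: "closedin S F \<Longrightarrow> generate W {\<omega>} \<subseteq> F \<Longrightarrow> F = carrier W"
  using generator closure_of_minimal[of "generate W {\<omega>}" F S] closedin_subset[of S F]
  by (auto simp: topological_generator_def)

lemma compact_S: "compact_space S"
proof -
  have "compactin S (d ` topspace T)"
    using image_compactin[OF _ d_cont, of "topspace T"] compact by (simp add: compact_space_def)
  then show ?thesis using d_surj by (simp add: compact_space_def)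
qed

lemma closedin_image:
  assumes "closedin T A" shows "closedin S (d ` A)"
  using image_compactin[OF closedin_compact_space[OF compact assms] d_cont]
  by (rule compactin_imp_closedin[OF W_Hausdorff])

section \<open>Closed subgroups of the value group and their indices\<close>

lemma Dg_closedin: "closedin S (Dg n)"
proof -
  have "compactin S ((\<lambda>x. x [^]\<^bsub>W\<^esub> n) ` topspace S)"
    using image_compactin[OF _ W.cont_pow[of n], of "topspace S"] compact_S by (simp add: compact_space_def)
  then show ?thesis using compactin_imp_closedin[OF W_Hausdorff] by (simp add: Dg_def)
qed

lemma Dg_subset: "Dg n \<subseteq> carrier W" by (auto simp: Dg_def)

lemma Dg_subgroup: "subgroup (Dg n) W"
proof (rule W.subgroupI)
  show "inv\<^bsub>W\<^esub> a \<in> Dg n" if "a \<in> Dg n" for a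
    using that by (auto simp: Dg_def W.nat_pow_inv[symmetric] intro!: imageI)
  show "a \<otimes>\<^bsub>W\<^esub> b \<in> Dg n" if "a \<in> Dg n" "b \<in> Dg n" for a b
    using that by (auto simp: Dg_def W.nat_pow_distrib[symmetric] intro!: imageI)
qed (auto simp: Dg_def)

lemma Dg_1: "Dg (Suc 0) = carrier W" by (force simp: Dg_def)

lemma Dg_mult: "Dg (a * b) \<subseteq> Dg a"
  by (auto simp: Dg_def W.nat_pow_pow[symmetric] mult.commute[of a] intro!: imageI)

lemma \<omega>_pow_Dg: "\<omega> [^]\<^bsub>W\<^esub> (n * m) \<in> Dg n"
  by (auto simp: Dg_def W.nat_pow_pow[symmetric] mult.commute[of n] intro!: imageI)

lemma W_pow_inj:
  assumes "x \<in> carrier W" "y \<in> carrier W" "n > 0" "x [^]\<^bsub>W\<^esub> (n::nat) = y [^]\<^bsub>W\<^esub> n"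
  shows "x = y"
proof -
  have "(x \<otimes>\<^bsub>W\<^esub> inv\<^bsub>W\<^esub> y) [^]\<^bsub>W\<^esub> n = \<one>\<^bsub>W\<^esub>"
    using assms by (simp add: W.nat_pow_distrib W.nat_pow_inv)
  then have "x \<otimes>\<^bsub>W\<^esub> inv\<^bsub>W\<^esub> y = \<one>\<^bsub>W\<^esub>" by (rule W_torsion_free[OF W.m_closed[OF assms(1) W.inv_closed[OF assms(2)]] assms(3)])
  then show ?thesis using assms by (metis W.inv_equality W.inv_inv W.inv_closed)
qed

text \<open>The elements whose \<open>n\<close>-th power lies in \<open>F\<close> form a closed
  subgroup containing \<open>\<omega>\<close>, hence are everything.\<close>

lemma closed_contains_Dg:
  assumes "closedin S F" "subgroup F W" "\<omega> [^]\<^bsub>W\<^esub> (n::nat) \<in> F"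
  shows "Dg n \<subseteq> F"
proof -
  define X where "X = {x \<in> topspace S. x [^]\<^bsub>W\<^esub> n \<in> F}"
  have "closedin S X" unfolding X_def by (rule closedin_continuous_map_preimage[OF W.cont_pow assms(1)])
  moreover have "subgroup X W"
    by (rule W.subgroupI)
      (use assms in \<open>auto simp: X_def W.nat_pow_inv W.nat_pow_distrib subgroup.m_closed
        subgroup.m_inv_closed subgroup.one_closed intro!: exI[of _ "\<one>\<^bsub>W\<^esub>"]\<close>)
  then have "generate W {\<omega>} \<subseteq> X"
    using assms by (intro W.generate_subgroup_incl) (auto simp: X_def)
  ultimately have "X = carrier W" by (rule \<omega>_dense)
  then show ?thesis by (auto simp: X_def Dg_def)
qed

text \<open>Division with remainder by \<open>n\<close> puts every integral power of
  \<open>\<omega>\<close> into a finite union of closed cosets; density of these powers extends this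
  to the whole value group.\<close>

lemma W_cover:
  assumes "n > 0" "x \<in> carrier W"
  shows "\<exists>i<n. x \<otimes>\<^bsub>W\<^esub> inv\<^bsub>W\<^esub> (\<omega> [^]\<^bsub>W\<^esub> i) \<in> Dg n"
proof -
  define X where "X = (\<Union>i\<in>{..<n}. Dg n #>\<^bsub>W\<^esub> (\<omega> [^]\<^bsub>W\<^esub> i))"
  have "closedin S X" unfolding X_def
    by (intro closedin_Union) (auto intro!: W.closedin_rcos Dg_closedin)
  moreover have "generate W {\<omega>} \<subseteq> X"
  proof
    fix y assume "y \<in> generate W {\<omega>}"
    then obtain k :: int where y: "y = \<omega> [^]\<^bsub>W\<^esub> k" using W.generate_pow[OF \<omega>_carrier] by auto
    have "k = (k div int n) * int n + int (nat (k mod int n))" using assms by simp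
    then have "y = \<omega> [^]\<^bsub>W\<^esub> ((k div int n) * int n) \<otimes>\<^bsub>W\<^esub> \<omega> [^]\<^bsub>W\<^esub> (nat (k mod int n))"
      using y by (metis W.int_pow_mult \<omega>_carrier int_pow_int)
    then have "y = (\<omega> [^]\<^bsub>W\<^esub> (k div int n)) [^]\<^bsub>W\<^esub> n \<otimes>\<^bsub>W\<^esub> \<omega> [^]\<^bsub>W\<^esub> (nat (k mod int n))"
      by (simp add: W.int_pow_pow[symmetric] int_pow_int)
    moreover have "(\<omega> [^]\<^bsub>W\<^esub> (k div int n)) [^]\<^bsub>W\<^esub> n \<in> Dg n" by (auto simp: Dg_def)
    moreover have "nat (k mod int n) < n" using assms by (simp add: nat_less_iff)
    ultimately show "y \<in> X" unfolding X_def r_coset_def by blast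
  qed
  ultimately have "x \<in> X" using \<omega>_dense assms by blast
  then obtain i where "i < n" "x \<in> Dg n #>\<^bsub>W\<^esub> (\<omega> [^]\<^bsub>W\<^esub> i)" by (auto simp: X_def)
  then show ?thesis using W.rcos_mem_iff[OF Dg_subset assms(2), of "\<omega> [^]\<^bsub>W\<^esub> i"] by auto
qed

lemma pow_exponents:
  assumes "subgroup F W" "\<omega> [^]\<^bsub>W\<^esub> (n::nat) \<in> F" "n > 0"
  obtains k where "k > 0" "\<And>i. \<omega> [^]\<^bsub>W\<^esub> (i::nat) \<in> F \<longleftrightarrow> k dvd i"
proof (rule least_exponent[of n "{i::nat. \<omega> [^]\<^bsub>W\<^esub> i \<in> F}"])
  show "i + j \<in> {i::nat. \<omega> [^]\<^bsub>W\<^esub> i \<in> F}" if "i \<in> {i. \<omega> [^]\<^bsub>W\<^esub> i \<in> F}" "j \<in> {i. \<omega> [^]\<^bsub>W\<^esub> i \<in> F}" for i j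
    using that assms by (auto simp: W.nat_pow_mult[symmetric] subgroup.m_closed)
  show "j - i \<in> {i::nat. \<omega> [^]\<^bsub>W\<^esub> i \<in> F}" if "i \<in> {i. \<omega> [^]\<^bsub>W\<^esub> i \<in> F}" "j \<in> {i. \<omega> [^]\<^bsub>W\<^esub> i \<in> F}" "i \<le> j" for i j
  proof -
    have "\<omega> [^]\<^bsub>W\<^esub> j \<otimes>\<^bsub>W\<^esub> inv\<^bsub>W\<^esub> (\<omega> [^]\<^bsub>W\<^esub> i) \<in> F"
      using that assms(1) by (auto intro: subgroup.m_closed subgroup.m_inv_closed)
    moreover have "\<omega> [^]\<^bsub>W\<^esub> j = \<omega> [^]\<^bsub>W\<^esub> (j - i) \<otimes>\<^bsub>W\<^esub> \<omega> [^]\<^bsub>W\<^esub> i"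
      using that by (simp add: W.nat_pow_mult)
    ultimately show ?thesis by (simp add: W.word_simps)
  qed
qed (use assms that in auto)

text \<open>With \<open>k\<close> the least positive exponent occurring in \<open>F\<close>, the
  remainder in \<open>W_cover\<close> vanishes on \<open>F\<close>. Counting cosets gives
  \<open>ix k = k\<close>: the exponent found has no primes outside \<open>P\<close>.\<close>

lemma closed_subgroup_Dg:
  assumes "closedin S F" "subgroup F W" "\<omega> [^]\<^bsub>W\<^esub> (n::nat) \<in> F" "n > 0"
  obtains k where "k > 0" "F = Dg k" "ix k = k" "\<And>i. \<omega> [^]\<^bsub>W\<^esub> (i::nat) \<in> Dg k \<longleftrightarrow> k dvd i"
proof -
  obtain k where k: "k > 0" "\<And>i. \<omega> [^]\<^bsub>W\<^esub> (i::nat) \<in> F \<longleftrightarrow> k dvd i"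
    using pow_exponents[OF assms(2-4)] by blast
  have sub: "Dg k \<subseteq> F" by (rule closed_contains_Dg[OF assms(1,2)]) (simp add: k)
  have "F \<subseteq> Dg k"
  proof
    fix x assume x: "x \<in> F"
    then have xc: "x \<in> carrier W" using subgroup.mem_carrier[OF assms(2)] by simp
    obtain i where i: "i < k" "x \<otimes>\<^bsub>W\<^esub> inv\<^bsub>W\<^esub> (\<omega> [^]\<^bsub>W\<^esub> i) \<in> Dg k" using W_cover[OF k(1) xc] by blast
    then have "inv\<^bsub>W\<^esub> (inv\<^bsub>W\<^esub> x \<otimes>\<^bsub>W\<^esub> (x \<otimes>\<^bsub>W\<^esub> inv\<^bsub>W\<^esub> (\<omega> [^]\<^bsub>W\<^esub> i))) \<in> F"
      using sub x assms(2) by (meson subgroup.m_closed subgroup.m_inv_closed subsetD)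
    then have "\<omega> [^]\<^bsub>W\<^esub> i \<in> F" using xc by simp
    then have "i = 0" using k i(1) by (metis dvd_imp_le gr0I linorder_not_less)
    then show "x \<in> Dg k" using i xc by simp
  qed
  with sub have F: "F = Dg k" by simp
  have "ix k = k" unfolding ix_def
  proof (rule W.grp_index_cyclic[where g = \<omega>])
    show "\<exists>i::nat. x \<otimes>\<^bsub>W\<^esub> inv\<^bsub>W\<^esub> (\<omega> [^]\<^bsub>W\<^esub> i) \<in> Dg k" if "x \<in> carrier W" for x
      using W_cover[OF k(1) that] by blast
  qed (use k F Dg_subgroup in auto)
  then show ?thesis using that k F by auto
qed

lemma ix_properties:
  assumes "n > 0"
  shows ix_pos: "ix n > 0" and Dg_ix: "Dg (ix n) = Dg n" and ix_ix: "ix (ix n) = ix n"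
    and \<omega>_pow_Dg_iff: "\<omega> [^]\<^bsub>W\<^esub> (i::nat) \<in> Dg n \<longleftrightarrow> ix n dvd i" and ix_dvd: "ix n dvd n"
proof -
  have n: "\<omega> [^]\<^bsub>W\<^esub> n \<in> Dg n" using \<omega>_pow_Dg[of n 1] by simp
  then obtain k where k: "k > 0" "Dg n = Dg k" "ix k = k"
      "\<And>i. \<omega> [^]\<^bsub>W\<^esub> (i::nat) \<in> Dg k \<longleftrightarrow> k dvd i"
    using closed_subgroup_Dg[OF Dg_closedin Dg_subgroup n assms] by metis
  then have "ix n = k" by (simp add: ix_def)
  then show "ix n > 0" "Dg (ix n) = Dg n" "ix (ix n) = ix n"
    "\<omega> [^]\<^bsub>W\<^esub> (i::nat) \<in> Dg n \<longleftrightarrow> ix n dvd i" "ix n dvd n" using k n by auto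
qed

lemma Dg_openin: assumes "n > 0" shows "openin S (Dg n)"
proof (rule W.openin_closed_finite_cover[OF Dg_subgroup Dg_closedin])
  show "carrier W \<subseteq> (\<Union>r\<in>(\<lambda>i::nat. \<omega> [^]\<^bsub>W\<^esub> i) ` {..<n}. Dg n #>\<^bsub>W\<^esub> r)"
    
  proof
    fix x assume x: "x \<in> carrier W"
    obtain i where "i < n" "x \<otimes>\<^bsub>W\<^esub> inv\<^bsub>W\<^esub> (\<omega> [^]\<^bsub>W\<^esub> i) \<in> Dg n" using W_cover[OF assms x] by blast
    then have "x \<in> Dg n #>\<^bsub>W\<^esub> (\<omega> [^]\<^bsub>W\<^esub> i)" using W.rcos_mem_iff[OF Dg_subset x] by simp
    then show "x \<in> (\<Union>r\<in>(\<lambda>i::nat. \<omega> [^]\<^bsub>W\<^esub> i) ` {..<n}. Dg n #>\<^bsub>W\<^esub> r)" using \<open>i < n\<close> by blast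
  qed
qed auto

text \<open>Torsion-freeness permits dividing exponents by \<open>a\<close>.\<close>

lemma Dg_cancel:
  assumes "a > 0" "x \<in> carrier W" "x [^]\<^bsub>W\<^esub> a \<in> Dg (a * m)"
  shows "x \<in> Dg m"
proof -
  obtain y where y: "y \<in> carrier W" "x [^]\<^bsub>W\<^esub> a = y [^]\<^bsub>W\<^esub> (a * m)" using assms by (auto simp: Dg_def)
  then have "x [^]\<^bsub>W\<^esub> a = (y [^]\<^bsub>W\<^esub> m) [^]\<^bsub>W\<^esub> a" by (simp add: W.nat_pow_pow mult.commute)
  then have "x = y [^]\<^bsub>W\<^esub> m" using W_pow_inj assms y by blast
  then show ?thesis using y by (auto simp: Dg_def)
qed

lemma \<omega>_pow_mult_Dg:
  "a > 0 \<Longrightarrow> m > 0 \<Longrightarrow> \<omega> [^]\<^bsub>W\<^esub> (a * i) \<in> Dg (a * m) \<longleftrightarrow> ix m dvd i"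
proof
  assume a: "a > 0" "m > 0" "\<omega> [^]\<^bsub>W\<^esub> (a * i) \<in> Dg (a * m)"
  then have "(\<omega> [^]\<^bsub>W\<^esub> i) [^]\<^bsub>W\<^esub> a \<in> Dg (a * m)" by (simp add: W.nat_pow_pow mult.commute)
  then have "\<omega> [^]\<^bsub>W\<^esub> i \<in> Dg m" using Dg_cancel[OF a(1) _, of "\<omega> [^]\<^bsub>W\<^esub> i" m] by simp
  then show "ix m dvd i" using \<omega>_pow_Dg_iff a by simp
next
  assume a: "a > 0" "m > 0" "ix m dvd i"
  then have "\<omega> [^]\<^bsub>W\<^esub> i \<in> Dg m" using \<omega>_pow_Dg_iff by simp
  then obtain y where "y \<in> carrier W" "\<omega> [^]\<^bsub>W\<^esub> i = y [^]\<^bsub>W\<^esub> m" by (auto simp: Dg_def)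
  then have "\<omega> [^]\<^bsub>W\<^esub> (a * i) = y [^]\<^bsub>W\<^esub> (a * m)"
    by (simp add: mult.commute[of a] W.nat_pow_pow[symmetric])
  then show "\<omega> [^]\<^bsub>W\<^esub> (a * i) \<in> Dg (a * m)" using \<open>y \<in> carrier W\<close> by (auto simp: Dg_def)
qed

text \<open>Both sides have the same multiples \<open>j\<close>: these are the exponents for which
  the \<open>j\<close>-th power of \<open>\<omega>\<close> is an \<open>(a * m)\<close>-th power. As
  \<open>ix a = a\<close>, such a \<open>j\<close> is divisible by \<open>a\<close>, and
  \<open>a\<close> can be cancelled.\<close>

lemma ix_mult:
  assumes "a > 0" "m > 0" "ix a = a" shows "ix (a * m) = a * ix m"
proof -
  have "ix (a * m) dvd j \<longleftrightarrow> a * ix m dvd j" for j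
  proof
    assume "ix (a * m) dvd j"
    then have *: "\<omega> [^]\<^bsub>W\<^esub> j \<in> Dg (a * m)" using \<omega>_pow_Dg_iff assms by simp
    then have "\<omega> [^]\<^bsub>W\<^esub> j \<in> Dg a" using Dg_mult by blast
    then have "a dvd j" using \<omega>_pow_Dg_iff assms by metis
    then obtain i where "j = a * i" by blast
    then show "a * ix m dvd j" using * \<omega>_pow_mult_Dg assms by simp
  next
    assume "a * ix m dvd j"
    then obtain i where "j = a * (ix m * i)" by (metis dvdE mult.assoc)
    then have "\<omega> [^]\<^bsub>W\<^esub> j \<in> Dg (a * m)" using \<omega>_pow_mult_Dg[OF assms(1,2), of "ix m * i"] by simp
    then show "ix (a * m) dvd j" using \<omega>_pow_Dg_iff assms by simp
  qed
  then show ?thesis by (metis dvd_antisym dvd_refl)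
qed

lemma preimage_opn:
  assumes "opn H" "n > 0" shows "opn {x \<in> H. d x \<in> Dg n}"
  unfolding open_subgroup_def
proof
  show "subgroup {x \<in> H. d x \<in> Dg n} G"
    by (rule subgroupI) (use assms opn_carrier[OF assms(1)] Dg_subgroup[of n] in
      \<open>auto simp: subgroup.one_closed subgroup.m_closed subgroup.m_inv_closed intro!: exI[of _ \<one>]\<close>)
  have "{x \<in> H. d x \<in> Dg n} = H \<inter> {x \<in> topspace T. d x \<in> Dg n}" using opn_carrier[OF assms(1)] by auto
  then show "openin T {x \<in> H. d x \<in> Dg n}"
    using openin_continuous_map_preimage[OF d_cont Dg_openin[OF assms(2)]] opnD[OF assms(1)] by auto
qed

lemma d_lift: "x \<in> carrier W \<Longrightarrow> \<exists>g\<in>carrier G. d g = x"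
  using d_surj by (metis imageE)

text \<open>Pulled back along \<open>d\<close>, the \<open>n\<close>-th powers become an open normal
  subgroup of \<open>G\<close> of index \<open>ix n\<close>, so the pro-P property of
  \<open>G\<close> applies.\<close>

lemma prime_factors_ix:
  assumes "n > 0" shows "prime_factors (ix n) \<subseteq> P"
proof -
  define U where "U = {x \<in> carrier G. d x \<in> Dg n}"
  have U: "opn U" unfolding U_def by (rule preimage_opn[OF opn_UNIV assms])
  have "U \<lhd> G" unfolding normal_inv_iff
  proof (intro conjI ballI opnD(1)[OF U])
    fix x h assume "x \<in> carrier G" "h \<in> U"
    moreover have "d x \<otimes>\<^bsub>W\<^esub> d h \<otimes>\<^bsub>W\<^esub> inv\<^bsub>W\<^esub> d x = d h" if "x \<in> carrier G" "h \<in> carrier G" for x h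
      using that by (simp add: W.m_comm[of "d x"] W.m_assoc)
    ultimately show "x \<otimes> h \<otimes> inv x \<in> U" by (auto simp: U_def)
  qed
  then have "prime_factors (order (G Mod U)) \<subseteq> P" using pro_P U by blast
  moreover obtain g where g: "g \<in> carrier G" "d g = \<omega>" using d_lift[OF \<omega>_carrier] by blast
  have "grp_index G (carrier G) U = ix n"
  proof (rule grp_index_cyclic[OF opnD(1)[OF U] g(1) ix_pos[OF assms]])
    show "g [^] i \<in> U \<longleftrightarrow> ix n dvd i" for i :: nat
      using g \<omega>_pow_Dg_iff[OF assms] by (simp add: U_def d.hom_nat_pow)
    show "\<exists>i::nat. x \<otimes> inv (g [^] i) \<in> U" if "x \<in> carrier G" for x
      using W_cover[OF assms, of "d x"] that g by (auto simp: U_def d.hom_nat_pow)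
  qed (use g in auto)
  moreover have "order (G Mod U) = grp_index G (carrier G) U"
    using order_Mod[of "carrier G" U] by simp
  ultimately show ?thesis by simp
qed

text \<open>If \<open>p\<close> divided \<open>q\<close>, then \<open>Dg (ix n)\<close> would lie in
  \<open>Dg (ix n * p)\<close>, and cancelling \<open>ix n\<close> would make every element a
  \<open>p\<close>-th power.\<close>

lemma ix_cofactor:
  assumes "n = ix n * q" "n > 0" "p \<in> P" shows "\<not> p dvd q"
proof
  assume "p dvd q"
  then obtain r where r: "q = p * r" by blast
  define k where "k = ix n"
  have k: "k > 0" "Dg k = Dg n" using ix_properties[OF assms(2)] by (auto simp: k_def)
  have "n = k * p * r" using assms(1) r by (simp add: k_def mult.assoc)
  then have *: "Dg k \<subseteq> Dg (k * p)" using k(2) Dg_mult[of "k * p" r] by simp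
  have "x \<in> Dg p" if "x \<in> carrier W" for x
  proof (rule Dg_cancel[OF k(1) that])
    have "x [^]\<^bsub>W\<^esub> k \<in> Dg k" using that by (auto simp: Dg_def)
    then show "x [^]\<^bsub>W\<^esub> k \<in> Dg (k * p)" using * by blast
  qed
  then have "Dg p = carrier W" using Dg_subset by auto
  then show False using W_not_divisible[OF assms(3)] by (simp add: Dg_def)
qed

text \<open>The primes of \<open>ix n\<close> lie in \<open>P\<close>, those of the cofactor
  outside, hence the cofactor is P'(n). All later handling of the exponent in the recipe goes
  through this factorization.\<close>

lemma ix_times_prime_to_part:
  assumes "n > 0" shows "ix n * prime_to_part P n = n"
proof -
  obtain q where q: "n = ix n * q" using ix_dvd[OF assms] by blast
  have pos: "q > 0" "ix n > 0" using q assms by (metis gr0I mult_0_right, use ix_pos assms in simp)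
  have nP: "p \<notin> P" if "p \<in> prime_factors q" for p using ix_cofactor[OF q assms] that by auto
  have "prime_factors n - P = prime_factors q"
    using prime_factors_ix[OF assms] nP pos prime_factors_product[of "ix n" q] q by auto
  moreover have "multiplicity p n = multiplicity p q" if "p \<in> prime_factors q" for p
  proof -
    have p: "prime p" "p \<notin> P" using that nP by auto
    then have "\<not> p dvd ix n" using prime_factors_ix[OF assms] pos by (auto simp: prime_factors_dvd)
    then have "multiplicity p (ix n) = 0" by (simp add: not_dvd_imp_multiplicity_0)
    then show ?thesis using q p pos by (metis add_0 prime_elem_multiplicity_mult_distrib
        prime_imp_prime_elem not_gr_zero)
  qed
  ultimately have "prime_to_part P n = (\<Prod>p\<in>prime_factors q. p ^ multiplicity p q)"
    by (simp add: prime_to_part_def)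
  also have "\<dots> = q" using pos prime_factorization_nat by metis
  finally show ?thesis using q by simp
qed

lemma ix_P_number:
  assumes "n > 0" "prime_factors n \<subseteq> P" shows "ix n = n"
proof -
  obtain q where q: "n = ix n * q" using ix_dvd[OF assms(1)] by blast
  have "q = 1"
  proof (rule ccontr)
    assume "q \<noteq> 1"
    then obtain p where p: "prime p" "p dvd q" by (meson prime_factor_nat)
    then have "p \<in> prime_factors n" using q assms(1) by (metis dvd_mult prime_factors_dvd CollectI not_gr_zero)
    then show False using ix_cofactor[OF q assms(1)] p assms(2) by auto
  qed
  then show ?thesis using q by simp
qed

lemma ix_dvd_P_number:
  assumes "ix n = n" "n > 0" "m dvd n" shows "ix m = m"
proof (rule ix_P_number)
  show m: "m > 0" using assms by (auto intro: Nat.gr0I)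
  show "prime_factors m \<subseteq> P"
    using prime_factors_ix[OF assms(2)] assms dvd_prime_factors[of n m] by auto
qed

lemma finite_index: "opn U \<Longrightarrow> H \<subseteq> carrier G \<Longrightarrow> H \<noteq> {} \<Longrightarrow> grp_index G H U > 0"
  unfolding grp_index_eq
  using finite_subset[OF image_mono[of H "carrier G" "\<lambda>x. U #> x"] open_subgroup_finite_rcosets[OF opnD]]
  by (simp add: card_gt_0_iff)

lemma index_pos: "opn U \<Longrightarrow> opn H \<Longrightarrow> grp_index G H U > 0"
  using finite_index opn_subset opn_closed(1) by blast

lemma core_ex:
  assumes "opn U"
  obtains N where "opn N" "N \<subseteq> U" "\<And>g n. g \<in> carrier G \<Longrightarrow> n \<in> N \<Longrightarrow> g \<otimes> n \<otimes> inv g \<in> N"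
  using open_normal_core[OF opnD[OF assms]] unfolding open_subgroup_def by blast

text \<open>The pro-P condition concerns normal subgroups of \<open>G\<close>, so a normal core is
  treated first; the index of \<open>U\<close> in \<open>H\<close> divides that of the core in
  \<open>G\<close>.\<close>

lemma index_P_number:
  assumes "opn U" "opn H" "U \<subseteq> H" shows "ix (grp_index G H U) = grp_index G H U"
proof -
  obtain N where N: "opn N" "N \<subseteq> U" "\<And>g n. g \<in> carrier G \<Longrightarrow> n \<in> N \<Longrightarrow> g \<otimes> n \<otimes> inv g \<in> N"
    using core_ex[OF assms(1)] by blast
  have pos: "grp_index G (carrier G) N > 0" using finite_index[OF N(1)] by auto
  have "N \<lhd> G" using N opnD by (auto simp: normal_inv_iff)
  then have "prime_factors (grp_index G (carrier G) N) \<subseteq> P"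
    using pro_P[OF N(1)] order_Mod[of "carrier G" N] by simp
  then have 1: "ix (grp_index G (carrier G) N) = grp_index G (carrier G) N" using ix_P_number pos by simp
  have "grp_index G (carrier G) N = grp_index G (carrier G) H * (grp_index G H U * grp_index G U N)"
    using grp_index_mult[OF subgroup_self opnD(1)[OF assms(2)] opnD(1)[OF N(1)]]
      grp_index_mult[OF opnD(1)[OF assms(2)] opnD(1)[OF assms(1)] opnD(1)[OF N(1)]]
      assms opn_subset N by auto
  then have "grp_index G H U dvd grp_index G (carrier G) N" by simp
  then show ?thesis using ix_dvd_P_number[OF 1 pos] by simp
qed

section \<open>Degrees of open subgroups and Frobenius lifts\<close>

lemma d_image_subgroup: "opn H \<Longrightarrow> subgroup (d ` H) W"
  using d.subgroup_img_is_subgroup opnD by blast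

text \<open>A positive power of a lift of \<open>\<omega>\<close> lies in \<open>H\<close>, so the
  classification of closed subgroups of the value group applies to the image of \<open>H\<close>,
  which is closed by compactness.\<close>

lemma degree_of_open_subgroup:
  assumes "opn H"
  shows d_image: "d ` H = Dg (f H)" and f_pos: "f H > 0" and ix_f: "ix (f H) = f H"
proof -
  obtain g where g: "g \<in> carrier G" "d g = \<omega>" using d_lift[OF \<omega>_carrier] by blast
  obtain n :: nat where n: "n > 0" "g [^] n \<in> H" using pow_mem_open_subgroup[OF opnD[OF assms] g(1)] by blast
  have "\<omega> [^]\<^bsub>W\<^esub> n \<in> d ` H" using n g by (metis d.hom_nat_pow imageI)
  then obtain k where k: "k > 0" "d ` H = Dg k" "ix k = k"
    using closed_subgroup_Dg[OF closedin_image[OF closedin_open_subgroup[OF opnD[OF assms]]]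
      d_image_subgroup[OF assms] _ n(1)] by metis
  then have "f H = k" unfolding res_degree_def d_surj by (simp add: ix_def)
  then show "d ` H = Dg (f H)" "f H > 0" "ix (f H) = f H" using k by auto
qed

lemma d_mem: "opn H \<Longrightarrow> h \<in> H \<Longrightarrow> d h \<in> Dg (f H)"
  using d_image by blast

lemma f_eqI: "opn H \<Longrightarrow> d ` H = Dg n \<Longrightarrow> n > 0 \<Longrightarrow> ix n = n \<Longrightarrow> f H = n"
  unfolding res_degree_def d_surj by (simp add: ix_def)

text \<open>Only the P-part of \<open>m\<close> is visible in the index, because \<open>m\<close>
  may contain factors that are invertible on the value group.\<close>

lemma res_degree_Dg:
  assumes "a > 0" "m > 0" shows "grp_index W (Dg a) (Dg (a * m)) = ix m"
proof (rule W.grp_index_cyclic[OF Dg_subgroup _ ix_pos[OF assms(2)] Dg_subset, of "\<omega> [^]\<^bsub>W\<^esub> a"])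
  show "(\<omega> [^]\<^bsub>W\<^esub> a) [^]\<^bsub>W\<^esub> i \<in> Dg a" for i :: nat by (simp add: W.nat_pow_pow \<omega>_pow_Dg)
  show "(\<omega> [^]\<^bsub>W\<^esub> a) [^]\<^bsub>W\<^esub> i \<in> Dg (a * m) \<longleftrightarrow> ix m dvd i" for i :: nat
    using \<omega>_pow_mult_Dg[OF assms] by (simp add: W.nat_pow_pow)
  show "\<exists>i::nat. x \<otimes>\<^bsub>W\<^esub> inv\<^bsub>W\<^esub> ((\<omega> [^]\<^bsub>W\<^esub> a) [^]\<^bsub>W\<^esub> i) \<in> Dg (a * m)" if xa: "x \<in> Dg a" for x
  proof -
    obtain y where y: "y \<in> carrier W" "x = y [^]\<^bsub>W\<^esub> a" using xa by (auto simp: Dg_def)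
    obtain i :: nat where "y \<otimes>\<^bsub>W\<^esub> inv\<^bsub>W\<^esub> (\<omega> [^]\<^bsub>W\<^esub> i) \<in> Dg m" using W_cover[OF assms(2) y(1)] by blast
    then obtain z where z: "z \<in> carrier W" "y \<otimes>\<^bsub>W\<^esub> inv\<^bsub>W\<^esub> (\<omega> [^]\<^bsub>W\<^esub> i) = z [^]\<^bsub>W\<^esub> m" by (auto simp: Dg_def)
    have "x \<otimes>\<^bsub>W\<^esub> inv\<^bsub>W\<^esub> ((\<omega> [^]\<^bsub>W\<^esub> a) [^]\<^bsub>W\<^esub> i) = (y \<otimes>\<^bsub>W\<^esub> inv\<^bsub>W\<^esub> (\<omega> [^]\<^bsub>W\<^esub> i)) [^]\<^bsub>W\<^esub> a"
      using y by (simp add: W.nat_pow_distrib W.nat_pow_inv W.nat_pow_pow mult.commute)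
    also have "\<dots> = z [^]\<^bsub>W\<^esub> (a * m)" using z by (simp add: W.nat_pow_pow mult.commute)
    finally show ?thesis using z by (auto simp: Dg_def)
  qed
qed simp

lemma f_sub:
  assumes "opn H" "opn K" "K \<subseteq> H"
  shows f_mult: "f K = f H * res_degree W d H K" and res_degree_pos: "res_degree W d H K > 0"
    and ix_res_degree: "ix (res_degree W d H K) = res_degree W d H K"
proof -
  have "\<omega> [^]\<^bsub>W\<^esub> f K \<in> Dg (f K)" using \<omega>_pow_Dg[of "f K" 1] by simp
  also have "\<dots> \<subseteq> Dg (f H)" using d_image assms by (metis image_mono)
  finally have "f H dvd f K" using \<omega>_pow_Dg_iff degree_of_open_subgroup assms(1) by metis
  then obtain m where m: "f K = f H * m" by blast
  have pos: "m > 0" using m f_pos[OF assms(2)] by (auto intro: Nat.gr0I)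
  have "ix m = m" using ix_mult[of "f H" m] degree_of_open_subgroup[OF assms(1)] degree_of_open_subgroup[OF assms(2)] m pos by simp
  moreover have "res_degree W d H K = ix m"
    using res_degree_Dg[OF f_pos[OF assms(1)] pos] d_image[OF assms(1)] d_image[OF assms(2)] m
    by (metis res_degree_def)
  ultimately show "f K = f H * res_degree W d H K" "res_degree W d H K > 0"
    "ix (res_degree W d H K) = res_degree W d H K" using m pos by simp_all
qed

lemma frob_ex: "opn H \<Longrightarrow> \<exists>\<phi>\<in>H. d \<phi> = \<omega> [^]\<^bsub>W\<^esub> f H"
  using d_image[of H] \<omega>_pow_Dg[of "f H" 1] by force

text \<open>Every class modulo \<open>U\<close> contains elements of positive Frobenius degree: the
  degree of \<open>h\<close> is a power of \<open>\<omega>\<close> up to an element of the image of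
  \<open>U\<close>, and a factor from \<open>U\<close> removes the latter.\<close>

lemma frob_lift:
  assumes "opn H" "opn U" "U \<subseteq> H" "h \<in> H"
  shows "\<exists>u\<in>U. \<exists>n>0. d (h \<otimes> u) = \<omega> [^]\<^bsub>W\<^esub> (f H * n)"
proof -
  define m where "m = res_degree W d H U"
  have m: "m > 0" "f U = f H * m" using f_sub[OF assms(1-3)] by (auto simp: m_def)
  note c = opn_carrier[OF assms(1)] opn_carrier[OF assms(2)]
  obtain x where x: "x \<in> carrier W" "d h = x [^]\<^bsub>W\<^esub> f H"
    using d_mem[OF assms(1,4)] by (auto simp: Dg_def)
  obtain i :: nat where "x \<otimes>\<^bsub>W\<^esub> inv\<^bsub>W\<^esub> (\<omega> [^]\<^bsub>W\<^esub> i) \<in> Dg m" using W_cover[OF m(1) x(1)] by blast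
  then obtain y where y: "y \<in> carrier W" "x \<otimes>\<^bsub>W\<^esub> inv\<^bsub>W\<^esub> (\<omega> [^]\<^bsub>W\<^esub> i) = y [^]\<^bsub>W\<^esub> m" by (auto simp: Dg_def)
  have "y [^]\<^bsub>W\<^esub> f U \<in> d ` U" using d_image[OF assms(2)] y by (auto simp: Dg_def)
  then obtain u where u: "u \<in> U" "d u = y [^]\<^bsub>W\<^esub> f U" by auto
  \<comment> \<open>The exponent \<open>i\<close> may be 0; the factor \<open>u'\<close> adds
    \<open>m\<close> to it and makes it positive.\<close>
  obtain u' where u': "u' \<in> U" "d u' = \<omega> [^]\<^bsub>W\<^esub> f U" using frob_ex[OF assms(2)] by blast
  have "x = y [^]\<^bsub>W\<^esub> m \<otimes>\<^bsub>W\<^esub> \<omega> [^]\<^bsub>W\<^esub> i" using y x by (metis W.inv_solve_right' W.nat_pow_closed \<omega>_carrier)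
  then have "d h = y [^]\<^bsub>W\<^esub> f U \<otimes>\<^bsub>W\<^esub> \<omega> [^]\<^bsub>W\<^esub> (f H * i)"
    using x y m by (simp add: W.nat_pow_distrib W.nat_pow_pow mult.commute)
  then have "d (h \<otimes> (inv u \<otimes> u')) = \<omega> [^]\<^bsub>W\<^esub> (f H * i) \<otimes>\<^bsub>W\<^esub> \<omega> [^]\<^bsub>W\<^esub> (f H * m)"
    using u u' c assms m y by (simp add: W.m_ac W.inv_cancel)
  also have "\<dots> = \<omega> [^]\<^bsub>W\<^esub> (f H * (i + m))" by (simp add: W.nat_pow_mult distrib_left)
  finally show ?thesis using u u' assms m(1) by (intro bexI[of _ "inv u \<otimes> u'"] exI[of _ "i + m"]) auto
qed

lemma norm_degree_iff:
  assumes "opn H" "h \<in> H"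
  shows "norm_degree G W d H h = \<omega> [^]\<^bsub>W\<^esub> (n::nat) \<longleftrightarrow> d h = \<omega> [^]\<^bsub>W\<^esub> (f H * n)"
proof -
  obtain x where x: "x \<in> carrier W" "d h = x [^]\<^bsub>W\<^esub> f H"
    using d_mem[OF assms] by (auto simp: Dg_def)
  have "norm_degree G W d H h = x" unfolding norm_degree_def
    by (rule the_equality) (use x W_pow_inj[OF _ _ f_pos[OF assms(1)]] in auto)
  moreover have "x = \<omega> [^]\<^bsub>W\<^esub> n \<longleftrightarrow> x [^]\<^bsub>W\<^esub> f H = (\<omega> [^]\<^bsub>W\<^esub> n) [^]\<^bsub>W\<^esub> f H"
    using W_pow_inj[OF x(1) _ f_pos[OF assms(1)]] by auto
  ultimately show ?thesis using x by (simp add: W.nat_pow_pow mult.commute)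
qed

text \<open>If two different powers coincided, torsion-freeness would make \<open>\<omega>\<close>
  trivial; then every element would be a \<open>p\<close>-th power for some \<open>p\<close> in
  \<open>P\<close>, against \<open>W_not_divisible\<close>.\<close>

lemma \<omega>_pow_inj: "\<omega> [^]\<^bsub>W\<^esub> (m::nat) = \<omega> [^]\<^bsub>W\<^esub> n \<longleftrightarrow> m = n"
proof -
  have *: "m = n" if "\<omega> [^]\<^bsub>W\<^esub> m = \<omega> [^]\<^bsub>W\<^esub> n" "n \<le> m" for m n :: nat
  proof (rule ccontr)
    assume "m \<noteq> n"
    have "\<omega> [^]\<^bsub>W\<^esub> (m - n) \<otimes>\<^bsub>W\<^esub> \<omega> [^]\<^bsub>W\<^esub> n = \<omega> [^]\<^bsub>W\<^esub> m" using that by (simp add: W.nat_pow_mult)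
    then have "\<omega> [^]\<^bsub>W\<^esub> (m - n) = \<one>\<^bsub>W\<^esub>" using that by (metis W.l_cancel_one' W.nat_pow_closed W.r_cancel_one \<omega>_carrier)
    then have 1: "\<omega> = \<one>\<^bsub>W\<^esub>" using W_torsion_free[of \<omega> "m - n"] that \<open>m \<noteq> n\<close> by simp
    obtain p where p: "p \<in> P" using P_nonempty by blast
    have "p > 0" using P_prime[OF p] prime_gt_0_nat by simp
    then have "ix p dvd 1" using \<omega>_pow_Dg_iff[of p 1] 1 subgroup.one_closed[OF Dg_subgroup] by simp
    then have "Dg p = carrier W" using Dg_ix[OF \<open>p > 0\<close>] Dg_1 by simp
    then show False using W_not_divisible[OF p] by (simp add: Dg_def)
  qed
  show ?thesis using *[of m n] *[of n m] by (metis nat_le_linear)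
qed

end

section \<open>Frobenius subgroups\<close>

context grp
begin

lemma set_mult_subgroup:
  assumes A: "subgroup A G" and N: "subgroup N G"
    and nrm: "\<And>a n. a \<in> A \<Longrightarrow> n \<in> N \<Longrightarrow> a \<otimes> n \<otimes> inv a \<in> N"
  shows "subgroup (A <#> N) G"
proof (rule subgroupI)
  note c = subgroup.mem_carrier[OF A] subgroup.mem_carrier[OF N]
  have mem: "x \<in> A <#> N \<longleftrightarrow> (\<exists>a\<in>A. \<exists>n\<in>N. x = a \<otimes> n)" for x by (auto simp: set_mult_def)
  show "A <#> N \<subseteq> carrier G" using c by (auto simp: mem)
  show "A <#> N \<noteq> {}" using subgroup.one_closed[OF A] subgroup.one_closed[OF N] mem by blast
  show "inv x \<in> A <#> N" if x: "x \<in> A <#> N" for x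
  proof -
    obtain a n where an: "a \<in> A" "n \<in> N" "x = a \<otimes> n" using x mem by auto
    have "inv x = inv a \<otimes> (a \<otimes> inv n \<otimes> inv a)" using an c by (simp add: word_simps)
    then show ?thesis using mem an A N nrm subgroup.m_inv_closed by metis
  qed
  show "x \<otimes> y \<in> A <#> N" if xy: "x \<in> A <#> N" "y \<in> A <#> N" for x y
  proof -
    obtain a n where an: "a \<in> A" "n \<in> N" "x = a \<otimes> n" using xy mem by auto
    obtain b m where bm: "b \<in> A" "m \<in> N" "y = b \<otimes> m" using xy mem by auto
    have "x \<otimes> y = (a \<otimes> b) \<otimes> ((inv b \<otimes> n \<otimes> inv (inv b)) \<otimes> m)" using an bm c by (simp add: word_simps)
    moreover have "inv b \<otimes> n \<otimes> inv (inv b) \<in> N" using nrm bm an A subgroup.m_inv_closed by metis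
    ultimately show ?thesis using mem an bm A N subgroup.m_closed by metis
  qed
qed

end

context degree_map
begin

lemma sp_iff:
  "spectrum_pair G T H U \<longleftrightarrow> opn H \<and> opn U \<and> U \<subseteq> H \<and> (\<forall>h\<in>H. \<forall>u\<in>U. h \<otimes> u \<otimes> inv h \<in> U)"
  unfolding spectrum_pair_def using normal_subgrp_iff[of H U] by (auto simp: open_subgroup_def)

abbreviation "sp \<equiv> spectrum_pair G T"

lemma spD:
  assumes "sp H U"
  shows "opn H" "opn U" "U \<subseteq> H" "h \<in> H \<Longrightarrow> u \<in> U \<Longrightarrow> h \<otimes> u \<otimes> inv h \<in> U"
  using assms by (auto simp: sp_iff)

lemma sp_normal: "sp H U \<Longrightarrow> U \<lhd> subgrp G H"
  by (simp add: spectrum_pair_def)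

lemma sp_refl: "opn H \<Longrightarrow> sp H H"
  by (simp add: sp_iff)

lemma sp_sub: "sp H U \<Longrightarrow> opn K \<Longrightarrow> U \<subseteq> K \<Longrightarrow> K \<subseteq> H \<Longrightarrow> sp K U"
  by (auto simp: sp_iff subset_iff)

lemma sp_Int: "sp H U \<Longrightarrow> sp H V \<Longrightarrow> sp H (U \<inter> V)"
  by (auto simp: sp_iff opn_Int subset_iff)

lemma opn_supergroup: "opn K \<Longrightarrow> subgroup H G \<Longrightarrow> K \<subseteq> H \<Longrightarrow> opn H"
  using openin_supergroup unfolding open_subgroup_def by blast

lemma sp_conj_set: "sp H U \<Longrightarrow> h \<in> H \<Longrightarrow> conj_set G h U = U"
  using conj_set_normal[OF opnD(1)] spD(1) sp_normal by blast

lemma opn_conj_set_self: "opn H \<Longrightarrow> h \<in> H \<Longrightarrow> conj_set G h H = H"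
  using conj_set_self opnD by blast

lemma opn_conj:
  assumes "opn H" "g \<in> carrier G" shows "opn (conj_set G g H)"
proof -
  have "conj_set G g H = {x \<in> topspace T. inv g \<otimes> x \<otimes> g \<in> H}"
    using mem_conj_set[OF opn_subset[OF assms(1)] assms(2)] by auto
  moreover have "continuous_map T T (\<lambda>x. inv g \<otimes> x \<otimes> g)"
    using assms by (intro cont_mult) (auto simp: continuous_map_id[unfolded id_def])
  ultimately have "openin T (conj_set G g H)"
    using openin_continuous_map_preimage[of T T _ H] opnD(2)[OF assms(1)] by simp
  then show ?thesis using conj_set_subgroup[OF opnD(1)[OF assms(1)] assms(2)] by (simp add: open_subgroup_def)
qed

lemma sp_conj:
  assumes "sp H U" "g \<in> carrier G" shows "sp (conj_set G g H) (conj_set G g U)"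
proof -
  note U = spD[OF assms(1)]
  have "(g \<otimes> h \<otimes> inv g) \<otimes> (g \<otimes> u \<otimes> inv g) \<otimes> inv (g \<otimes> h \<otimes> inv g) \<in> conj_set G g U" if "h \<in> H" "u \<in> U" for h u
  proof -
    have "(g \<otimes> h \<otimes> inv g) \<otimes> (g \<otimes> u \<otimes> inv g) \<otimes> inv (g \<otimes> h \<otimes> inv g) = g \<otimes> (h \<otimes> u \<otimes> inv h) \<otimes> inv g"
      using that assms opn_carrier[OF U(1)] opn_carrier[OF U(2)] by (simp add: word_simps)
    then show ?thesis using that U by (auto intro: conj_setI)
  qed
  then show ?thesis
    using U assms by (auto simp: sp_iff opn_conj conj_set_mono) (auto simp: conj_set_def)
qed

lemma W_conj [simp]:
  assumes "x \<in> carrier W" "y \<in> carrier W"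
  shows "x \<otimes>\<^bsub>W\<^esub> y \<otimes>\<^bsub>W\<^esub> inv\<^bsub>W\<^esub> x = y"
  unfolding W.m_comm[OF assms] using assms by (simp add: W.m_assoc)

lemma d_conj: "g \<in> carrier G \<Longrightarrow> x \<in> carrier G \<Longrightarrow> d (g \<otimes> x \<otimes> inv g) = d x"
  by simp

lemma d_image_conj: "g \<in> carrier G \<Longrightarrow> H \<subseteq> carrier G \<Longrightarrow> d ` conj_set G g H = d ` H"
  unfolding conj_set_def image_image by (rule image_cong) auto

lemma f_conj: "g \<in> carrier G \<Longrightarrow> opn H \<Longrightarrow> f (conj_set G g H) = f H"
  using d_image_conj opn_subset by (simp add: res_degree_def)

lemma mem_inertia: "opn H \<Longrightarrow> x \<in> \<I> H \<longleftrightarrow> x \<in> H \<and> d x = \<one>\<^bsub>W\<^esub>"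
  using opn_carrier by (auto simp: inertia_def kernel_def)

lemma mem_inertia': "x \<in> \<I> H \<longleftrightarrow> x \<in> H \<and> x \<in> carrier G \<and> d x = \<one>\<^bsub>W\<^esub>"
  by (auto simp: inertia_def kernel_def)

lemma inertia_mono: "K \<subseteq> H \<Longrightarrow> \<I> K \<subseteq> \<I> H" by (auto simp: mem_inertia')

lemma inertia_subset: "\<I> H \<subseteq> H" by (auto simp: mem_inertia')

lemma inertia_conj:
  assumes "g \<in> carrier G" "H \<subseteq> carrier G"
  shows "\<I> (conj_set G g H) = conj_set G g (\<I> H)"
proof -
  have "d (inv g \<otimes> x \<otimes> g) = d x" if "x \<in> carrier G" for x
    using d_conj[of "inv g" x] assms that by simp
  moreover have "\<I> H \<subseteq> carrier G" using assms inertia_subset by blast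
  ultimately show ?thesis
    using assms by (auto simp: mem_inertia' mem_conj_set subset_iff)
qed

lemma inertia_subgroup: "opn H \<Longrightarrow> subgroup (\<I> H) G"
  unfolding inertia_def using opnD(1) d.subgroup_kernel by (rule subgroups_Inter_pair)

text \<open>The map \<open>d\<close> separates cosets of the inertia group, so a subgroup containing
  the inertia of \<open>L\<close> and having the same degrees fills \<open>L\<close>. Several later
  identifications of open subgroups reduce to this.\<close>

lemma degree_inertia_eq:
  assumes "opn K" "opn L" "K \<subseteq> L" "\<I> L \<subseteq> K" "d ` L \<subseteq> d ` K"
  shows "K = L"
proof
  show "L \<subseteq> K"
  proof
    fix x assume x: "x \<in> L"
    then obtain y where y: "y \<in> K" "d x = d y" using assms by blast
    note c = opn_carrier[OF assms(1) y(1)] opn_carrier[OF assms(2) x]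
    have "x \<otimes> inv y \<in> \<I> L" using x y assms c by (auto simp: mem_inertia)
    then have "x \<otimes> inv y \<otimes> y \<in> K" using assms y by auto
    then show "x \<in> K" using c by (simp add: word_simps)
  qed
qed (rule assms)

lemma pow_index_mem:
  assumes "sp H U" "h \<in> H" shows "h [^] grp_index G H U \<in> U"
proof -
  note U = spD[OF assms(1)]
  interpret N: normal U "subgrp G H" by (rule sp_normal[OF assms(1)])
  interpret Q: group "subgrp G H Mod U" by (rule N.factorgroup_is_group)
  have hc: "h \<in> carrier G" using assms opn_carrier U by blast
  have "(U #>\<^bsub>subgrp G H\<^esub> h) [^]\<^bsub>subgrp G H Mod U\<^esub> order (subgrp G H Mod U) = \<one>\<^bsub>subgrp G H Mod U\<^esub>"
    by (rule Q.pow_order_eq_1) (use assms in \<open>auto simp: FactGroup_def RCOSETS_def\<close>)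
  then have "U #>\<^bsub>subgrp G H\<^esub> (h [^]\<^bsub>subgrp G H\<^esub> grp_index G H U) = U"
    using N.FactGroup_pow assms by (simp add: order_Mod)
  then have "U #> (h [^] grp_index G H U) = U #> \<one>"
    using opn_subset[OF U(2)] nat_pow_consistent[of h _ H] by simp
  then show ?thesis using rcos_eq_iff[OF opnD(1)[OF U(2)], of "h [^] grp_index G H U" \<one>] hc by simp
qed

subsection \<open>Preimages and unramified pairs\<close>

text \<open>The unramified subgroups of \<open>H\<close>: each contains the whole inertia group, and
  by \<open>unramified_pre\<close> all of them have this form. They are the finite-level stand-in
  for the maximal unramified extension.\<close>

definition pre :: "'g set \<Rightarrow> nat \<Rightarrow> 'g set" where "pre H n = {x \<in> H. d x \<in> Dg n}"

lemma pre_subset: "pre H n \<subseteq> H" by (auto simp: pre_def)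

lemma opn_pre: "opn H \<Longrightarrow> n > 0 \<Longrightarrow> opn (pre H n)"
  unfolding pre_def by (rule preimage_opn)

lemma inertia_pre: "\<I> (pre H n) = \<I> H"
  using subgroup.one_closed[OF Dg_subgroup] by (auto simp: mem_inertia' pre_def)

lemma sp_pre:
  assumes "sp H V" "n > 0" shows "sp H (pre V n)"
proof -
  note V = spD[OF assms(1)]
  have "h \<otimes> u \<otimes> inv h \<in> pre V n" if "h \<in> H" "u \<in> pre V n" for h u
    using that V opn_carrier[OF V(1)] opn_carrier[OF V(2)] by (auto simp: pre_def)
  then show ?thesis using assms(2) V(1-3) opn_pre pre_subset[of V n] by (auto simp: sp_iff)
qed

lemma pre_image:
  assumes "opn H" shows "d ` pre H (f H * m) = Dg (f H * m)"
proof
  have "x \<in> d ` pre H (f H * m)" if "x \<in> Dg (f H * m)" for x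
    using that d_image[OF assms] Dg_mult[of "f H" m] by (force simp: pre_def image_iff)
  then show "Dg (f H * m) \<subseteq> d ` pre H (f H * m)" by blast
qed (auto simp: pre_def)

lemma f_pre: "opn H \<Longrightarrow> m > 0 \<Longrightarrow> ix m = m \<Longrightarrow> f (pre H (f H * m)) = f H * m"
  using pre_image[of H m] f_pos[of H] ix_f[of H] ix_mult[of "f H" m]
  by (intro f_eqI opn_pre) auto

lemma unramified_pre:
  assumes "opn H" "opn U" "U \<subseteq> H" "\<I> H \<subseteq> U" shows "U = pre H (f U)"
proof (rule degree_inertia_eq)
  show "U \<subseteq> pre H (f U)" using assms d_mem[OF assms(2)] by (auto simp: pre_def)
  show "d ` pre H (f U) \<subseteq> d ` U" using d_image[OF assms(2)] by (auto simp: pre_def)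
qed (use assms inertia_pre opn_pre f_pos in auto)

lemma unramified_mem_iff:
  assumes "opn H" "opn U" "U \<subseteq> H" "\<I> H \<subseteq> U" "x \<in> H"
  shows "x \<in> U \<longleftrightarrow> d x \<in> Dg (f U)"
  using unramified_pre[OF assms(1-4)] assms(5) by (auto simp: pre_def)

lemma frob_pow_coset:
  assumes "opn H" "\<phi> \<in> H" "d \<phi> = \<omega> [^]\<^bsub>W\<^esub> f H" "x \<in> H" "m > 0"
  shows "\<exists>i<m. d (x \<otimes> inv (\<phi> [^] i)) \<in> Dg (f H * m)"
proof -
  obtain y where y: "y \<in> carrier W" "d x = y [^]\<^bsub>W\<^esub> f H" using d_mem[OF assms(1,4)] by (auto simp: Dg_def)
  obtain i where i: "i < m" "y \<otimes>\<^bsub>W\<^esub> inv\<^bsub>W\<^esub> (\<omega> [^]\<^bsub>W\<^esub> i) \<in> Dg m" using W_cover[OF assms(5) y(1)] by blast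
  then obtain z where z: "z \<in> carrier W" "y \<otimes>\<^bsub>W\<^esub> inv\<^bsub>W\<^esub> (\<omega> [^]\<^bsub>W\<^esub> i) = z [^]\<^bsub>W\<^esub> m" by (auto simp: Dg_def)
  have "d (x \<otimes> inv (\<phi> [^] i)) = (y \<otimes>\<^bsub>W\<^esub> inv\<^bsub>W\<^esub> (\<omega> [^]\<^bsub>W\<^esub> i)) [^]\<^bsub>W\<^esub> f H"
    using y assms opn_carrier[OF assms(1)]
    by (simp add: d.hom_nat_pow W.nat_pow_distrib W.nat_pow_inv W.nat_pow_pow mult.commute)
  also have "\<dots> = z [^]\<^bsub>W\<^esub> (f H * m)" using z by (simp add: W.nat_pow_pow mult.commute)
  finally show ?thesis using i z by (auto simp: Dg_def)
qed

text \<open>Membership in an unramified \<open>U\<close> is read off from the degree, so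
  \<open>H/U\<close> is cyclic, generated by the Frobenius class, and its order is the residue
  degree.\<close>

lemma unramified_frobenius_cosets:
  assumes "opn H" "opn U" "U \<subseteq> H" "\<I> H \<subseteq> U" "\<phi> \<in> H" "d \<phi> = \<omega> [^]\<^bsub>W\<^esub> f H"
  shows unramified_coset: "x \<in> H \<Longrightarrow> \<exists>i<res_degree W d H U. x \<otimes> inv (\<phi> [^] i) \<in> U"
    and unramified_index': "grp_index G H U = res_degree W d H U"
proof -
  define m where "m = res_degree W d H U"
  have m: "m > 0" "f U = f H * m" "ix m = m" using f_sub[OF assms(1-3)] by (auto simp: m_def)
  note c = opn_carrier[OF assms(1)]
  show *: "\<exists>i<res_degree W d H U. x \<otimes> inv (\<phi> [^] i) \<in> U" if xH: "x \<in> H" for x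
  proof -
    obtain i where i: "i < m" "d (x \<otimes> inv (\<phi> [^] i)) \<in> Dg (f H * m)"
      using frob_pow_coset[OF assms(1,5,6) xH m(1)] by blast
    have "x \<otimes> inv (\<phi> [^] i) \<in> H" using xH assms by simp
    then show ?thesis using unramified_mem_iff[OF assms(1-4)] m i by (auto simp: m_def[symmetric])
  qed
  have **: "\<phi> [^] (i::nat) \<in> U \<longleftrightarrow> res_degree W d H U dvd i" for i
    using unramified_mem_iff[OF assms(1-4), of "\<phi> [^] i"] assms(1,5,6) c m \<omega>_pow_mult_Dg[OF f_pos[OF assms(1)] m(1), of i]
    by (simp add: d.hom_nat_pow W.nat_pow_pow m_def[symmetric])
  show "grp_index G H U = res_degree W d H U"
    by (rule grp_index_cyclic[OF opnD(1)[OF assms(2)] c[OF assms(5)]])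
      (use m(1) * ** assms(1,5) opn_subset[OF assms(1)] in \<open>auto simp: m_def\<close>, blast)
qed

lemma unramified_index:
  assumes "opn H" "opn U" "U \<subseteq> H" "\<I> H \<subseteq> U"
  shows "grp_index G H U = res_degree W d H U"
  using frob_ex[OF assms(1)] unramified_index'[OF assms] by blast

lemma ram_index_1: "opn H \<Longrightarrow> \<I> H = \<I> K \<Longrightarrow> ram_index G W d H K = 1"
  unfolding ram_index_def using grp_index_self[OF inertia_subgroup] by metis

subsection \<open>The subgroups attached to Frobenius lifts\<close>

abbreviation "cl h \<equiv> T closure_of (generate G {h})"
abbreviation "\<Sigma> U h \<equiv> frobenius_subgroup G T W d U h"

lemma cl_subgroup: "h \<in> carrier G \<Longrightarrow> subgroup (cl h) G"
  by (intro closure_generate_subgroup generate_is_subgroup) simp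

lemma cl_self: "h \<in> carrier G \<Longrightarrow> h \<in> cl h"
  using closure_of_subset[of "generate G {h}" T] generate_in_carrier[of "{h}"] generate.incl[of h "{h}" G] by auto

lemma cl_subset:
  assumes "subgroup F G" "closedin T F" "h \<in> F" shows "cl h \<subseteq> F"
  using assms by (intro closure_of_minimal generate_subgroup_incl) auto

lemma cl_pow_subset:
  assumes "h \<in> carrier G" shows "cl (h [^] (n::nat)) \<subseteq> cl h"
proof (rule cl_subset[OF cl_subgroup[OF assms] closedin_closure_of])
  show "h [^] n \<in> cl h"
    using subgroup_int_pow_closed[OF cl_subgroup[OF assms] cl_self[OF assms], of "int n"]
    by (simp add: int_pow_int)
qed

lemma cl_subset_opn: "opn H \<Longrightarrow> h \<in> H \<Longrightarrow> cl h \<subseteq> H"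
  using cl_subset closedin_open_subgroup opnD by metis

text \<open>Elements of the closure are in general not integral powers of \<open>h\<close>. This is
  the available substitute for division of an exponent with remainder, proved like
  \<open>W_cover\<close>.\<close>

lemma cl_decomp:
  fixes m :: nat assumes "h \<in> carrier G" "m > 0" "x \<in> cl h"
  shows "\<exists>i<m. x \<otimes> inv (h [^] i) \<in> cl (h [^] m)"
proof -
  define B where "B = cl (h [^] m)"
  have B: "subgroup B G"
    unfolding B_def by (rule cl_subgroup[OF nat_pow_closed[OF assms(1)]])
  have hB: "h [^] m \<in> B"
    unfolding B_def by (rule cl_self[OF nat_pow_closed[OF assms(1)]])
  have closed: "closedin T (\<Union>i\<in>{..<m}. B #> (h [^] i))"
    using assms by (intro closedin_Union) (auto intro!: closedin_rcos simp: B_def)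
  have "generate G {h} \<subseteq> (\<Union>i\<in>{..<m}. B #> (h [^] i))"
  proof
    fix y assume "y \<in> generate G {h}"
    then obtain k :: int where y: "y = h [^] k" using generate_pow[OF assms(1)] by auto
    have "k = int m * (k div int m) + int (nat (k mod int m))" using assms by simp
    then have "y = h [^] (int m * (k div int m)) \<otimes> h [^] (nat (k mod int m))"
      using y by (metis int_pow_mult assms(1) int_pow_int)
    then have "y = (h [^] m) [^] (k div int m) \<otimes> h [^] (nat (k mod int m))"
      using assms(1) by (simp add: int_pow_pow[symmetric] int_pow_int)
    moreover have "(h [^] m) [^] (k div int m) \<in> B" using subgroup_int_pow_closed[OF B hB] .
    moreover have "nat (k mod int m) < m" using assms by (simp add: nat_less_iff)
    ultimately show "y \<in> (\<Union>i\<in>{..<m}. B #> (h [^] i))" unfolding r_coset_def by blast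
  qed
  then have "cl h \<subseteq> (\<Union>i\<in>{..<m}. B #> (h [^] i))" using closed by (rule closure_of_minimal)
  then obtain i where "i < m" "x \<in> B #> (h [^] i)" using assms by auto
  moreover have "x \<in> carrier G" using assms subgroup.mem_carrier[OF cl_subgroup] by blast
  ultimately show ?thesis using rcos_mem_iff[OF subgroup.subset[OF B], of x "h [^] i"] assms by (auto simp: B_def)
qed

lemma d_cl:
  assumes "h \<in> carrier G" "d h = \<omega> [^]\<^bsub>W\<^esub> (n::nat)" shows "d ` cl h = Dg n"
proof
  have "closedin T {x \<in> topspace T. d x \<in> Dg n}"
    by (rule closedin_continuous_map_preimage[OF d_cont Dg_closedin])
  moreover have "subgroup {x \<in> topspace T. d x \<in> Dg n} G"
    by (rule subgroupI) (use Dg_subgroup[of n] in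
      \<open>auto simp: subgroup.one_closed subgroup.m_closed subgroup.m_inv_closed intro!: exI[of _ \<one>]\<close>)
  ultimately have "cl h \<subseteq> {x \<in> topspace T. d x \<in> Dg n}"
    using assms \<omega>_pow_Dg[of n 1] by (intro cl_subset) auto
  then show "d ` cl h \<subseteq> Dg n" by auto
  show "Dg n \<subseteq> d ` cl h"
  proof (rule closed_contains_Dg)
    show "closedin S (d ` cl h)" by (rule closedin_image) simp
    show "subgroup (d ` cl h) W" using d.subgroup_img_is_subgroup cl_subgroup[OF assms(1)] by blast
    show "\<omega> [^]\<^bsub>W\<^esub> n \<in> d ` cl h" using assms cl_self by (metis imageI)
  qed
qed

lemma mem_\<Sigma>: "x \<in> \<Sigma> U h \<longleftrightarrow> (\<exists>a\<in>cl h. \<exists>i\<in>\<I> U. x = a \<otimes> i)"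
  by (auto simp: frobenius_subgroup_def set_mult_def)

text \<open>The lift has degree \<open>n\<close> over \<open>H\<close>, but the residue degree is
  only \<open>ix n\<close>, since \<open>Dg n\<close> and \<open>Dg (ix n)\<close> coincide. The
  exponent P'(n) in the recipe makes up for this difference.\<close>

lemma \<Sigma>_properties:
  assumes sp: "sp H U" and h: "h \<in> H" "n > 0" "d h = \<omega> [^]\<^bsub>W\<^esub> (f H * n)"
  shows opn_\<Sigma>: "opn (\<Sigma> U h)" and \<Sigma>_subset: "\<Sigma> U h \<subseteq> H" and \<Sigma>_self: "h \<in> \<Sigma> U h"
    and inertia_\<Sigma>: "\<I> (\<Sigma> U h) = \<I> U" and d_\<Sigma>: "d ` \<Sigma> U h = Dg (f H * n)"
    and f_\<Sigma>: "f (\<Sigma> U h) = f H * ix n"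
proof -
  note U = spD[OF sp]
  note c = opn_carrier[OF U(1)]
  have hc: "h \<in> carrier G" using c h by simp
  have fpos: "f H > 0" by (rule f_pos[OF U(1)])
  have A: "subgroup (cl h) G" "h \<in> cl h" "cl h \<subseteq> H"
    using cl_subgroup cl_self hc cl_subset_opn[OF U(1) h(1)] by auto
  have IU: "\<I> U \<subseteq> U" "subgroup (\<I> U) G" using inertia_subset inertia_subgroup U by auto
  note cA = subgroup.mem_carrier[OF A(1)] and cI = subgroup.mem_carrier[OF IU(2)]
  have sub: "subgroup (\<Sigma> U h) G" unfolding frobenius_subgroup_def
  proof (rule set_mult_subgroup[OF A(1) IU(2)])
    show "a \<otimes> i \<otimes> inv a \<in> \<I> U" if "a \<in> cl h" "i \<in> \<I> U" for a i
      using that A U(4)[of a i] c cA cI by (auto simp: mem_inertia[OF U(2)])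
  qed
  show subH: "\<Sigma> U h \<subseteq> H" using A IU U by (auto simp: mem_\<Sigma> subset_iff)
  show hS: "h \<in> \<Sigma> U h" using A IU hc by (metis mem_\<Sigma> r_one subgroup.one_closed)
  have IS: "\<I> U \<subseteq> \<Sigma> U h" using cI subgroup.one_closed[OF A(1)] mem_\<Sigma> l_one by (metis subsetI)
  have AS: "cl h \<subseteq> \<Sigma> U h" using cA subgroup.one_closed[OF IU(2)] mem_\<Sigma> r_one by (metis subsetI)
  have dA: "d ` cl h = Dg (f H * n)" by (rule d_cl[OF hc h(3)])
  show d\<Sigma>: "d ` \<Sigma> U h = Dg (f H * n)"
  proof
    show "Dg (f H * n) \<subseteq> d ` \<Sigma> U h" using dA AS by blast
    have "d (a \<otimes> i) \<in> Dg (f H * n)" if "a \<in> cl h" "i \<in> \<I> U" for a i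
      using that dA cA cI by (auto simp: mem_inertia')
    then show "d ` \<Sigma> U h \<subseteq> Dg (f H * n)" by (auto simp: mem_\<Sigma>)
  qed
  \<comment> \<open>The \<open>m\<close>-th power of \<open>h\<close> lies in \<open>U\<close>, and
    so does the closed subgroup it generates. As \<open>m\<close> is a P-number, divisibility by
    \<open>m\<close> can be seen on degrees.\<close>
  define m where "m = grp_index G H U"
  have m: "m > 0" "ix m = m" "h [^] m \<in> U"
    using index_pos index_P_number pow_index_mem U sp h by (auto simp: m_def)
  have dB: "d ` cl (h [^] m) = Dg (f H * n * m)"
    by (rule d_cl) (use hc h in \<open>auto simp: d.hom_nat_pow W.nat_pow_pow\<close>)
  have BU: "cl (h [^] m) \<subseteq> U" using cl_subset_opn[OF U(2) m(3)] .
  have BA: "cl (h [^] m) \<subseteq> cl h"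
    by (rule cl_pow_subset[OF hc])
  show inertia: "\<I> (\<Sigma> U h) = \<I> U"
  proof
    show "\<I> (\<Sigma> U h) \<subseteq> \<I> U"
    proof
      fix x assume "x \<in> \<I> (\<Sigma> U h)"
      then obtain a i where x: "a \<in> cl h" "i \<in> \<I> U" "x = a \<otimes> i" "d x = \<one>\<^bsub>W\<^esub>"
        by (auto simp: mem_inertia' mem_\<Sigma>)
      have da: "d a = \<one>\<^bsub>W\<^esub>" using x cA cI by (simp add: mem_inertia')
      \<comment> \<open>The element \<open>a\<close> has trivial degree, so the remainder
        \<open>j\<close> must be divisible by \<open>m\<close>, hence is 0; this places
        \<open>a\<close> in \<open>U\<close>.\<close>
      obtain j where j: "j < m" "a \<otimes> inv (h [^] j) \<in> cl (h [^] m)" using cl_decomp[OF hc m(1) x(1)] by blast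
      have "d (a \<otimes> inv (h [^] j)) \<in> Dg (f H * n * m)" using dB j by blast
      then have "inv\<^bsub>W\<^esub> (\<omega> [^]\<^bsub>W\<^esub> (f H * n * j)) \<in> Dg (f H * n * m)"
        using da hc h x cA by (simp add: d.hom_nat_pow W.nat_pow_pow)
      then have "\<omega> [^]\<^bsub>W\<^esub> (f H * n * j) \<in> Dg (f H * n * m)"
        using subgroup.m_inv_closed[OF Dg_subgroup] W.inv_inv W.nat_pow_closed \<omega>_carrier by metis
      then have "m dvd j" using \<omega>_pow_mult_Dg[of "f H * n" m j] fpos h m by simp
      then have "j = 0" using j(1) by (metis dvd_imp_le gr0I linorder_not_less)
      then have "a \<in> U" using j BU x cA by auto
      then have "a \<in> \<I> U" using da by (simp add: mem_inertia[OF U(2)])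
      then show "x \<in> \<I> U" using x IU subgroup.m_closed by metis
    qed
    show "\<I> U \<subseteq> \<I> (\<Sigma> U h)" using IS by (auto simp: mem_inertia')
  qed
  show opn: "opn (\<Sigma> U h)"
  proof (rule opn_supergroup[OF _ sub])
    show "opn {x \<in> U. d x \<in> Dg (f H * n * m)}" by (rule preimage_opn[OF U(2)]) (use fpos h m in simp)
    \<comment> \<open>An \<open>x\<close> of such a degree differs from an element of the closed
      subgroup generated by \<open>h [^] m\<close> only by inertia of \<open>U\<close>.\<close>
    show "{x \<in> U. d x \<in> Dg (f H * n * m)} \<subseteq> \<Sigma> U h"
    proof clarify
      fix x assume x: "x \<in> U" "d x \<in> Dg (f H * n * m)"
      then obtain b where b: "b \<in> cl (h [^] m)" "d x = d b" using dB by blast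
      have bc: "b \<in> U" "b \<in> cl h" using b BU BA by auto
      have "inv b \<otimes> x \<in> \<I> U" using x bc b U opn_carrier[OF U(2)] by (simp add: mem_inertia)
      moreover have "x = b \<otimes> (inv b \<otimes> x)" using x bc opn_carrier[OF U(2)] by simp
      ultimately show "x \<in> \<Sigma> U h" using bc mem_\<Sigma> by blast
    qed
  qed
  show "f (\<Sigma> U h) = f H * ix n"
  proof (rule f_eqI[OF opn])
    show "ix (f H * ix n) = f H * ix n" using ix_mult[OF fpos ix_pos[OF h(2)] ix_f[OF U(1)]] ix_ix[OF h(2)] by simp
    have "ix (f H * n) = f H * ix n" using ix_mult[OF fpos h(2) ix_f[OF U(1)]] .
    then show "d ` \<Sigma> U h = Dg (f H * ix n)" using d\<Sigma> Dg_ix[of "f H * n"] fpos h by simp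
    show "f H * ix n > 0" using fpos ix_pos[OF h(2)] by simp
  qed
qed

text \<open>Degrees and inertia pin down the subgroup, so conjugates of it are recognised without
  handling closures.\<close>

lemma \<Sigma>_unique:
  assumes "sp H U" "h \<in> H" "n > 0" "d h = \<omega> [^]\<^bsub>W\<^esub> (f H * n)"
    and "opn L" "h \<in> L" "\<I> L = \<I> U" "d ` L \<subseteq> Dg (f H * n)"
  shows "\<Sigma> U h = L"
proof (rule degree_inertia_eq)
  note S = \<Sigma>_properties[OF assms(1-4)]
  show "\<Sigma> U h \<subseteq> L"
    using cl_subset_opn[OF assms(5,6)] inertia_subset[of L] assms opn_closed(2)[OF assms(5)]
    by (auto simp: mem_\<Sigma> subset_iff)
  show "\<I> L \<subseteq> \<Sigma> U h" using S(4) assms(7) inertia_subset by metis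
  show "d ` L \<subseteq> d ` \<Sigma> U h" using S(5) assms(8) by simp
qed (use assms \<Sigma>_properties(1)[OF assms(1-4)] in simp_all)

lemma \<Sigma>_conj:
  assumes "sp H U" "h \<in> H" "n > 0" "d h = \<omega> [^]\<^bsub>W\<^esub> (f H * n)" "g \<in> carrier G"
  shows "\<Sigma> (conj_set G g U) (g \<otimes> h \<otimes> inv g) = conj_set G g (\<Sigma> U h)"
proof (rule \<Sigma>_unique[OF sp_conj[OF assms(1,5)] conj_setI[OF assms(2)] assms(3)])
  note S = \<Sigma>_properties[OF assms(1-4)] and U = spD[OF assms(1)]
  note hc = opn_carrier[OF U(1) assms(2)]
  show "d (g \<otimes> h \<otimes> inv g) = \<omega> [^]\<^bsub>W\<^esub> (f (conj_set G g H) * n)"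
    using assms hc U by (simp add: f_conj d_conj del: d.hom_mult)
  show "opn (conj_set G g (\<Sigma> U h))" by (rule opn_conj[OF S(1) assms(5)])
  show "g \<otimes> h \<otimes> inv g \<in> conj_set G g (\<Sigma> U h)" by (rule conj_setI[OF S(3)])
  show "\<I> (conj_set G g (\<Sigma> U h)) = \<I> (conj_set G g U)"
    using S(4) inertia_conj assms(5) opn_subset S(1) U(2) by metis
  show "d ` conj_set G g (\<Sigma> U h) \<subseteq> Dg (f (conj_set G g H) * n)"
    using d_image_conj[OF assms(5) opn_subset[OF S(1)]] S(5) f_conj assms(5) U by simp
qed

text \<open>Such intersections appear when the recipe is restricted by the Mackey formula. In
  \<open>cl_decomp\<close> with the return time \<open>k\<close> the remaining power
  \<open>h [^] j\<close>, \<open>j < k\<close>, would lie in \<open>J\<close>, so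
  \<open>j = 0\<close>.\<close>

lemma \<Sigma>_Int:
  assumes "sp H U" "h \<in> H" "opn J" "U \<subseteq> J" "k > 0" "\<And>i::nat. h [^] i \<in> J \<longleftrightarrow> k dvd i"
  shows "\<Sigma> U h \<inter> J = \<Sigma> U (h [^] k)"
proof
  note U = spD[OF assms(1)]
  have hc: "h \<in> carrier G" using assms opn_carrier U by blast
  have BJ: "cl (h [^] k) \<subseteq> J" by (rule cl_subset_opn[OF assms(3)]) (simp add: assms)
  have BA: "cl (h [^] k) \<subseteq> cl h"
    by (rule cl_pow_subset[OF hc])
  have IJ: "\<I> U \<subseteq> J" using assms inertia_subset by blast
  show "\<Sigma> U (h [^] k) \<subseteq> \<Sigma> U h \<inter> J"
    using BA BJ IJ opn_closed(2)[OF assms(3)] by (auto simp: mem_\<Sigma> subset_iff)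
  show "\<Sigma> U h \<inter> J \<subseteq> \<Sigma> U (h [^] k)"
  proof
    fix x assume "x \<in> \<Sigma> U h \<inter> J"
    then obtain a i where x: "a \<in> cl h" "i \<in> \<I> U" "x = a \<otimes> i" "x \<in> J" by (auto simp: mem_\<Sigma>)
    have ac: "a \<in> carrier G" "i \<in> carrier G" using x subgroup.mem_carrier[OF cl_subgroup[OF hc]] mem_inertia' by auto
    have "x \<otimes> inv i \<in> J" using x IJ assms(3) by auto
    then have aJ: "a \<in> J" using x ac by (simp add: word_simps)
    obtain j where j: "j < k" "a \<otimes> inv (h [^] j) \<in> cl (h [^] k)" using cl_decomp[OF hc assms(5) x(1)] by blast
    then have "inv (inv a \<otimes> (a \<otimes> inv (h [^] j))) \<in> J" using BJ aJ opn_closed[OF assms(3)] by blast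
    then have "h [^] j \<in> J" using ac hc by simp
    then have "j = 0" using assms(6) j(1) by (metis dvd_imp_le gr0I linorder_not_less)
    then show "x \<in> \<Sigma> U (h [^] k)" using j x ac mem_\<Sigma> by auto
  qed
qed

text \<open>A normal core of \<open>U\<close> and all \<open>L\<close> has too little inertia.
  Multiplying it by the inertia group of \<open>U\<close>, which is normalized by \<open>H\<close>
  and contained in every \<open>L\<close>, restores the inertia while staying below all of
  them.\<close>

lemma normal_in_all:
  assumes sp: "sp H U" and F: "finite F" "\<And>L. L \<in> F \<Longrightarrow> opn L \<and> \<I> U \<subseteq> L"
  obtains V where "sp H V" "V \<subseteq> U" "\<And>L. L \<in> F \<Longrightarrow> V \<subseteq> L" "\<I> V = \<I> U"
proof -
  note U = spD[OF sp]
  have "opn (U \<inter> \<Inter>F)" using F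
    by (induction F rule: finite_induct) (use U opn_Int in \<open>auto simp: Int_left_commute\<close>)
  then obtain N where N: "opn N" "N \<subseteq> U \<inter> \<Inter>F" "\<And>g n. g \<in> carrier G \<Longrightarrow> n \<in> N \<Longrightarrow> g \<otimes> n \<otimes> inv g \<in> N"
    using core_ex by blast
  have mem: "x \<in> N <#> \<I> U \<longleftrightarrow> (\<exists>n\<in>N. \<exists>i\<in>\<I> U. x = n \<otimes> i)" for x by (auto simp: set_mult_def)
  note cN = opn_carrier[OF N(1)] and cU = opn_carrier[OF U(2)] and cH = opn_carrier[OF U(1)]
  have IU: "subgroup (\<I> U) G" "\<I> U \<subseteq> U" using inertia_subgroup U inertia_subset by auto
  have nI: "h \<otimes> i \<otimes> inv h \<in> \<I> U" if "h \<in> H" "i \<in> \<I> U" for h i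
    using that U(4)[of h i] cH cU by (auto simp: mem_inertia[OF U(2)])
  have "subgroup (N <#> \<I> U) G"
    by (rule set_mult_subgroup[OF opnD(1)[OF N(1)] IU(1)]) (use nI N(2) U(3) in auto)
  moreover have NV: "N \<subseteq> N <#> \<I> U" using cN subgroup.one_closed[OF IU(1)] mem r_one by (metis subsetI)
  ultimately have opn: "opn (N <#> \<I> U)" using opn_supergroup[OF N(1)] by blast
  have VU: "N <#> \<I> U \<subseteq> U"
  proof
    fix x assume "x \<in> N <#> \<I> U"
    then obtain n i where "n \<in> N" "i \<in> \<I> U" "x = n \<otimes> i" using mem by auto
    then show "x \<in> U" using N(2) IU(2) opn_closed(2)[OF U(2), of n i] by blast
  qed
  have VL: "N <#> \<I> U \<subseteq> L" if "L \<in> F" for L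
  proof -
    have "opn L" "\<I> U \<subseteq> L" "N \<subseteq> L" using F that N by auto
    then show ?thesis using opn_closed(2) by (auto simp: mem subset_iff)
  qed
  have "sp H (N <#> \<I> U)" unfolding sp_iff
  proof (intro conjI ballI opn U(1))
    show "N <#> \<I> U \<subseteq> H" using VU U by blast
    fix h x assume h: "h \<in> H" and "x \<in> N <#> \<I> U"
    then obtain n i where x: "n \<in> N" "i \<in> \<I> U" "x = n \<otimes> i" using mem by auto
    have "h \<otimes> x \<otimes> inv h = (h \<otimes> n \<otimes> inv h) \<otimes> (h \<otimes> i \<otimes> inv h)"
      using x h cN cH cU IU by (simp add: word_simps subset_iff)
    then show "h \<otimes> x \<otimes> inv h \<in> N <#> \<I> U" using mem N(3)[OF cH[OF h] x(1)] nI[OF h x(2)] by blast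
  qed
  moreover have "\<I> (N <#> \<I> U) = \<I> U"
  proof
    show "\<I> (N <#> \<I> U) \<subseteq> \<I> U" by (rule inertia_mono[OF VU])
    have "\<I> U \<subseteq> N <#> \<I> U"
    proof
      fix i assume i: "i \<in> \<I> U"
      then have "i = \<one> \<otimes> i" using subgroup.mem_carrier[OF IU(1)] by simp
      then show "i \<in> N <#> \<I> U" using i opn_closed(1)[OF N(1)] mem by blast
    qed
    then show "\<I> U \<subseteq> \<I> (N <#> \<I> U)" by (auto simp: mem_inertia')
  qed
  ultimately show ?thesis using that VU VL by blast
qed

end

section \<open>Units and norms\<close>

text \<open>Only the conditions on unramified pairs are collected here; those on ramified pairs of
  prime degree come with \<open>cft_injective\<close>. This separates what makes the morphism well
  defined from what makes it bijective.\<close>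

locale cft = degree_map G T W S P \<omega> d + M: cohomological_mackey_functor G T C
  for G :: "'g monoid" (structure) and T and W :: "'w monoid" and S and P and \<omega> and d
    and C :: "('g, 'c) mackey" +
  fixes v :: "'g set \<Rightarrow> 'c \<Rightarrow> 'w"
  assumes val: "v \<in> valuations G T W \<omega> d C (generate W {\<omega>})"
    and cfa_unramified: "spectrum_pair G T H U \<Longrightarrow> inertia G W d H \<subseteq> U \<Longrightarrow> class_field_axiom G C H U"
    and descent: "spectrum_pair G T H U \<Longrightarrow> inertia G W d H \<subseteq> U \<Longrightarrow> galois_descent C H U"
begin

abbreviation "cc H \<equiv> carrier (mobj C H)"
abbreviation "res \<equiv> mres C"
abbreviation "ind \<equiv> mind C"
abbreviation "con \<equiv> mcon C"
abbreviation mulC (\<open>(_ \<cdot>\<^bsub>_\<^esub> _)\<close> [70, 0, 71] 70) where "x \<cdot>\<^bsub>H\<^esub> y \<equiv> x \<otimes>\<^bsub>mobj C H\<^esub> y"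
abbreviation oneC (\<open>\<one>\<^sub>C\<close>) where "\<one>\<^sub>C H \<equiv> \<one>\<^bsub>mobj C H\<^esub>"
abbreviation invC where "invC H x \<equiv> inv\<^bsub>mobj C H\<^esub> x"
abbreviation powC where "powC H x (n::nat) \<equiv> x [^]\<^bsub>mobj C H\<^esub> n"
abbreviation "Nm \<equiv> norm_group C"

lemma cg: "opn H \<Longrightarrow> comm_group (mobj C H)" by (rule M.comm_group_mobj)
lemma gr: "opn H \<Longrightarrow> group (mobj C H)" by (rule comm_group.axioms(2)[OF cg])

lemma C_closed [simp]:
  assumes "opn H"
  shows "x \<in> cc H \<Longrightarrow> y \<in> cc H \<Longrightarrow> x \<cdot>\<^bsub>H\<^esub> y \<in> cc H" "\<one>\<^sub>C H \<in> cc H"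
    "x \<in> cc H \<Longrightarrow> invC H x \<in> cc H" "x \<in> cc H \<Longrightarrow> powC H x n \<in> cc H"
proof -
  interpret q: comm_group "mobj C H" by (rule cg[OF assms])
  show "x \<in> cc H \<Longrightarrow> y \<in> cc H \<Longrightarrow> x \<cdot>\<^bsub>H\<^esub> y \<in> cc H" "\<one>\<^sub>C H \<in> cc H"
    "x \<in> cc H \<Longrightarrow> invC H x \<in> cc H" "x \<in> cc H \<Longrightarrow> powC H x n \<in> cc H" by auto
qed

lemma res_ghom: "opn H \<Longrightarrow> opn I \<Longrightarrow> I \<subseteq> H \<Longrightarrow> group_hom (mobj C H) (mobj C I) (res I H)"
  using M.mres_hom gr by (simp add: group_hom_def group_hom_axioms_def)

lemma ind_ghom: "opn H \<Longrightarrow> opn I \<Longrightarrow> I \<subseteq> H \<Longrightarrow> group_hom (mobj C I) (mobj C H) (ind H I)"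
  using M.mind_hom gr by (simp add: group_hom_def group_hom_axioms_def)

lemma con_ghom: "opn H \<Longrightarrow> g \<in> carrier G \<Longrightarrow> group_hom (mobj C H) (mobj C (conj_set G g H)) (con g H)"
  using M.mcon_hom gr opn_conj by (simp add: group_hom_def group_hom_axioms_def)

lemma act_ghom: "sp H V \<Longrightarrow> g \<in> H \<Longrightarrow> group_hom (mobj C V) (mobj C V) (con g V)"
  using con_ghom[of V g] sp_conj_set[of H V g] spD opn_carrier by metis

lemma v_ghom: assumes "opn H" shows "group_hom (mobj C H) W (v H)"
proof -
  have "v H \<in> hom (mobj C H) (subgrp W (generate W {\<omega>}))"
    using val assms by (auto simp: valuations_def)
  moreover have "generate W {\<omega>} \<subseteq> carrier W" by (rule W.generate_incl) simp
  ultimately have "v H \<in> hom (mobj C H) W" by (auto simp: hom_def)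
  then show ?thesis using gr[OF assms] by (simp add: group_hom_def group_hom_axioms_def W.is_group)
qed

lemma v_gen: "opn H \<Longrightarrow> x \<in> cc H \<Longrightarrow> v H x \<in> generate W {\<omega>}"
  using val by (auto simp: valuations_def hom_def)

lemma v_int: "opn H \<Longrightarrow> x \<in> cc H \<Longrightarrow> \<exists>k::int. v H x = \<omega> [^]\<^bsub>W\<^esub> k"
  using v_gen W.generate_pow[OF \<omega>_carrier] by blast

lemma v_carrier [simp]: "opn H \<Longrightarrow> x \<in> cc H \<Longrightarrow> v H x \<in> carrier W"
  using v_ghom group_hom.hom_closed by metis

lemma prime_ex: "opn H \<Longrightarrow> \<exists>\<pi>\<in>cc H. v H \<pi> = \<omega>"
  using val unfolding valuations_def by blast

lemma v_con: "opn H \<Longrightarrow> g \<in> carrier G \<Longrightarrow> x \<in> cc H \<Longrightarrow> v (conj_set G g H) (con g H x) = v H x"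
  using val unfolding valuations_def by blast

lemma v_act: "sp H V \<Longrightarrow> g \<in> H \<Longrightarrow> x \<in> cc V \<Longrightarrow> v V (con g V x) = v V x"
  using v_con[of V g x] sp_conj_set[of H V g] spD opn_carrier by metis

lemma v_ind: "opn H \<Longrightarrow> opn K \<Longrightarrow> K \<subseteq> H \<Longrightarrow> x \<in> cc K \<Longrightarrow> v H (ind H K x) = v K x [^]\<^bsub>W\<^esub> res_degree W d H K"
  using val unfolding valuations_def by blast

text \<open>Equal inertia means ramification index 1. This is why auxiliary levels are chosen with
  unchanged inertia: primes then restrict to primes.\<close>

lemma v_res:
  assumes "opn H" "opn K" "K \<subseteq> H" "x \<in> cc H" "\<I> K = \<I> H" shows "v K (res K H x) = v H x"
proof -
  have "v K (res K H x) = v H x [^]\<^bsub>W\<^esub> ram_index G W d H K"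
    using val assms(1-4) unfolding valuations_def by blast
  then show ?thesis using ram_index_1[OF assms(1)] assms by simp
qed

lemma ind_closed [simp]: "opn H \<Longrightarrow> opn I \<Longrightarrow> I \<subseteq> H \<Longrightarrow> x \<in> cc I \<Longrightarrow> ind H I x \<in> cc H"
  using ind_ghom group_hom.hom_closed by metis
lemma res_closed [simp]: "opn H \<Longrightarrow> opn I \<Longrightarrow> I \<subseteq> H \<Longrightarrow> x \<in> cc H \<Longrightarrow> res I H x \<in> cc I"
  using res_ghom group_hom.hom_closed by metis
lemma con_closed [simp]: "opn H \<Longrightarrow> g \<in> carrier G \<Longrightarrow> x \<in> cc H \<Longrightarrow> con g H x \<in> cc (conj_set G g H)"
  using con_ghom group_hom.hom_closed by metis
lemma act_closed: "sp H V \<Longrightarrow> g \<in> H \<Longrightarrow> x \<in> cc V \<Longrightarrow> con g V x \<in> cc V"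
  using act_ghom group_hom.hom_closed by metis

lemma ind_mult: "opn H \<Longrightarrow> opn I \<Longrightarrow> I \<subseteq> H \<Longrightarrow> x \<in> cc I \<Longrightarrow> y \<in> cc I \<Longrightarrow> ind H I (x \<cdot>\<^bsub>I\<^esub> y) = ind H I x \<cdot>\<^bsub>H\<^esub> ind H I y"
  using group_hom.hom_mult[OF ind_ghom] by blast
lemma res_mult: "opn H \<Longrightarrow> opn I \<Longrightarrow> I \<subseteq> H \<Longrightarrow> x \<in> cc H \<Longrightarrow> y \<in> cc H \<Longrightarrow> res I H (x \<cdot>\<^bsub>H\<^esub> y) = res I H x \<cdot>\<^bsub>I\<^esub> res I H y"
  using group_hom.hom_mult[OF res_ghom] by blast

lemma act_act:
  assumes "sp H V" "g \<in> H" "g' \<in> H" "x \<in> cc V"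
  shows "con g' V (con g V x) = con (g' \<otimes> g) V x"
  using M.mcon_trans[of V g g' x] sp_conj_set[OF assms(1,2)] assms spD opn_carrier by metis

lemma act_ind:
  assumes "sp H V" "sp H L" "V \<subseteq> L" "g \<in> H" "x \<in> cc V"
  shows "con g L (ind L V x) = ind L V (con g V x)"
  using M.mcon_mind[of L V g x] sp_conj_set[OF assms(1,4)] sp_conj_set[OF assms(2,4)] assms spD opn_carrier
  by metis

lemma act_res:
  assumes "sp H V" "sp H L" "V \<subseteq> L" "g \<in> H" "x \<in> cc L"
  shows "con g V (res V L x) = res V L (con g L x)"
  using M.mcon_mres[of L V g x] sp_conj_set[OF assms(1,4)] sp_conj_set[OF assms(2,4)] assms spD opn_carrier
  by metis

lemma act_res_fixed:
  assumes "sp H V" "opn L" "V \<subseteq> L" "L \<subseteq> H" "g \<in> L" "x \<in> cc L"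
  shows "con g V (res V L x) = res V L x"
  using act_res[OF sp_sub[OF assms(1-4)] sp_refl[OF assms(2)] assms(3,5,6)] M.mcon_refl[OF assms(2,5,6)] by simp

lemma Nm_subgroup: "opn H \<Longrightarrow> opn U \<Longrightarrow> U \<subseteq> H \<Longrightarrow> subgroup (Nm H U) (mobj C H)"
  unfolding norm_group_def using group_hom.img_is_subgroup[OF ind_ghom] by blast

lemma Nm_trans:
  assumes "opn H" "opn U" "opn V" "V \<subseteq> U" "U \<subseteq> H" shows "Nm H V \<subseteq> Nm H U"
proof
  fix y assume "y \<in> Nm H V"
  then obtain x where "x \<in> cc V" "y = ind H V x" by (auto simp: norm_group_def)
  then show "y \<in> Nm H U" using M.mind_trans[OF assms] ind_closed[OF assms(2-4)]
    unfolding norm_group_def by (metis imageI)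
qed

lemma Nm_mult: "opn H \<Longrightarrow> opn U \<Longrightarrow> U \<subseteq> H \<Longrightarrow> x \<in> Nm H U \<Longrightarrow> y \<in> Nm H U \<Longrightarrow> x \<cdot>\<^bsub>H\<^esub> y \<in> Nm H U"
  using subgroup.m_closed[OF Nm_subgroup] by blast

lemma Nm_carrier: "opn H \<Longrightarrow> opn U \<Longrightarrow> U \<subseteq> H \<Longrightarrow> x \<in> Nm H U \<Longrightarrow> x \<in> cc H"
  using subgroup.mem_carrier[OF Nm_subgroup] by blast

lemma pow_index_Nm:
  assumes "opn H" "opn U" "U \<subseteq> H" "x \<in> cc H" shows "powC H x (grp_index G H U) \<in> Nm H U"
  using M.mind_mres[OF assms] assms by (auto simp: norm_group_def intro!: image_eqI[of _ _ "res U H x"])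

subsection \<open>Partial norms along a Frobenius element\<close>

text \<open>The twisted power \<open>x\<close> to the exponent \<open>1 + \<phi> + \<dots> + \<phi>\<^sup>n\<^sup>-\<^sup>1\<close>.\<close>

primrec Phi :: "'g \<Rightarrow> 'g set \<Rightarrow> 'c \<Rightarrow> nat \<Rightarrow> 'c" where
  "Phi \<phi> V x 0 = \<one>\<^sub>C V"
| "Phi \<phi> V x (Suc n) = Phi \<phi> V x n \<cdot>\<^bsub>V\<^esub> con (\<phi> [^] n) V x"

context
  fixes H V \<phi> assumes sp: "sp H V" and \<phi>: "\<phi> \<in> H"
begin

lemma \<phi>_pow: "\<phi> [^] (n::nat) \<in> H" using sp \<phi> by (simp add: sp_iff)

lemma Phi_closed [simp]: "x \<in> cc V \<Longrightarrow> Phi \<phi> V x n \<in> cc V"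
  by (induction n) (use sp spD act_closed[OF sp \<phi>_pow] in auto)

lemma act_Suc_pow: "x \<in> cc V \<Longrightarrow> con \<phi> V (con (\<phi> [^] n) V x) = con (\<phi> [^] Suc n) V x"
  using act_act[OF sp \<phi>_pow \<phi>] nat_pow_Suc2[of \<phi> n] opn_carrier[OF spD(1)[OF sp] \<phi>] by simp

text \<open>The identity \<open>(\<phi> - 1) (1 + ... + \<phi>^(n-1)) = \<phi>^n - 1\<close> in
  multiplicative notation, with the inverses moved to the other side.\<close>

lemma Phi_shift:
  assumes x: "x \<in> cc V"
  shows "con \<phi> V (Phi \<phi> V x n) \<cdot>\<^bsub>V\<^esub> x = Phi \<phi> V x n \<cdot>\<^bsub>V\<^esub> con (\<phi> [^] n) V x"
proof (induction n)
  interpret q: comm_group "mobj C V" using cg spD sp by blast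
  interpret a: group_hom "mobj C V" "mobj C V" "con \<phi> V" by (rule act_ghom[OF sp \<phi>])
  {
    case 0 show ?case using x M.mcon_refl[of V \<one> x] spD[OF sp] by simp
  next
    case (Suc n)
    have "con \<phi> V (Phi \<phi> V x (Suc n)) \<cdot>\<^bsub>V\<^esub> x = (con \<phi> V (Phi \<phi> V x n) \<cdot>\<^bsub>V\<^esub> x) \<cdot>\<^bsub>V\<^esub> con (\<phi> [^] Suc n) V x"
      using x act_closed[OF sp \<phi>_pow x, of n] act_closed[OF sp \<phi>_pow x, of "Suc n"] act_closed[OF sp \<phi>]
      by (simp add: act_Suc_pow q.m_ac del: nat_pow_Suc)
    then show ?case using Suc by simp
  }
qed

lemma Phi_add:
  assumes x: "x \<in> cc V"
  shows "Phi \<phi> V x (m + n) = Phi \<phi> V x m \<cdot>\<^bsub>V\<^esub> con (\<phi> [^] m) V (Phi \<phi> V x n)"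
proof (induction n)
  interpret q: comm_group "mobj C V" using cg spD sp by blast
  interpret a: group_hom "mobj C V" "mobj C V" "con (\<phi> [^] m) V" by (rule act_ghom[OF sp \<phi>_pow])
  {
    case 0 show ?case using x by simp
  next
    case (Suc n) 
    have "con (\<phi> [^] (m + n)) V x = con (\<phi> [^] m) V (con (\<phi> [^] n) V x)"
      using act_act[OF sp \<phi>_pow \<phi>_pow x] opn_carrier[OF spD(1)[OF sp] \<phi>] by (simp add: nat_pow_mult)
    then show ?case using Suc x act_closed[OF sp \<phi>_pow] by (simp add: q.m_ac)
  }
qed

text \<open>The factors repeat with period \<open>k\<close>. In this way the exponent P'(n)
  lengthens a twisted power from \<open>ix n\<close> to \<open>n\<close> factors.\<close>

lemma Phi_period:
  assumes x: "x \<in> cc V" and per: "con (\<phi> [^] k) V x = x"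
  shows "Phi \<phi> V x (k * q) = powC V (Phi \<phi> V x k) q"
proof (induction q)
  interpret q: comm_group "mobj C V" using cg spD sp by blast
  interpret a: group_hom "mobj C V" "mobj C V" "con (\<phi> [^] k) V" by (rule act_ghom[OF sp \<phi>_pow])
  note pc = opn_carrier[OF spD(1)[OF sp] \<phi>]
  have fix_pow: "con (\<phi> [^] k) V (con (\<phi> [^] i) V x) = con (\<phi> [^] i) V x" for i :: nat
  proof -
    have "con (\<phi> [^] k) V (con (\<phi> [^] i) V x) = con (\<phi> [^] i) V (con (\<phi> [^] k) V x)"
      using act_act[OF sp \<phi>_pow \<phi>_pow x] pc by (simp add: nat_pow_mult add.commute)
    then show ?thesis using per by simp
  qed
  have fixP: "con (\<phi> [^] k) V (Phi \<phi> V x n) = Phi \<phi> V x n" for n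
    by (induction n) (use x act_closed[OF sp \<phi>_pow] fix_pow in auto)
  {
    case 0 show ?case by simp
  next
    case (Suc q)
    have "Phi \<phi> V x (k * Suc q) = Phi \<phi> V x (k + k * q)" by simp
    also have "\<dots> = Phi \<phi> V x k \<cdot>\<^bsub>V\<^esub> Phi \<phi> V x (k * q)" using Phi_add[OF x] fixP by simp
    finally show ?case using Suc x by (simp add: q.m_comm)
  }
qed

lemma Phi_ind:
  assumes x: "x \<in> cc V" and L: "sp H L" "V \<subseteq> L"
  shows "ind L V (Phi \<phi> V x n) = Phi \<phi> L (ind L V x) n"
proof (induction n)
  interpret i: group_hom "mobj C V" "mobj C L" "ind L V" using ind_ghom spD sp L by blast
  {
    case 0 show ?case by simp
  next
    case (Suc n) then show ?case
      using x act_closed[OF sp \<phi>_pow] act_ind[OF sp L \<phi>_pow x] by simp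
  }
qed

lemma v_Phi: "x \<in> cc V \<Longrightarrow> v V (Phi \<phi> V x n) = v V x [^]\<^bsub>W\<^esub> n"
proof (induction n)
  interpret i: group_hom "mobj C V" W "v V" using v_ghom spD sp by blast
  {
    case 0 show ?case by simp
  next
    case (Suc n) then show ?case
      using act_closed[OF sp \<phi>_pow] v_act[OF sp \<phi>_pow] by simp
  }
qed

text \<open>The form in which the Mackey formula delivers a twisted power.\<close>

lemma Phi_finprod:
  assumes x: "x \<in> cc V"
  shows "Phi \<phi> V x n = (\<Otimes>\<^bsub>mobj C V\<^esub>i\<in>{..<n}. con (\<phi> [^] i) V x)"
proof (induction n)
  interpret q: comm_group "mobj C V" using cg spD sp by blast
  {
    case 0 show ?case by simp
  next
    case (Suc n) then show ?case
      using x act_closed[OF sp \<phi>_pow] by (simp add: lessThan_Suc q.m_comm Pi_def)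
  }
qed

end

subsection \<open>Unramified pairs\<close>

context
  fixes H U assumes sp: "sp H U" and unr: "\<I> H \<subseteq> U"
begin

lemma unramified_inertia: "\<I> U = \<I> H"
  using unr spD[OF sp] by (auto simp: mem_inertia')

lemma index_res_degree: "grp_index G H U = res_degree W d H U"
  using unramified_index spD[OF sp] unr by blast

text \<open>By the class field axiom the norm group has index \<open>n\<close>, and norms have
  valuation in \<open>Dg n\<close>. Hence the powers of a prime with exponent below \<open>n\<close>
  represent all classes, and the class of a unit belongs to exponent 0. Its preimage is a unit by
  torsion-freeness.\<close>

lemma norm_unit_surj:
  assumes u: "u \<in> cc H" "v H u = \<one>\<^bsub>W\<^esub>"
  shows "\<exists>x\<in>cc U. v U x = \<one>\<^bsub>W\<^esub> \<and> ind H U x = u"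
proof -
  note U = spD[OF sp]
  define n where "n = res_degree W d H U"
  have n: "n > 0" "ix n = n" using f_sub[OF U(1-3)] by (auto simp: n_def)
  interpret H: comm_group "mobj C H" by (rule cg[OF U(1)])
  interpret Hg: grp "mobj C H" by (simp add: grp_def H.is_group)
  interpret vH: group_hom "mobj C H" W "v H" by (rule v_ghom[OF U(1)])
  interpret vU: group_hom "mobj C U" W "v U" by (rule v_ghom[OF U(2)])
  note N = Nm_subgroup[OF U(1-3)]
  have vN: "v H x \<in> Dg n" if "x \<in> Nm H U" for x
    using that v_ind[OF U(1-3)] U(2) by (auto simp: norm_group_def n_def Dg_def)
  obtain \<pi> where \<pi>: "\<pi> \<in> cc H" "v H \<pi> = \<omega>" using prime_ex[OF U(1)] by blast
  let ?c = "\<lambda>i::nat. Nm H U #>\<^bsub>mobj C H\<^esub> powC H \<pi> i"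
  have inj: "inj_on ?c {..<n}"
  proof (rule linorder_inj_onI')
    fix i j assume ij: "i \<in> {..<n}" "j \<in> {..<n}" "i < j"
    show "?c i \<noteq> ?c j"
    proof
      assume "?c i = ?c j"
      then have "powC H \<pi> i \<cdot>\<^bsub>H\<^esub> invC H (powC H \<pi> j) \<in> Nm H U" using Hg.rcos_eq_iff[OF N] \<pi> by simp
      then have "\<omega> [^]\<^bsub>W\<^esub> i \<otimes>\<^bsub>W\<^esub> inv\<^bsub>W\<^esub> (\<omega> [^]\<^bsub>W\<^esub> j) \<in> Dg n" using vN[of "powC H \<pi> i \<cdot>\<^bsub>H\<^esub> invC H (powC H \<pi> j)"] \<pi> by (simp add: vH.hom_nat_pow)
      then have "inv\<^bsub>W\<^esub> (\<omega> [^]\<^bsub>W\<^esub> i \<otimes>\<^bsub>W\<^esub> inv\<^bsub>W\<^esub> (\<omega> [^]\<^bsub>W\<^esub> j)) \<in> Dg n" by (rule subgroup.m_inv_closed[OF Dg_subgroup])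
      moreover have "\<omega> [^]\<^bsub>W\<^esub> j = \<omega> [^]\<^bsub>W\<^esub> (j - i) \<otimes>\<^bsub>W\<^esub> \<omega> [^]\<^bsub>W\<^esub> i" using ij by (simp add: W.nat_pow_mult)
      ultimately have "\<omega> [^]\<^bsub>W\<^esub> (j - i) \<in> Dg n" by (simp add: W.word_simps)
      then have "n dvd j - i" using \<omega>_pow_Dg_iff[OF n(1)] n by simp
      then show False using ij by (auto dest: dvd_imp_le)
    qed
  qed
  have card: "card (rcosets\<^bsub>mobj C H\<^esub> Nm H U) = n"
    using cfa_unramified[OF sp unr] index_res_degree
    by (simp add: class_field_axiom_def order_def FactGroup_def n_def)
  have "?c ` {..<n} = rcosets\<^bsub>mobj C H\<^esub> Nm H U"
  proof (rule card_seteq)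
    show "finite (rcosets\<^bsub>mobj C H\<^esub> Nm H U)" using card n card_ge_0_finite by metis
    show "?c ` {..<n} \<subseteq> rcosets\<^bsub>mobj C H\<^esub> Nm H U" using \<pi> by (auto simp: RCOSETS_def)
    show "card (rcosets\<^bsub>mobj C H\<^esub> Nm H U) \<le> card (?c ` {..<n})" using card card_image[OF inj] by simp
  qed
  moreover have "Nm H U #>\<^bsub>mobj C H\<^esub> u \<in> rcosets\<^bsub>mobj C H\<^esub> Nm H U" using u by (auto simp: RCOSETS_def)
  ultimately obtain i where i: "i < n" "Nm H U #>\<^bsub>mobj C H\<^esub> u = ?c i" by auto
  then have mem: "u \<cdot>\<^bsub>H\<^esub> invC H (powC H \<pi> i) \<in> Nm H U" using Hg.rcos_eq_iff[OF N] u \<pi> by simp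
  then have "inv\<^bsub>W\<^esub> (\<omega> [^]\<^bsub>W\<^esub> i) \<in> Dg n" using vN[OF mem] \<pi> u by (simp add: vH.hom_nat_pow)
  then have "\<omega> [^]\<^bsub>W\<^esub> i \<in> Dg n"
    using subgroup.m_inv_closed[OF Dg_subgroup] W.inv_inv W.nat_pow_closed \<omega>_carrier by metis
  then have "n dvd i" using \<omega>_pow_Dg_iff[OF n(1)] n by simp
  then have "i = 0" using i by (metis dvd_imp_le gr0I linorder_not_less)
  then have "u \<in> Nm H U" using mem u by simp
  then obtain x where x: "x \<in> cc U" "ind H U x = u" by (auto simp: norm_group_def)
  then have "v U x [^]\<^bsub>W\<^esub> n = \<one>\<^bsub>W\<^esub>" using v_ind[OF U(1-3) x(1)] u by (simp add: n_def)
  then have "v U x = \<one>\<^bsub>W\<^esub>" by (rule W_torsion_free[OF v_carrier[OF U(2) x(1)] n(1)])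
  then show ?thesis using x by blast
qed

context
  fixes \<phi> assumes \<phi>: "\<phi> \<in> H" "d \<phi> = \<omega> [^]\<^bsub>W\<^esub> f H"
begin

text \<open>\<open>U\<close> acts trivially on \<open>C(U)\<close>, so the action of
  \<open>H\<close> factors through the cyclic group generated by the Frobenius class.\<close>

lemma act_frob_pow:
  assumes "h \<in> H"
  obtains i :: nat where "\<And>x. x \<in> cc U \<Longrightarrow> con h U x = con (\<phi> [^] i) U x"
proof -
  note U = spD[OF sp]
  note c = opn_carrier[OF U(1)]
  obtain i :: nat where i: "h \<otimes> inv (\<phi> [^] i) \<in> U"
    using unramified_coset[OF U(1-3) unr \<phi> assms] by blast
  have iH: "\<phi> [^] i \<in> H" "h \<otimes> inv (\<phi> [^] i) \<in> H" using \<phi> U i by auto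
  have h: "h = (h \<otimes> inv (\<phi> [^] i)) \<otimes> \<phi> [^] i" using c assms \<phi> by (simp add: word_simps)
  have "con h U x = con (\<phi> [^] i) U x" if "x \<in> cc U" for x
    using act_act[OF sp iH that] M.mcon_refl[OF U(2) i] act_closed[OF sp iH(1) that] h by metis
  then show ?thesis using that by blast
qed

text \<open>The axiom describes the kernel of the norm by the quotients \<open>con h x / x\<close>
  for all \<open>h\<close>. Each \<open>h\<close> acts as a power of the Frobenius, so a twisted
  power of \<open>x\<close> solves the equation for such a generator, and the solvable
  \<open>z\<close> form a subgroup \<open>Z\<close>. That \<open>w\<close> can be made a unit rests
  on the valuations being integral powers of \<open>\<omega>\<close>.\<close>

lemma hilbert90:
  assumes z: "z \<in> cc U" "ind H U z = \<one>\<^sub>C H"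
  shows "\<exists>w\<in>cc U. v U w = \<one>\<^bsub>W\<^esub> \<and> con \<phi> U w = z \<cdot>\<^bsub>U\<^esub> w"
proof -
  note U = spD[OF sp]
  interpret U: comm_group "mobj C U" by (rule cg[OF U(2)])
  interpret H: comm_group "mobj C H" by (rule cg[OF U(1)])
  interpret a: group_hom "mobj C U" "mobj C U" "con \<phi> U" by (rule act_ghom[OF sp \<phi>(1)])
  interpret vH: group_hom "mobj C H" W "v H" by (rule v_ghom[OF U(1)])
  interpret vU: group_hom "mobj C U" W "v U" by (rule v_ghom[OF U(2)])
  define Z where "Z = {z \<in> cc U. \<exists>w\<in>cc U. con \<phi> U w = z \<cdot>\<^bsub>U\<^esub> w}"
  have "subgroup Z (mobj C U)"
  proof (rule U.subgroupI)
    show "Z \<noteq> {}" using a.hom_one by (force simp: Z_def)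
    show "invC U z \<in> Z" if "z \<in> Z" for z
    proof -
      obtain w where w: "z \<in> cc U" "w \<in> cc U" "con \<phi> U w = z \<cdot>\<^bsub>U\<^esub> w" using \<open>z \<in> Z\<close> by (auto simp: Z_def)
      then have "con \<phi> U (invC U w) = invC U z \<cdot>\<^bsub>U\<^esub> invC U w" by (simp add: U.inv_mult)
      moreover have "invC U w \<in> cc U" "invC U z \<in> cc U" using w by auto
      ultimately show ?thesis unfolding Z_def by blast
    qed
    show "x \<cdot>\<^bsub>U\<^esub> y \<in> Z" if xy: "x \<in> Z" "y \<in> Z" for x y
    proof -
      obtain w where w: "x \<in> cc U" "w \<in> cc U" "con \<phi> U w = x \<cdot>\<^bsub>U\<^esub> w" using xy by (auto simp: Z_def)
      obtain w' where w': "y \<in> cc U" "w' \<in> cc U" "con \<phi> U w' = y \<cdot>\<^bsub>U\<^esub> w'" using xy by (auto simp: Z_def)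
      have "con \<phi> U (w \<cdot>\<^bsub>U\<^esub> w') = (x \<cdot>\<^bsub>U\<^esub> y) \<cdot>\<^bsub>U\<^esub> (w \<cdot>\<^bsub>U\<^esub> w')" using w w' by (simp add: U.m_ac)
      moreover have "w \<cdot>\<^bsub>U\<^esub> w' \<in> cc U" "x \<cdot>\<^bsub>U\<^esub> y \<in> cc U" using w w' by auto
      ultimately show ?thesis unfolding Z_def by blast
    qed
  qed (auto simp: Z_def)
  moreover have "con h U x \<cdot>\<^bsub>U\<^esub> invC U x \<in> Z" if hx: "h \<in> H" "x \<in> cc U" for h x
  proof -
    obtain i :: nat where i: "con h U x = con (\<phi> [^] i) U x" using act_frob_pow[OF hx(1)] hx(2) by metis
    define w where "w = Phi \<phi> U x i"
    have c: "w \<in> cc U" "con h U x \<in> cc U" using Phi_closed[OF sp \<phi>(1)] act_closed[OF sp] hx by (auto simp: w_def)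
    have "con \<phi> U w \<cdot>\<^bsub>U\<^esub> x = w \<cdot>\<^bsub>U\<^esub> con h U x" using Phi_shift[OF sp \<phi>(1) hx(2)] i by (simp add: w_def)
    then have "con \<phi> U w = (w \<cdot>\<^bsub>U\<^esub> con h U x) \<cdot>\<^bsub>U\<^esub> invC U x" using hx c by (metis U.inv_solve_right' a.hom_closed C_closed(1) U(2))
    then have "con \<phi> U w = (con h U x \<cdot>\<^bsub>U\<^esub> invC U x) \<cdot>\<^bsub>U\<^esub> w" using hx c by (simp add: U.m_ac)
    then show ?thesis using c hx by (auto simp: Z_def)
  qed
  ultimately have "generate (mobj C U) {con h U x \<cdot>\<^bsub>U\<^esub> invC U x | h x. h \<in> H \<and> x \<in> cc U} \<subseteq> Z"
    by (intro U.generate_subgroup_incl) auto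
  moreover have "z \<in> kernel (mobj C U) (mobj C H) (ind H U)" using z by (simp add: kernel_def)
  ultimately obtain w where w: "w \<in> cc U" "con \<phi> U w = z \<cdot>\<^bsub>U\<^esub> w"
    using cfa_unramified[OF sp unr] by (auto simp: class_field_axiom_def Z_def)
  obtain k :: int where k: "v U w = \<omega> [^]\<^bsub>W\<^esub> k" using v_int[OF U(2) w(1)] by blast
  obtain \<pi> where \<pi>: "\<pi> \<in> cc H" "v H \<pi> = \<omega>" using prime_ex[OF U(1)] by blast
  interpret r: group_hom "mobj C H" "mobj C U" "res U H" by (rule res_ghom[OF U(1-3)])
  \<comment> \<open>A prime of \<open>C(H)\<close> stays prime in \<open>C(U)\<close> and is fixed
    by \<open>\<phi>\<close>; its power corrects the valuation of \<open>w\<close> without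
    disturbing the equation.\<close>
  define p where "p = res U H \<pi> [^]\<^bsub>mobj C U\<^esub> (- k)"
  have p: "p \<in> cc U" using \<pi> by (simp add: p_def)
  have "v U (res U H \<pi>) = \<omega>" using v_res[OF U(1-3) \<pi>(1)] unramified_inertia \<pi> by simp
  then have vp: "v U p = inv\<^bsub>W\<^esub> (v U w)" using \<pi> k unfolding p_def
    by (simp add: vU.hom_int_pow W.int_pow_neg)
  have "con \<phi> U (res U H \<pi>) = res U H \<pi>"
    using act_res_fixed[OF sp U(1,3) _ \<phi>(1) \<pi>(1)] by simp
  then have cp: "con \<phi> U p = p" using \<pi> unfolding p_def by (simp add: a.hom_int_pow)
  show ?thesis
  proof (rule bexI[of _ "w \<cdot>\<^bsub>U\<^esub> p"])
    show "v U (w \<cdot>\<^bsub>U\<^esub> p) = \<one>\<^bsub>W\<^esub> \<and> con \<phi> U (w \<cdot>\<^bsub>U\<^esub> p) = z \<cdot>\<^bsub>U\<^esub> (w \<cdot>\<^bsub>U\<^esub> p)"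
      using w p vp cp z U by (simp add: U.m_assoc)
  qed (use w p in simp)
qed

lemma frob_fixed_descent:
  assumes t: "t \<in> cc U" "con \<phi> U t = t"
  shows "\<exists>t0\<in>cc H. res U H t0 = t"
proof -
  note U = spD[OF sp]
  have pw: "con (\<phi> [^] i) U t = t" for i :: nat
  proof (induction i)
    case 0 then show ?case using M.mcon_refl[of U \<one> t] U t by simp
  next
    case (Suc i) then show ?case using act_Suc_pow[OF sp \<phi>(1) t(1), of i] t by simp
  qed
  have "\<forall>h\<in>H. con h U t = t"
  proof
    fix h assume "h \<in> H"
    then obtain i :: nat where "con h U t = con (\<phi> [^] i) U t" using act_frob_pow t by metis
    then show "con h U t = t" using pw by simp
  qed
  then have "t \<in> {x \<in> cc U. \<forall>h\<in>H. con h U x = x}" using t by simp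
  moreover have "res U H ` cc H = {x \<in> cc U. \<forall>h\<in>H. con h U x = x}"
    using descent[OF sp unr] by (simp add: galois_descent_def iso_def bij_betw_def)
  ultimately have "t \<in> res U H ` cc H" by (simp only:)
  then show ?thesis by blast
qed

end

lemma res_inj: "inj_on (res U H) (cc H)"
  using descent[OF sp unr] by (auto simp: galois_descent_def iso_def bij_betw_def)

end

subsection \<open>Restriction of norms to the maximal unramified part\<close>

text \<open>Since \<open>M\<close> contains the inertia of \<open>H\<close>, the double coset of an
  element for \<open>M\<close> and \<open>L\<close> depends only on its degree modulo the degrees of
  \<open>L\<close>; so the powers of \<open>\<phi>\<close> below \<open>k\<close> are
  representatives. As \<open>M\<close> and \<open>V\<close> are normal in \<open>H\<close>, every
  Mackey summand is a conjugate of one and the same norm.\<close>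

lemma res_ind_frob:
  assumes sp: "sp H V" and L: "opn L" "V \<subseteq> L" "L \<subseteq> H" and M: "M = pre H (f V)" and LM: "L \<inter> M = V"
    and \<phi>: "\<phi> \<in> H" "d \<phi> = \<omega> [^]\<^bsub>W\<^esub> f H" and k: "k > 0" "ix k = k" "f L = f H * k"
    and x: "x \<in> cc L"
  shows "res M H (ind H L x) = Phi \<phi> M (ind M V (res V L x)) k"
proof -
  note V = spD[OF sp]
  note c = opn_carrier[OF V(1)]
  have spM: "sp H M" unfolding M by (rule sp_pre[OF sp_refl[OF V(1)] f_pos[OF V(2)]])
  note Mf = spD[OF spM]
  have VM: "V \<subseteq> M" using LM by auto
  define R where "R = (\<lambda>i::nat. \<phi> [^] i) ` {..<k}"
  have \<phi>c: "\<phi> \<in> carrier G" and \<phi>p: "\<phi> [^] i \<in> H" for i :: nat using \<phi> c V by auto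
  have d\<phi>: "d (\<phi> [^] i) = \<omega> [^]\<^bsub>W\<^esub> (f H * i)" for i :: nat
    using \<phi> \<phi>c by (simp add: d.hom_nat_pow W.nat_pow_pow)
  have fH: "f H > 0" by (rule f_pos[OF V(1)])
  have inj: "inj_on (\<lambda>i::nat. \<phi> [^] i) {..<k}"
    using d\<phi> \<omega>_pow_inj fH by (intro inj_onI) (metis mult_left_cancel nat_neq_iff)
  have dM: "d m \<in> Dg (f L)" if "m \<in> M" for m
  proof -
    have "Dg (f V) \<subseteq> Dg (f L)" using d_image[OF V(2)] d_image[OF L(1)] L(2) by (metis image_mono)
    then show ?thesis using that by (auto simp: M pre_def)
  qed
  have mem: "y \<in> (M #> \<phi> [^] i) <#> L \<longleftrightarrow> d (y \<otimes> inv (\<phi> [^] i)) \<in> Dg (f L)" if y: "y \<in> H" for y and i :: nat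
  proof
    assume "y \<in> (M #> \<phi> [^] i) <#> L"
    then obtain m l where ml: "m \<in> M" "l \<in> L" "y = m \<otimes> \<phi> [^] i \<otimes> l" using double_coset_mem by blast
    have "d (y \<otimes> inv (\<phi> [^] i)) = d m \<otimes>\<^bsub>W\<^esub> d l"
      using ml opn_carrier[OF Mf(2)] opn_carrier[OF L(1)] \<phi>c
      by (simp add: W.m_assoc W.m_comm[of "d l"])
    then show "d (y \<otimes> inv (\<phi> [^] i)) \<in> Dg (f L)"
      using dM[OF ml(1)] d_mem[OF L(1) ml(2)] subgroup.m_closed[OF Dg_subgroup] by simp
  next
    assume "d (y \<otimes> inv (\<phi> [^] i)) \<in> Dg (f L)"
    then obtain l where l: "l \<in> L" "d (y \<otimes> inv (\<phi> [^] i)) = d l" using d_image[OF L(1)] by (metis imageE)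
    define m where "m = y \<otimes> inv l \<otimes> inv (\<phi> [^] i)"
    have cs: "y \<in> carrier G" "l \<in> carrier G" "l \<in> H" using y l c L by auto
    have "d m = d (y \<otimes> inv (\<phi> [^] i)) \<otimes>\<^bsub>W\<^esub> inv\<^bsub>W\<^esub> d l"
      using cs \<phi>c by (simp add: m_def W.m_ac)
    then have "d m = \<one>\<^bsub>W\<^esub>" using l cs by simp
    moreover have "m \<in> H" using y cs \<phi>p V(1) by (simp add: m_def)
    ultimately have "m \<in> M" using subgroup.one_closed[OF Dg_subgroup] by (simp add: M pre_def)
    moreover have "y = m \<otimes> \<phi> [^] i \<otimes> l" using cs \<phi>c by (simp add: m_def word_simps)
    ultimately show "y \<in> (M #> \<phi> [^] i) <#> L" using l double_coset_mem by blast
  qed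
  have "double_coset_reps G M H L R" unfolding double_coset_reps_def
  proof (intro conjI ballI)
    show "R \<subseteq> H" using \<phi>p by (auto simp: R_def)
    fix y assume y: "y \<in> H"
    obtain i where i: "i < k" "d (y \<otimes> inv (\<phi> [^] i)) \<in> Dg (f H * k)"
      using frob_pow_coset[OF V(1) \<phi> y k(1)] by blast
    show "\<exists>!r. r \<in> R \<and> y \<in> (M #> r) <#> L"
    proof (rule ex1I[of _ "\<phi> [^] i"])
      show "\<phi> [^] i \<in> R \<and> y \<in> (M #> \<phi> [^] i) <#> L" using mem[OF y] i k by (simp add: R_def)
      fix r assume r: "r \<in> R \<and> y \<in> (M #> r) <#> L"
      then obtain j where j: "j < k" "r = \<phi> [^] j" by (auto simp: R_def)
      have dj: "d (y \<otimes> inv (\<phi> [^] j)) \<in> Dg (f H * k)" using r j mem[OF y] k by simp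
      have eq: "i = j" if ij: "i \<le> j" "j < k" "d (y \<otimes> inv (\<phi> [^] i)) \<in> Dg (f H * k)"
        "d (y \<otimes> inv (\<phi> [^] j)) \<in> Dg (f H * k)" for i j :: nat
      proof -
        have "d (y \<otimes> inv (\<phi> [^] i)) \<otimes>\<^bsub>W\<^esub> inv\<^bsub>W\<^esub> d (y \<otimes> inv (\<phi> [^] j)) \<in> Dg (f H * k)"
          using ij by (intro subgroup.m_closed[OF Dg_subgroup] subgroup.m_inv_closed[OF Dg_subgroup])
        moreover have "\<phi> [^] j = \<phi> [^] (j - i) \<otimes> \<phi> [^] i" using ij \<phi>c by (simp add: nat_pow_mult)
        then have "d (y \<otimes> inv (\<phi> [^] i)) \<otimes>\<^bsub>W\<^esub> inv\<^bsub>W\<^esub> d (y \<otimes> inv (\<phi> [^] j)) = d (\<phi> [^] (j - i))"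
          using c[OF y] \<phi>c by (simp add: W.inv_mult W.m_ac W.inv_cancel)
        ultimately have "\<omega> [^]\<^bsub>W\<^esub> (f H * (j - i)) \<in> Dg (f H * k)" using d\<phi> by simp
        then have "k dvd j - i" using \<omega>_pow_mult_Dg[OF fH k(1)] k by simp
        then show "i = j" using ij by (metis diff_is_0_eq dvd_imp_le le_antisym less_imp_diff_less linorder_not_less gr0I)
      qed
      have "i = j" using eq[of i j] eq[of j i] i j dj by (metis nat_le_linear)
      then show "r = \<phi> [^] i" using j by simp
    qed
  qed
  then have "res M H (ind H L x) = (\<Otimes>\<^bsub>mobj C M\<^esub>h\<in>R. ind M (M \<inter> conj_set G h L)
      (con h (conj_set G (inv h) M \<inter> L) (res (conj_set G (inv h) M \<inter> L) L x)))"
    by (rule M.mackey_formula[OF V(1) Mf(2) L(1) Mf(3) L(3) _ x])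
  also have "\<dots> = (\<Otimes>\<^bsub>mobj C M\<^esub>h\<in>R. con h M (ind M V (res V L x)))"
  proof -
    interpret CM: comm_group "mobj C M" by (rule cg[OF Mf(2)])
    have y: "res V L x \<in> cc V" using L V x by simp
    show ?thesis
    proof (rule CM.finprod_cong')
      show "(\<lambda>h. con h M (ind M V (res V L x))) \<in> R \<rightarrow> cc M"
        using y act_closed[OF spM] V Mf VM \<phi>p by (auto simp: R_def)
      fix h assume "h \<in> R"
      then have h: "h \<in> H" using \<phi>p by (auto simp: R_def)
      have 1: "conj_set G (inv h) M = M" by (rule sp_conj_set[OF spM]) (use h V in simp)
      have "M \<inter> conj_set G h L = conj_set G h (M \<inter> L)"
        using conj_set_Int[OF opn_subset[OF Mf(2)] opn_subset[OF L(1)] c[OF h]] sp_conj_set[OF spM h] by simp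
      then have 2: "M \<inter> conj_set G h L = V" using LM sp_conj_set[OF sp h] by (simp add: Int_commute)
      show "ind M (M \<inter> conj_set G h L)
          (con h (conj_set G (inv h) M \<inter> L) (res (conj_set G (inv h) M \<inter> L) L x)) = con h M (ind M V (res V L x))"
        using act_ind[OF sp spM VM h y] LM by (simp add: 1 2 Int_commute)
    qed simp
  qed
  also have "\<dots> = (\<Otimes>\<^bsub>mobj C M\<^esub>i\<in>{..<k}. con (\<phi> [^] i) M (ind M V (res V L x)))"
  proof -
    interpret CM: comm_group "mobj C M" by (rule cg[OF Mf(2)])
    show ?thesis unfolding R_def
      by (rule CM.finprod_reindex[OF _ inj]) (use act_closed[OF spM] V Mf VM \<phi>p L x in auto)
  qed
  also have "\<dots> = Phi \<phi> M (ind M V (res V L x)) k"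
    by (rule Phi_finprod[OF spM \<phi>(1), symmetric]) (use V Mf VM L x in simp)
  finally show ?thesis .
qed

end

section \<open>The reciprocity relation\<close>

context comm_group
begin

lemma cross_mult:
  assumes "p \<in> carrier G" "q \<in> carrier G" "r \<in> carrier G" "s \<in> carrier G"
  shows "p \<otimes> inv q = r \<otimes> inv s \<longleftrightarrow> p \<otimes> s = r \<otimes> q"
proof
  assume "p \<otimes> inv q = r \<otimes> inv s"
  then have "(p \<otimes> inv q) \<otimes> (q \<otimes> s) = (r \<otimes> inv s) \<otimes> (q \<otimes> s)" by simp
  moreover have "(p \<otimes> inv q) \<otimes> (q \<otimes> s) = p \<otimes> s"
    using assms by (simp add: m_assoc) (simp add: m_assoc[symmetric])
  moreover have "(r \<otimes> inv s) \<otimes> (q \<otimes> s) = r \<otimes> q"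
    using assms by (simp add: m_assoc m_comm[of q s]) (simp add: m_assoc[symmetric])
  ultimately show "p \<otimes> s = r \<otimes> q" by simp
next
  assume *: "p \<otimes> s = r \<otimes> q"
  have "p \<otimes> inv q = (p \<otimes> s) \<otimes> (inv q \<otimes> inv s)"
    using assms by (simp add: m_assoc m_comm[of "inv q"]) (simp add: m_assoc[symmetric])
  also have "\<dots> = (r \<otimes> q) \<otimes> (inv q \<otimes> inv s)" using * by simp
  also have "\<dots> = r \<otimes> inv s" using assms by (simp add: m_assoc) (simp add: m_assoc[symmetric])
  finally show "p \<otimes> inv q = r \<otimes> inv s" .
qed

lemma conj_cancel: "x \<in> carrier G \<Longrightarrow> a \<in> carrier G \<Longrightarrow> x \<otimes> (a \<otimes> inv x) = a"
  by (simp add: m_comm[of a] m_assoc[symmetric])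

text \<open>The formal part of \<open>frep_mult\<close>. Each hypothesis is a telescoping relation,
  with a prime written as a unit times the common prime \<open>x\<close>. After cross-multiplication
  one factor \<open>x\<close> cancels; the left side keeps the units
  \<open>e4 \<otimes> x \<otimes> inv t1\<close> and \<open>inv e3\<close>, the right side their
  images under the two inertia elements.\<close>

lemma frobenius_cross:
  assumes c: "ca \<in> carrier G" "cb \<in> carrier G" "cd \<in> carrier G" "a \<in> carrier G" "b \<in> carrier G"
      "e \<in> carrier G" "x \<in> carrier G" "t1 \<in> carrier G" "t3 \<in> carrier G" "t4 \<in> carrier G"
      "e3 \<in> carrier G" "e4 \<in> carrier G" "s3 \<in> carrier G" "s4 \<in> carrier G"
    and 1: "ca \<otimes> x = a \<otimes> t1" and 2: "cb \<otimes> (e4 \<otimes> x) = b \<otimes> (s4 \<otimes> t4)" and 3: "cd \<otimes> (e3 \<otimes> x) = e \<otimes> (s3 \<otimes> t3)"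
  shows "(ca \<otimes> cb \<otimes> inv cd) \<otimes> ((e4 \<otimes> x \<otimes> inv t1) \<otimes> inv e3) = (a \<otimes> b \<otimes> inv e) \<otimes> ((s4 \<otimes> t4 \<otimes> inv t3) \<otimes> inv s3)"
proof -
  have "(ca \<otimes> cb \<otimes> (e4 \<otimes> x)) \<otimes> (e \<otimes> (t3 \<otimes> s3)) \<otimes> x = (ca \<otimes> x) \<otimes> (cb \<otimes> (e4 \<otimes> x)) \<otimes> (e \<otimes> (s3 \<otimes> t3))"
    using c by (simp add: m_ac)
  also have "\<dots> = (a \<otimes> b \<otimes> (s4 \<otimes> t4)) \<otimes> (cd \<otimes> (t1 \<otimes> e3)) \<otimes> x"
    unfolding 1 2 3[symmetric] using c by (simp add: m_ac)
  finally have "(ca \<otimes> cb \<otimes> (e4 \<otimes> x)) \<otimes> (e \<otimes> (t3 \<otimes> s3)) = (a \<otimes> b \<otimes> (s4 \<otimes> t4)) \<otimes> (cd \<otimes> (t1 \<otimes> e3))"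
    using c by simp
  then have "(ca \<otimes> cb \<otimes> (e4 \<otimes> x)) \<otimes> inv (cd \<otimes> (t1 \<otimes> e3)) = (a \<otimes> b \<otimes> (s4 \<otimes> t4)) \<otimes> inv (e \<otimes> (t3 \<otimes> s3))"
    using c by (subst cross_mult) auto
  then show ?thesis using c by (simp add: inv_mult m_ac)
qed

end

context cft
begin

text \<open>The norms to \<open>M\<close> of a lift of \<open>u\<close> and of the twisted power of the Hilbert 90 element differ by a
  \<open>\<phi>\<close>-invariant, hence by an element of \<open>C(H)\<close>, whose norm is an \<open>[H:U]\<close>-th power.\<close>

lemma norm_of_frobenius_unit:
  assumes sp: "sp H V" and VU: "opn U" "V \<subseteq> U" "U \<subseteq> H" and \<phi>: "\<phi> \<in> H" "d \<phi> = \<omega> [^]\<^bsub>W\<^esub> f H"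
    and u: "u \<in> cc V" "v V u = \<one>\<^bsub>W\<^esub>" and a: "a \<in> cc V" "v V a = \<one>\<^bsub>W\<^esub>" and b: "b \<in> cc V" "v V b = \<one>\<^bsub>W\<^esub>"
    and \<tau>: "\<tau> \<in> \<I> H" "\<tau>' \<in> \<I> H"
    and eq: "con \<phi> V u \<cdot>\<^bsub>V\<^esub> (a \<cdot>\<^bsub>V\<^esub> b) = u \<cdot>\<^bsub>V\<^esub> (con \<tau> V a \<cdot>\<^bsub>V\<^esub> con \<tau>' V b)"
    and M: "M = pre H (f V)" and y: "y \<in> cc H" "res M H y = ind M V u"
  shows "y \<in> Nm H U"
proof -
  note V = spD[OF sp]
  note c = opn_carrier[OF V(1)]
  define m where "m = grp_index G H U"
  have m: "m > 0" "ix m = m" using index_pos index_P_number VU V by (auto simp: m_def)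
  define e where "e = res_degree W d H V"
  have e: "e > 0" "ix e = e" "f V = f H * e" using f_sub[OF V(1-3)] by (auto simp: e_def)
  have fpos: "f H > 0" "f V > 0" using f_pos V by auto
  have spM: "sp H M" unfolding M by (rule sp_pre[OF sp_refl[OF V(1)] fpos(2)])
  note Mf = spD[OF spM]
  have fM: "f M = f V" unfolding M e(3) by (rule f_pre[OF V(1) e(1,2)])
  have VM: "V \<subseteq> M" using d_mem[OF V(2)] V(3) by (auto simp: M pre_def)
  have IM: "\<I> M = \<I> H" unfolding M by (rule inertia_pre)
  \<comment> \<open>The same unramified condition of degree \<open>m = [H:U]\<close> is imposed
    below \<open>V\<close> and below \<open>M\<close>, so that the norm from \<open>M'\<close> to
    \<open>M\<close> of an invariant element becomes an \<open>m\<close>-th power.\<close>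
  define V' where "V' = pre V (f V * m)"
  define M' where "M' = pre M (f M * m)"
  have posm: "f V * m > 0" "f M * m > 0" using fpos fM m by auto
  have spV': "sp H V'" unfolding V'_def by (rule sp_pre[OF sp posm(1)])
  have spM': "sp H M'" unfolding M'_def by (rule sp_pre[OF spM posm(2)])
  note V'f = spD[OF spV'] and M'f = spD[OF spM']
  have V'V: "V' \<subseteq> V" and M'M: "M' \<subseteq> M" by (auto simp: V'_def M'_def pre_subset)
  have V'M': "V' \<subseteq> M'" using VM fM by (auto simp: V'_def M'_def pre_def)
  have spVV': "sp V V'" and spMM': "sp M M'"
    using sp_sub[OF spV' V(2) V'V V(3)] sp_sub[OF spM' Mf(2) M'M Mf(3)] by auto
  have I': "\<I> V' = \<I> V" "\<I> M' = \<I> H" unfolding V'_def M'_def inertia_pre by (simp_all add: IM)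
  have unrV: "\<I> V \<subseteq> V'" and unrM: "\<I> M \<subseteq> M'" and unrH: "\<I> H \<subseteq> M'" and unrHM: "\<I> H \<subseteq> M"
    using I' IM inertia_subset by metis+
  have fM': "f M' = f M * m" unfolding M'_def by (rule f_pre[OF Mf(2) m])
  have indexM: "grp_index G M M' = m"
  proof -
    have "f M * m = f M * res_degree W d M M'" using f_mult[OF Mf(2) M'f(2) M'M] fM' by simp
    then show ?thesis using unramified_index[OF Mf(2) M'f(2) M'M unrM] fpos fM by simp
  qed
  have \<tau>H: "\<tau> \<in> H" "\<tau>' \<in> H" "\<tau> \<in> M'" "\<tau>' \<in> M'" using \<tau> inertia_subset unrH by auto
  obtain u' a' b' where lifts:
      "u' \<in> cc V'" "ind V V' u' = u" "a' \<in> cc V'" "ind V V' a' = a" "b' \<in> cc V'" "ind V V' b' = b"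
    using norm_unit_surj[OF spVV' unrV] u a b by metis
  interpret CV': comm_group "mobj C V'" by (rule cg[OF V'f(2)])
  interpret CM': comm_group "mobj C M'" by (rule cg[OF M'f(2)])
  interpret CM: comm_group "mobj C M" by (rule cg[OF Mf(2)])
  interpret iV: group_hom "mobj C V'" "mobj C V" "ind V V'" by (rule ind_ghom[OF V(2) V'f(2) V'V])
  interpret N: group_hom "mobj C V'" "mobj C M'" "ind M' V'" by (rule ind_ghom[OF M'f(2) V'f(2) V'M'])
  interpret N2: group_hom "mobj C M'" "mobj C M" "ind M M'" by (rule ind_ghom[OF Mf(2) M'f(2) M'M])
  define X where "X = con \<phi> V' u' \<cdot>\<^bsub>V'\<^esub> (a' \<cdot>\<^bsub>V'\<^esub> b')"
  define Y where "Y = u' \<cdot>\<^bsub>V'\<^esub> (con \<tau> V' a' \<cdot>\<^bsub>V'\<^esub> con \<tau>' V' b')"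
  have acl: "con g V' x \<in> cc V'" if "g \<in> H" "x \<in> cc V'" for g x using act_closed[OF spV'] that by blast
  have XY: "X \<in> cc V'" "Y \<in> cc V'" using lifts acl \<phi> \<tau>H by (auto simp: X_def Y_def)
  have "ind V V' X = ind V V' Y"
    using eq lifts acl \<phi> \<tau>H by (simp add: X_def Y_def act_ind[OF spV' sp V'V, symmetric])
  then have z: "ind V V' (X \<cdot>\<^bsub>V'\<^esub> invC V' Y) = \<one>\<^sub>C V" "X \<cdot>\<^bsub>V'\<^esub> invC V' Y \<in> cc V'" using XY by simp_all
  obtain s where s: "s \<in> V" "d s = \<omega> [^]\<^bsub>W\<^esub> f V" using frob_ex[OF V(2)] by blast
  have sH: "s \<in> H" using s V by auto
  obtain w where w: "w \<in> cc V'" "con s V' w = (X \<cdot>\<^bsub>V'\<^esub> invC V' Y) \<cdot>\<^bsub>V'\<^esub> w"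
    using hilbert90[OF spVV' unrV s z(2,1)] by blast
  have "Y \<cdot>\<^bsub>V'\<^esub> con s V' w = (Y \<cdot>\<^bsub>V'\<^esub> invC V' Y) \<cdot>\<^bsub>V'\<^esub> (X \<cdot>\<^bsub>V'\<^esub> w)"
    unfolding w(2) using w(1) XY by (simp add: CV'.m_ac CV'.conj_cancel)
  then have Yw: "Y \<cdot>\<^bsub>V'\<^esub> con s V' w = X \<cdot>\<^bsub>V'\<^esub> w" using w XY by simp
  define cu where "cu = ind M' V' u'"
  define cb where "cb = ind M' V' w"
  have cc': "cu \<in> cc M'" "cb \<in> cc M'" using lifts w by (auto simp: cu_def cb_def)
  have acl2: "con g M' x \<in> cc M'" if "g \<in> H" "x \<in> cc M'" for g x using act_closed[OF spM'] that by blast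
  have indcon: "ind M' V' (con g V' x) = con g M' (ind M' V' x)" if "g \<in> H" "x \<in> cc V'" for g x
    using act_ind[OF spV' spM' V'M' that] by simp
  \<comment> \<open>The inertia of \<open>H\<close> lies in \<open>M'\<close> and acts trivially on
    its group, so the twists by the two inertia elements disappear once norms to \<open>M'\<close>
    are taken.\<close>
  have triv: "con g M' x = x" if "g \<in> M'" "x \<in> cc M'" for g x using M.mcon_refl[OF M'f(2) that] .
  have NX: "ind M' V' X = con \<phi> M' cu \<cdot>\<^bsub>M'\<^esub> ind M' V' (a' \<cdot>\<^bsub>V'\<^esub> b')"
    using lifts acl \<phi> by (simp add: X_def indcon cu_def)
  have NY: "ind M' V' Y = cu \<cdot>\<^bsub>M'\<^esub> ind M' V' (a' \<cdot>\<^bsub>V'\<^esub> b')"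
    using lifts acl \<tau>H by (simp add: Y_def indcon cu_def triv)
  have "ind M' V' (Y \<cdot>\<^bsub>V'\<^esub> con s V' w) = ind M' V' (X \<cdot>\<^bsub>V'\<^esub> w)" using Yw by simp
  then have "(cu \<cdot>\<^bsub>M'\<^esub> ind M' V' (a' \<cdot>\<^bsub>V'\<^esub> b')) \<cdot>\<^bsub>M'\<^esub> con s M' cb
      = (con \<phi> M' cu \<cdot>\<^bsub>M'\<^esub> ind M' V' (a' \<cdot>\<^bsub>V'\<^esub> b')) \<cdot>\<^bsub>M'\<^esub> cb"
    using XY w(1) sH acl NX NY by (simp add: indcon cb_def)
  then have "(cu \<cdot>\<^bsub>M'\<^esub> con s M' cb) \<cdot>\<^bsub>M'\<^esub> ind M' V' (a' \<cdot>\<^bsub>V'\<^esub> b')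
      = (con \<phi> M' cu \<cdot>\<^bsub>M'\<^esub> cb) \<cdot>\<^bsub>M'\<^esub> ind M' V' (a' \<cdot>\<^bsub>V'\<^esub> b')"
    using cc' lifts acl2 sH \<phi> by (simp add: CM'.m_ac)
  then have 1: "cu \<cdot>\<^bsub>M'\<^esub> con s M' cb = con \<phi> M' cu \<cdot>\<^bsub>M'\<^esub> cb"
    using cc' lifts acl2 sH \<phi> by simp
  have \<phi>e: "\<phi> [^] e \<in> H" using \<phi> V by simp
  \<comment> \<open>The Frobenius \<open>s\<close> of \<open>V\<close> and the \<open>e\<close>-th
    power of \<open>\<phi>\<close> have equal degree, so they differ by inertia of
    \<open>H\<close>.\<close>
  have 2: "con s M' cb = con (\<phi> [^] e) M' cb"
  proof -
    define g where "g = s \<otimes> inv (\<phi> [^] e)"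
    have "d g = \<one>\<^bsub>W\<^esub>" "g \<in> H" using s sH \<phi>(2) \<phi>e c[OF sH] c[OF \<phi>(1)] V(1) e(3)
      by (simp_all add: g_def d.hom_nat_pow W.nat_pow_pow)
    then have "g \<in> M'" using unrH by (auto simp: mem_inertia[OF V(1)])
    moreover have "s = g \<otimes> \<phi> [^] e" using c[OF sH] c[OF \<phi>(1)] by (simp add: g_def word_simps)
    ultimately show ?thesis
      using act_act[OF spM' \<phi>e \<open>g \<in> H\<close> cc'(2)] triv acl2[OF \<phi>e cc'(2)] by simp
  qed
  \<comment> \<open>The twisted power of length \<open>e\<close> turns a quotient under the
    \<open>e\<close>-th power of \<open>\<phi>\<close> into a quotient under \<open>\<phi>\<close>.
    Thus \<open>cu\<close> and \<open>F\<close> have the same \<open>\<phi>\<close>-quotient, and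
    \<open>t\<close> is invariant.\<close>
  define F where "F = Phi \<phi> M' cb e"
  have F: "F \<in> cc M'" "con \<phi> M' F \<cdot>\<^bsub>M'\<^esub> cb = F \<cdot>\<^bsub>M'\<^esub> con (\<phi> [^] e) M' cb"
    using Phi_closed[OF spM' \<phi>(1) cc'(2)] Phi_shift[OF spM' \<phi>(1) cc'(2)] by (simp_all add: F_def)
  interpret a\<phi>: group_hom "mobj C M'" "mobj C M'" "con \<phi> M'" by (rule act_ghom[OF spM' \<phi>(1)])
  define t where "t = cu \<cdot>\<^bsub>M'\<^esub> invC M' F"
  have t: "t \<in> cc M'" using cc' F by (simp add: t_def)
  have cl: "con \<phi> M' cu \<in> cc M'" "con \<phi> M' F \<in> cc M'" "con (\<phi> [^] e) M' cb \<in> cc M'"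
    using acl2 \<phi> \<phi>e cc' F by auto
  have "con \<phi> M' t = t"
  proof -
    have "(con \<phi> M' cu \<cdot>\<^bsub>M'\<^esub> F) \<cdot>\<^bsub>M'\<^esub> (cb \<cdot>\<^bsub>M'\<^esub> con (\<phi> [^] e) M' cb)
        = (con \<phi> M' cu \<cdot>\<^bsub>M'\<^esub> cb) \<cdot>\<^bsub>M'\<^esub> (F \<cdot>\<^bsub>M'\<^esub> con (\<phi> [^] e) M' cb)"
      using cl cc' F(1) by (simp add: CM'.m_ac)
    also have "\<dots> = (cu \<cdot>\<^bsub>M'\<^esub> con (\<phi> [^] e) M' cb) \<cdot>\<^bsub>M'\<^esub> (con \<phi> M' F \<cdot>\<^bsub>M'\<^esub> cb)"
      using 1 2 F(2) by simp
    also have "\<dots> = (cu \<cdot>\<^bsub>M'\<^esub> con \<phi> M' F) \<cdot>\<^bsub>M'\<^esub> (cb \<cdot>\<^bsub>M'\<^esub> con (\<phi> [^] e) M' cb)"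
      using cl cc' F(1) by (simp add: CM'.m_ac)
    finally have "con \<phi> M' cu \<cdot>\<^bsub>M'\<^esub> F = cu \<cdot>\<^bsub>M'\<^esub> con \<phi> M' F" using cl cc' F(1) by simp
    then show ?thesis using cl cc' F(1) by (simp add: t_def CM'.cross_mult)
  qed
  then obtain t0 where t0: "t0 \<in> cc H" "res M' H t0 = t"
    using frob_fixed_descent[OF spM' unrH \<phi> t] by blast
  have cu_eq: "cu = t \<cdot>\<^bsub>M'\<^esub> F" using cc' F(1) by (simp add: t_def CM'.m_assoc)
  have n1: "ind M M' t = res M H (powC H t0 m)"
  proof -
    interpret r: group_hom "mobj C H" "mobj C M" "res M H" by (rule res_ghom[OF V(1) Mf(2,3)])
    have "ind M M' t = ind M M' (res M' M (res M H t0))"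
      using M.mres_trans[OF V(1) Mf(2) M'f(2) M'M Mf(3) t0(1)] t0 by simp
    also have "\<dots> = powC M (res M H t0) m"
      using M.mind_mres[OF Mf(2) M'f(2) M'M] t0 indexM by simp
    finally show ?thesis using t0 by (simp add: r.hom_nat_pow)
  qed
  have n2: "ind M M' F = res M H (ind H V' w)"
  proof -
    have "ind M M' F = Phi \<phi> M (ind M M' cb) e" unfolding F_def
      by (rule Phi_ind[OF spM' \<phi>(1) cc'(2) spM M'M])
    also have "ind M M' cb = ind M V' w"
      unfolding cb_def by (rule M.mind_trans[OF Mf(2) M'f(2) V'f(2) V'M' M'M w(1)])
    finally have 3: "ind M M' F = Phi \<phi> M (ind M V' w) e" .
    have wM: "ind M V' w \<in> cc M" using Mf V'f V'M' M'M w by simp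
    \<comment> \<open>The case where \<open>L\<close> and \<open>V\<close> are both
      \<open>M\<close>, with \<open>k = e\<close>: a twisted power of this length is a restricted
      norm.\<close>
    have "res M H (ind H M (ind M V' w)) = Phi \<phi> M (ind M M (res M M (ind M V' w))) e"
      by (rule res_ind_frob[OF spM Mf(2) _ Mf(3) _ _ \<phi>]) (use M fM e wM in auto)
    also have "\<dots> = ind M M' F" using 3 wM M.mind_refl[OF Mf(2) wM] M.mres_refl[OF Mf(2) wM] by simp
    also have "ind H M (ind M V' w) = ind H V' w"
      by (rule M.mind_trans[OF V(1) Mf(2) V'f(2) _ Mf(3) w(1)]) (use V'M' M'M in auto)
    finally show ?thesis by simp
  qed
  have y': "powC H t0 m \<cdot>\<^bsub>H\<^esub> ind H V' w \<in> cc H" using t0 w V V'f by simp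
  have "res M H y = ind M V' u'"
    using y lifts M.mind_trans[OF Mf(2) V(2) V'f(2) V'V VM lifts(1)] by simp
  also have "\<dots> = ind M M' cu" unfolding cu_def
    by (rule M.mind_trans[OF Mf(2) M'f(2) V'f(2) V'M' M'M lifts(1), symmetric])
  also have "\<dots> = res M H (powC H t0 m) \<cdot>\<^bsub>M\<^esub> res M H (ind H V' w)"
    unfolding cu_eq using t F(1) n1 n2 by simp
  also have "\<dots> = res M H (powC H t0 m \<cdot>\<^bsub>H\<^esub> ind H V' w)"
    using res_mult[OF V(1) Mf(2,3)] t0 w V V'f by simp
  finally have "y = powC H t0 m \<cdot>\<^bsub>H\<^esub> ind H V' w"
    using inj_onD[OF res_inj[OF spM unrHM]] y(1) y' by blast
  moreover have "powC H t0 m \<in> Nm H U" unfolding m_def by (rule pow_index_Nm[OF V(1) VU(1,3) t0(1)])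
  moreover have "ind H V' w \<in> Nm H U"
    using Nm_trans[OF V(1) VU(1) V'f(2) _ VU(3)] V'V VU(2) w by (auto simp: norm_group_def)
  ultimately show ?thesis using Nm_mult[OF V(1) VU(1,3)] by simp
qed

text \<open>\<open>frep H U h y\<close>: the value of the Fesenko--Neukirch recipe at the Frobenius lift \<open>h\<close> for one choice of
  prime element is \<open>y\<close>.\<close>

definition frep :: "'g set \<Rightarrow> 'g set \<Rightarrow> 'g \<Rightarrow> 'c \<Rightarrow> bool" where
  "frep H U h y \<longleftrightarrow> h \<in> H \<and> (\<exists>n>0. d h = \<omega> [^]\<^bsub>W\<^esub> (f H * n) \<and>
     (\<exists>\<pi>\<in>cc (\<Sigma> U h). v (\<Sigma> U h) \<pi> = \<omega> \<and> y = powC H (ind H (\<Sigma> U h) \<pi>) (prime_to_part P n)))"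

lemma frep_ex:
  assumes "sp H U" "h \<in> H" "n > 0" "d h = \<omega> [^]\<^bsub>W\<^esub> (f H * n)" shows "\<exists>y. frep H U h y"
  using prime_ex[OF opn_\<Sigma>[OF assms]] assms unfolding frep_def by blast

lemma frep_closed: assumes "sp H U" "frep H U h y" shows "y \<in> cc H"
  using assms \<Sigma>_properties[OF assms(1)] spD[OF assms(1)] by (auto simp: frep_def)

text \<open>If \<open>h\<close> lies in \<open>U\<close>, so does the whole subgroup attached to it,
  and the norm in the recipe factors through \<open>U\<close>.\<close>

lemma frep_Nm:
  assumes sp: "sp H U" and "frep H U h y" "h \<in> U" shows "y \<in> Nm H U"
proof -
  note U = spD[OF sp]
  obtain n \<pi> where n: "h \<in> H" "n > 0" "d h = \<omega> [^]\<^bsub>W\<^esub> (f H * n)" "\<pi> \<in> cc (\<Sigma> U h)"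
      "y = powC H (ind H (\<Sigma> U h) \<pi>) (prime_to_part P n)" using assms by (auto simp: frep_def)
  note S = \<Sigma>_properties[OF sp n(1-3)]
  have "\<Sigma> U h \<subseteq> U"
    using cl_subset_opn[OF U(2) assms(3)] inertia_subset[of U] opn_closed(2)[OF U(2)] by (force simp: mem_\<Sigma>)
  then have "ind H (\<Sigma> U h) \<pi> \<in> Nm H U"
    using Nm_trans[OF U(1,2) S(1) _ U(3)] n by (auto simp: norm_group_def)
  then show ?thesis
    using n(5) group.subgroup_int_pow_closed[OF gr[OF U(1)] Nm_subgroup[OF U(1-3)], of _ "int (prime_to_part P n)"]
    by (simp add: int_pow_int)
qed

text \<open>Mackey produces \<open>ix n\<close> conjugates. A Frobenius element of \<open>L\<close>
  fixes the restricted prime and agrees with the \<open>ix n\<close>-th power of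
  \<open>\<phi>\<close> up to \<open>M\<close>, so the twisted power is periodic, and the exponent
  P'(n) extends it to length \<open>n\<close>.\<close>

lemma res_frep:
  assumes sp: "sp H V" and L: "opn L" "V \<subseteq> L" "L \<subseteq> H" "\<I> L = \<I> V"
    and n: "n > 0" "f L = f H * ix n"
    and \<phi>: "\<phi> \<in> H" "d \<phi> = \<omega> [^]\<^bsub>W\<^esub> f H" and M: "M = pre H (f V)" and \<pi>: "\<pi> \<in> cc L"
  shows "res M H (powC H (ind H L \<pi>) (prime_to_part P n)) = Phi \<phi> M (ind M V (res V L \<pi>)) n"
proof -
  note V = spD[OF sp]
  note c = opn_carrier[OF V(1)]
  have spM: "sp H M" unfolding M by (rule sp_pre[OF sp_refl[OF V(1)] f_pos[OF V(2)]])
  note Mf = spD[OF spM]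
  have VM: "V \<subseteq> M" using d_mem[OF V(2)] V(3) by (auto simp: M pre_def)
  have LM: "L \<inter> M = V"
  proof (rule degree_inertia_eq[symmetric])
    show "d ` (L \<inter> M) \<subseteq> d ` V" using d_image[OF V(2)] by (auto simp: M pre_def)
    show "\<I> (L \<inter> M) \<subseteq> V" using inertia_mono[of "L \<inter> M" L] L inertia_subset[of V] by auto
  qed (use V L Mf VM opn_Int in auto)
  define k where "k = ix n"
  have k: "k > 0" "ix k = k" "f L = f H * k" using ix_properties[OF n(1)] n by (auto simp: k_def)
  define b where "b = ind M V (res V L \<pi>)"
  have r: "res V L \<pi> \<in> cc V" using L V \<pi> by simp
  have b: "b \<in> cc M" using r V Mf VM by (simp add: b_def)
  have \<phi>k: "\<phi> [^] k \<in> H" using \<phi> V by simp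
  have per: "con (\<phi> [^] k) M b = b"
  proof -
    obtain s where s: "s \<in> L" "d s = \<omega> [^]\<^bsub>W\<^esub> (f H * k)" using frob_ex[OF L(1)] k by auto
    have sH: "s \<in> H" using s L by auto
    have "con s V (res V L \<pi>) = res V L \<pi>" by (rule act_res_fixed[OF sp L(1-3) s(1) \<pi>])
    then have 1: "con s M b = b" using act_ind[OF sp spM VM sH r] by (simp add: b_def)
    define g where "g = \<phi> [^] k \<otimes> inv s"
    have "d g = \<one>\<^bsub>W\<^esub>" "g \<in> H" using s sH \<phi>(2) \<phi>k c[OF sH] c[OF \<phi>(1)] V(1)
      by (simp_all add: g_def d.hom_nat_pow W.nat_pow_pow)
    then have g: "g \<in> M" "g \<in> H" using subgroup.one_closed[OF Dg_subgroup] by (simp_all add: M pre_def)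
    have "\<phi> [^] k = g \<otimes> s" using c[OF sH] c[OF \<phi>(1)] by (simp add: g_def word_simps)
    then show ?thesis using act_act[OF spM sH g(2) b] 1 M.mcon_refl[OF Mf(2) g(1) b] by simp
  qed
  interpret r: group_hom "mobj C H" "mobj C M" "res M H" by (rule res_ghom[OF V(1) Mf(2,3)])
  have "res M H (powC H (ind H L \<pi>) (prime_to_part P n)) = powC M (Phi \<phi> M b k) (prime_to_part P n)"
    using res_ind_frob[OF sp L(1-3) M LM \<phi> k \<pi>] L V \<pi> by (simp add: r.hom_nat_pow b_def)
  also have "\<dots> = Phi \<phi> M b (k * prime_to_part P n)" using Phi_period[OF spM \<phi>(1) b per] by simp
  also have "k * prime_to_part P n = n" using ix_times_prime_to_part[OF n(1)] by (simp add: k_def)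
  finally show ?thesis by (simp add: b_def)
qed

text \<open>Replacing \<open>h2\<close> by its conjugate \<open>h4\<close> under \<open>\<phi>\<close> to the \<open>n1\<close> does not change \<open>y2\<close>, and makes the inertia
  elements \<open>\<tau>i\<close> measuring the deviation of the lifts from powers of \<open>\<phi>\<close> satisfy \<open>\<tau>3 = \<tau>4\<tau>1\<close>.\<close>

lemma frep_mult:
  assumes sp: "sp H U" and r1: "frep H U h1 y1" and r2: "frep H U h2 y2" and r3: "frep H U (h1 \<otimes> h2) y3"
  shows "y1 \<cdot>\<^bsub>H\<^esub> y2 \<cdot>\<^bsub>H\<^esub> invC H y3 \<in> Nm H U"
proof -
  note U = spD[OF sp]
  note c = opn_carrier[OF U(1)]
  define h3 where "h3 = h1 \<otimes> h2"
  obtain n1 \<pi>1 where 1: "h1 \<in> H" "n1 > 0" "d h1 = \<omega> [^]\<^bsub>W\<^esub> (f H * n1)" "\<pi>1 \<in> cc (\<Sigma> U h1)" "v (\<Sigma> U h1) \<pi>1 = \<omega>"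
      "y1 = powC H (ind H (\<Sigma> U h1) \<pi>1) (prime_to_part P n1)" using r1 by (auto simp: frep_def)
  obtain n2 \<pi>2 where 2: "h2 \<in> H" "n2 > 0" "d h2 = \<omega> [^]\<^bsub>W\<^esub> (f H * n2)" "\<pi>2 \<in> cc (\<Sigma> U h2)" "v (\<Sigma> U h2) \<pi>2 = \<omega>"
      "y2 = powC H (ind H (\<Sigma> U h2) \<pi>2) (prime_to_part P n2)" using r2 by (auto simp: frep_def)
  obtain n3 \<pi>3 where 3: "h3 \<in> H" "n3 > 0" "d h3 = \<omega> [^]\<^bsub>W\<^esub> (f H * n3)" "\<pi>3 \<in> cc (\<Sigma> U h3)" "v (\<Sigma> U h3) \<pi>3 = \<omega>"
      "y3 = powC H (ind H (\<Sigma> U h3) \<pi>3) (prime_to_part P n3)" using r3 by (auto simp: frep_def h3_def)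
  have fpos: "f H > 0" by (rule f_pos[OF U(1)])
  have "d h3 = \<omega> [^]\<^bsub>W\<^esub> (f H * (n1 + n2))"
    using 1(1,3) 2(1,3) c by (simp add: h3_def W.nat_pow_mult distrib_left)
  then have n3: "n3 = n1 + n2" using 3(3) fpos \<omega>_pow_inj by (metis mult_left_cancel nat_neq_iff)
  obtain \<phi> where \<phi>: "\<phi> \<in> H" "d \<phi> = \<omega> [^]\<^bsub>W\<^esub> f H" using frob_ex[OF U(1)] by blast
  define g where "g = \<phi> [^] n1"
  have g: "g \<in> H" "g \<in> carrier G" "d g = \<omega> [^]\<^bsub>W\<^esub> (f H * n1)"
    using \<phi> U c by (simp_all add: g_def d.hom_nat_pow W.nat_pow_pow)
  have hc: "h1 \<in> carrier G" "h2 \<in> carrier G" "\<phi> \<in> carrier G" using 1 2 \<phi> c by auto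
  define h4 where "h4 = g \<otimes> h2 \<otimes> inv g"
  have h4: "h4 \<in> H" "d h4 = \<omega> [^]\<^bsub>W\<^esub> (f H * n2)" "h4 \<in> carrier G" using 2 g hc U by (simp_all add: h4_def)
  note S1 = \<Sigma>_properties[OF sp 1(1-3)] and S2 = \<Sigma>_properties[OF sp 2(1-3)] and S3 = \<Sigma>_properties[OF sp 3(1-3)]
    and S4 = \<Sigma>_properties[OF sp h4(1) 2(2) h4(2)]
  have \<Sigma>4: "\<Sigma> U h4 = conj_set G g (\<Sigma> U h2)"
    using \<Sigma>_conj[OF sp 2(1-3) g(2)] sp_conj_set[OF sp g(1)] by (simp add: h4_def)
  define \<pi>4 where "\<pi>4 = con g (\<Sigma> U h2) \<pi>2"
  have \<pi>4: "\<pi>4 \<in> cc (\<Sigma> U h4)" "v (\<Sigma> U h4) \<pi>4 = \<omega>"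
    using con_closed[OF S2(1) g(2) 2(4)] v_con[OF S2(1) g(2) 2(4)] 2(5) by (simp_all add: \<Sigma>4 \<pi>4_def)
  have "ind H (\<Sigma> U h4) \<pi>4 = con g H (ind H (\<Sigma> U h2) \<pi>2)"
    using M.mcon_mind[OF U(1) S2(1,2) g(2) 2(4)] opn_conj_set_self[OF U(1) g(1)] by (simp add: \<Sigma>4 \<pi>4_def)
  also have "\<dots> = ind H (\<Sigma> U h2) \<pi>2" by (rule M.mcon_refl[OF U(1) g(1)]) (use U S2 2 in simp)
  finally have y2: "y2 = powC H (ind H (\<Sigma> U h4) \<pi>4) (prime_to_part P n2)" using 2(6) by simp
  \<comment> \<open>A common level below the three attached subgroups, normal in \<open>H\<close>
    and with the inertia of \<open>U\<close>; all three primes remain prime there.\<close>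
  obtain Vn where spV: "sp H Vn" and VU: "Vn \<subseteq> U" and VL: "\<And>L. L \<in> {\<Sigma> U h1, \<Sigma> U h4, \<Sigma> U h3} \<Longrightarrow> Vn \<subseteq> L"
    and IV: "\<I> Vn = \<I> U"
  proof (rule normal_in_all[OF sp, of "{\<Sigma> U h1, \<Sigma> U h4, \<Sigma> U h3}"])
    fix L assume "L \<in> {\<Sigma> U h1, \<Sigma> U h4, \<Sigma> U h3}"
    then show "opn L \<and> \<I> U \<subseteq> L" using S1(1,4) S3(1,4) S4(1,4) inertia_subset by (metis insertE singletonD)
  qed auto
  note V = spD[OF spV]
  define Mx where "Mx = pre H (f Vn)"
  have spM: "sp H Mx" unfolding Mx_def by (rule sp_pre[OF sp_refl[OF U(1)] f_pos[OF V(2)]])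
  note Mf = spD[OF spM]
  have VM: "Vn \<subseteq> Mx" using d_mem[OF V(2)] V(3) by (auto simp: Mx_def pre_def)
  define p1 where "p1 = res Vn (\<Sigma> U h1) \<pi>1"
  define p4 where "p4 = res Vn (\<Sigma> U h4) \<pi>4"
  define p3 where "p3 = res Vn (\<Sigma> U h3) \<pi>3"
  have p: "p1 \<in> cc Vn" "p3 \<in> cc Vn" "p4 \<in> cc Vn"
    using 1(4) 3(4) \<pi>4(1) S1 S3 S4 V VL by (auto simp: p1_def p3_def p4_def)
  have vp: "v Vn p1 = \<omega>" "v Vn p3 = \<omega>" "v Vn p4 = \<omega>"
    unfolding p1_def p3_def p4_def
    using v_res[OF S1(1) V(2) _ 1(4)] v_res[OF S3(1) V(2) _ 3(4)] v_res[OF S4(1) V(2) _ \<pi>4(1)]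
      1(5) 3(5) \<pi>4(2) VL IV S1(4) S3(4) S4(4) by auto
  have fx: "con h1 Vn p1 = p1" "con h3 Vn p3 = p3" "con h4 Vn p4 = p4"
    unfolding p1_def p3_def p4_def
    using act_res_fixed[OF spV S1(1) _ S1(2,3) 1(4)] act_res_fixed[OF spV S3(1) _ S3(2,3) 3(4)]
      act_res_fixed[OF spV S4(1) _ S4(2,3) \<pi>4(1)] VL by auto
  interpret CV: comm_group "mobj C Vn" by (rule cg[OF V(2)])
  interpret CM: comm_group "mobj C Mx" by (rule cg[OF Mf(2)])
  interpret vV: group_hom "mobj C Vn" W "v Vn" by (rule v_ghom[OF V(2)])
  define A where "A = Phi \<phi> Vn p1 n1"
  define B where "B = Phi \<phi> Vn p4 n2"
  define D where "D = Phi \<phi> Vn p3 n3"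
  have ABD: "A \<in> cc Vn" "B \<in> cc Vn" "D \<in> cc Vn" using Phi_closed[OF spV \<phi>(1)] p by (auto simp: A_def B_def D_def)
  \<comment> \<open>A unit because the degrees of the lifts add up:
    \<open>n3 = n1 + n2\<close>.\<close>
  define u where "u = A \<cdot>\<^bsub>Vn\<^esub> B \<cdot>\<^bsub>Vn\<^esub> invC Vn D"
  have u: "u \<in> cc Vn" "v Vn u = \<one>\<^bsub>W\<^esub>"
    using ABD p vp v_Phi[OF spV \<phi>(1)] by (simp_all add: u_def A_def B_def D_def n3 W.nat_pow_mult)
  have inertI: "\<tau> \<in> \<I> H" if "\<tau> \<in> H" "d \<tau> = \<one>\<^bsub>W\<^esub>" for \<tau> using that mem_inertia[OF U(1)] by simp
  have \<phi>p: "\<phi> [^] n \<in> H" "d (\<phi> [^] n) = \<omega> [^]\<^bsub>W\<^esub> (f H * n)" for n :: nat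
    using \<phi> U hc by (simp_all add: d.hom_nat_pow W.nat_pow_pow)
  define \<tau>1 where "\<tau>1 = \<phi> [^] n1 \<otimes> inv h1"
  define \<tau>4 where "\<tau>4 = \<phi> [^] n2 \<otimes> inv h4"
  define \<tau>3 where "\<tau>3 = \<phi> [^] n3 \<otimes> inv h3"
  have \<tau>H: "\<tau>1 \<in> H" "\<tau>4 \<in> H" "\<tau>3 \<in> H" using \<phi>p 1(1) 3(1) h4(1) U(1) by (simp_all add: \<tau>1_def \<tau>4_def \<tau>3_def)
  have d1: "d \<tau>1 = \<one>\<^bsub>W\<^esub>" using \<phi>p(2)[of n1] 1(3) hc by (simp add: \<tau>1_def)
  have d4: "d \<tau>4 = \<one>\<^bsub>W\<^esub>" using \<phi>p(2)[of n2] h4 hc by (simp add: \<tau>4_def)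
  have d3: "d \<tau>3 = \<one>\<^bsub>W\<^esub>" using \<phi>p(2)[of n3] 3(3) c[OF 3(1)] hc by (simp add: \<tau>3_def)
  have \<tau>I: "\<tau>4 \<in> \<I> H" "\<tau>3 \<in> \<I> H" using inertI \<tau>H d4 d3 by auto
  have \<tau>34: "\<tau>3 = \<tau>4 \<otimes> \<tau>1"
  proof -
    have "\<phi> [^] n3 = \<phi> [^] n2 \<otimes> \<phi> [^] n1" using hc by (simp add: nat_pow_mult n3 add.commute)
    then show ?thesis unfolding \<tau>3_def \<tau>4_def \<tau>1_def h3_def h4_def using hc by (simp add: g_def word_simps)
  qed
  have e1: "\<phi> [^] n1 = \<tau>1 \<otimes> h1" "\<phi> [^] n2 = \<tau>4 \<otimes> h4" "\<phi> [^] n3 = \<tau>3 \<otimes> h3"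
    using hc h4(3) c[OF 3(1)] by (simp_all add: \<tau>1_def \<tau>4_def \<tau>3_def word_simps)
  have c\<phi>: "con (\<phi> [^] n1) Vn p1 = con \<tau>1 Vn p1" "con (\<phi> [^] n2) Vn p4 = con \<tau>4 Vn p4"
    "con (\<phi> [^] n3) Vn p3 = con \<tau>3 Vn p3"
    using act_act[OF spV 1(1) \<tau>H(1) p(1)] act_act[OF spV h4(1) \<tau>H(2) p(3)] act_act[OF spV 3(1) \<tau>H(3) p(2)] fx
    unfolding e1 by simp_all
  \<comment> \<open>The other two primes are compared with \<open>p1\<close>, so that only unit
    quotients enter the relation passed to \<open>norm_of_frobenius_unit\<close>.\<close>
  define e3 where "e3 = p3 \<cdot>\<^bsub>Vn\<^esub> invC Vn p1"
  define e4 where "e4 = p4 \<cdot>\<^bsub>Vn\<^esub> invC Vn p1"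
  have e: "e3 \<in> cc Vn" "e4 \<in> cc Vn" "v Vn e3 = \<one>\<^bsub>W\<^esub>" "v Vn e4 = \<one>\<^bsub>W\<^esub>"
    "p3 = e3 \<cdot>\<^bsub>Vn\<^esub> p1" "p4 = e4 \<cdot>\<^bsub>Vn\<^esub> p1"
    using p vp by (simp_all add: e3_def e4_def CV.m_assoc)
  have acl: "con h Vn x \<in> cc Vn" if "h \<in> H" "x \<in> cc Vn" for h x using act_closed[OF spV] that by blast
  define t1 where "t1 = con \<tau>1 Vn p1"
  have t1: "t1 \<in> cc Vn" "v Vn t1 = \<omega>" using acl \<tau>H p vp v_act[OF spV] by (auto simp: t1_def)
  \<comment> \<open>Again a unit: \<open>t1\<close> is a conjugate of the prime \<open>p1\<close>
    and has the same valuation.\<close>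
  define a where "a = e4 \<cdot>\<^bsub>Vn\<^esub> p1 \<cdot>\<^bsub>Vn\<^esub> invC Vn t1"
  have a: "a \<in> cc Vn" "v Vn a = \<one>\<^bsub>W\<^esub>" using e p t1 vp by (simp_all add: a_def)
  define b where "b = invC Vn e3"
  have b: "b \<in> cc Vn" "v Vn b = \<one>\<^bsub>W\<^esub>" using e by (simp_all add: b_def)
  interpret a\<phi>: group_hom "mobj C Vn" "mobj C Vn" "con \<phi> Vn" by (rule act_ghom[OF spV \<phi>(1)])
  interpret a4: group_hom "mobj C Vn" "mobj C Vn" "con \<tau>4 Vn" by (rule act_ghom[OF spV \<tau>H(2)])
  interpret a3: group_hom "mobj C Vn" "mobj C Vn" "con \<tau>3 Vn" by (rule act_ghom[OF spV \<tau>H(3)])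
  have "con \<phi> Vn u \<cdot>\<^bsub>Vn\<^esub> (a \<cdot>\<^bsub>Vn\<^esub> b) = u \<cdot>\<^bsub>Vn\<^esub> (con \<tau>4 Vn a \<cdot>\<^bsub>Vn\<^esub> con \<tau>3 Vn b)"
  proof -
    have A1: "con \<phi> Vn A \<cdot>\<^bsub>Vn\<^esub> p1 = A \<cdot>\<^bsub>Vn\<^esub> t1"
      using Phi_shift[OF spV \<phi>(1) p(1), of n1] c\<phi> by (simp add: A_def t1_def)
    have B1: "con \<phi> Vn B \<cdot>\<^bsub>Vn\<^esub> (e4 \<cdot>\<^bsub>Vn\<^esub> p1) = B \<cdot>\<^bsub>Vn\<^esub> (con \<tau>4 Vn e4 \<cdot>\<^bsub>Vn\<^esub> con \<tau>4 Vn p1)"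
      using Phi_shift[OF spV \<phi>(1) p(3), of n2] c\<phi> e p by (simp add: B_def)
    have D1: "con \<phi> Vn D \<cdot>\<^bsub>Vn\<^esub> (e3 \<cdot>\<^bsub>Vn\<^esub> p1) = D \<cdot>\<^bsub>Vn\<^esub> (con \<tau>3 Vn e3 \<cdot>\<^bsub>Vn\<^esub> con \<tau>3 Vn p1)"
      using Phi_shift[OF spV \<phi>(1) p(2), of n3] c\<phi> e p by (simp add: D_def)
    \<comment> \<open>This is where the factorization of \<open>\<tau>3\<close> is used: the image
      of \<open>t1\<close> under \<open>\<tau>4\<close> is the twist of \<open>p1\<close> occurring
      in the relation for \<open>h3\<close>.\<close>
    have t3: "con \<tau>4 Vn t1 = con \<tau>3 Vn p1" unfolding \<tau>34 t1_def by (rule act_act[OF spV \<tau>H(1,2) p(1)])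
    have l: "con \<phi> Vn u = con \<phi> Vn A \<cdot>\<^bsub>Vn\<^esub> con \<phi> Vn B \<cdot>\<^bsub>Vn\<^esub> invC Vn (con \<phi> Vn D)"
      using ABD by (simp add: u_def)
    have r: "con \<tau>4 Vn a = con \<tau>4 Vn e4 \<cdot>\<^bsub>Vn\<^esub> con \<tau>4 Vn p1 \<cdot>\<^bsub>Vn\<^esub> invC Vn (con \<tau>3 Vn p1)"
      "con \<tau>3 Vn b = invC Vn (con \<tau>3 Vn e3)"
      using e p t1 t3 by (simp_all add: a_def b_def)
    show ?thesis unfolding l r unfolding u_def a_def b_def
      by (rule CV.frobenius_cross[OF _ _ _ _ _ _ _ _ _ _ _ _ _ _ A1 B1 D1])
        (use ABD p e t1 acl \<phi> \<tau>H in auto)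
  qed
  moreover have "res Mx H (y1 \<cdot>\<^bsub>H\<^esub> y2 \<cdot>\<^bsub>H\<^esub> invC H y3) = ind Mx Vn u"
  proof -
    interpret r: group_hom "mobj C H" "mobj C Mx" "res Mx H" by (rule res_ghom[OF U(1) Mf(2,3)])
    interpret i: group_hom "mobj C Vn" "mobj C Mx" "ind Mx Vn" by (rule ind_ghom[OF Mf(2) V(2) VM])
    have q1: "res Mx H y1 = ind Mx Vn A" unfolding 1(6) A_def
      using res_frep[OF spV S1(1) _ S1(2) _ 1(2) S1(6) \<phi> Mx_def 1(4)] VL IV S1(4) p
        Phi_ind[OF spV \<phi>(1) p(1) spM VM, of n1] by (simp add: p1_def)
    have q2: "res Mx H y2 = ind Mx Vn B" unfolding y2 B_def
      using res_frep[OF spV S4(1) _ S4(2) _ 2(2) S4(6) \<phi> Mx_def \<pi>4(1)] VL IV S4(4) p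
        Phi_ind[OF spV \<phi>(1) p(3) spM VM, of n2] by (simp add: p4_def)
    have q3: "res Mx H y3 = ind Mx Vn D" unfolding 3(6) D_def
      using res_frep[OF spV S3(1) _ S3(2) _ 3(2) S3(6) \<phi> Mx_def 3(4)] VL IV S3(4) p
        Phi_ind[OF spV \<phi>(1) p(2) spM VM, of n3] by (simp add: p3_def)
    have "y1 \<in> cc H" "y2 \<in> cc H" "y3 \<in> cc H"
      using frep_closed[OF sp] r1 r2 r3 by auto
    then show ?thesis using q1 q2 q3 ABD by (simp add: u_def)
  qed
  ultimately show ?thesis
    using norm_of_frobenius_unit[OF spV U(2) VU U(3) \<phi> u a b \<tau>I _ Mx_def] frep_closed[OF sp] r1 r2 r3 U(1)
    by simp
qed

text \<open>\<open>rec H U h y\<close>: the class of \<open>y\<close> modulo \<open>Nm H U\<close> is the image of the coset of \<open>h\<close>. Keeping this as a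
  relation between elements avoids quotients and choices until bijectivity has been settled.\<close>

definition rec :: "'g set \<Rightarrow> 'g set \<Rightarrow> 'g \<Rightarrow> 'c \<Rightarrow> bool" where
  "rec H U h y \<longleftrightarrow> h \<in> H \<and> (\<exists>u\<in>U. \<exists>z. frep H U (h \<otimes> u) z \<and> (\<exists>\<nu>\<in>Nm H U. y = z \<cdot>\<^bsub>H\<^esub> \<nu>))"

context
  fixes H U assumes sp: "sp H U"
begin

lemma rec_mem: "rec H U h y \<Longrightarrow> h \<in> H" by (simp add: rec_def)

lemma rec_closed: "rec H U h y \<Longrightarrow> y \<in> cc H"
  using frep_closed[OF sp] Nm_carrier[OF spD(1-3)[OF sp]] spD[OF sp] by (auto simp: rec_def)

lemma frep_rec: "frep H U h y \<Longrightarrow> rec H U h y"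
proof -
  assume r: "frep H U h y"
  interpret H: comm_group "mobj C H" by (rule cg[OF spD(1)[OF sp]])
  have h: "h \<in> H" "h \<in> carrier G" using r opn_carrier[OF spD(1)[OF sp]] by (auto simp: frep_def)
  then show ?thesis unfolding rec_def
    using r frep_closed[OF sp r] opn_closed(1)[OF spD(2)[OF sp]] subgroup.one_closed[OF Nm_subgroup[OF spD(1-3)[OF sp]]]
    by (intro conjI bexI[of _ \<one>] exI[of _ y] bexI[of _ "\<one>\<^sub>C H"]) auto
qed

lemma rec_ex: assumes "h \<in> H" shows "\<exists>y. rec H U h y"
proof -
  note U = spD[OF sp]
  obtain u n where u: "u \<in> U" "n > 0" "d (h \<otimes> u) = \<omega> [^]\<^bsub>W\<^esub> (f H * n)" using frob_lift[OF U(1-3) assms] by blast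
  have "h \<otimes> u \<in> H" using u assms U by auto
  then obtain z where z: "frep H U (h \<otimes> u) z" using frep_ex[OF sp] u by blast
  interpret H: comm_group "mobj C H" by (rule cg[OF U(1)])
  show ?thesis unfolding rec_def
    using assms u(1) z subgroup.one_closed[OF Nm_subgroup[OF U(1-3)]] by blast
qed

lemma rec_Nm: assumes "rec H U h y" "h \<in> U" shows "y \<in> Nm H U"
proof -
  note U = spD[OF sp]
  obtain u z \<nu> where "u \<in> U" "frep H U (h \<otimes> u) z" "\<nu> \<in> Nm H U" "y = z \<cdot>\<^bsub>H\<^esub> \<nu>" using assms by (auto simp: rec_def)
  then show ?thesis using frep_Nm[OF sp] assms U Nm_mult[OF U(1-3)] by auto
qed

lemma rec_mult_Nm: assumes "rec H U h y" "\<mu> \<in> Nm H U" shows "rec H U h (y \<cdot>\<^bsub>H\<^esub> \<mu>)"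
proof -
  note U = spD[OF sp]
  interpret H: comm_group "mobj C H" by (rule cg[OF U(1)])
  obtain u z \<nu> where z: "h \<in> H" "u \<in> U" "frep H U (h \<otimes> u) z" "\<nu> \<in> Nm H U" "y = z \<cdot>\<^bsub>H\<^esub> \<nu>" using assms by (auto simp: rec_def)
  have "y \<cdot>\<^bsub>H\<^esub> \<mu> = z \<cdot>\<^bsub>H\<^esub> (\<nu> \<cdot>\<^bsub>H\<^esub> \<mu>)"
    using z frep_closed[OF sp z(3)] Nm_carrier[OF U(1-3)] assms by (simp add: H.m_assoc)
  then show ?thesis using z assms Nm_mult[OF U(1-3)] unfolding rec_def by blast
qed

lemma rec_mult: assumes "rec H U h y" "rec H U h' y'" shows "rec H U (h \<otimes> h') (y \<cdot>\<^bsub>H\<^esub> y')"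
proof -
  note U = spD[OF sp]
  note c = opn_carrier[OF U(1)]
  interpret H: comm_group "mobj C H" by (rule cg[OF U(1)])
  obtain u z \<nu> where z: "h \<in> H" "u \<in> U" "frep H U (h \<otimes> u) z" "\<nu> \<in> Nm H U" "y = z \<cdot>\<^bsub>H\<^esub> \<nu>"
    using assms by (auto simp: rec_def)
  obtain u' z' \<nu>' where z': "h' \<in> H" "u' \<in> U" "frep H U (h' \<otimes> u') z'" "\<nu>' \<in> Nm H U" "y' = z' \<cdot>\<^bsub>H\<^esub> \<nu>'"
    using assms by (auto simp: rec_def)
  obtain n where n: "n > 0" "d (h \<otimes> u) = \<omega> [^]\<^bsub>W\<^esub> (f H * n)" using z(3) by (auto simp: frep_def)
  obtain n' where n': "n' > 0" "d (h' \<otimes> u') = \<omega> [^]\<^bsub>W\<^esub> (f H * n')" using z'(3) by (auto simp: frep_def)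
  have uH: "u \<in> H" "u' \<in> H" using z z' U by auto
  \<comment> \<open>Normality of \<open>U\<close> moves \<open>u\<close> past
    \<open>h'\<close>.\<close>
  define u2 where "u2 = (inv h' \<otimes> u \<otimes> inv (inv h')) \<otimes> u'"
  have u2: "u2 \<in> U" using z z' U(4)[of "inv h'" u] U(1,2) by (simp add: u2_def)
  have eq: "(h \<otimes> u) \<otimes> (h' \<otimes> u') = (h \<otimes> h') \<otimes> u2"
    using z(1) z'(1) uH c by (simp add: u2_def word_simps)
  have cl: "h \<otimes> u \<in> carrier G" "h' \<otimes> u' \<in> carrier G" using z(1) z'(1) uH c by auto
  have "d ((h \<otimes> u) \<otimes> (h' \<otimes> u')) = \<omega> [^]\<^bsub>W\<^esub> (f H * (n + n'))"
    using n n' d.hom_mult[OF cl] by (simp add: W.nat_pow_mult distrib_left)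
  moreover have "(h \<otimes> u) \<otimes> (h' \<otimes> u') \<in> H" using z(1) z'(1) uH U(1) by simp
  ultimately obtain z2 where z2: "frep H U ((h \<otimes> u) \<otimes> (h' \<otimes> u')) z2" using frep_ex[OF sp] n(1) by (metis add_gr_0)
  define \<mu> where "\<mu> = z \<cdot>\<^bsub>H\<^esub> z' \<cdot>\<^bsub>H\<^esub> invC H z2"
  have \<mu>: "\<mu> \<in> Nm H U" unfolding \<mu>_def by (rule frep_mult[OF sp z(3) z'(3) z2])
  have zc: "z \<in> cc H" "z' \<in> cc H" "z2 \<in> cc H" "\<nu> \<in> cc H" "\<nu>' \<in> cc H" "\<mu> \<in> cc H"
    using frep_closed[OF sp] z(3) z'(3) z2 Nm_carrier[OF U(1-3)] z(4) z'(4) \<mu> by auto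
  have "z \<cdot>\<^bsub>H\<^esub> z' = \<mu> \<cdot>\<^bsub>H\<^esub> z2" using zc by (simp add: \<mu>_def H.m_assoc)
  moreover have "y \<cdot>\<^bsub>H\<^esub> y' = (z \<cdot>\<^bsub>H\<^esub> z') \<cdot>\<^bsub>H\<^esub> (\<nu> \<cdot>\<^bsub>H\<^esub> \<nu>')" using zc z z' by (simp add: H.m_ac)
  ultimately have "y \<cdot>\<^bsub>H\<^esub> y' = z2 \<cdot>\<^bsub>H\<^esub> (\<mu> \<cdot>\<^bsub>H\<^esub> (\<nu> \<cdot>\<^bsub>H\<^esub> \<nu>'))" using zc by (simp add: H.m_ac)
  moreover have "\<mu> \<cdot>\<^bsub>H\<^esub> (\<nu> \<cdot>\<^bsub>H\<^esub> \<nu>') \<in> Nm H U" using \<mu> z(4) z'(4) Nm_mult[OF U(1-3)] by simp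
  ultimately show ?thesis unfolding rec_def using z2 u2 eq z(1) z'(1) opn_closed(2)[OF U(1)] by metis
qed

text \<open>For any value \<open>y'\<close> of the inverse, the product of \<open>y\<close> and
  \<open>y'\<close> is a value of the unit, hence a norm, and dividing by it turns \<open>y'\<close>
  into the inverse of \<open>y\<close>.\<close>

lemma rec_inv: assumes "rec H U h y" shows "rec H U (inv h) (invC H y)"
proof -
  note U = spD[OF sp]
  interpret H: comm_group "mobj C H" by (rule cg[OF U(1)])
  have h: "h \<in> H" "h \<in> carrier G" using assms rec_mem opn_carrier[OF U(1)] by auto
  obtain y' where y': "rec H U (inv h) y'" using rec_ex[of "inv h"] h U by auto
  have c: "y \<in> cc H" "y' \<in> cc H" using rec_closed assms y' by auto
  have "y \<cdot>\<^bsub>H\<^esub> y' \<in> Nm H U" using rec_Nm[OF rec_mult[OF assms y']] h U by simp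
  then have "invC H (y \<cdot>\<^bsub>H\<^esub> y') \<in> Nm H U" using subgroup.m_inv_closed[OF Nm_subgroup[OF U(1-3)]] by blast
  then have "rec H U (inv h) (y' \<cdot>\<^bsub>H\<^esub> invC H (y \<cdot>\<^bsub>H\<^esub> y'))" by (rule rec_mult_Nm[OF y'])
  moreover have "y' \<cdot>\<^bsub>H\<^esub> invC H (y \<cdot>\<^bsub>H\<^esub> y') = (y' \<cdot>\<^bsub>H\<^esub> invC H y') \<cdot>\<^bsub>H\<^esub> invC H y"
    using c by (simp add: H.inv_mult H.m_ac H.conj_cancel)
  ultimately show ?thesis using c by simp
qed

lemma rec_unique: assumes "rec H U h y" "rec H U h y'" shows "y \<cdot>\<^bsub>H\<^esub> invC H y' \<in> Nm H U"
proof -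
  note U = spD[OF sp]
  have h: "h \<in> H" "h \<in> carrier G" using assms rec_mem opn_carrier[OF U(1)] by auto
  then show ?thesis using rec_Nm[OF rec_mult[OF assms(1) rec_inv[OF assms(2)]]] U by simp
qed

lemma rec_mult_U: assumes "rec H U h y" "u \<in> U" shows "rec H U (h \<otimes> u) y"
proof -
  note U = spD[OF sp]
  interpret H: comm_group "mobj C H" by (rule cg[OF U(1)])
  obtain \<nu> where \<nu>: "rec H U u \<nu>" using rec_ex[of u] assms U by auto
  have n: "\<nu> \<in> Nm H U" using rec_Nm[OF \<nu> assms(2)] .
  have "rec H U (h \<otimes> u) ((y \<cdot>\<^bsub>H\<^esub> \<nu>) \<cdot>\<^bsub>H\<^esub> invC H \<nu>)"
    by (rule rec_mult_Nm[OF rec_mult[OF assms(1) \<nu>]])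
      (rule subgroup.m_inv_closed[OF Nm_subgroup[OF U(1-3)] n])
  then show ?thesis using rec_closed[OF assms(1)] rec_closed[OF \<nu>] by (simp add: H.m_assoc)
qed

lemma rec_one: "\<nu> \<in> Nm H U \<Longrightarrow> rec H U \<one> \<nu>"
proof -
  assume n: "\<nu> \<in> Nm H U"
  note U = spD[OF sp]
  interpret H: comm_group "mobj C H" by (rule cg[OF U(1)])
  obtain \<mu> where \<mu>: "rec H U \<one> \<mu>" using rec_ex[of \<one>] U by auto
  have "rec H U (\<one> \<otimes> inv \<one>) ((\<mu> \<cdot>\<^bsub>H\<^esub> invC H \<mu>) \<cdot>\<^bsub>H\<^esub> \<nu>)"
    by (rule rec_mult_Nm[OF rec_mult[OF \<mu> rec_inv[OF \<mu>]] n])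
  then show ?thesis using rec_closed[OF \<mu>] Nm_carrier[OF U(1-3) n] by simp
qed

lemma rec_U: assumes "u \<in> U" "\<nu> \<in> Nm H U" shows "rec H U u \<nu>"
proof -
  have "u \<in> carrier G" using assms opn_carrier[OF spD(2)[OF sp]] by blast
  then show ?thesis using rec_mult_U[OF rec_one[OF assms(2)] assms(1)] by simp
qed

end

end

section \<open>Functoriality of the reciprocity relation\<close>

lemma (in comm_group) finprod_pow:
  assumes "finite A" "f \<in> A \<rightarrow> carrier G"
  shows "(finprod G f A) [^] (n::nat) = finprod G (\<lambda>x. f x [^] n) A"
  using assms
proof (induction A rule: finite_induct)
  case (insert a A)
  then have "f a \<in> carrier G" "f \<in> A \<rightarrow> carrier G" by auto
  moreover then have "(\<lambda>x. f x [^] n) \<in> A \<rightarrow> carrier G" by auto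
  ultimately show ?case using insert by (simp add: nat_pow_distrib)
qed simp

context cft
begin

text \<open>Compare the factorizations of \<open>n\<close> and \<open>a * n\<close> into
  \<open>ix\<close> and P', using that \<open>ix\<close> is multiplicative in the P-number
  \<open>a\<close>.\<close>

lemma prime_to_part_mult:
  assumes "ix a = a" "a > 0" "n > 0" shows "prime_to_part P (a * n) = prime_to_part P n"
proof -
  have "a * ix n * prime_to_part P (a * n) = a * (ix n * prime_to_part P n)"
    using ix_times_prime_to_part[of "a * n"] ix_times_prime_to_part[OF assms(3)] ix_mult[of a n] assms by simp
  then show ?thesis using assms(2) ix_pos[OF assms(3)] by simp
qed

lemma Nm_con:
  assumes "opn H" "opn U" "U \<subseteq> H" "g \<in> carrier G" "\<nu> \<in> Nm H U"
  shows "con g H \<nu> \<in> Nm (conj_set G g H) (conj_set G g U)"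
proof -
  obtain x where x: "x \<in> cc U" "\<nu> = ind H U x" using assms by (auto simp: norm_group_def)
  then show ?thesis using M.mcon_mind[OF assms(1-4) x(1)] assms
    by (auto simp: norm_group_def)
qed

lemma Nm_ind:
  assumes "opn H" "opn I" "opn U" "opn V" "I \<subseteq> H" "V \<subseteq> U" "V \<subseteq> I" "U \<subseteq> H" "\<nu> \<in> Nm I V"
  shows "ind H I \<nu> \<in> Nm H U"
proof -
  obtain x where "x \<in> cc V" "\<nu> = ind I V x" using assms by (auto simp: norm_group_def)
  then have "ind H I \<nu> \<in> Nm H V" using M.mind_trans[OF assms(1,2,4,7,5)] by (auto simp: norm_group_def)
  then show ?thesis using Nm_trans[OF assms(1,3,4,6,8)] by blast
qed

text \<open>As \<open>U\<close> is normal in \<open>H\<close> and contained in \<open>I\<close>,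
  every Mackey summand is the norm from \<open>U\<close> to \<open>I\<close> of a conjugate of
  \<open>x\<close>.\<close>

lemma Nm_res:
  assumes sp: "sp H U" and I: "opn I" "U \<subseteq> I" "I \<subseteq> H" and \<nu>: "\<nu> \<in> Nm H U"
  shows "res I H \<nu> \<in> Nm I U"
proof -
  note U = spD[OF sp]
  obtain x where x: "x \<in> cc U" "\<nu> = ind H U x" using \<nu> by (auto simp: norm_group_def)
  obtain R where R: "double_coset_reps G I H U R"
    using double_coset_reps_exist[OF opnD(1)[OF I(1)] opnD(1)[OF U(2)] opnD(1)[OF U(1)] I(3) U(3)] by blast
  interpret CI: comm_group "mobj C I" by (rule cg[OF I(1)])
  have N: "subgroup (Nm I U) (mobj C I)" by (rule Nm_subgroup[OF I(1) U(2) I(2)])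
  \<comment> \<open>For an infinite \<open>S\<close> the product is the unit by convention, which
    lies in the norm group as well.\<close>
  have fp: "finprod (mobj C I) z S \<in> Nm I U" if "\<And>r. r \<in> S \<Longrightarrow> z r \<in> Nm I U" for z and S :: "'g set"
  proof (cases "finite S")
    case True
    then show ?thesis using that
    proof (induction S rule: finite_induct)
      case empty show ?case using subgroup.one_closed[OF N] by simp
    next
      case (insert r S)
      moreover have "z \<in> S \<rightarrow> cc I" "z r \<in> cc I" using insert.prems subgroup.mem_carrier[OF N] by auto
      ultimately show ?case using subgroup.m_closed[OF N] by simp
    qed
  qed (use subgroup.one_closed[OF N] in simp)
  show ?thesis unfolding x(2) M.mackey_formula[OF U(1) I(1) U(2) I(3) U(3) R x(1)]
  proof (rule fp)
    fix r assume "r \<in> R"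
    then have r: "r \<in> H" using R by (auto simp: double_coset_reps_def)
    have 1: "conj_set G r U = U" by (rule sp_conj_set[OF sp r])
    have rc: "r \<in> carrier G" using r opn_carrier[OF U(1)] by blast
    have "U \<subseteq> conj_set G (inv r) I"
      using conj_set_mono[OF I(2), of "inv r"] sp_conj_set[OF sp, of "inv r"] r U(1) by simp
    then have 2: "conj_set G (inv r) I \<inter> U = U" "I \<inter> U = U" using I by auto
    show "ind I (I \<inter> conj_set G r U) (con r (conj_set G (inv r) I \<inter> U) (res (conj_set G (inv r) I \<inter> U) U x)) \<in> Nm I U"
      unfolding 1 2 using x act_closed[OF sp r] M.mres_refl[OF U(2)] by (auto simp: norm_group_def)
  qed
qed

lemma frep_con:
  assumes sp: "sp H U" and g: "g \<in> carrier G" and r: "frep H U h y"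
  shows "frep (conj_set G g H) (conj_set G g U) (g \<otimes> h \<otimes> inv g) (con g H y)"
proof -
  note U = spD[OF sp]
  obtain n \<pi> where n: "h \<in> H" "n > 0" "d h = \<omega> [^]\<^bsub>W\<^esub> (f H * n)" "\<pi> \<in> cc (\<Sigma> U h)" "v (\<Sigma> U h) \<pi> = \<omega>"
      "y = powC H (ind H (\<Sigma> U h) \<pi>) (prime_to_part P n)" using r by (auto simp: frep_def)
  note S = \<Sigma>_properties[OF sp n(1-3)]
  have hc: "h \<in> carrier G" using n opn_carrier U by blast
  interpret c: group_hom "mobj C H" "mobj C (conj_set G g H)" "con g H" by (rule con_ghom[OF U(1) g])
  have "con g H y = powC (conj_set G g H) (ind (conj_set G g H) (conj_set G g (\<Sigma> U h)) (con g (\<Sigma> U h) \<pi>)) (prime_to_part P n)"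
    using n S U M.mcon_mind[OF U(1) S(1,2) g n(4)] by (simp add: c.hom_nat_pow)
  then show ?thesis unfolding frep_def \<Sigma>_conj[OF sp n(1-3) g]
    using n g hc U S con_closed[OF S(1) g n(4)] v_con[OF S(1) g n(4)]
    by (intro conjI conj_setI exI[of _ n] bexI[of _ "con g (\<Sigma> U h) \<pi>"]) (simp_all add: f_conj)
qed

lemma rec_con:
  assumes sp: "sp H U" and g: "g \<in> carrier G" and r: "rec H U h y"
  shows "rec (conj_set G g H) (conj_set G g U) (g \<otimes> h \<otimes> inv g) (con g H y)"
proof -
  note U = spD[OF sp]
  obtain u z \<nu> where z: "h \<in> H" "u \<in> U" "frep H U (h \<otimes> u) z" "\<nu> \<in> Nm H U" "y = z \<cdot>\<^bsub>H\<^esub> \<nu>"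
    using r by (auto simp: rec_def)
  have c: "h \<in> carrier G" "u \<in> carrier G" using z opn_carrier U by auto
  interpret c: group_hom "mobj C H" "mobj C (conj_set G g H)" "con g H" by (rule con_ghom[OF U(1) g])
  have "g \<otimes> (h \<otimes> u) \<otimes> inv g = (g \<otimes> h \<otimes> inv g) \<otimes> (g \<otimes> u \<otimes> inv g)" using c g by (simp add: word_simps)
  moreover have "con g H y = con g H z \<cdot>\<^bsub>conj_set G g H\<^esub> con g H \<nu>"
    using z frep_closed[OF sp z(3)] Nm_carrier[OF U(1-3)] by simp
  ultimately show ?thesis unfolding rec_def
    using frep_con[OF sp g z(3)] Nm_con[OF U(1-3) g z(4)] conj_setI[OF z(1)] conj_setI[OF z(2)] by metis
qed

text \<open>One lift serves both pairs. The two attached subgroups have the same residue degree, so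
  the norm of a prime from one to the other is prime; the degree \<open>n\<close> is multiplied by
  the P-number \<open>r\<close>, which leaves P' unchanged.\<close>

lemma frep_ind:
  assumes spU: "sp H U" and spV: "sp I V" and sub: "I \<subseteq> H" "V \<subseteq> U" and r: "frep I V h y"
  shows "frep H U h (ind H I y)"
proof -
  note U = spD[OF spU] and V = spD[OF spV]
  obtain n \<pi> where n: "h \<in> I" "n > 0" "d h = \<omega> [^]\<^bsub>W\<^esub> (f I * n)" "\<pi> \<in> cc (\<Sigma> V h)" "v (\<Sigma> V h) \<pi> = \<omega>"
      "y = powC I (ind I (\<Sigma> V h) \<pi>) (prime_to_part P n)" using r by (auto simp: frep_def)
  define r where "r = res_degree W d H I"
  have r: "r > 0" "ix r = r" "f I = f H * r" using f_sub[OF U(1) V(1) sub(1)] by (auto simp: r_def)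
  have h: "h \<in> H" "d h = \<omega> [^]\<^bsub>W\<^esub> (f H * (r * n))" using n sub r by (auto simp: mult.assoc)
  have rn: "r * n > 0" using r n by simp
  note S = \<Sigma>_properties[OF spV n(1-3)] and L = \<Sigma>_properties[OF spU h(1) rn h(2)]
  have SL: "\<Sigma> V h \<subseteq> \<Sigma> U h" using inertia_mono[OF sub(2)] unfolding frobenius_subgroup_def
    by (rule mono_set_mult[OF subset_refl])
  have "f (\<Sigma> U h) = f (\<Sigma> V h)" using S(6) L(6) r ix_mult[OF r(1) n(2) r(2)] by simp
  then have deg: "res_degree W d (\<Sigma> U h) (\<Sigma> V h) = 1"
    using f_mult[OF L(1) S(1) SL] f_pos[OF S(1)] by simp
  define \<pi>' where "\<pi>' = ind (\<Sigma> U h) (\<Sigma> V h) \<pi>"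
  have \<pi>': "\<pi>' \<in> cc (\<Sigma> U h)" "v (\<Sigma> U h) \<pi>' = \<omega>"
    using L(1) S(1) SL n v_ind[OF L(1) S(1) SL n(4)] deg by (simp_all add: \<pi>'_def)
  interpret i: group_hom "mobj C I" "mobj C H" "ind H I" by (rule ind_ghom[OF U(1) V(1) sub(1)])
  have "ind H I y = powC H (ind H (\<Sigma> U h) \<pi>') (prime_to_part P (r * n))"
    using n(4,6) S V U sub M.mind_trans[OF U(1) L(1) S(1) SL L(2) n(4)] M.mind_trans[OF U(1) V(1) S(1,2) sub(1) n(4)]
      prime_to_part_mult[OF r(2,1) n(2)] by (simp add: i.hom_nat_pow \<pi>'_def)
  then show ?thesis unfolding frep_def using h rn \<pi>' by blast
qed

lemma rec_ind:
  assumes spU: "sp H U" and spV: "sp I V" and sub: "I \<subseteq> H" "V \<subseteq> U" and r: "rec I V h y"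
  shows "rec H U h (ind H I y)"
proof -
  note U = spD[OF spU] and V = spD[OF spV]
  obtain u z \<nu> where z: "h \<in> I" "u \<in> V" "frep I V (h \<otimes> u) z" "\<nu> \<in> Nm I V" "y = z \<cdot>\<^bsub>I\<^esub> \<nu>"
    using r by (auto simp: rec_def)
  have "ind H I y = ind H I z \<cdot>\<^bsub>H\<^esub> ind H I \<nu>"
    using z ind_mult[OF U(1) V(1) sub(1)] frep_closed[OF spV z(3)] Nm_carrier[OF V(1-3)] by simp
  then show ?thesis unfolding rec_def
    using frep_ind[OF spU spV sub z(3)] Nm_ind[OF U(1) V(1) U(2) V(2) sub V(3) U(3) z(4)] z sub by blast
qed

subsection \<open>Restriction and orbits of cosets\<close>

text \<open>The restriction side of the comparison with the transfer. Representatives of the double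
  cosets of \<open>I\<close> and \<open>\<Sigma> U h\<close> are exported as representatives of the
  orbits of \<open>h\<close> on the cosets of \<open>I\<close>, with return times \<open>k\<close>,
  because the transfer is computed from exactly these data. \<open>z r\<close> is the Mackey summand
  for the orbit of \<open>r\<close>, raised to P'(n).\<close>

lemma frep_res:
  assumes spH: "sp H U" and spI: "sp I U" and sub: "I \<subseteq> H" and r: "frep H U h y"
  shows "\<exists>R (k :: 'g \<Rightarrow> nat) z. finite R \<and> R \<subseteq> H \<and> (\<forall>r\<in>R. k r > 0) \<and>
    (\<forall>r\<in>R. \<forall>i::nat. r \<otimes> h [^] i \<otimes> inv r \<in> I \<longleftrightarrow> k r dvd i) \<and>
    (\<forall>x\<in>H. \<exists>r\<in>R. \<exists>i::nat. x \<otimes> inv (r \<otimes> h [^] i) \<in> I) \<and>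
    (\<forall>r\<in>R. \<forall>r'\<in>R. \<forall>x\<in>H. \<forall>i::nat. \<forall>j::nat. x \<otimes> inv (r \<otimes> h [^] i) \<in> I \<longrightarrow>
        x \<otimes> inv (r' \<otimes> h [^] j) \<in> I \<longrightarrow> r = r') \<and>
    (\<forall>r\<in>R. rec I U (r \<otimes> h [^] k r \<otimes> inv r) (z r)) \<and> res I H y = finprod (mobj C I) z R"
proof -
  note U = spD[OF spH] and I = spD[OF spI]
  note c = opn_carrier[OF U(1)] and cI = opn_carrier[OF I(1)]
  obtain n \<pi> where n: "h \<in> H" "n > 0" "d h = \<omega> [^]\<^bsub>W\<^esub> (f H * n)" "\<pi> \<in> cc (\<Sigma> U h)" "v (\<Sigma> U h) \<pi> = \<omega>"
      "y = powC H (ind H (\<Sigma> U h) \<pi>) (prime_to_part P n)" using r by (auto simp: frep_def)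
  note S = \<Sigma>_properties[OF spH n(1-3)]
  have hc: "h \<in> carrier G" using n c by blast
  have hp: "h [^] i \<in> H" for i :: nat using n U by simp
  define s where "s = res_degree W d H I"
  have s: "s > 0" "ix s = s" "f I = f H * s" using f_sub[OF U(1) I(1) sub] by (auto simp: s_def)
  obtain R where R: "double_coset_reps G I H (\<Sigma> U h) R"
    using double_coset_reps_exist[OF opnD(1)[OF I(1)] opnD(1)[OF S(1)] opnD(1)[OF U(1)] sub S(2)] by blast
  have RH: "R \<subseteq> H" using R by (auto simp: double_coset_reps_def)
  have "\<exists>k>0. \<forall>i::nat. r \<otimes> h [^] i \<otimes> inv r \<in> I \<longleftrightarrow> k dvd i" if r: "r \<in> H" for r
  proof -
    have rc: "r \<in> carrier G" using r c by blast
    have add: "r \<otimes> h [^] (i + j) \<otimes> inv r = (r \<otimes> h [^] i \<otimes> inv r) \<otimes> (r \<otimes> h [^] j \<otimes> inv r)" for i j :: nat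
      using rc hc by (simp add: nat_pow_mult[symmetric] word_simps)
    have "h [^] grp_index G H U \<in> U" by (rule pow_index_mem[OF spH n(1)])
    then have N: "grp_index G H U \<in> {i. r \<otimes> h [^] i \<otimes> inv r \<in> I}" using U(4)[OF r] I(3) by blast
    obtain k where "k > 0" "\<And>i. i \<in> {i. r \<otimes> h [^] (i::nat) \<otimes> inv r \<in> I} \<longleftrightarrow> k dvd i"
    proof (rule least_exponent[OF N index_pos[OF U(2,1)]])
      show "i + j \<in> {i. r \<otimes> h [^] (i::nat) \<otimes> inv r \<in> I}"
        if "i \<in> {i. r \<otimes> h [^] i \<otimes> inv r \<in> I}" "j \<in> {i. r \<otimes> h [^] i \<otimes> inv r \<in> I}" for i j
        using that I(1) unfolding mem_Collect_eq add by simp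
      show "j - i \<in> {i. r \<otimes> h [^] (i::nat) \<otimes> inv r \<in> I}"
        if ij: "i \<in> {i. r \<otimes> h [^] i \<otimes> inv r \<in> I}" "j \<in> {i. r \<otimes> h [^] i \<otimes> inv r \<in> I}" "i \<le> j" for i j
      proof -
        have "r \<otimes> h [^] (j - i) \<otimes> inv r = (r \<otimes> h [^] j \<otimes> inv r) \<otimes> inv (r \<otimes> h [^] i \<otimes> inv r)"
          using add[of "j - i" i] ij rc hc by (simp add: word_simps)
        then show ?thesis using ij I(1) by simp
      qed
    qed blast
    then show ?thesis by blast
  qed
  then obtain k where k: "\<And>r. r \<in> H \<Longrightarrow> k r > 0 \<and> (\<forall>i::nat. r \<otimes> h [^] i \<otimes> inv r \<in> I \<longleftrightarrow> k r dvd i)"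
    by metis
  define J where "J r = conj_set G (inv r) I" for r
  have J: "opn (J r)" "U \<subseteq> J r" "\<And>i::nat. h [^] i \<in> J r \<longleftrightarrow> k r dvd i" if r: "r \<in> H" for r
  proof -
    have rc: "r \<in> carrier G" "inv r \<in> H" using r c U by auto
    show "opn (J r)" unfolding J_def by (rule opn_conj[OF I(1)]) (use rc in simp)
    show "U \<subseteq> J r" using conj_set_mono[OF I(3), of "inv r"] sp_conj_set[OF spH rc(2)] by (simp add: J_def)
    show "h [^] i \<in> J r \<longleftrightarrow> k r dvd i" for i :: nat
      using mem_conj_set[OF opn_subset[OF I(1)], of "inv r" "h [^] i"] rc hc k[OF r] by (simp add: J_def)
  qed
  \<comment> \<open>\<open>\<Sigma> U h\<close> and the powers of \<open>h\<close> have the same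
    orbits on cosets of \<open>I\<close>: an element of the closure is a power of \<open>h\<close>
    up to the closed subgroup generated by \<open>h [^] k r\<close>, and this, like the inertia of
    \<open>U\<close>, is absorbed by \<open>I\<close> after conjugation.\<close>
  have mem: "x \<in> (I #> r) <#> \<Sigma> U h \<longleftrightarrow> (\<exists>i::nat. x \<otimes> inv (r \<otimes> h [^] i) \<in> I)" if x: "x \<in> H" and r: "r \<in> H" for x r
  proof
    have xc: "x \<in> carrier G" "r \<in> carrier G" using x r c by auto
    assume "x \<in> (I #> r) <#> \<Sigma> U h"
    then obtain a \<sigma> where a: "a \<in> I" "\<sigma> \<in> \<Sigma> U h" "x = a \<otimes> r \<otimes> \<sigma>" using double_coset_mem by blast
    obtain b \<iota> where b: "b \<in> cl h" "\<iota> \<in> \<I> U" "\<sigma> = b \<otimes> \<iota>" using a mem_\<Sigma> by auto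
    have kr: "k r > 0" using k r by blast
    obtain i :: nat where i: "b \<otimes> inv (h [^] i) \<in> cl (h [^] k r)" using cl_decomp[OF hc kr b(1)] by blast
    define e where "e = b \<otimes> inv (h [^] i)"
    have "cl (h [^] k r) \<subseteq> J r" by (rule cl_subset_opn[OF J(1)[OF r]]) (simp add: J(3)[OF r])
    then have "e \<in> J r" using i by (auto simp: e_def)
    then have e: "e \<in> carrier G" "r \<otimes> e \<otimes> inv r \<in> I"
      using mem_conj_set[OF opn_subset[OF I(1)], of "inv r" e] xc(2) by (simp_all add: J_def)
    have bc: "b \<in> carrier G" "\<iota> \<in> carrier G" "\<iota> \<in> U" "a \<in> carrier G"
      using b subgroup.mem_carrier[OF cl_subgroup[OF hc]] mem_inertia' cI a by auto
    have "(r \<otimes> h [^] i) \<otimes> \<iota> \<otimes> inv (r \<otimes> h [^] i) \<in> U" by (rule U(4)) (use r hp U bc in auto)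
    then have "a \<otimes> (r \<otimes> e \<otimes> inv r) \<otimes> ((r \<otimes> h [^] i) \<otimes> \<iota> \<otimes> inv (r \<otimes> h [^] i)) \<in> I"
      using opn_closed(2)[OF I(1)] a(1) e(2) I(3) by (meson subsetD)
    moreover have "x \<otimes> inv (r \<otimes> h [^] i) = a \<otimes> (r \<otimes> e \<otimes> inv r) \<otimes> ((r \<otimes> h [^] i) \<otimes> \<iota> \<otimes> inv (r \<otimes> h [^] i))"
      unfolding a(3) b(3) e_def using bc xc hc by (simp add: word_simps)
    ultimately have "x \<otimes> inv (r \<otimes> h [^] i) \<in> I" by (simp only:)
    then show "\<exists>i::nat. x \<otimes> inv (r \<otimes> h [^] i) \<in> I" by blast
  next
    have xc: "x \<in> carrier G" "r \<in> carrier G" using x r c by auto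
    assume "\<exists>i::nat. x \<otimes> inv (r \<otimes> h [^] i) \<in> I"
    then obtain i :: nat where i: "x \<otimes> inv (r \<otimes> h [^] i) \<in> I" by blast
    have "h [^] i \<in> \<Sigma> U h" using S(1,3) by simp
    moreover have "x = (x \<otimes> inv (r \<otimes> h [^] i)) \<otimes> r \<otimes> h [^] i" using xc hc by (simp add: word_simps)
    ultimately show "x \<in> (I #> r) <#> \<Sigma> U h" using i double_coset_mem by blast
  qed
  have exu: "\<exists>!r. r \<in> R \<and> x \<in> (I #> r) <#> \<Sigma> U h" if "x \<in> H" for x
    using R that by (auto simp: double_coset_reps_def)
  have ex: "\<exists>r\<in>R. \<exists>i::nat. x \<otimes> inv (r \<otimes> h [^] i) \<in> I" if "x \<in> H" for x
    using exu[OF that] mem[OF that] RH by blast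
  have un: "r = r'" if "r \<in> R" "r' \<in> R" "x \<in> H" "x \<otimes> inv (r \<otimes> h [^] (i::nat)) \<in> I"
      "x \<otimes> inv (r' \<otimes> h [^] (j::nat)) \<in> I" for r r' x i j
  proof -
    have "x \<in> (I #> r) <#> \<Sigma> U h" "x \<in> (I #> r') <#> \<Sigma> U h" using mem that RH by blast+
    then show ?thesis using exu[OF that(3)] that(1,2) by blast
  qed
  have fin: "finite R"
  proof (rule inj_on_finite)
    show "inj_on (\<lambda>r. I #> r) R"
    proof (rule inj_onI)
      fix r r' assume r: "r \<in> R" "r' \<in> R" "I #> r = I #> r'"
      have rH: "r \<in> H" "r' \<in> H" using r RH by auto
      have "r \<otimes> inv r' \<in> I" using rcos_eq_iff[OF opnD(1)[OF I(1)] c c] rH r by simp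
      then show "r = r'" using un[of r r' r 0 0] r rH c I(1) by simp
    qed
    show "(\<lambda>r. I #> r) ` R \<subseteq> (\<lambda>r. I #> r) ` carrier G" using RH c by auto
    show "finite ((\<lambda>r. I #> r) ` carrier G)" by (rule open_subgroup_finite_rcosets[OF opnD[OF I(1)]])
  qed
  interpret CI: comm_group "mobj C I" by (rule cg[OF I(1)])
  define z0 where "z0 r = ind I (I \<inter> conj_set G r (\<Sigma> U h))
      (con r (J r \<inter> \<Sigma> U h) (res (J r \<inter> \<Sigma> U h) (\<Sigma> U h) \<pi>))" for r
  have z0: "z0 r \<in> cc I \<and> frep I U (r \<otimes> h [^] k r \<otimes> inv r) (powC I (z0 r) (prime_to_part P n))" if r: "r \<in> H" for r
  proof -
    have rc: "r \<in> carrier G" "inv r \<in> H" using r c U by auto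
    have kr: "k r > 0" using k r by blast
    define g where "g = r \<otimes> h [^] k r \<otimes> inv r"
    have gI: "g \<in> I" using k[OF r] by (simp add: g_def)
    have hk: "d (h [^] k r) = \<omega> [^]\<^bsub>W\<^esub> (f H * (k r * n))" using n hc by (simp add: d.hom_nat_pow W.nat_pow_pow mult_ac)
    have nk: "k r * n > 0" using kr n by simp
    have dg: "d g = \<omega> [^]\<^bsub>W\<^esub> (f H * (k r * n))" using d_conj[of r "h [^] k r"] rc hc hk by (simp add: g_def)
    then have "\<omega> [^]\<^bsub>W\<^esub> (f H * (k r * n)) \<in> Dg (f H * s)" using d_mem[OF I(1) gI] s by simp
    then have "s dvd k r * n" using \<omega>_pow_mult_Dg[OF f_pos[OF U(1)] s(1)] s by simp
    \<comment> \<open>The degree of the returned lift \<open>g\<close> over \<open>I\<close>. Both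
      \<open>k r\<close> and \<open>s\<close> are P-numbers, so P'(n') and P'(n) agree.\<close>
    then obtain n' where n': "k r * n = s * n'" by blast
    have n'pos: "n' > 0" using n' nk by (auto intro: Nat.gr0I)
    have dg': "d g = \<omega> [^]\<^bsub>W\<^esub> (f I * n')" using dg n' s by (simp add: mult.assoc)
    have "k r dvd grp_index G H U" using J(3)[OF r] pow_index_mem[OF spH n(1)] J(2)[OF r] by blast
    then have "ix (k r) = k r" using ix_dvd_P_number[OF index_P_number[OF U(2,1,3)] index_pos[OF U(2,1)]] by blast
    then have Pn: "prime_to_part P n' = prime_to_part P n"
      using prime_to_part_mult[of "k r" n] prime_to_part_mult[of s n'] kr n s n' n'pos by simp
    have JS: "J r \<inter> \<Sigma> U h = \<Sigma> U (h [^] k r)"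
      using \<Sigma>_Int[OF spH n(1) J(1,2)[OF r] kr J(3)[OF r]] by (simp add: Int_commute)
    note S' = \<Sigma>_properties[OF spH hp nk hk]
    note Sg = \<Sigma>_properties[OF spI gI n'pos dg']
    have Sg_eq: "\<Sigma> U g = conj_set G r (\<Sigma> U (h [^] k r))"
      using \<Sigma>_conj[OF spH hp nk hk rc(1)] sp_conj_set[OF spH r] by (simp add: g_def)
    have "conj_set G r (J r) = I" using conj_set_conj_set[OF opn_subset[OF I(1)] rc(1), of "inv r"] rc opn_subset[OF I(1)]
      by (simp add: J_def)
    then have IS: "I \<inter> conj_set G r (\<Sigma> U h) = \<Sigma> U g"
      using conj_set_Int[OF opn_subset[OF J(1)[OF r]] opn_subset[OF S(1)] rc(1)] JS Sg_eq by simp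
    have sub': "\<Sigma> U (h [^] k r) \<subseteq> \<Sigma> U h" using JS by blast
    define \<rho> where "\<rho> = con r (\<Sigma> U (h [^] k r)) (res (\<Sigma> U (h [^] k r)) (\<Sigma> U h) \<pi>)"
    have "res (\<Sigma> U (h [^] k r)) (\<Sigma> U h) \<pi> \<in> cc (\<Sigma> U (h [^] k r))" using S S' sub' n by simp
    moreover have "v (\<Sigma> U (h [^] k r)) (res (\<Sigma> U (h [^] k r)) (\<Sigma> U h) \<pi>) = \<omega>"
      using v_res[OF S(1) S'(1) sub' n(4)] S(4) S'(4) n(5) by simp
    ultimately have \<rho>: "\<rho> \<in> cc (\<Sigma> U g)" "v (\<Sigma> U g) \<rho> = \<omega>"
      unfolding \<rho>_def Sg_eq using con_closed[OF S'(1) rc(1)] v_con[OF S'(1) rc(1)] by auto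
    have z: "z0 r = ind I (\<Sigma> U g) \<rho>" unfolding z0_def IS JS \<rho>_def ..
    have zc: "z0 r \<in> cc I" unfolding z using ind_closed[OF I(1) Sg(1,2) \<rho>(1)] .
    have "frep I U g (powC I (z0 r) (prime_to_part P n))" unfolding frep_def z
      using gI n'pos dg' \<rho> Pn by metis
    with zc show ?thesis by (simp add: g_def)
  qed
  have zc: "z0 \<in> R \<rightarrow> cc I" using z0 RH by blast
  define z where "z r = powC I (z0 r) (prime_to_part P n)" for r
  have "res I H (ind H (\<Sigma> U h) \<pi>) = finprod (mobj C I) z0 R"
    unfolding z0_def J_def by (rule M.mackey_formula[OF U(1) I(1) S(1) sub S(2) R n(4)])
  moreover interpret rs: group_hom "mobj C H" "mobj C I" "res I H" by (rule res_ghom[OF U(1) I(1) sub])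
  have "res I H y = powC I (res I H (ind H (\<Sigma> U h) \<pi>)) (prime_to_part P n)"
    using n U S by (simp add: rs.hom_nat_pow)
  ultimately have resy: "res I H y = finprod (mobj C I) z R"
    using CI.finprod_pow[OF fin zc] by (simp add: z_def[abs_def])
  have 1: "\<forall>r\<in>R. rec I U (r \<otimes> h [^] k r \<otimes> inv r) (z r)"
    using frep_rec[OF spI] z0 RH by (auto simp: z_def)
  have 2: "\<forall>r\<in>R. k r > 0" and 3: "\<forall>r\<in>R. \<forall>i::nat. r \<otimes> h [^] i \<otimes> inv r \<in> I \<longleftrightarrow> k r dvd i"
    using k RH by blast+
  have 4: "\<forall>x\<in>H. \<exists>r\<in>R. \<exists>i::nat. x \<otimes> inv (r \<otimes> h [^] i) \<in> I" using ex by blast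
  have 5: "\<forall>r\<in>R. \<forall>r'\<in>R. \<forall>x\<in>H. \<forall>i::nat. \<forall>j::nat. x \<otimes> inv (r \<otimes> h [^] i) \<in> I \<longrightarrow>
        x \<otimes> inv (r' \<otimes> h [^] j) \<in> I \<longrightarrow> r = r'"
  proof (intro ballI allI impI)
    fix r r' x and i j :: nat
    assume a: "r \<in> R" "r' \<in> R" "x \<in> H" "x \<otimes> inv (r \<otimes> h [^] i) \<in> I" "x \<otimes> inv (r' \<otimes> h [^] j) \<in> I"
    show "r = r'" by (rule un[OF a])
  qed
  show ?thesis
    by (intro exI[of _ R] exI[of _ k] exI[of _ z] conjI)
      (rule fin, rule RH, rule 2, rule 3, rule 4, rule 5, rule 1, rule resy)
qed

subsection \<open>Classes in abelianized quotients\<close>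

abbreviation "Q H U \<equiv> subgrp G H Mod U"
abbreviation "pic \<equiv> pi_class G"
abbreviation "Ab H U \<equiv> abelianization (Q H U)"

context
  fixes H U assumes sp: "sp H U"
begin

lemma Q_group: "group (Q H U)"
  using normal.factorgroup_is_group[OF sp_normal[OF sp]] .

lemma Q_carrier: "carrier (Q H U) = (\<lambda>h. U #> h) ` H"
  by (simp add: carrier_FactGroup)

lemma Q_hom: "group_hom (subgrp G H) (Q H U) (\<lambda>h. U #> h)"
  using normal.r_coset_hom_Mod[OF sp_normal[OF sp]] Q_group
    subgroup.subgroup_is_group[OF opnD(1)[OF spD(1)[OF sp]] is_group]
  by (simp add: group_hom_def group_hom_axioms_def)

lemma Q_mult: "h \<in> H \<Longrightarrow> h' \<in> H \<Longrightarrow> (U #> h) \<otimes>\<^bsub>Q H U\<^esub> (U #> h') = U #> (h \<otimes> h')"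
  using group_hom.hom_mult[OF Q_hom, of h h'] by simp

lemma Q_mult': "h \<in> H \<Longrightarrow> h' \<in> H \<Longrightarrow> (U #> h) <#> (U #> h') = U #> (h \<otimes> h')"
  using Q_mult[of h h'] by simp

lemma Q_inv: "h \<in> H \<Longrightarrow> inv\<^bsub>Q H U\<^esub> (U #> h) = U #> inv h"
  using group_hom.hom_inv[OF Q_hom, of h] m_inv_consistent[OF opnD(1)[OF spD(1)[OF sp]]] by simp

lemma Q_derived_normal: "derived (Q H U) (carrier (Q H U)) \<lhd> Q H U"
  by (rule group.derived_self_is_normal[OF Q_group])

lemma Ab_comm: "comm_group (Ab H U)"
  unfolding abelianization_def by (rule group.derived_quot_is_comm_group[OF Q_group])

lemma pic_hom: "pic H U \<in> hom (subgrp G H) (Ab H U)"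
proof -
  have "ab_proj (Q H U) \<in> hom (Q H U) (Ab H U)"
    unfolding abelianization_def ab_proj_def[abs_def] by (rule normal.r_coset_hom_Mod[OF Q_derived_normal])
  moreover have "(\<lambda>h. U #> h) \<in> hom (subgrp G H) (Q H U)" using group_hom.homh[OF Q_hom] .
  ultimately show ?thesis unfolding pi_class_def[abs_def] using Group.hom_compose by (force simp: o_def)
qed

lemma pic_closed: "h \<in> H \<Longrightarrow> pic H U h \<in> carrier (Ab H U)"
  using pic_hom by (auto simp: hom_def)

lemma pic_mult: "h \<in> H \<Longrightarrow> h' \<in> H \<Longrightarrow> pic H U (h \<otimes> h') = pic H U h \<otimes>\<^bsub>Ab H U\<^esub> pic H U h'"
  using pic_hom by (auto simp: hom_def)

lemma Ab_carrier: "carrier (Ab H U) = pic H U ` H"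
  unfolding abelianization_def carrier_FactGroup Q_carrier pi_class_def ab_proj_def image_image by simp

lemma pic_ghom: "group_hom (subgrp G H) (Ab H U) (pic H U)"
  using pic_hom comm_group.axioms(2)[OF Ab_comm] subgroup.subgroup_is_group[OF opnD(1)[OF spD(1)[OF sp]] is_group]
  by (simp add: group_hom_def group_hom_axioms_def)

lemma pic_one: "pic H U \<one> = \<one>\<^bsub>Ab H U\<^esub>"
  using group_hom.hom_one[OF pic_ghom] by simp

lemma pic_inv: "h \<in> H \<Longrightarrow> pic H U (inv h) = inv\<^bsub>Ab H U\<^esub> pic H U h"
  using group_hom.hom_inv[OF pic_ghom, of h] m_inv_consistent[OF opnD(1)[OF spD(1)[OF sp]]] by simp

lemma pic_U: assumes "u \<in> U" shows "pic H U u = \<one>\<^bsub>Ab H U\<^esub>"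
proof -
  have "U #> u = U #> \<one>"
    using assms opn_subset[OF spD(2)[OF sp]] subgroup.rcos_const[OF opnD(1)[OF spD(2)[OF sp]] is_group] by simp
  then show ?thesis using pic_one by (simp add: pi_class_def)
qed

lemma pic_mult_U: "h \<in> H \<Longrightarrow> u \<in> U \<Longrightarrow> pic H U (h \<otimes> u) = pic H U h"
proof -
  assume h: "h \<in> H" "u \<in> U"
  interpret A: comm_group "Ab H U" by (rule Ab_comm)
  show ?thesis using pic_mult[of h u] pic_U[of u] pic_closed[of h] h spD(3)[OF sp] by auto
qed

lemma pic_conj: "a \<in> H \<Longrightarrow> h \<in> H \<Longrightarrow> pic H U (a \<otimes> h \<otimes> inv a) = pic H U h"
proof -
  assume h: "a \<in> H" "h \<in> H"
  interpret A: comm_group "Ab H U" by (rule Ab_comm)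
  have "pic H U (a \<otimes> h \<otimes> inv a) = (pic H U a \<otimes>\<^bsub>Ab H U\<^esub> pic H U h) \<otimes>\<^bsub>Ab H U\<^esub> inv\<^bsub>Ab H U\<^esub> pic H U a"
    using h spD(1)[OF sp] by (simp add: pic_mult pic_inv)
  also have "\<dots> = pic H U h" using h pic_closed by (simp add: A.m_assoc A.conj_cancel)
  finally show ?thesis .
qed

lemma mem_Union_pic: assumes "k \<in> H" shows "h \<in> \<Union> (pic H U k) \<longleftrightarrow> h \<in> H \<and> pic H U h = pic H U k"
proof -
  interpret D: normal "derived (Q H U) (carrier (Q H U))" "Q H U" by (rule Q_derived_normal)
  note U = spD[OF sp]
  have Kc: "U #> k \<in> carrier (Q H U)" using assms Q_carrier by auto
  have sub: "pic H U k \<subseteq> carrier (Q H U)" unfolding pi_class_def ab_proj_def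
    using D.subset Kc by (rule D.r_coset_subset_G)
  have X: "X \<in> pic H U k \<longleftrightarrow> ab_proj (Q H U) X = pic H U k" if "X \<in> carrier (Q H U)" for X
    using that Kc D.rcos_self[OF that D.is_subgroup] D.repr_independence[OF _ Kc D.is_subgroup]
    by (auto simp: pi_class_def ab_proj_def)
  show ?thesis
  proof
    assume "h \<in> \<Union> (pic H U k)"
    then obtain X where X1: "X \<in> pic H U k" "h \<in> X" by blast
    then obtain x where x: "x \<in> H" "X = U #> x" using sub Q_carrier by blast
    have xc: "x \<in> carrier G" using x opn_carrier[OF U(1)] by blast
    obtain u where "u \<in> U" "h = u \<otimes> x" using X1 x by (auto simp: r_coset_def)
    then have hH: "h \<in> H" using x U by auto
    have "U #> h = X" using repr_independence[of h U x] X1 x xc opnD(1)[OF U(2)] by simp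
    then show "h \<in> H \<and> pic H U h = pic H U k" using X X1 sub hH by (auto simp: pi_class_def)
  next
    assume h: "h \<in> H \<and> pic H U h = pic H U k"
    then have "U #> h \<in> pic H U k" using X[of "U #> h"] Q_carrier by (auto simp: pi_class_def)
    moreover have "h \<in> U #> h" using h opn_carrier[OF U(1)] rcos_self opnD(1)[OF U(2)] by blast
    ultimately show "h \<in> \<Union> (pic H U k)" by blast
  qed
qed

text \<open>Values of a commutator cancel in the commutative group \<open>C(H)\<close>, so the
  elements with value 1 form a subgroup whose image contains the derived group. This makes the
  recipe a function on the abelianization.\<close>

lemma derived_rec: assumes "h \<in> H" "U #> h \<in> derived (Q H U) (carrier (Q H U))" shows "rec H U h (\<one>\<^sub>C H)"
proof -
  note U = spD[OF sp]
  interpret H: comm_group "mobj C H" by (rule cg[OF U(1)])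
  interpret Qg: group "Q H U" by (rule Q_group)
  define K where "K = {h \<in> H. rec H U h (\<one>\<^sub>C H)}"
  have N1: "\<one>\<^sub>C H \<in> Nm H U" using subgroup.one_closed[OF Nm_subgroup[OF U(1-3)]] .
  have KG: "subgroup K (subgrp G H)"
  proof (rule group.subgroupI)
    show "group (subgrp G H)" using subgroup.subgroup_is_group[OF opnD(1)[OF U(1)] is_group] .
    show "K \<noteq> {}" using rec_one[OF sp N1] U by (auto simp: K_def intro!: exI[of _ \<one>])
    show "inv\<^bsub>subgrp G H\<^esub> a \<in> K" if "a \<in> K" for a
      using that rec_inv[OF sp, of a "\<one>\<^sub>C H"] m_inv_consistent[OF opnD(1)[OF U(1)]] U by (auto simp: K_def)
    show "a \<otimes>\<^bsub>subgrp G H\<^esub> b \<in> K" if "a \<in> K" "b \<in> K" for a b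
      using that rec_mult[OF sp, of a "\<one>\<^sub>C H" b "\<one>\<^sub>C H"] U by (auto simp: K_def)
  qed (auto simp: K_def)
  have "derived (Q H U) (carrier (Q H U)) \<subseteq> (\<lambda>h. U #> h) ` K" unfolding derived_def
  proof (rule Qg.generate_subgroup_incl)
    show "subgroup ((\<lambda>h. U #> h) ` K) (Q H U)" by (rule group_hom.subgroup_img_is_subgroup[OF Q_hom KG])
    show "derived_set (Q H U) (carrier (Q H U)) \<subseteq> (\<lambda>h. U #> h) ` K"
    proof clarify
      fix X Y assume "X \<in> carrier (Q H U)" "Y \<in> carrier (Q H U)"
      then obtain a b where ab: "a \<in> H" "X = U #> a" "b \<in> H" "Y = U #> b" using Q_carrier by auto
      have "X \<otimes>\<^bsub>Q H U\<^esub> Y \<otimes>\<^bsub>Q H U\<^esub> inv\<^bsub>Q H U\<^esub> X \<otimes>\<^bsub>Q H U\<^esub> inv\<^bsub>Q H U\<^esub> Y = U #> (a \<otimes> b \<otimes> inv a \<otimes> inv b)"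
        using ab U(1) by (simp add: Q_mult' Q_inv)
      moreover have "a \<otimes> b \<otimes> inv a \<otimes> inv b \<in> K"
      proof -
        obtain y z where yz: "rec H U a y" "rec H U b z" using rec_ex[OF sp] ab by metis
        have "rec H U (a \<otimes> b \<otimes> inv a \<otimes> inv b) (y \<cdot>\<^bsub>H\<^esub> z \<cdot>\<^bsub>H\<^esub> invC H y \<cdot>\<^bsub>H\<^esub> invC H z)"
          using yz rec_mult[OF sp] rec_inv[OF sp] by blast
        moreover have "y \<cdot>\<^bsub>H\<^esub> z \<cdot>\<^bsub>H\<^esub> invC H y \<cdot>\<^bsub>H\<^esub> invC H z = \<one>\<^sub>C H"
          using rec_closed[OF sp] yz by (simp add: H.m_assoc H.conj_cancel)
        ultimately show ?thesis using ab U(1) by (simp add: K_def)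
      qed
      ultimately show "X \<otimes>\<^bsub>Q H U\<^esub> Y \<otimes>\<^bsub>Q H U\<^esub> inv\<^bsub>Q H U\<^esub> X \<otimes>\<^bsub>Q H U\<^esub> inv\<^bsub>Q H U\<^esub> Y \<in> (\<lambda>h. U #> h) ` K" by auto
    qed
  qed
  then obtain k where k: "k \<in> K" "U #> h = U #> k" using assms by blast
  have kh: "k \<in> carrier G" "h \<in> carrier G" "k \<in> H" using k assms opn_carrier[OF U(1)] by (auto simp: K_def)
  have "h \<otimes> inv k \<in> U" using rcos_eq_iff[OF opnD(1)[OF U(2)] kh(2,1)] k by simp
  then have "rec H U (h \<otimes> inv k) (\<one>\<^sub>C H)" by (rule rec_U[OF sp _ N1])
  then have "rec H U (h \<otimes> inv k \<otimes> k) (\<one>\<^sub>C H \<cdot>\<^bsub>H\<^esub> \<one>\<^sub>C H)"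
    using k by (intro rec_mult[OF sp]) (auto simp: K_def)
  then show ?thesis using kh by (simp add: word_simps)
qed

lemma rec_pic: assumes "rec H U h y" "h' \<in> H" "pic H U h = pic H U h'" shows "rec H U h' y"
proof -
  note U = spD[OF sp]
  interpret H: comm_group "mobj C H" by (rule cg[OF U(1)])
  interpret A: comm_group "Ab H U" by (rule Ab_comm)
  interpret D: normal "derived (Q H U) (carrier (Q H U))" "Q H U" by (rule Q_derived_normal)
  have h: "h \<in> H" "h \<in> carrier G" "h' \<in> carrier G" using rec_mem[OF sp assms(1)] assms opn_carrier[OF U(1)] by auto
  define g where "g = h' \<otimes> inv h"
  have g: "g \<in> H" using h assms U(1) by (simp add: g_def)
  have "pic H U g = \<one>\<^bsub>Ab H U\<^esub>"
    using h assms U(1) pic_closed by (simp add: g_def pic_mult pic_inv)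
  then have eq: "ab_proj (Q H U) (U #> g) = derived (Q H U) (carrier (Q H U))"
    by (simp add: pi_class_def abelianization_def)
  have "U #> g \<in> carrier (Q H U)" using g Q_carrier by auto
  then have "U #> g \<in> derived (Q H U) (carrier (Q H U))"
    using D.rcos_self[OF _ D.is_subgroup] eq by (auto simp: ab_proj_def)
  then have "rec H U g (\<one>\<^sub>C H)" by (rule derived_rec[OF g])
  then have "rec H U (g \<otimes> h) (\<one>\<^sub>C H \<cdot>\<^bsub>H\<^esub> y)" using rec_mult[OF sp] assms by blast
  then show ?thesis using h rec_closed[OF sp assms(1)] by (simp add: g_def word_simps)
qed

end

subsection \<open>The transfer\<close>

text \<open>The transfer is a product over all cosets with representatives from Hilbert choice.
  Grouped by orbits of a Frobenius lift \<open>g\<close> of the same coset, it telescopes, whatever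
  the representatives, to the classes of \<open>r \<otimes> g [^] k r \<otimes> inv r\<close>; these
  are the lifts produced by \<open>frep_res\<close>.\<close>

lemma transfer_rec:
  assumes spH: "sp H U" and spI: "sp I U" and sub: "I \<subseteq> H" and r: "rec H U h y"
  shows "\<exists>K. group_transfer (Q H U) (carrier (Q I U)) (U #> h) = pic I U K \<and> rec I U K (res I H y)"
proof -
  note U = spD[OF spH] and I = spD[OF spI]
  note c = opn_carrier[OF U(1)] and cI = opn_carrier[OF I(1)]
  interpret CI: comm_group "mobj C I" by (rule cg[OF I(1)])
  interpret A: comm_group "Ab I U" by (rule Ab_comm[OF spI])
  interpret Qg: group "Q H U" by (rule Q_group[OF spH])
  obtain u0 y0 \<nu>0 where z: "h \<in> H" "u0 \<in> U" "frep H U (h \<otimes> u0) y0" "\<nu>0 \<in> Nm H U" "y = y0 \<cdot>\<^bsub>H\<^esub> \<nu>0"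
    using r by (auto simp: rec_def)
  define g where "g = h \<otimes> u0"
  have g: "g \<in> H" "g \<in> carrier G" "frep H U g y0" using z U c by (auto simp: g_def)
  have gp: "g [^] i \<in> H" for i :: nat using g U by simp
  obtain R and k :: "'g \<Rightarrow> nat" and w where R0: "finite R" "R \<subseteq> H" "\<forall>r\<in>R. k r > 0"
    "\<forall>r\<in>R. \<forall>i::nat. r \<otimes> g [^] i \<otimes> inv r \<in> I \<longleftrightarrow> k r dvd i"
    "\<forall>x\<in>H. \<exists>r\<in>R. \<exists>i::nat. x \<otimes> inv (r \<otimes> g [^] i) \<in> I"
    "\<forall>r\<in>R. \<forall>r'\<in>R. \<forall>x\<in>H. \<forall>i::nat. \<forall>j::nat. x \<otimes> inv (r \<otimes> g [^] i) \<in> I \<longrightarrow>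
        x \<otimes> inv (r' \<otimes> g [^] j) \<in> I \<longrightarrow> r = r'"
    "\<forall>r\<in>R. rec I U (r \<otimes> g [^] k r \<otimes> inv r) (w r)" "res I H y0 = finprod (mobj C I) w R"
    using frep_res[OF spH spI sub g(3)] by (elim exE conjE) (rule that)
  have R3: "\<And>r. r \<in> R \<Longrightarrow> k r > 0" using R0(3) by blast
  have R4: "\<And>r i. r \<in> R \<Longrightarrow> r \<otimes> g [^] (i::nat) \<otimes> inv r \<in> I \<longleftrightarrow> k r dvd i" using R0(4) by blast
  have R5: "\<And>x. x \<in> H \<Longrightarrow> \<exists>r\<in>R. \<exists>i::nat. x \<otimes> inv (r \<otimes> g [^] i) \<in> I" using R0(5) by blast
  have R6: "r = r'" if a: "r \<in> R" "r' \<in> R" "x \<in> H" "x \<otimes> inv (r \<otimes> g [^] i) \<in> I"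
      "x \<otimes> inv (r' \<otimes> g [^] j) \<in> I" for r r' x and i j :: nat
    by (rule R0(6)[rule_format, OF a])
  have R7: "\<And>r. r \<in> R \<Longrightarrow> rec I U (r \<otimes> g [^] k r \<otimes> inv r) (w r)" using R0(7) by blast
  note R = R0(1,2) R3 R4 R5 R6 R7 R0(8)
  have Uh: "U #> h = U #> g"
  proof -
    have "h \<otimes> inv g = h \<otimes> inv u0 \<otimes> inv h" using z c opn_carrier[OF U(2)] by (simp add: g_def word_simps)
    then have "h \<otimes> inv g \<in> U" using U(4)[OF z(1)] z(2) U(2) by simp
    then show ?thesis using rcos_eq_iff[OF opnD(1)[OF U(2)]] z c g by simp
  qed
  \<comment> \<open>The transfer lives in \<open>Q H U\<close>; \<open>\<rho> x\<close> is the coset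
    of \<open>carrier (Q I U)\<close> there that corresponds to the coset of \<open>I\<close>
    through \<open>x\<close>.\<close>
  define \<rho> where "\<rho> x = carrier (Q I U) #>\<^bsub>Q H U\<^esub> (U #> x)" for x
  have BI: "carrier (Q I U) = (\<lambda>h. U #> h) ` I" by (rule Q_carrier[OF spI])
  have \<rho>mem: "X \<in> \<rho> x \<longleftrightarrow> (\<exists>a\<in>I. X = U #> (a \<otimes> x))" if "x \<in> H" for X x
    unfolding \<rho>_def r_coset_def[of "Q H U"] BI
    using Q_mult'[OF spH _ that] sub by (auto simp: subset_iff)
  have \<rho>mem': "U #> x' \<in> \<rho> x \<longleftrightarrow> x' \<otimes> inv x \<in> I" if x: "x \<in> H" "x' \<in> H" for x x'
  proof
    assume "U #> x' \<in> \<rho> x"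
    then obtain a where a: "a \<in> I" "U #> x' = U #> (a \<otimes> x)" using \<rho>mem x by blast
    have cs: "x \<in> carrier G" "x' \<in> carrier G" "a \<in> carrier G" using x a c cI by auto
    then have "x' \<otimes> inv (a \<otimes> x) \<in> U" using rcos_eq_iff[OF opnD(1)[OF U(2)], of x' "a \<otimes> x"] a by simp
    then have "(x' \<otimes> inv (a \<otimes> x)) \<otimes> a \<in> I" using I a by auto
    then show "x' \<otimes> inv x \<in> I" using cs by (simp add: word_simps)
  next
    assume a: "x' \<otimes> inv x \<in> I"
    have "x' = (x' \<otimes> inv x) \<otimes> x" using x c by (simp add: word_simps)
    then show "U #> x' \<in> \<rho> x" using \<rho>mem[OF x(1)] a by metis
  qed
  have \<rho>self: "U #> x \<in> \<rho> x" if "x \<in> H" for x using \<rho>mem'[OF that that] c[OF that] I by simp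
  have \<rho>eq: "\<rho> x = \<rho> x' \<longleftrightarrow> x \<otimes> inv x' \<in> I" if x: "x \<in> H" "x' \<in> H" for x x'
  proof
    assume "\<rho> x = \<rho> x'" then show "x \<otimes> inv x' \<in> I" using \<rho>self[OF x(1)] \<rho>mem'[OF x(2,1)] by simp
  next
    assume a: "x \<otimes> inv x' \<in> I"
    have *: "\<rho> x \<subseteq> \<rho> x'" if x: "x \<in> H" "x' \<in> H" "x \<otimes> inv x' \<in> I" for x x'
    proof
      fix X assume "X \<in> \<rho> x"
      then obtain b where b: "b \<in> I" "X = U #> (b \<otimes> x)" using \<rho>mem x by blast
      have "b \<otimes> x = (b \<otimes> (x \<otimes> inv x')) \<otimes> x'" using b x c cI by (simp add: word_simps)
      then show "X \<in> \<rho> x'" using \<rho>mem[OF x(2)] b x(3) I(1) opn_closed(2)[OF I(1)] by metis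
    qed
    have "x' \<otimes> inv x \<in> I" using opn_closed(3)[OF I(1) a] x c by (simp add: word_simps)
    then show "\<rho> x = \<rho> x'" using *[of x x'] *[of x' x] x a by blast
  qed
  have rc: "rcosets\<^bsub>Q H U\<^esub> carrier (Q I U) = \<rho> ` H"
    unfolding RCOSETS_def \<rho>_def Q_carrier[OF spH] by auto
  have \<rho>mult: "\<rho> x #>\<^bsub>Q H U\<^esub> (U #> g) = \<rho> (x \<otimes> g)" if x: "x \<in> H" for x
  proof -
    have "carrier (Q I U) \<subseteq> carrier (Q H U)" using Q_carrier[OF spH] BI sub by auto
    then show ?thesis unfolding \<rho>_def using x g Q_carrier[OF spH]
      by (subst Qg.coset_mult_assoc) (auto simp: Q_mult'[OF spH])
  qed
  define sl where "sl M = (SOME X. X \<in> M)" for M :: "'g set set"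
  have "\<exists>t\<in>H. sl (\<rho> x) = U #> t \<and> t \<otimes> inv x \<in> I" if x: "x \<in> H" for x
  proof -
    have "sl (\<rho> x) \<in> \<rho> x" unfolding sl_def by (rule someI[of _ "U #> x"]) (rule \<rho>self[OF x])
    then obtain a where a: "a \<in> I" "sl (\<rho> x) = U #> (a \<otimes> x)" using \<rho>mem x by blast
    moreover have "(a \<otimes> x) \<otimes> inv x = a" using a x c cI by (simp add: word_simps)
    ultimately show ?thesis using x sub U(1) by (intro bexI[of _ "a \<otimes> x"]) auto
  qed
  then obtain t0 where t0: "\<And>x. x \<in> H \<Longrightarrow> t0 x \<in> H \<and> sl (\<rho> x) = U #> t0 x \<and> t0 x \<otimes> inv x \<in> I" by metis
  \<comment> \<open>The lift to \<open>H\<close> of the chosen representative has to depend on the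
    coset \<open>M\<close> alone, hence a second choice on top of \<open>t0\<close>.\<close>
  define t where "t M = t0 (SOME x. x \<in> H \<and> \<rho> x = M)" for M
  have t: "t (\<rho> x) \<in> H \<and> sl (\<rho> x) = U #> t (\<rho> x) \<and> t (\<rho> x) \<otimes> inv x \<in> I" if x: "x \<in> H" for x
  proof -
    define x' where "x' = (SOME x'. x' \<in> H \<and> \<rho> x' = \<rho> x)"
    have x': "x' \<in> H \<and> \<rho> x' = \<rho> x" unfolding x'_def by (rule someI[of _ x]) (use x in simp)
    then have x2: "x' \<in> H" "x' \<otimes> inv x \<in> I" using \<rho>eq x by auto
    have T: "t0 x' \<in> H" "sl (\<rho> x) = U #> t0 x'" "t0 x' \<otimes> inv x' \<in> I" using t0[of x'] x' by auto
    have "(t0 x' \<otimes> inv x') \<otimes> (x' \<otimes> inv x) \<in> I" using T x2 I(1) by simp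
    then have "t0 x' \<otimes> inv x \<in> I" using T x2 x c by (simp add: word_simps)
    then show ?thesis using T unfolding t_def x'_def[symmetric] by simp
  qed
  define b where "b M = t M \<otimes> g \<otimes> inv (t (M #>\<^bsub>Q H U\<^esub> (U #> g)))" for M
  have bI: "b (\<rho> x) = t (\<rho> x) \<otimes> g \<otimes> inv (t (\<rho> (x \<otimes> g)))" "b (\<rho> x) \<in> I" if x: "x \<in> H" for x
  proof -
    show 1: "b (\<rho> x) = t (\<rho> x) \<otimes> g \<otimes> inv (t (\<rho> (x \<otimes> g)))" by (simp add: b_def \<rho>mult[OF x])
    have xg: "x \<otimes> g \<in> H" using x g U by simp
    have "(t (\<rho> x) \<otimes> inv x) \<otimes> inv (t (\<rho> (x \<otimes> g)) \<otimes> inv (x \<otimes> g)) \<in> I" using t[OF x] t[OF xg] I(1) by simp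
    then show "b (\<rho> x) \<in> I" unfolding 1 using t[OF x] t[OF xg] x g c by (simp add: word_simps)
  qed
  have sg: "subgrp (Q H U) (carrier (Q I U)) = Q I U"
    by (simp add: FactGroup_def fun_eq_iff)
  have tr: "group_transfer (Q H U) (carrier (Q I U)) (U #> g) = (\<Otimes>\<^bsub>Ab I U\<^esub>M\<in>\<rho> ` H. pic I U (b M))"
    unfolding group_transfer_def sg rc
  proof (rule A.finprod_cong')
    show "(\<lambda>M. pic I U (b M)) \<in> \<rho> ` H \<rightarrow> carrier (Ab I U)" using pic_closed[OF spI] bI by auto
    fix M assume "M \<in> \<rho> ` H"
    then obtain x where x: "x \<in> H" "M = \<rho> x" by blast
    have xg: "x \<otimes> g \<in> H" using x g U by simp
    have "(SOME X. X \<in> M) \<otimes>\<^bsub>Q H U\<^esub> (U #> g) \<otimes>\<^bsub>Q H U\<^esub> inv\<^bsub>Q H U\<^esub> (SOME Y. Y \<in> M #>\<^bsub>Q H U\<^esub> (U #> g)) = U #> b M"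
      unfolding x(2) \<rho>mult[OF x(1)] sl_def[symmetric] bI(1)[OF x(1)]
      using t[OF x(1)] t[OF xg] g U(1) by (simp add: Q_mult'[OF spH] Q_inv[OF spH])
    then show "ab_proj (Q I U) ((SOME X. X \<in> M) \<otimes>\<^bsub>Q H U\<^esub> (U #> g) \<otimes>\<^bsub>Q H U\<^esub> inv\<^bsub>Q H U\<^esub> (SOME Y. Y \<in> M #>\<^bsub>Q H U\<^esub> (U #> g)))
      = pic I U (b M)" by (simp add: pi_class_def)
  qed simp
  let ?o = "\<lambda>r. (\<lambda>i::nat. \<rho> (r \<otimes> g [^] i)) ` {..<k r}"
  have rg: "r \<otimes> g [^] i \<in> H" if "r \<in> R" for r and i :: nat using that R(2) gp U by auto
  have per: "r \<otimes> g [^] i \<otimes> inv (r \<otimes> g [^] j) \<in> I \<longleftrightarrow> k r dvd i - j" if "r \<in> R" "j \<le> i" for r and i j :: nat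
  proof -
    have "r \<otimes> g [^] i \<otimes> inv (r \<otimes> g [^] j) = r \<otimes> g [^] (i - j) \<otimes> inv r"
    proof -
      have "g [^] i = g [^] (i - j) \<otimes> g [^] j" using that g by (simp add: nat_pow_mult)
      then show ?thesis using that R(2) c g by (simp add: word_simps subset_iff)
    qed
    then show ?thesis using R(4)[OF that(1)] by simp
  qed
  have cover: "\<rho> ` H = (\<Union>r\<in>R. ?o r)"
  proof (intro equalityI subsetI)
    fix X assume "X \<in> \<rho> ` H"
    then obtain x where x: "x \<in> H" "X = \<rho> x" by blast
    obtain r and i :: nat where ri: "r \<in> R" "x \<otimes> inv (r \<otimes> g [^] i) \<in> I" using R(5)[OF x(1)] by blast
    have "X = \<rho> (r \<otimes> g [^] i)" using \<rho>eq[OF x(1) rg] ri x by simp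
    also have "\<dots> = \<rho> (r \<otimes> g [^] (i mod k r))"
      using \<rho>eq[OF rg rg] ri per[OF ri(1), of "i mod k r" i] by (simp add: minus_mod_eq_mult_div)
    finally show "X \<in> (\<Union>r\<in>R. ?o r)" using ri R(3) by (auto intro!: bexI[of _ r])
  qed (use rg in auto)
  have inj: "inj_on (\<lambda>i::nat. \<rho> (r \<otimes> g [^] i)) {..<k r}" if "r \<in> R" for r
  proof (rule linorder_inj_onI')
    fix i j assume ij: "i \<in> {..<k r}" "j \<in> {..<k r}" "i < j"
    then have "\<not> k r dvd j - i" by (simp add: nat_dvd_not_less less_imp_diff_less)
    then show "\<rho> (r \<otimes> g [^] i) \<noteq> \<rho> (r \<otimes> g [^] j)"
      using \<rho>eq[OF rg rg, of r r j i] per[OF that, of i j] that ij by auto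
  qed
  have disj: "pairwise (\<lambda>r r'. disjnt (?o r) (?o r')) R"
  proof (rule pairwiseI)
    fix r r' assume rr: "r \<in> R" "r' \<in> R" "r \<noteq> r'"
    have "\<rho> (r \<otimes> g [^] i) \<noteq> \<rho> (r' \<otimes> g [^] j)" for i j :: nat
    proof
      assume "\<rho> (r \<otimes> g [^] i) = \<rho> (r' \<otimes> g [^] j)"
      then have "(r \<otimes> g [^] i) \<otimes> inv (r' \<otimes> g [^] j) \<in> I" using \<rho>eq[OF rg rg] rr by simp
      moreover have "(r \<otimes> g [^] i) \<otimes> inv (r \<otimes> g [^] i) \<in> I" using c[OF rg[OF rr(1)]] I by simp
      ultimately show False using R(6)[OF rr(1,2) rg[OF rr(1)], of i i j] rr by blast
    qed
    then show "disjnt (?o r) (?o r')" unfolding disjnt_def by blast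
  qed
  \<comment> \<open>Along an orbit the factors
    \<open>T i \<otimes> g \<otimes> inv (T (Suc i))\<close> telescope. The orbit closes up, so both
    ends carry the same representative, and a conjugation inside \<open>I\<close> does not change
    the class.\<close>
  have orb: "finprod (Ab I U) (\<lambda>M. pic I U (b M)) (?o r) = pic I U (r \<otimes> g [^] k r \<otimes> inv r)" if r: "r \<in> R" for r
  proof -
    define T where "T i = t (\<rho> (r \<otimes> g [^] i))" for i :: nat
    have T: "T i \<in> H" "T i \<otimes> inv (r \<otimes> g [^] i) \<in> I" for i using t[OF rg[OF r]] by (auto simp: T_def)
    have bT: "b (\<rho> (r \<otimes> g [^] i)) = T i \<otimes> g \<otimes> inv (T (Suc i))" for i :: nat
      using bI(1)[OF rg[OF r], of i] c R(2) r g by (simp add: T_def m_assoc subset_iff)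
    have TI: "T 0 \<otimes> g [^] i \<otimes> inv (T i) \<in> I" for i
    proof -
      have "(T 0 \<otimes> inv (r \<otimes> g [^] (0::nat))) \<otimes> inv (T i \<otimes> inv (r \<otimes> g [^] i)) \<in> I"
        using T(2)[of 0] T(2)[of i] opn_closed(2,3)[OF I(1)] by blast
      then show ?thesis using c[OF T(1)] R(2) r g c by (simp add: word_simps subset_iff)
    qed
    have "finprod (Ab I U) (\<lambda>i. pic I U (b (\<rho> (r \<otimes> g [^] i)))) {..<n} = pic I U (T 0 \<otimes> g [^] n \<otimes> inv (T n))" for n :: nat
    proof (induction n)
      case 0 show ?case using pic_one[OF spI] c[OF T(1)] by simp
    next
      case (Suc n)
      have bn: "b (\<rho> (r \<otimes> g [^] i)) \<in> I" for i :: nat using bI(2)[OF rg[OF r]] .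
      have "finprod (Ab I U) (\<lambda>i. pic I U (b (\<rho> (r \<otimes> g [^] i)))) {..<Suc n}
        = pic I U (T 0 \<otimes> g [^] n \<otimes> inv (T n)) \<otimes>\<^bsub>Ab I U\<^esub> pic I U (b (\<rho> (r \<otimes> g [^] n)))"
        using Suc bn pic_closed[OF spI] TI by (simp add: lessThan_Suc A.m_comm Pi_def)
      also have "\<dots> = pic I U ((T 0 \<otimes> g [^] n \<otimes> inv (T n)) \<otimes> b (\<rho> (r \<otimes> g [^] n)))"
        using pic_mult[OF spI TI bn] by simp
      also have "(T 0 \<otimes> g [^] n \<otimes> inv (T n)) \<otimes> b (\<rho> (r \<otimes> g [^] n)) = T 0 \<otimes> g [^] Suc n \<otimes> inv (T (Suc n))"
        unfolding bT using c[OF T(1)] g by (simp add: word_simps)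
      finally show ?case .
    qed
    then have "finprod (Ab I U) (\<lambda>M. pic I U (b M)) (?o r) = pic I U (T 0 \<otimes> g [^] k r \<otimes> inv (T (k r)))"
      using inj[OF r] pic_closed[OF spI] bI(2)[OF rg[OF r]] by (subst A.finprod_reindex) auto
    also have "T (k r) = T 0"
    proof -
      have "\<rho> (r \<otimes> g [^] k r) = \<rho> (r \<otimes> g [^] (0::nat))" using \<rho>eq[OF rg[OF r] rg[OF r], of "k r" 0] per[OF r, of 0 "k r"] by simp
      then show ?thesis by (simp add: T_def)
    qed
    also have "T 0 \<otimes> g [^] k r \<otimes> inv (T 0) = (T 0 \<otimes> inv r) \<otimes> (r \<otimes> g [^] k r \<otimes> inv r) \<otimes> inv (T 0 \<otimes> inv r)"
      using c[OF T(1)] g R(2) r c by (simp add: word_simps subset_iff)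
    also have "pic I U \<dots> = pic I U (r \<otimes> g [^] k r \<otimes> inv r)"
    proof (rule pic_conj[OF spI])
      show "T 0 \<otimes> inv r \<in> I" using T(2)[of 0] R(2) r c by (simp add: subset_iff)
      show "r \<otimes> g [^] k r \<otimes> inv r \<in> I" using R(4)[OF r] by simp
    qed
    finally show ?thesis .
  qed
  have wc: "w r \<in> cc I" if "r \<in> R" for r using rec_closed[OF spI R(7)[OF that]] .
  have gI: "r \<otimes> g [^] k r \<otimes> inv r \<in> I" if "r \<in> R" for r using R(4)[OF that] by simp
  have "\<exists>K\<in>I. finprod (Ab I U) (\<lambda>r. pic I U (r \<otimes> g [^] k r \<otimes> inv r)) S = pic I U K \<and> rec I U K (finprod (mobj C I) w S)"
    if "S \<subseteq> R" for S
    using finite_subset[OF that R(1)] that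
  proof (induction S rule: finite_induct)
    case empty
    show ?case using pic_one[OF spI] rec_one[OF spI subgroup.one_closed[OF Nm_subgroup[OF I(1-3)]]] I(1) by (auto intro!: bexI[of _ \<one>])
  next
    case (insert r S)
    then obtain K where K: "K \<in> I" "finprod (Ab I U) (\<lambda>r. pic I U (r \<otimes> g [^] k r \<otimes> inv r)) S = pic I U K"
      "rec I U K (finprod (mobj C I) w S)" by auto
    have rR: "r \<in> R" "S \<subseteq> R" using insert by auto
    have p: "(\<lambda>r. pic I U (r \<otimes> g [^] k r \<otimes> inv r)) \<in> S \<rightarrow> carrier (Ab I U)" "w \<in> S \<rightarrow> cc I"
      using rR gI pic_closed[OF spI] wc by auto
    show ?case
      using K p insert.hyps rR gI pic_closed[OF spI] wc rec_mult[OF spI R(7)[OF rR(1)] K(3)] pic_mult[OF spI gI[OF rR(1)] K(1)] I(1)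
      by (intro bexI[of _ "(r \<otimes> g [^] k r \<otimes> inv r) \<otimes> K"]) simp_all
  qed
  then obtain K where K: "K \<in> I" "finprod (Ab I U) (\<lambda>r. pic I U (r \<otimes> g [^] k r \<otimes> inv r)) R = pic I U K"
    "rec I U K (finprod (mobj C I) w R)" by blast
  have "group_transfer (Q H U) (carrier (Q I U)) (U #> h) = finprod (Ab I U) (\<lambda>r. finprod (Ab I U) (\<lambda>M. pic I U (b M)) (?o r)) R"
    unfolding Uh tr cover
    by (rule A.finprod_UN_disjoint[OF R(1) _ disj]) (use bI(2) rg pic_closed[OF spI] in auto)
  also have "\<dots> = finprod (Ab I U) (\<lambda>r. pic I U (r \<otimes> g [^] k r \<otimes> inv r)) R"
    by (rule A.finprod_cong') (use orb gI pic_closed[OF spI] in auto)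
  finally have 1: "group_transfer (Q H U) (carrier (Q I U)) (U #> h) = pic I U K" using K by simp
  have "res I H y = res I H y0 \<cdot>\<^bsub>I\<^esub> res I H \<nu>0"
    using z res_mult[OF U(1) I(1) sub] frep_closed[OF spH g(3)] Nm_carrier[OF U(1-3)] by simp
  then have "rec I U K (res I H y)"
    using rec_mult_Nm[OF spI K(3) Nm_res[OF spH I(1,3) sub z(4)]] R(8) by simp
  then show ?thesis using 1 by blast
qed

end

section \<open>Bijectivity\<close>

lemma (in group) prime_order_cyclic:
  assumes "prime (order G)" shows "cyclic_group G"
proof -
  have fin: "finite (carrier G)" using prime_gt_0_nat[OF assms] order_gt_0_iff_finite by simp
  have "card (carrier G) > 1" using prime_gt_1_nat[OF assms] by (simp add: order_def)
  then have "carrier G \<noteq> {\<one>}" by auto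
  then obtain x where x: "x \<in> carrier G" "x \<noteq> \<one>" using one_closed by blast
  have "ord x dvd order G" using ord_dvd_group_order[OF x(1)] .
  moreover have "ord x \<noteq> 1" using x ord_eq_1 by blast
  ultimately have "ord x = order G" using assms by (metis prime_nat_iff)
  then have "card (generate G {x}) = card (carrier G)" using generate_pow_card[OF x(1)] by (simp add: order_def)
  then have "generate G {x} = carrier G" using fin x by (intro card_subset_eq generate_incl) auto
  then show ?thesis unfolding cyclic_group using x(1) generate_pow[OF x(1)] by blast
qed

lemma (in grp) grp_index_conj:
  assumes "subgroup H G" "subgroup K G" "K \<subseteq> H" "g \<in> H"
  shows "grp_index G H (conj_set G g K) = grp_index G H K"
proof -
  note cH = subgroup.mem_carrier[OF assms(1)] and cK = subgroup.mem_carrier[OF assms(2)]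
  have gc: "g \<in> carrier G" using cH assms by blast
  have eq: "conj_set G g K #> (g \<otimes> x \<otimes> inv g) = conj_set G g (K #> x)" if "x \<in> H" for x
  proof -
    have *: "(g \<otimes> k \<otimes> inv g) \<otimes> (g \<otimes> x \<otimes> inv g) = g \<otimes> (k \<otimes> x) \<otimes> inv g" if "k \<in> K" for k
      using that \<open>x \<in> H\<close> gc cH cK by (simp add: word_simps)
    show ?thesis unfolding conj_set_def r_coset_def using * by force
  qed
  have "(\<lambda>x. conj_set G g K #> x) ` H = conj_set G g ` ((\<lambda>x. K #> x) ` H)"
  proof -
    have "H = (\<lambda>x. g \<otimes> x \<otimes> inv g) ` H"
      using conj_set_self[OF assms(1,4)] by (simp add: conj_set_def)
    then have "(\<lambda>x. conj_set G g K #> x) ` H = (\<lambda>x. conj_set G g K #> x) ` (\<lambda>x. g \<otimes> x \<otimes> inv g) ` H" by simp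
    also have "\<dots> = conj_set G g ` ((\<lambda>x. K #> x) ` H)" unfolding image_image using eq by simp
    finally show ?thesis .
  qed
  moreover have "inj_on (conj_set G g) ((\<lambda>x. K #> x) ` H)"
  proof (rule inj_on_inverseI)
    fix X assume "X \<in> (\<lambda>x. K #> x) ` H"
    then have "X \<subseteq> carrier G" using r_coset_subset_G[OF subgroup.subset[OF assms(2)]] cH by auto
    then show "conj_set G (inv g) (conj_set G g X) = X" using gc by (simp add: conj_set_conj_set)
  qed
  ultimately show ?thesis by (simp add: grp_index_eq card_image)
qed

section \<open>Subgroups of prime and prime power index\<close>

context degree_map
begin

text \<open>Sylow's theorem in the finite quotient, pulled back to \<open>H\<close>. As
  \<open>m\<close> may be divisible by \<open>p\<close>, the power \<open>p ^ a\<close> can be taken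
  one below the full one, which \<open>abelian_prime_index\<close> exploits.\<close>

lemma subgroup_of_prime_power_index:
  assumes sp: "sp H U" and p: "prime p" "grp_index G H U = p ^ a * m"
  obtains K where "opn K" "U \<subseteq> K" "K \<subseteq> H" "grp_index G K U = p ^ a"
proof -
  note U = spD[OF sp]
  interpret N: normal U "subgrp G H" by (rule sp_normal[OF sp])
  have Qg: "group (subgrp G H Mod U)" by (rule N.factorgroup_is_group)
  have "order (subgrp G H Mod U) = p ^ a * m" using p by (simp add: order_Mod)
  moreover have fin: "finite (carrier (subgrp G H Mod U))"
    using index_pos[OF U(2,1)] order_Mod[of H U] by (intro card_ge_0_finite) (simp add: order_def)
  ultimately obtain S where S: "subgroup S (subgrp G H Mod U)" "card S = p ^ a"
    using sylow_thm[OF p(1) Qg] by blast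
  define K where "K = {x \<in> H. U #> x \<in> S}"
  have K: "K = \<Union>S" using N.factgroup_subgroup_union_char[OF S(1)] by (simp add: K_def)
  have "subgroup K (subgrp G H)" unfolding K by (rule N.factgroup_subgroup_union_subgroup[OF S(1)])
  then have Ks: "subgroup K G" "K \<subseteq> H"
    using incl_subgroup[OF opnD(1)[OF U(1)]] by (auto simp: K_def)
  have UK: "U \<subseteq> K"
  proof
    fix u assume u: "u \<in> U"
    have "U #> u = U" by (rule subgroup.rcos_const[OF opnD(1)[OF U(2)] is_group u])
    then show "u \<in> K" using u U subgroup.one_closed[OF S(1)] by (auto simp: K_def)
  qed
  have "(\<lambda>x. U #> x) ` K = S"
  proof
    have "S \<subseteq> (\<lambda>x. U #> x) ` H" using subgroup.subset[OF S(1)] by (simp add: carrier_FactGroup)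
    then show "S \<subseteq> (\<lambda>x. U #> x) ` K" by (auto simp: K_def)
  qed (auto simp: K_def)
  then have "grp_index G K U = p ^ a" using S by (simp add: grp_index_eq)
  then show ?thesis using that opn_supergroup[OF U(2) Ks(1) UK] UK Ks by blast
qed

text \<open>If a conjugate \<open>L\<close> of \<open>K\<close> is not contained in
  \<open>K\<close>, the index of \<open>K \<inter> L\<close> in \<open>L\<close> is a nontrivial
  power of \<open>p\<close>, so \<open>L\<close> already meets all \<open>p\<close> cosets of
  \<open>K\<close> in \<open>H\<close>. Then the inverse of the conjugating element is a product
  from \<open>K\<close> and \<open>L\<close>, which puts that element into \<open>K\<close>.\<close>

lemma prime_power_index_normal:
  assumes sp: "sp H U" and p: "prime p" "grp_index G H U = p ^ a"
    and K: "opn K" "U \<subseteq> K" "K \<subseteq> H" "grp_index G H K = p"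
  shows "sp H K"
proof (rule ccontr)
  assume "\<not> sp H K"
  note U = spD[OF sp]
  note c = opn_carrier[OF U(1)]
  then obtain g k where g: "g \<in> H" "k \<in> K" "g \<otimes> k \<otimes> inv g \<notin> K" using \<open>\<not> sp H K\<close> K U by (auto simp: sp_iff)
  have gc: "g \<in> carrier G" using g c by blast
  define L where "L = conj_set G g K"
  define D where "D = K \<inter> L"
  have L: "opn L" "L \<subseteq> H" unfolding L_def
    using opn_conj[OF K(1) gc] conj_set_mono[OF K(3), of g] opn_conj_set_self[OF U(1) g(1)] by auto
  have D: "opn D" "D \<subseteq> K" "D \<subseteq> L" using opn_Int[OF K(1) L(1)] by (auto simp: D_def)
  have UD: "U \<subseteq> D" using conj_set_mono[OF K(2), of g] sp_conj_set[OF sp g(1)] K by (auto simp: D_def L_def)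
  note s = opnD(1)[OF U(1)] opnD(1)[OF K(1)] opnD(1)[OF L(1)] opnD(1)[OF D(1)] opnD(1)[OF U(2)]
  have HL: "grp_index G H L = p" unfolding L_def using grp_index_conj[OF s(1,2) K(3) g(1)] K(4) by simp
  have "p * grp_index G K D = p * grp_index G L D"
    using grp_index_mult[OF s(1,2,4) D(2) K(3)] grp_index_mult[OF s(1,3,4) D(3) L(2)] K(4) HL by metis
  then have eq: "grp_index G K D = grp_index G L D" using prime_gt_0_nat[OF p(1)] by auto
  have "K \<noteq> D"
  proof
    assume "K = D"
    then have "grp_index G L D = 1" using eq grp_index_self[OF s(4)] by simp
    then have "L = D" using grp_index_eq_1[OF s(4,3) D(3)] by simp
    then have "L \<subseteq> K" using D by simp
    then show False using g conj_setI[OF g(2)] by (auto simp: L_def)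
  qed
  then have ne1: "grp_index G K D \<noteq> 1" using grp_index_eq_1[OF s(4,2) D(2)] by blast
  have "p ^ a = p * (grp_index G K D * grp_index G D U)"
    using grp_index_mult[OF s(1,2,5) K(2,3)] grp_index_mult[OF s(2,4,5) UD D(2)] p(2) K(4) by simp
  then have "grp_index G K D dvd p ^ a" by simp
  then obtain i where i: "grp_index G K D = p ^ i" using divides_primepow_nat[OF p(1)] by blast
  with ne1 have "i \<noteq> 0" by (cases i) auto
  then have ge: "p \<le> grp_index G L D" using i eq prime_ge_1_nat[OF p(1)] by (simp add: self_le_power)
  have inj: "inj_on (\<lambda>X. K <#> X) ((\<lambda>x. D #> x) ` L)"
  proof (rule inj_onI, clarify)
    fix x y assume xy: "x \<in> L" "y \<in> L" "K <#> (D #> x) = K <#> (D #> y)"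
    have cs: "x \<in> carrier G" "y \<in> carrier G" using xy opn_carrier[OF L(1)] by auto
    have "K <#> (D #> z) = K #> z" if "z \<in> carrier G" for z
    proof -
      have "K <#> D = K" using set_mult_subgroup_idem[OF s(2) subgroup_incl[OF s(4,2) D(2)]] by simp
      then show ?thesis using setmult_rcos_assoc[OF opn_subset[OF K(1)] opn_subset[OF D(1)] that] by simp
    qed
    then have "K #> x = K #> y" using xy cs by simp
    then have "x \<otimes> inv y \<in> D" using rcos_eq_iff[OF s(2) cs] xy L(1) by (simp add: D_def)
    then show "D #> x = D #> y" using rcos_eq_iff[OF s(4) cs] by simp
  qed
  have img: "(\<lambda>X. K <#> X) ` ((\<lambda>x. D #> x) ` L) = (\<lambda>x. K #> x) ` L"
  proof -
    have "K <#> (D #> z) = K #> z" if "z \<in> L" for z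
    proof -
      have "K <#> D = K" using set_mult_subgroup_idem[OF s(2) subgroup_incl[OF s(4,2) D(2)]] by simp
      then show ?thesis
        using setmult_rcos_assoc[OF opn_subset[OF K(1)] opn_subset[OF D(1)] opn_carrier[OF L(1) that]] by simp
    qed
    then show ?thesis unfolding image_image by simp
  qed
  have "card ((\<lambda>x. K #> x) ` L) = grp_index G L D" using card_image[OF inj] img by (simp add: grp_index_eq)
  then have "(\<lambda>x. K #> x) ` L = (\<lambda>x. K #> x) ` H"
    using ge K(4) L(2) finite_subset[OF image_mono[OF opn_subset[OF U(1)]] open_subgroup_finite_rcosets[OF opnD[OF K(1)]]]
    by (intro card_seteq) (auto simp: grp_index_eq)
  moreover have "inv g \<in> H" using g U by simp
  ultimately obtain x where x: "x \<in> L" "K #> inv g = K #> x" by (metis imageE imageI)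
  obtain k' where k': "k' \<in> K" "x = g \<otimes> k' \<otimes> inv g" using x by (auto simp: L_def conj_set_def)
  have kc: "k' \<in> carrier G" using k' opn_carrier[OF K(1)] by blast
  have "inv g \<otimes> inv x \<in> K" using rcos_eq_iff[OF s(2)] x gc kc k' by simp
  then have "inv (inv g \<otimes> inv x) \<in> K" using K(1) by simp
  moreover have "inv (inv g \<otimes> inv x) = g \<otimes> k'" using gc kc k' by (simp add: word_simps)
  ultimately have "g \<otimes> k' \<otimes> inv k' \<in> K" using k' K(1) by simp
  then have gK: "g \<in> K" using gc kc by (simp add: word_simps)
  then show False using g K(1) by simp
qed

lemma commutator_mem:
  assumes sp: "sp H U" and ab: "comm_group (subgrp G H Mod U)" and gk: "g \<in> H" "k \<in> H"
  shows "g \<otimes> k \<otimes> inv g \<otimes> inv k \<in> U"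
proof -
  note U = spD[OF sp]
  interpret N: normal U "subgrp G H" by (rule sp_normal[OF sp])
  have c: "g \<in> carrier G" "k \<in> carrier G" using gk opn_carrier[OF U(1)] by auto
  have m: "(U #> x) \<otimes>\<^bsub>subgrp G H Mod U\<^esub> (U #> y) = U #> (x \<otimes> y)" if "x \<in> H" "y \<in> H" for x y
    using N.rcos_sum[of x y] that by simp
  have "U #> g \<in> carrier (subgrp G H Mod U)" "U #> k \<in> carrier (subgrp G H Mod U)"
    using gk by (auto simp: carrier_FactGroup)
  then have "(U #> g) \<otimes>\<^bsub>subgrp G H Mod U\<^esub> (U #> k) = (U #> k) \<otimes>\<^bsub>subgrp G H Mod U\<^esub> (U #> g)"
    using comm_groupE(4)[OF ab] by blast
  then have "U #> (g \<otimes> k) = U #> (k \<otimes> g)" unfolding m[OF gk] m[OF gk(2,1)] .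
  then have "g \<otimes> k \<otimes> inv (k \<otimes> g) \<in> U" using rcos_eq_iff[OF opnD(1)[OF U(2)]] c by simp
  then show ?thesis using c by (simp add: word_simps)
qed

lemma comm_group_Mod:
  assumes sp: "sp H U" and ab: "\<And>g k. g \<in> H \<Longrightarrow> k \<in> H \<Longrightarrow> g \<otimes> k \<otimes> inv g \<otimes> inv k \<in> U"
  shows "comm_group (subgrp G H Mod U)"
proof -
  note U = spD[OF sp]
  interpret N: normal U "subgrp G H" by (rule sp_normal[OF sp])
  have m: "(U #> x) \<otimes>\<^bsub>subgrp G H Mod U\<^esub> (U #> y) = U #> (x \<otimes> y)" if "x \<in> H" "y \<in> H" for x y
    using N.rcos_sum[of x y] that by simp
  show ?thesis
  proof (rule group.group_comm_groupI[OF N.factorgroup_is_group])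
    fix X Y assume "X \<in> carrier (subgrp G H Mod U)" "Y \<in> carrier (subgrp G H Mod U)"
    then obtain x y where x: "x \<in> H" "X = U #> x" "y \<in> H" "Y = U #> y" by (auto simp: carrier_FactGroup)
    have c: "x \<in> carrier G" "y \<in> carrier G" using x opn_carrier[OF U(1)] by auto
    have "(x \<otimes> y) \<otimes> inv (y \<otimes> x) \<in> U" using ab[OF x(1,3)] c by (simp add: word_simps)
    then have "U #> (x \<otimes> y) = U #> (y \<otimes> x)" using rcos_eq_iff[OF opnD(1)[OF U(2)]] c by simp
    then show "X \<otimes>\<^bsub>subgrp G H Mod U\<^esub> Y = Y \<otimes>\<^bsub>subgrp G H Mod U\<^esub> X" unfolding x m[OF x(1,3)] m[OF x(3,1)] .
  qed
qed

lemma abelian_intermediate: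
  assumes sp: "sp H U" and ab: "comm_group (subgrp G H Mod U)" and K: "opn K" "U \<subseteq> K" "K \<subseteq> H"
  shows "sp H K" "comm_group (subgrp G H Mod K)" "sp K U" "comm_group (subgrp G K Mod U)"
proof -
  note U = spD[OF sp]
  have com: "g \<otimes> k \<otimes> inv g \<otimes> inv k \<in> U" if "g \<in> H" "k \<in> H" for g k
    using commutator_mem[OF sp ab that] .
  have "g \<otimes> k \<otimes> inv g \<in> K" if "g \<in> H" "k \<in> K" for g k
  proof -
    have "(g \<otimes> k \<otimes> inv g \<otimes> inv k) \<otimes> k \<in> K" using com[of g k] that K(2,3) opn_closed(2)[OF K(1)] by blast
    then show ?thesis using that K opn_carrier[OF U(1)] by (simp add: word_simps subset_iff)
  qed
  then show 1: "sp H K" using K U by (simp add: sp_iff)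
  show "comm_group (subgrp G H Mod K)" by (rule comm_group_Mod[OF 1]) (use com K in blast)
  show 2: "sp K U" by (rule sp_sub[OF sp K])
  show "comm_group (subgrp G K Mod U)" by (rule comm_group_Mod[OF 2]) (use com K in blast)
qed

text \<open>A proper intermediate subgroup of least index is maximal. Sylow subgroups above it force
  its index to be a power of one prime, and a subgroup of one power less forces it to be that
  prime.\<close>

lemma abelian_prime_index:
  assumes sp: "sp H U" and ab: "comm_group (subgrp G H Mod U)" and ne: "H \<noteq> U"
  obtains K where "opn K" "U \<subseteq> K" "K \<subseteq> H" "prime (grp_index G H K)"
proof -
  note U = spD[OF sp]
  define A where "A = {K. opn K \<and> U \<subseteq> K \<and> K \<subset> H}"
  have "U \<in> A" using U ne by (auto simp: A_def)
  then obtain K where K: "K \<in> A" "\<And>L. L \<in> A \<Longrightarrow> grp_index G H K \<le> grp_index G H L"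
    using ex_has_least_nat[of "\<lambda>K. K \<in> A" U "grp_index G H"] by blast
  have Ko: "opn K" "U \<subseteq> K" "K \<subseteq> H" "K \<noteq> H" using K(1) by (auto simp: A_def)
  note spK = abelian_intermediate(1)[OF sp ab Ko(1-3)]
  have max: "L = H" if L: "opn L" "K \<subseteq> L" "L \<subseteq> H" "L \<noteq> K" for L
  proof (rule ccontr)
    assume "L \<noteq> H"
    then have LA: "L \<in> A" using L Ko by (auto simp: A_def)
    have "grp_index G H K = grp_index G H L * grp_index G L K"
      using grp_index_mult[OF opnD(1)[OF U(1)] opnD(1)[OF L(1)] opnD(1)[OF Ko(1)] L(2,3)] .
    moreover have "grp_index G L K \<noteq> 1"
      using grp_index_eq_1[OF opnD(1)[OF Ko(1)] opnD(1)[OF L(1)] L(2)] L(4) by blast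
    then have "grp_index G L K > 1" using index_pos[OF Ko(1) L(1)] by linarith
    ultimately have "grp_index G H L < grp_index G H K" using index_pos[OF L(1) U(1)] by simp
    then show False using K(2)[OF LA] by simp
  qed
  obtain h where h: "h \<in> H" "h \<notin> K" using Ko by blast
  have hc: "h \<in> carrier G" using h opn_carrier[OF U(1)] by blast
  define n where "n = grp_index G H K"
  have n1: "n \<noteq> 1" unfolding n_def
    using grp_index_eq_1[OF opnD(1)[OF Ko(1)] opnD(1)[OF U(1)] Ko(3)] Ko(4) by blast
  obtain p where p: "prime p" "p dvd n" using n1 prime_factor_nat by blast
  obtain q where q: "n = p * q" using p by blast
  have qpos: "q > 0" "q < n" using q index_pos[OF Ko(1) U(1)] prime_gt_1_nat[OF p(1)] by (auto simp: n_def intro!: Nat.gr0I)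
  obtain L where L: "opn L" "K \<subseteq> L" "L \<subseteq> H" "grp_index G L K = p ^ multiplicity p n"
  proof -
    have "n = p ^ multiplicity p n * (n div p ^ multiplicity p n)" by (simp add: multiplicity_dvd)
    then show ?thesis using subgroup_of_prime_power_index[OF spK p(1)] that by (metis n_def)
  qed
  have npos: "n \<noteq> 0" using qpos by simp
  have "multiplicity p n > 0" using p npos by (simp add: prime_multiplicity_gt_zero_iff)
  then have "grp_index G L K \<noteq> 1" using L(4) prime_gt_1_nat[OF p(1)]
    by (metis less_irrefl one_less_power)
  then have "L \<noteq> K" using grp_index_self[OF opnD(1)[OF Ko(1)]] by auto
  then have LH: "L = H" using max L by blast
  then have np: "n = p ^ multiplicity p n" using L by (simp add: n_def)
  obtain b where b: "multiplicity p n = Suc b" using \<open>multiplicity p n > 0\<close> gr0_conv_Suc by blast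
  obtain L2 where L2: "opn L2" "K \<subseteq> L2" "L2 \<subseteq> H" "grp_index G L2 K = p ^ b"
  proof -
    have "grp_index G H K = p ^ b * p" using np b by (simp add: n_def mult.commute)
    then show ?thesis using subgroup_of_prime_power_index[OF spK p(1)] that by metis
  qed
  have "L2 \<noteq> H"
  proof
    assume "L2 = H"
    then have "p ^ b = p ^ Suc b" using L2(4) np b by (simp add: n_def)
    then show False using prime_gt_1_nat[OF p(1)] by simp
  qed
  then have "L2 = K" using max L2 by blast
  then have "p ^ b = 1" using L2(4) grp_index_self[OF opnD(1)[OF Ko(1)]] by simp
  then have "n = p" using np b by simp
  then show ?thesis using that Ko p(1) by (simp add: n_def)
qed

end

section \<open>Values of the morphism and criteria for bijectivity\<close>

context cft
begin

lemma norm_class_eq_iff: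
  assumes "opn H" "opn U" "U \<subseteq> H" "x \<in> cc H" "y \<in> cc H"
  shows "norm_class C H U x = norm_class C H U y \<longleftrightarrow> x \<cdot>\<^bsub>H\<^esub> invC H y \<in> Nm H U"
proof -
  interpret H: comm_group "mobj C H" by (rule cg[OF assms(1)])
  interpret H: grp "mobj C H" by (simp add: grp_def H.is_group)
  show ?thesis unfolding norm_class_def using H.rcos_eq_iff[OF Nm_subgroup[OF assms(1-3)] assms(4,5)] .
qed

abbreviation "FN \<equiv> fesenko_neukirch_morphism P G T W \<omega> d C v"

text \<open>This resolves the definite description in the morphism: two recipes whose lifts have the
  same class are values of one \<open>h\<close> by \<open>rec_pic\<close>, hence agree modulo
  norms.\<close>

lemma FN_value:
  assumes sp: "sp H U" and r: "rec H U h y"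
  shows "FN H U (pic H U h) = norm_class C H U y"
proof -
  note U = spD[OF sp]
  interpret H: comm_group "mobj C H" by (rule cg[OF U(1)])
  have mult: "Defs.mult_of W \<omega> (\<omega> [^]\<^bsub>W\<^esub> n) = n" if "n > 0" for n :: nat
    unfolding Defs.mult_of_def by (rule the_equality) (use that \<omega>_pow_inj in auto)
  obtain u z \<nu> where z: "h \<in> H" "u \<in> U" "frep H U (h \<otimes> u) z" "\<nu> \<in> Nm H U" "y = z \<cdot>\<^bsub>H\<^esub> \<nu>"
    using r by (auto simp: rec_def)
  obtain n \<pi> where n: "h \<otimes> u \<in> H" "n > 0" "d (h \<otimes> u) = \<omega> [^]\<^bsub>W\<^esub> (f H * n)" "\<pi> \<in> cc (\<Sigma> U (h \<otimes> u))"
      "v (\<Sigma> U (h \<otimes> u)) \<pi> = \<omega>" "z = powC H (ind H (\<Sigma> U (h \<otimes> u)) \<pi>) (prime_to_part P n)"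
    using z(3) by (auto simp: frep_def)
  have nd: "norm_degree G W d H (h \<otimes> u) = \<omega> [^]\<^bsub>W\<^esub> n" using norm_degree_iff[OF U(1) n(1)] n(3) by simp
  have zc: "z \<in> cc H" using frep_closed[OF sp z(3)] .
  have "z \<cdot>\<^bsub>H\<^esub> invC H y = invC H \<nu>" using z zc Nm_carrier[OF U(1-3)] by (simp add: H.inv_mult H.m_assoc[symmetric])
  then have zy: "norm_class C H U y = norm_class C H U z"
    using norm_class_eq_iff[OF U(1-3) zc rec_closed[OF sp r]] subgroup.m_inv_closed[OF Nm_subgroup[OF U(1-3)] z(4)] by simp
  show ?thesis unfolding fesenko_neukirch_morphism_def
  proof (rule the_equality)
    show "\<exists>k\<in>frobenius_set G W \<omega> d H. \<exists>x\<in>prime_elements \<omega> C v (\<Sigma> U k). pic H U k = pic H U h \<and>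
        norm_class C H U y = norm_class C H U (powC H (ind H (\<Sigma> U k) x)
          (prime_to_part P (Defs.mult_of W \<omega> (norm_degree G W d H k))))"
    proof (intro bexI[of _ "h \<otimes> u"] bexI[of _ \<pi>] conjI)
      show "pic H U (h \<otimes> u) = pic H U h" by (rule pic_mult_U[OF sp z(1,2)])
      show "norm_class C H U y = norm_class C H U (powC H (ind H (\<Sigma> U (h \<otimes> u)) \<pi>)
          (prime_to_part P (Defs.mult_of W \<omega> (norm_degree G W d H (h \<otimes> u)))))"
        using zy n mult nd by simp
    qed (use n nd in \<open>auto simp: prime_elements_def frobenius_set_def\<close>)
  next
    fix Y assume "\<exists>k\<in>frobenius_set G W \<omega> d H. \<exists>x\<in>prime_elements \<omega> C v (\<Sigma> U k). pic H U k = pic H U h \<and>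
        Y = norm_class C H U (powC H (ind H (\<Sigma> U k) x)
          (prime_to_part P (Defs.mult_of W \<omega> (norm_degree G W d H k))))"
    then obtain k x where k: "k \<in> frobenius_set G W \<omega> d H" "x \<in> cc (\<Sigma> U k)" "v (\<Sigma> U k) x = \<omega>" "pic H U k = pic H U h"
      "Y = norm_class C H U (powC H (ind H (\<Sigma> U k) x)
          (prime_to_part P (Defs.mult_of W \<omega> (norm_degree G W d H k))))" by (auto simp: prime_elements_def)
    obtain m where m: "k \<in> H" "m > 0" "norm_degree G W d H k = \<omega> [^]\<^bsub>W\<^esub> (m::nat)"
      using k(1) by (auto simp: frobenius_set_def)
    define w where "w = powC H (ind H (\<Sigma> U k) x) (prime_to_part P m)"
    have "frep H U k w" unfolding frep_def w_def using m k norm_degree_iff[OF U(1) m(1)] by blast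
    then have "rec H U k w" by (rule frep_rec[OF sp])
    then have "rec H U h w" using rec_pic[OF sp] z(1) k(4) by blast
    then have "norm_class C H U w = norm_class C H U y"
      using norm_class_eq_iff[OF U(1-3)] rec_unique[OF sp] rec_closed[OF sp] r by simp
    then show "Y = norm_class C H U y" using k(5) m mult by (simp add: w_def)
  qed
qed

text \<open>This is injectivity on \<open>H/U\<close> itself, not on its abelianization, and
  therefore suits abelian quotients; the kernel in general is found in
  \<open>rec_kernel\<close>.\<close>

definition "rinj H U \<longleftrightarrow> (\<forall>h y. rec H U h y \<longrightarrow> y \<in> Nm H U \<longrightarrow> h \<in> U)"
definition "rsurj H U \<longleftrightarrow> (\<forall>y\<in>cc H. \<exists>h. rec H U h y)"

lemma rec_coarsen: "sp H K \<Longrightarrow> sp H U \<Longrightarrow> U \<subseteq> K \<Longrightarrow> rec H U h y \<Longrightarrow> rec H K h y"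
  using rec_ind[of H K H U h y] M.mind_refl[of H y] rec_closed[of H U h y] spD(1) by simp

text \<open>The valuation of a recipe value is the degree of its lift, while norms from
  \<open>U\<close> have valuation divisible by the residue degree.\<close>

lemma rinj_unramified:
  assumes sp: "sp H U" and unr: "\<I> H \<subseteq> U" shows "rinj H U"
  unfolding rinj_def
proof (intro allI impI)
  fix h y assume r: "rec H U h y" and y: "y \<in> Nm H U"
  note U = spD[OF sp]
  interpret H: comm_group "mobj C H" by (rule cg[OF U(1)])
  interpret vH: group_hom "mobj C H" W "v H" by (rule v_ghom[OF U(1)])
  obtain u z \<nu> where z: "h \<in> H" "u \<in> U" "frep H U (h \<otimes> u) z" "\<nu> \<in> Nm H U" "y = z \<cdot>\<^bsub>H\<^esub> \<nu>"
    using r by (auto simp: rec_def)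
  obtain n \<pi> where n: "h \<otimes> u \<in> H" "n > 0" "d (h \<otimes> u) = \<omega> [^]\<^bsub>W\<^esub> (f H * n)" "\<pi> \<in> cc (\<Sigma> U (h \<otimes> u))"
      "v (\<Sigma> U (h \<otimes> u)) \<pi> = \<omega>" "z = powC H (ind H (\<Sigma> U (h \<otimes> u)) \<pi>) (prime_to_part P n)"
    using z(3) by (auto simp: frep_def)
  note S = \<Sigma>_properties[OF sp n(1-3)]
  have zc: "z \<in> cc H" "\<nu> \<in> cc H" using frep_closed[OF sp z(3)] Nm_carrier[OF U(1-3) z(4)] .
  have "y \<cdot>\<^bsub>H\<^esub> invC H \<nu> \<in> Nm H U"
    using Nm_mult[OF U(1-3) y] subgroup.m_inv_closed[OF Nm_subgroup[OF U(1-3)] z(4)] by blast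
  then have zN: "z \<in> Nm H U" using zc z by (simp add: H.m_assoc)
  have "res_degree W d H (\<Sigma> U (h \<otimes> u)) = ix n"
    using f_mult[OF U(1) S(1,2)] S(6) f_pos[OF U(1)] by simp
  then have "v H z = (\<omega> [^]\<^bsub>W\<^esub> ix n) [^]\<^bsub>W\<^esub> prime_to_part P n"
    using n v_ind[OF U(1) S(1,2) n(4)] U S by (simp add: vH.hom_nat_pow)
  then have vz: "v H z = \<omega> [^]\<^bsub>W\<^esub> n" using ix_times_prime_to_part[OF n(2)] by (simp add: W.nat_pow_pow)
  define m where "m = res_degree W d H U"
  have m: "m > 0" "ix m = m" "f U = f H * m" using f_sub[OF U(1-3)] by (auto simp: m_def)
  obtain x where x: "x \<in> cc U" "z = ind H U x" using zN by (auto simp: norm_group_def)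
  then have "\<omega> [^]\<^bsub>W\<^esub> n = v U x [^]\<^bsub>W\<^esub> m" using vz v_ind[OF U(1-3) x(1)] by (simp add: m_def)
  then have "\<omega> [^]\<^bsub>W\<^esub> n \<in> Dg m" using x U by (auto simp: Dg_def)
  then have "ix m dvd n" using \<omega>_pow_Dg_iff[OF m(1)] by simp
  then have "d (h \<otimes> u) \<in> Dg (f U)" using \<omega>_pow_mult_Dg[OF f_pos[OF U(1)] m(1), of n] n m by simp
  then have "h \<otimes> u \<in> U" using unramified_mem_iff[OF U(1-3) unr n(1)] by simp
  then have "h \<otimes> u \<otimes> inv u \<in> U" using z U by simp
  then show "h \<in> U" using z opn_carrier[OF U(1)] opn_carrier[OF U(2)] by (simp add: word_simps)
qed

text \<open>A count: distinct cosets of \<open>U\<close> go to distinct classes modulo norms, and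
  \<open>ord\<close> makes the two finite sets equally large.\<close>

lemma rsurj_of_rinj:
  assumes sp: "sp H U" and inj: "rinj H U" and ord: "order (mobj C H Mod Nm H U) = grp_index G H U"
  shows "rsurj H U"
  unfolding rsurj_def
proof
  note U = spD[OF sp]
  interpret H: comm_group "mobj C H" by (rule cg[OF U(1)])
  interpret H: grp "mobj C H" by (simp add: grp_def H.is_group)
  note N = Nm_subgroup[OF U(1-3)]
  define rv where "rv h = (SOME y. rec H U h y)" for h
  have rv: "rec H U h (rv h)" if "h \<in> H" for h unfolding rv_def by (rule someI_ex[OF rec_ex[OF sp that]])
  define sl where "sl X = (SOME h. h \<in> H \<and> X = U #> h)" for X
  have sl: "sl X \<in> H \<and> X = U #> sl X" if "X \<in> (\<lambda>h. U #> h) ` H" for X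
    unfolding sl_def by (rule someI_ex) (use that in auto)
  define F where "F X = Nm H U #>\<^bsub>mobj C H\<^esub> rv (sl X)" for X
  have inj_F: "inj_on F ((\<lambda>h. U #> h) ` H)"
  proof (rule inj_onI)
    fix X Y assume X: "X \<in> (\<lambda>h. U #> h) ` H" and Y: "Y \<in> (\<lambda>h. U #> h) ` H" and eq: "F X = F Y"
    note sX = sl[OF X] and sY = sl[OF Y]
    have cs: "sl X \<in> carrier G" "sl Y \<in> carrier G" using sX sY opn_carrier[OF U(1)] by auto
    have "rv (sl X) \<cdot>\<^bsub>H\<^esub> invC H (rv (sl Y)) \<in> Nm H U"
      using eq H.rcos_eq_iff[OF N rec_closed[OF sp rv] rec_closed[OF sp rv]] conjunct1[OF sX] conjunct1[OF sY]
      by (simp add: F_def)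
    moreover have "rec H U (sl X \<otimes> inv (sl Y)) (rv (sl X) \<cdot>\<^bsub>H\<^esub> invC H (rv (sl Y)))"
      using rec_mult[OF sp rv rec_inv[OF sp rv]] sX sY by blast
    ultimately have "sl X \<otimes> inv (sl Y) \<in> U" using inj unfolding rinj_def by blast
    then have "U #> sl X = U #> sl Y" using rcos_eq_iff[OF opnD(1)[OF U(2)] cs] by simp
    then show "X = Y" using sX sY by simp
  qed
  have card: "card (rcosets\<^bsub>mobj C H\<^esub> Nm H U) = grp_index G H U" using ord by (simp add: order_def FactGroup_def)
  have "F ` ((\<lambda>h. U #> h) ` H) = rcosets\<^bsub>mobj C H\<^esub> Nm H U"
  proof (rule card_seteq)
    show "finite (rcosets\<^bsub>mobj C H\<^esub> Nm H U)" using card index_pos[OF U(2,1)] card_ge_0_finite by metis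
    show "F ` ((\<lambda>h. U #> h) ` H) \<subseteq> rcosets\<^bsub>mobj C H\<^esub> Nm H U"
    proof (rule image_subsetI)
      fix X assume "X \<in> (\<lambda>h. U #> h) ` H"
      then have "rv (sl X) \<in> cc H" using sl rv rec_closed[OF sp] by blast
      then show "F X \<in> rcosets\<^bsub>mobj C H\<^esub> Nm H U" by (auto simp: F_def RCOSETS_def)
    qed
    show "card (rcosets\<^bsub>mobj C H\<^esub> Nm H U) \<le> card (F ` (\<lambda>h. U #> h) ` H)"
      using card card_image[OF inj_F] by (simp add: grp_index_eq)
  qed
  moreover fix y assume y: "y \<in> cc H"
  then have "Nm H U #>\<^bsub>mobj C H\<^esub> y \<in> rcosets\<^bsub>mobj C H\<^esub> Nm H U" by (auto simp: RCOSETS_def)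
  ultimately obtain X where X: "X \<in> (\<lambda>h. U #> h) ` H" "F X = Nm H U #>\<^bsub>mobj C H\<^esub> y" by (metis imageE)
  have r: "rec H U (sl X) (rv (sl X))" using sl[OF X(1)] rv by blast
  have c: "rv (sl X) \<in> cc H" using rec_closed[OF sp r] .
  have "y \<cdot>\<^bsub>H\<^esub> invC H (rv (sl X)) \<in> Nm H U" using X(2) H.rcos_eq_iff[OF N y c] by (simp add: F_def)
  then have "rec H U (sl X) (rv (sl X) \<cdot>\<^bsub>H\<^esub> (y \<cdot>\<^bsub>H\<^esub> invC H (rv (sl X))))" by (rule rec_mult_Nm[OF sp r])
  then show "\<exists>h. rec H U h y" using y c by (auto simp: H.conj_cancel)
qed

text \<open>A lift \<open>h\<close> found modulo \<open>K\<close> reproduces \<open>y\<close> up to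
  a norm from \<open>K\<close>. That error is treated one level down, where it is a value, and
  pushed up by \<open>rec_ind\<close>.\<close>

lemma rsurj_tower:
  assumes spK: "sp H K" and spU: "sp H U" and UK: "U \<subseteq> K" and s1: "rsurj H K" and s2: "rsurj K U"
  shows "rsurj H U"
  unfolding rsurj_def
proof
  note K = spD[OF spK] and U = spD[OF spU]
  have spKU: "sp K U" by (rule sp_sub[OF spU K(2) UK K(3)])
  interpret H: comm_group "mobj C H" by (rule cg[OF U(1)])
  fix y assume y: "y \<in> cc H"
  then obtain h where h: "rec H K h y" using s1 by (auto simp: rsurj_def)
  obtain y' where y': "rec H U h y'" using rec_ex[OF spU rec_mem[OF spK h]] by blast
  have c: "y' \<in> cc H" using rec_closed[OF spU y'] .
  have "y \<cdot>\<^bsub>H\<^esub> invC H y' \<in> Nm H K" using rec_unique[OF spK h rec_coarsen[OF spK spU UK y']] .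
  then obtain b where b: "b \<in> cc K" "y \<cdot>\<^bsub>H\<^esub> invC H y' = ind H K b" by (auto simp: norm_group_def)
  then obtain k where k: "rec K U k b" using s2 by (auto simp: rsurj_def)
  have "rec H U k (ind H K b)" by (rule rec_ind[OF spU spKU K(3) subset_refl k])
  then have "rec H U (h \<otimes> k) (y' \<cdot>\<^bsub>H\<^esub> (y \<cdot>\<^bsub>H\<^esub> invC H y'))" using rec_mult[OF spU y'] b by simp
  then show "\<exists>h. rec H U h y" using y c by (auto simp: H.conj_cancel)
qed

lemma rsurj_refl: "opn H \<Longrightarrow> rsurj H H"
  unfolding rsurj_def using rec_one[OF sp_refl] M.mind_refl[of H]
  by (metis norm_group_def image_eqI)

end

section \<open>From prime index to arbitrary pairs\<close>

locale cft_injective = cft +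
  assumes cfa_ramified: "\<lbrakk>spectrum_pair G T H U; cyclic_group (subgrp G H Mod U);
        prime (order (subgrp G H Mod U)); res_degree W d H U = 1\<rbrakk> \<Longrightarrow> class_field_axiom G C H U"
    and injective: "\<lbrakk>spectrum_pair G T H U; cyclic_group (subgrp G H Mod U);
        prime (order (subgrp G H Mod U)); res_degree W d H U = 1\<rbrakk>
      \<Longrightarrow> inj_on (fesenko_neukirch_morphism P G T W \<omega> d C v H U) (carrier (abelianization (subgrp G H Mod U)))"
begin

text \<open>The unramified subgroup \<open>L\<close> with the degrees of \<open>K\<close> lies
  between \<open>K\<close> and \<open>H\<close>, so for prime index it equals one of them.\<close>

lemma prime_index_cases:
  assumes sp: "sp H K" and p: "prime (grp_index G H K)"
  shows "\<I> H \<subseteq> K \<or> res_degree W d H K = 1"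
proof -
  note K = spD[OF sp]
  define L where "L = pre H (f K)"
  have L: "opn L" "K \<subseteq> L" "L \<subseteq> H"
    using opn_pre[OF K(1) f_pos[OF K(2)]] K d_mem[OF K(2)] by (auto simp: L_def pre_def)
  have "grp_index G H K = grp_index G H L * grp_index G L K"
    by (rule grp_index_mult[OF opnD(1)[OF K(1)] opnD(1)[OF L(1)] opnD(1)[OF K(2)] L(2,3)])
  then have "grp_index G H L = 1 \<or> grp_index G L K = 1" using p by (metis prime_product)
  then show ?thesis
  proof
    assume "grp_index G L K = 1"
    then have "K = L" using grp_index_eq_1[OF opnD(1)[OF K(2)] opnD(1)[OF L(1)] L(2)] by simp
    then show ?thesis using inertia_pre[of H "f K"] inertia_subset L_def by metis
  next
    assume "grp_index G H L = 1"
    then have "L = H" using grp_index_eq_1[OF opnD(1)[OF L(1)] opnD(1)[OF K(1)] L(3)] by simp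
    then have "d ` H \<subseteq> Dg (f K)" by (auto simp: L_def pre_def)
    moreover obtain \<phi> where \<phi>: "\<phi> \<in> H" "d \<phi> = \<omega> [^]\<^bsub>W\<^esub> f H" using frob_ex[OF K(1)] by blast
    ultimately have "\<omega> [^]\<^bsub>W\<^esub> f H \<in> Dg (f K)" by auto
    then have "f K dvd f H" using \<omega>_pow_Dg_iff[OF f_pos[OF K(2)]] ix_f[OF K(2)] by simp
    then have "f H * res_degree W d H K \<le> f H * 1" using f_mult[OF K(1-3)] dvd_imp_le[OF _ f_pos[OF K(1)]] by simp
    then show ?thesis using f_pos[OF K(1)] res_degree_pos[OF K(1-3)] by simp
  qed
qed

lemma Q_trivial_class:
  assumes sp: "sp H U" and ab: "comm_group (Q H U)" and h: "h \<in> H" "pic H U h = \<one>\<^bsub>Ab H U\<^esub>"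
  shows "h \<in> U"
proof -
  note U = spD[OF sp]
  have hc: "h \<in> carrier G" using h opn_carrier[OF U(1)] by blast
  interpret Qc: comm_group "Q H U" by fact
  have der: "derived (Q H U) (carrier (Q H U)) = {\<one>\<^bsub>Q H U\<^esub>}" by (rule Qc.derived_eq_singleton) simp
  have "U #> h \<in> carrier (Q H U)" using Q_carrier[OF sp] h by auto
  then have "pic H U h = {U #> h}" unfolding pi_class_def ab_proj_def der
    by (auto simp: r_coset_def simp del: one_FactGroup mult_FactGroup)
  moreover have "\<one>\<^bsub>Ab H U\<^esub> = {U}" using der by (simp add: abelianization_def)
  ultimately have "U #> h = U" using h by simp
  then show ?thesis using rcos_self[OF hc opnD(1)[OF U(2)]] by simp
qed

text \<open>In the ramified case the assumed injectivity of the morphism is translated into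
  \<open>rinj\<close>; this is possible because a group of prime order is its own
  abelianization.\<close>

lemma prime_case:
  assumes sp: "sp H K" and p: "prime (grp_index G H K)"
  shows "class_field_axiom G C H K" "rinj H K" "rsurj H K"
proof -
  note K = spD[OF sp]
  have cyc: "cyclic_group (Q H K)"
    using group.prime_order_cyclic[OF Q_group[OF sp]] p by (simp add: order_Mod)
  then have ab: "comm_group (Q H K)" by (rule group.cyclic_imp_abelian_group[OF Q_group[OF sp]])
  have "class_field_axiom G C H K \<and> rinj H K"
  proof (cases "\<I> H \<subseteq> K")
    case True then show ?thesis using cfa_unramified[OF sp] rinj_unramified[OF sp] by blast
  next
    case False
    then have f1: "res_degree W d H K = 1" using prime_index_cases[OF sp p] by blast
    have inj: "inj_on (FN H K) (carrier (Ab H K))" using injective[OF sp cyc _ f1] p by (simp add: order_Mod)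
    have "rinj H K" unfolding rinj_def
    proof (intro allI impI)
      fix h y assume r: "rec H K h y" and y: "y \<in> Nm H K"
      have h: "h \<in> H" using rec_mem[OF sp r] .
      have "FN H K (pic H K h) = FN H K (pic H K \<one>)"
        using FN_value[OF sp r] FN_value[OF sp rec_one[OF sp y]] by simp
      then have "pic H K h = pic H K \<one>" using inj_onD[OF inj] pic_closed[OF sp] h K by simp
      then show "h \<in> K" using Q_trivial_class[OF sp ab h] pic_one[OF sp] by simp
    qed
    then show ?thesis using cfa_ramified[OF sp cyc _ f1] p by (simp add: order_Mod)
  qed
  then show "class_field_axiom G C H K" "rinj H K" by auto
  then show "rsurj H K" using rsurj_of_rinj[OF sp] by (simp add: class_field_axiom_def)
qed

lemma rbij_abelian:
  assumes "sp H U" "comm_group (Q H U)" shows "rinj H U \<and> rsurj H U"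
  using assms
proof (induction "grp_index G H U" arbitrary: H U rule: less_induct)
  case less
  note sp = less.prems(1) and ab = less.prems(2)
  note U = spD[OF sp]
  show ?case
  proof (cases "H = U")
    case True
    then show ?thesis using rsurj_refl[OF U(1)] rec_mem[OF sp] by (auto simp: rinj_def)
  next
    case False
    then obtain K where K: "opn K" "U \<subseteq> K" "K \<subseteq> H" "prime (grp_index G H K)"
      using abelian_prime_index[OF sp ab] by blast
    note ai = abelian_intermediate[OF sp ab K(1-3)]
    note pc = prime_case[OF ai(1) K(4)]
    have "grp_index G H U = grp_index G H K * grp_index G K U"
      by (rule grp_index_mult[OF opnD(1)[OF U(1)] opnD(1)[OF K(1)] opnD(1)[OF U(2)] K(2,3)])
    then have "grp_index G K U < grp_index G H U"
      using prime_gt_1_nat[OF K(4)] index_pos[OF U(2) K(1)] by simp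
    then have IH: "rinj K U" "rsurj K U" using less.hyps ai(3,4) by auto
    have "rinj H U" unfolding rinj_def
    proof (intro allI impI)
      fix h y assume r: "rec H U h y" and y: "y \<in> Nm H U"
      interpret H: comm_group "mobj C H" by (rule cg[OF U(1)])
      interpret CK: comm_group "mobj C K" by (rule cg[OF K(1)])
      interpret i: group_hom "mobj C K" "mobj C H" "ind H K" by (rule ind_ghom[OF U(1) K(1,3)])
      have "y \<in> Nm H K" using y Nm_trans[OF U(1) K(1) U(2) K(2,3)] by blast
      then have hK: "h \<in> K" using rec_coarsen[OF ai(1) sp K(2) r] pc(2) unfolding rinj_def by blast
      obtain x where x: "rec K U h x" using rec_ex[OF ai(3) hK] by blast
      have xc: "x \<in> cc K" using rec_closed[OF ai(3) x] .
      have "ind H K x \<cdot>\<^bsub>H\<^esub> invC H y \<in> Nm H U"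
        by (rule rec_unique[OF sp rec_ind[OF sp ai(3) K(3) subset_refl x] r])
      then have "ind H K x \<cdot>\<^bsub>H\<^esub> invC H y \<cdot>\<^bsub>H\<^esub> y \<in> Nm H U" using y Nm_mult[OF U(1-3)] by blast
      then have "ind H K x \<in> Nm H U" using xc rec_closed[OF sp r] by (simp add: H.m_assoc)
      then obtain w where w: "w \<in> cc U" "ind H K x = ind H U w" by (auto simp: norm_group_def)
      \<comment> \<open>The factor \<open>ind K U w\<close> is a norm from \<open>U\<close> with the
        same norm to \<open>H\<close> as \<open>x\<close>. Dividing by it moves \<open>x\<close>
        into the kernel described by the class field axiom for the pair of \<open>H\<close> and
        \<open>K\<close>.\<close>
      define x' where "x' = x \<cdot>\<^bsub>K\<^esub> invC K (ind K U w)"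
      have wK: "ind K U w \<in> cc K" using w K U by simp
      have "ind H K x' = \<one>\<^sub>C H"
        using xc wK w M.mind_trans[OF U(1) K(1) U(2) K(2,3) w(1)] U by (simp add: x'_def)
      then have "x' \<in> kernel (mobj C K) (mobj C H) (ind H K)" using xc wK by (simp add: kernel_def x'_def)
      then have "x' \<in> generate (mobj C K) {con g K c \<cdot>\<^bsub>K\<^esub> invC K c | g c. g \<in> H \<and> c \<in> cc K}"
        using pc(1) by (simp add: class_field_axiom_def)
      also have "\<dots> \<subseteq> Nm K U"
      \<comment> \<open>By surjectivity on \<open>K\<close>, \<open>c\<close> is a value of some
        \<open>k\<close>, so the quotient of \<open>con g K c\<close> by \<open>c\<close> is a value
        of the commutator of \<open>g\<close> and \<open>k\<close>. This lies in \<open>U\<close>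
        because \<open>H/U\<close> is abelian.\<close>
      proof (rule CK.generate_subgroup_incl[OF _ Nm_subgroup[OF K(1) U(2) K(2)]], clarify)
        fix g c assume g: "g \<in> H" "c \<in> cc K"
        then obtain k where k: "rec K U k c" using IH(2) by (auto simp: rsurj_def)
        have gc: "g \<in> carrier G" "k \<in> K" "k \<in> H" using g opn_carrier[OF U(1)] rec_mem[OF ai(3) k] K by auto
        have "rec K U (g \<otimes> k \<otimes> inv g) (con g K c)"
          using rec_con[OF ai(3) gc(1) k] sp_conj_set[OF ai(1) g(1)] sp_conj_set[OF sp g(1)] by simp
        then have "rec K U (g \<otimes> k \<otimes> inv g \<otimes> inv k) (con g K c \<cdot>\<^bsub>K\<^esub> invC K c)"
          using rec_mult[OF ai(3)] rec_inv[OF ai(3) k] by blast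
        then show "con g K c \<cdot>\<^bsub>K\<^esub> invC K c \<in> Nm K U"
          using rec_Nm[OF ai(3)] commutator_mem[OF sp ab g(1) gc(3)] by blast
      qed
      finally have "x' \<cdot>\<^bsub>K\<^esub> ind K U w \<in> Nm K U"
        using w Nm_mult[OF K(1) U(2) K(2)] by (auto simp: norm_group_def)
      then have "x \<in> Nm K U" using xc wK by (simp add: x'_def CK.m_assoc)
      then show "h \<in> U" using IH(1) x unfolding rinj_def by blast
    qed
    then show ?thesis using rsurj_tower[OF ai(1) sp K(2) pc(3) IH(2)] by blast
  qed
qed

text \<open>In prime power index each subgroup of index \<open>p\<close> is normal, so surjectivity
  climbs the chain of such subgroups by \<open>rsurj_tower\<close>.\<close>

lemma rsurj_prime_power:
  assumes "prime p" "sp H U" "grp_index G H U = p ^ a" shows "rsurj H U"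
  using assms(2,3)
proof (induction a arbitrary: H)
  case 0
  then have "U = H" using grp_index_eq_1[OF opnD(1) opnD(1)] spD by simp
  then show ?case using rsurj_refl spD 0 by blast
next
  case (Suc a)
  note U = spD[OF Suc.prems(1)]
  obtain K where K: "opn K" "U \<subseteq> K" "K \<subseteq> H" "grp_index G K U = p ^ a"
    using subgroup_of_prime_power_index[OF Suc.prems(1) assms(1), of a p] Suc.prems(2) by (auto simp: mult.commute)
  have "p ^ Suc a = grp_index G H K * p ^ a"
    using grp_index_mult[OF opnD(1)[OF U(1)] opnD(1)[OF K(1)] opnD(1)[OF U(2)] K(2,3)] K(4) Suc.prems(2) by simp
  then have HK: "grp_index G H K = p" using prime_gt_0_nat[OF assms(1)] by simp
  have spK: "sp H K" by (rule prime_power_index_normal[OF Suc.prems(1) assms(1) Suc.prems(2) K(1-3) HK])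
  have spKU: "sp K U" by (rule sp_sub[OF Suc.prems(1) K(1-3)])
  show ?case using rsurj_tower[OF spK Suc.prems(1) K(2) prime_case(3)[OF spK] Suc.IH[OF spKU K(4)]] HK assms(1) by simp
qed

text \<open>The exponents for which a power of \<open>y\<close> is a value are the multiples of some
  \<open>k\<close>. If a prime \<open>p\<close> divided \<open>k\<close>, a subgroup of full p-power
  order modulo \<open>U\<close> would give, by restricting \<open>y\<close> to it and taking the
  norm, such an exponent prime to \<open>p\<close>.\<close>

lemma rsurj: assumes sp: "sp H U" shows "rsurj H U"
  unfolding rsurj_def
proof
  note U = spD[OF sp]
  interpret H: comm_group "mobj C H" by (rule cg[OF U(1)])
  fix y assume y: "y \<in> cc H"
  define n where "n = grp_index G H U"
  have npos: "n > 0" using index_pos[OF U(2,1)] by (simp add: n_def)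
  define A where "A = {m::nat. \<exists>h. rec H U h (powC H y m)}"
  have nA: "n \<in> A" using rec_one[OF sp] pow_index_Nm[OF U(1-3) y] by (auto simp: A_def n_def)
  obtain k where k: "k > 0" "\<And>i. i \<in> A \<longleftrightarrow> k dvd i"
  proof (rule least_exponent[OF nA npos])
    show "i + j \<in> A" if "i \<in> A" "j \<in> A" for i j
      using that rec_mult[OF sp] y by (fastforce simp: A_def H.nat_pow_mult[symmetric])
    show "j - i \<in> A" if ij: "i \<in> A" "j \<in> A" "i \<le> j" for i j
    proof -
      obtain h h' where h: "rec H U h (powC H y i)" "rec H U h' (powC H y j)" using ij by (auto simp: A_def)
      have "powC H y j = powC H y (j - i) \<cdot>\<^bsub>H\<^esub> powC H y i" using y ij by (simp add: H.nat_pow_mult)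
      then have "powC H y j \<cdot>\<^bsub>H\<^esub> invC H (powC H y i) = powC H y (j - i)" using y by (simp add: H.m_assoc)
      then show ?thesis using rec_mult[OF sp h(2) rec_inv[OF sp h(1)]] by (auto simp: A_def)
    qed
  qed blast
  have "k = 1"
  proof (rule ccontr)
    assume "k \<noteq> 1"
    then obtain p where p: "prime p" "p dvd k" using prime_factor_nat by blast
    define m where "m = n div p ^ multiplicity p n"
    have nm: "n = p ^ multiplicity p n * m" by (simp add: m_def multiplicity_dvd)
    have "\<not> p dvd m" using multiplicity_decompose[of n p] npos prime_gt_1_nat[OF p(1)] by (simp add: m_def)
    obtain K where K: "opn K" "U \<subseteq> K" "K \<subseteq> H" "grp_index G K U = p ^ multiplicity p n"
      using subgroup_of_prime_power_index[OF sp p(1)] nm by (metis n_def)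
    have "n = grp_index G H K * p ^ multiplicity p n" unfolding n_def
      using grp_index_mult[OF opnD(1)[OF U(1)] opnD(1)[OF K(1)] opnD(1)[OF U(2)] K(2,3)] K(4) by (simp add: n_def)
    then have "p ^ multiplicity p n * grp_index G H K = p ^ multiplicity p n * m" using nm by (metis mult.commute)
    then have HK: "grp_index G H K = m" using prime_gt_0_nat[OF p(1)] by simp
    have spKU: "sp K U" by (rule sp_sub[OF sp K(1-3)])
    obtain h where h: "rec K U h (res K H y)"
      using rsurj_prime_power[OF p(1) spKU K(4)] res_closed[OF U(1) K(1,3) y] unfolding rsurj_def by blast
    have "rec H U h (powC H y m)"
      using rec_ind[OF sp spKU K(3) subset_refl h] M.mind_mres[OF U(1) K(1,3) y] HK by simp
    then have "k dvd m" using k(2) by (auto simp: A_def)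
    then show False using p(2) \<open>\<not> p dvd m\<close> by (meson dvd_trans)
  qed
  then have "1 \<in> A" using k(2) by simp
  then show "\<exists>h. rec H U h y" using y by (auto simp: A_def)
qed

text \<open>The elements with trivial class form an open normal \<open>V\<close> with abelian
  quotient; coarsening from \<open>U\<close> to \<open>V\<close> leads back to
  \<open>rbij_abelian\<close>.\<close>

lemma rec_kernel: assumes sp: "sp H U" and r: "rec H U h y" and y: "y \<in> Nm H U" shows "pic H U h = \<one>\<^bsub>Ab H U\<^esub>"
proof -
  note U = spD[OF sp]
  note c = opn_carrier[OF U(1)]
  interpret A: comm_group "Ab H U" by (rule Ab_comm[OF sp])
  define V where "V = {h \<in> H. pic H U h = \<one>\<^bsub>Ab H U\<^esub>}"
  have sub: "subgroup V G"
    by (rule subgroupI) (use U(1) c pic_one[OF sp] pic_mult[OF sp] pic_inv[OF sp] in \<open>auto simp: V_def intro!: exI[of _ \<one>]\<close>)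
  have UV: "U \<subseteq> V" using U(3) pic_U[OF sp] by (auto simp: V_def)
  have V: "opn V" "V \<subseteq> H" using opn_supergroup[OF U(2) sub UV] by (auto simp: V_def)
  have spV: "sp H V" unfolding sp_iff using U(1) V pic_conj[OF sp] by (auto simp: V_def)
  have "comm_group (Q H V)"
  proof (rule comm_group_Mod[OF spV])
    fix g k assume gk: "g \<in> H" "k \<in> H"
    then have "g \<otimes> k \<otimes> inv g \<otimes> inv k \<in> H" using U(1) by simp
    moreover have "pic H U (g \<otimes> k \<otimes> inv g \<otimes> inv k) = pic H U (g \<otimes> k \<otimes> inv g) \<otimes>\<^bsub>Ab H U\<^esub> inv\<^bsub>Ab H U\<^esub> pic H U k"
      using gk U(1) pic_mult[OF sp, of "g \<otimes> k \<otimes> inv g" "inv k"] pic_inv[OF sp, of k] by simp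
    ultimately show "g \<otimes> k \<otimes> inv g \<otimes> inv k \<in> V"
      using pic_conj[OF sp gk] pic_closed[OF sp gk(2)] by (simp add: V_def)
  qed
  then have "rinj H V" using rbij_abelian[OF spV] by blast
  moreover have "y \<in> Nm H V" using y Nm_trans[OF U(1) V(1) U(2) UV V(2)] by blast
  ultimately have "h \<in> V" using rec_coarsen[OF spV sp UV r] unfolding rinj_def by blast
  then show ?thesis by (simp add: V_def)
qed

end

section \<open>The Fesenko--Neukirch datum\<close>

lemma (in group) subgrp_hom:
  assumes "h \<in> hom G H" "A \<subseteq> carrier G" "h ` A \<subseteq> B" shows "h \<in> hom (G\<lparr>carrier := A\<rparr>) (H\<lparr>carrier := B\<rparr>)"
  using assms by (auto simp: hom_def subset_iff)

context cft
begin

abbreviation "units H \<equiv> kernel (mobj C H) W (v H)"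
abbreviation "UG \<equiv> unit_group W C v"

lemma units_subgroup: "opn H \<Longrightarrow> subgroup (units H) (mobj C H)"
  using group_hom.subgroup_kernel[OF v_ghom] .

lemma mem_units: "x \<in> units H \<longleftrightarrow> x \<in> cc H \<and> v H x = \<one>\<^bsub>W\<^esub>"
  by (simp add: kernel_def)

lemma UG_group: "opn H \<Longrightarrow> group (UG H)"
  unfolding unit_group_def using subgroup.subgroup_is_group[OF units_subgroup gr] by simp

text \<open>All valuations have the infinite cyclic group generated by \<open>\<omega>\<close> as
  image, and membership in \<open>Dg n\<close> detects divisibility of its exponents by the P-number
  \<open>n\<close>.\<close>

lemma datum_valuation_index:
  assumes n: "n > 0" "ix n = n" and E: "E = generate W {\<omega>}" and N: "N = (\<lambda>y. y [^]\<^bsub>W\<^esub> n) ` E"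
  shows "order (subgrp W E Mod N) = n" "generate (subgrp W E Mod N) {N #>\<^bsub>W\<^esub> \<omega>} = carrier (subgrp W E Mod N)"
proof -
  have Es: "subgroup E W" unfolding E by (rule W.generate_is_subgroup) simp
  have Ep: "E = range (\<lambda>k::int. \<omega> [^]\<^bsub>W\<^esub> k)" unfolding E W.generate_pow[OF \<omega>_carrier] by auto
  have Ec: "E \<subseteq> carrier W" by (rule subgroup.subset[OF Es])
  have NE: "N \<subseteq> E" unfolding N
    using W.subgroup_int_pow_closed[OF Es, of _ "int n"] by (auto simp: int_pow_int)
  have Nsub: "subgroup N W"
  proof (rule W.subgroupI)
    show "N \<subseteq> carrier W" using NE Ec by blast
    show "N \<noteq> {}" using subgroup.one_closed[OF Es] by (auto simp: N)
    show "inv\<^bsub>W\<^esub> a \<in> N" if "a \<in> N" for a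
    proof -
      obtain y where y: "y \<in> E" "a = y [^]\<^bsub>W\<^esub> n" using \<open>a \<in> N\<close> by (auto simp: N)
      then have "inv\<^bsub>W\<^esub> a = (inv\<^bsub>W\<^esub> y) [^]\<^bsub>W\<^esub> n" using Ec by (auto simp: W.nat_pow_inv)
      then show ?thesis using y subgroup.m_inv_closed[OF Es] by (auto simp: N)
    qed
    show "a \<otimes>\<^bsub>W\<^esub> b \<in> N" if ab: "a \<in> N" "b \<in> N" for a b
    proof -
      obtain y z where y: "y \<in> E" "a = y [^]\<^bsub>W\<^esub> n" "z \<in> E" "b = z [^]\<^bsub>W\<^esub> n" using ab by (auto simp: N)
      then have "a \<otimes>\<^bsub>W\<^esub> b = (y \<otimes>\<^bsub>W\<^esub> z) [^]\<^bsub>W\<^esub> n" using W.nat_pow_distrib[of y z n] subsetD[OF Ec] by simp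
      then show ?thesis using y subgroup.m_closed[OF Es] by (auto simp: N)
    qed
  qed
  have "grp_index W E N = n"
  proof (rule W.grp_index_cyclic[OF Nsub \<omega>_carrier n(1) Ec])
    show "\<omega> [^]\<^bsub>W\<^esub> i \<in> E" for i :: nat unfolding Ep by (metis int_pow_int rangeI)
    show "\<omega> [^]\<^bsub>W\<^esub> i \<in> N \<longleftrightarrow> n dvd i" for i :: nat
    proof
      assume "\<omega> [^]\<^bsub>W\<^esub> i \<in> N"
      then have "\<omega> [^]\<^bsub>W\<^esub> i \<in> Dg n" using Ec by (auto simp: N Dg_def)
      then show "n dvd i" using \<omega>_pow_Dg_iff[OF n(1)] n by simp
    next
      assume "n dvd i"
      then obtain q where "i = q * n" by (metis dvd_def mult.commute)
      then have "\<omega> [^]\<^bsub>W\<^esub> i = (\<omega> [^]\<^bsub>W\<^esub> int q) [^]\<^bsub>W\<^esub> n" by (simp add: int_pow_int W.nat_pow_pow)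
      then show "\<omega> [^]\<^bsub>W\<^esub> i \<in> N" unfolding N Ep by blast
    qed
    show "\<exists>i::nat. x \<otimes>\<^bsub>W\<^esub> inv\<^bsub>W\<^esub> (\<omega> [^]\<^bsub>W\<^esub> i) \<in> N" if xE: "x \<in> E" for x
    proof -
      obtain k :: int where k: "x = \<omega> [^]\<^bsub>W\<^esub> k" using xE Ep by auto
      define i where "i = nat (k mod int n)"
      have "k = (k div int n) * int n + int i" using n by (simp add: i_def)
      then have "x = \<omega> [^]\<^bsub>W\<^esub> ((k div int n) * int n) \<otimes>\<^bsub>W\<^esub> \<omega> [^]\<^bsub>W\<^esub> i"
        using k by (metis W.int_pow_mult \<omega>_carrier int_pow_int)
      then have "x \<otimes>\<^bsub>W\<^esub> inv\<^bsub>W\<^esub> (\<omega> [^]\<^bsub>W\<^esub> i) = (\<omega> [^]\<^bsub>W\<^esub> (k div int n)) [^]\<^bsub>W\<^esub> n"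
        by (simp add: W.word_simps W.int_pow_pow[symmetric] int_pow_int)
      then show ?thesis unfolding N Ep by blast
    qed
  qed
  then show "order (subgrp W E Mod N) = n" by (simp add: W.order_Mod)
  have nrm: "N \<lhd> subgrp W E"
    using W.normal_subgrp_iff[OF Es] Nsub NE Ec subgroup.subset[OF Nsub] by (auto simp: subset_iff)
  interpret N: normal N "subgrp W E" by (rule nrm)
  have hom: "group_hom (subgrp W E) (subgrp W E Mod N) (\<lambda>a. N #>\<^bsub>W\<^esub> a)"
    using N.r_coset_hom_Mod N.factorgroup_is_group N.is_group by (simp add: group_hom_def group_hom_axioms_def)
  have \<omega>E: "\<omega> \<in> E" unfolding E by (simp add: generate.incl)
  have "generate (subgrp W E Mod N) ((\<lambda>a. N #>\<^bsub>W\<^esub> a) ` {\<omega>}) = (\<lambda>a. N #>\<^bsub>W\<^esub> a) ` generate (subgrp W E) {\<omega>}"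
    by (rule group_hom.generate_img[OF hom]) (use \<omega>E in simp)
  also have "generate (subgrp W E) {\<omega>} = E" using W.generate_consistent[OF _ Es] \<omega>E E by simp
  also have "(\<lambda>a. N #>\<^bsub>W\<^esub> a) ` E = carrier (subgrp W E Mod N)" by (simp add: carrier_FactGroup)
  finally show "generate (subgrp W E Mod N) {N #>\<^bsub>W\<^esub> \<omega>} = carrier (subgrp W E Mod N)" by simp
qed

lemma v_image: assumes "opn H" shows "v H ` cc H = generate W {\<omega>}"
proof
  show "v H ` cc H \<subseteq> generate W {\<omega>}" using v_gen[OF assms] by blast
  have "subgroup (v H ` cc H) W" using group_hom.img_is_subgroup[OF v_ghom[OF assms]] .
  moreover have "\<omega> \<in> v H ` cc H" using prime_ex[OF assms] by (metis imageI)
  ultimately show "generate W {\<omega>} \<subseteq> v H ` cc H" by (intro W.generate_subgroup_incl) auto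
qed

lemma datum: "fesenko_neukirch_datum G T W \<omega> d C v"
  unfolding fesenko_neukirch_datum_def
proof (intro conjI allI impI)
  show "cohomological_mackey_functor G T C" by (rule M.cohomological_mackey_functor_axioms)
  show "v \<in> valuations G T W \<omega> d C (carrier W)"
  proof -
    have "generate W {\<omega>} \<subseteq> carrier W" by (rule W.generate_incl) simp
    then have "x \<in> hom A (subgrp W (generate W {\<omega>})) \<Longrightarrow> x \<in> hom A (subgrp W (carrier W))" for x and A :: "'c monoid"
      by (auto simp: hom_def)
    then show ?thesis using val unfolding valuations_def by blast
  qed
  fix H U assume HU: "sp H U \<and> \<I> H \<subseteq> U"
  then have sp: "sp H U" and unr: "\<I> H \<subseteq> U" by auto
  note U = spD[OF sp]
  have n: "grp_index G H U > 0" "ix (grp_index G H U) = grp_index G H U"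
    using index_pos[OF U(2,1)] index_P_number[OF U(2,1,3)] by auto
  show "let n = grp_index G H U; M = v H ` cc H; N = (\<lambda>y. y [^]\<^bsub>W\<^esub> n) ` v U ` cc U; Q = subgrp W M Mod N
        in order Q = n \<and> generate Q {N #>\<^bsub>W\<^esub> \<omega>} = carrier Q"
    unfolding Let_def v_image[OF U(1)] v_image[OF U(2)] using datum_valuation_index[OF n refl refl] by simp
  have img: "ind H U ` units U = units H"
  proof
    show "units H \<subseteq> ind H U ` units U"
    proof
      fix u assume "u \<in> units H"
      then obtain x where "x \<in> cc U" "v U x = \<one>\<^bsub>W\<^esub>" "ind H U x = u"
        using norm_unit_surj[OF sp unr] by (auto simp: mem_units)
      then show "u \<in> ind H U ` units U" by (auto simp: mem_units)
    qed
    show "ind H U ` units U \<subseteq> units H" using v_ind[OF U(1-3)] U by (auto simp: mem_units)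
  qed
  then show "ind H U ` carrier (UG U) = carrier (UG H)" by (simp add: unit_group_def)
  have cfa: "order (mobj C H Mod Nm H U) = grp_index G H U"
    using cfa_unramified[OF sp unr] by (simp add: class_field_axiom_def)
  then show "finite (carrier (mobj C H Mod Nm H U))"
    using n by (intro card_ge_0_finite) (simp add: order_def)
  show "order (mobj C H Mod Nm H U) \<le> grp_index G H U" using cfa by simp
  show "\<forall>\<phi>\<in>frobenius_elem G W \<omega> d H U. exact_seq
           ([singleton_group (\<one>\<^sub>C H), UG H, UG U, UG U, UG H, singleton_group (\<one>\<^sub>C H)],
            [\<lambda>_. \<one>\<^sub>C H, ind H U, \<lambda>x. con \<phi> U x \<cdot>\<^bsub>U\<^esub> invC U x, res U H, \<lambda>_. \<one>\<^sub>C H])"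
  proof
    \<comment> \<open>An element \<open>\<phi>\<close> of the Frobenius coset need not have
      Frobenius degree itself. The element \<open>\<psi>\<close> does, and both act alike on
      \<open>C(U)\<close>.\<close>
    fix \<phi> assume "\<phi> \<in> frobenius_elem G W \<omega> d H U"
    obtain \<psi> where \<psi>: "\<psi> \<in> H" "d \<psi> = \<omega> [^]\<^bsub>W\<^esub> f H" using frob_ex[OF U(1)] by blast
    have nd: "norm_degree G W d H h = \<omega> \<longleftrightarrow> d h = \<omega> [^]\<^bsub>W\<^esub> f H" if "h \<in> H" for h
      using norm_degree_iff[OF U(1) that, of 1] by simp
    have "frobenius_elem G W \<omega> d H U = U #> \<psi>" unfolding frobenius_elem_def
    proof (rule the_equality)
      show "\<exists>h\<in>H. norm_degree G W d H h = \<omega> \<and> U #> \<psi> = U #> h" using \<psi> nd by blast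
      fix X assume "\<exists>h\<in>H. norm_degree G W d H h = \<omega> \<and> X = U #> h"
      then obtain h where h: "h \<in> H" "norm_degree G W d H h = \<omega>" "X = U #> h" by blast
      have cs: "h \<in> carrier G" "\<psi> \<in> carrier G" using h \<psi> opn_carrier[OF U(1)] by auto
      have "h \<otimes> inv \<psi> \<in> \<I> H" using h \<psi> nd[OF h(1)] cs U(1) by (simp add: mem_inertia[OF U(1)])
      then have "h \<otimes> inv \<psi> \<in> U" using unr by blast
      then show "X = U #> \<psi>" using h rcos_eq_iff[OF opnD(1)[OF U(2)] cs] by simp
    qed
    then obtain u where u: "u \<in> U" "\<phi> = u \<otimes> \<psi>" using \<open>\<phi> \<in> _\<close> by (auto simp: r_coset_def)
    have \<phi>H: "\<phi> \<in> H" using u \<psi> U by auto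
    have con_eq: "con \<phi> U x = con \<psi> U x" if "x \<in> cc U" for x
    proof -
      have "con u U (con \<psi> U x) = con \<phi> U x" using act_act[OF sp \<psi>(1) _ that, of u] u U(3) by auto
      then show ?thesis using M.mcon_refl[OF U(2) u(1) act_closed[OF sp \<psi>(1) that]] by simp
    qed
    interpret CU: comm_group "mobj C U" by (rule cg[OF U(2)])
    interpret CH: comm_group "mobj C H" by (rule cg[OF U(1)])
    interpret a: group_hom "mobj C U" "mobj C U" "con \<phi> U" by (rule act_ghom[OF sp \<phi>H])
    let ?D = "\<lambda>x. con \<phi> U x \<cdot>\<^bsub>U\<^esub> invC U x"
    interpret vU: group_hom "mobj C U" W "v U" by (rule v_ghom[OF U(2)])
    have Dunit: "?D x \<in> units U" if "x \<in> cc U" for x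
      using that act_closed[OF sp \<phi>H that] v_act[OF sp \<phi>H that] by (simp add: mem_units)
    have uc: "units U \<subseteq> cc U" "units H \<subseteq> cc H" by (auto simp: mem_units)
    have Dhom: "?D \<in> hom (mobj C U) (mobj C U)"
      by (auto simp: hom_def a.hom_closed CU.inv_mult CU.m_ac)
    have res_units: "res U H ` units H \<subseteq> units U"
      using v_res[OF U(1-3) _ unramified_inertia[OF sp unr]] U by (auto simp: mem_units)
    have h1: "(\<lambda>_. \<one>\<^sub>C H) \<in> hom (singleton_group (\<one>\<^sub>C H)) (UG H)"
      using subgroup.one_closed[OF units_subgroup[OF U(1)]] by (auto simp: hom_def unit_group_def)
    have h2: "res U H \<in> hom (UG H) (UG U)" unfolding unit_group_def
      by (rule CH.subgrp_hom[OF M.mres_hom[OF U(1-3)] uc(2) res_units])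
    have h3: "?D \<in> hom (UG U) (UG U)" unfolding unit_group_def
      by (rule CU.subgrp_hom[OF Dhom uc(1)]) (use Dunit uc in auto)
    have h4: "ind H U \<in> hom (UG U) (UG H)" unfolding unit_group_def
      by (rule CU.subgrp_hom[OF M.mind_hom[OF U(1-3)] uc(1)]) (use img in simp)
    have h5: "(\<lambda>_. \<one>\<^sub>C H) \<in> hom (UG H) (singleton_group (\<one>\<^sub>C H))"
      by (auto simp: hom_def singleton_group_def)
    have k1: "kernel (UG H) (UG U) (res U H) = (\<lambda>_. \<one>\<^sub>C H) ` carrier (singleton_group (\<one>\<^sub>C H))"
    proof -
      interpret r: group_hom "mobj C H" "mobj C U" "res U H" by (rule res_ghom[OF U(1-3)])
      have "x = \<one>\<^sub>C H" if "x \<in> cc H" "res U H x = \<one>\<^sub>C U" for x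
        using inj_onD[OF res_inj[OF sp unr], of x "\<one>\<^sub>C H"] that by simp
      then show ?thesis using subgroup.one_closed[OF units_subgroup[OF U(1)]]
        by (auto simp: kernel_def unit_group_def)
    qed
    have k2: "kernel (UG U) (UG U) ?D = res U H ` carrier (UG H)"
    proof -
      have "x \<in> units U \<and> ?D x = \<one>\<^sub>C U \<longleftrightarrow> x \<in> res U H ` units H" for x
      proof
        assume x: "x \<in> units U \<and> ?D x = \<one>\<^sub>C U"
        then have xc: "x \<in> cc U" by (simp add: mem_units)
        have "con \<psi> U x = x" using x xc act_closed[OF sp \<phi>H xc] con_eq[OF xc]
          by (metis CU.inv_equality CU.inv_inv C_closed(3) U(2))
        then obtain t where t: "t \<in> cc H" "res U H t = x" using frob_fixed_descent[OF sp unr \<psi> xc] by blast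
        then have "t \<in> units H" using v_res[OF U(1-3) t(1) unramified_inertia[OF sp unr]] x by (simp add: mem_units)
        then show "x \<in> res U H ` units H" using t by blast
      next
        assume "x \<in> res U H ` units H"
        then obtain t where t: "t \<in> units H" "x = res U H t" by blast
        then have tc: "t \<in> cc H" by (simp add: mem_units)
        have "con \<phi> U x = x" using act_res_fixed[OF sp U(1,3) subset_refl \<phi>H tc] t by simp
        then show "x \<in> units U \<and> ?D x = \<one>\<^sub>C U" using t res_units U tc by auto
      qed
      then show ?thesis by (auto simp: kernel_def unit_group_def)
    qed
    have k3: "kernel (UG U) (UG H) (ind H U) = ?D ` carrier (UG U)"
    proof -
      have "x \<in> units U \<and> ind H U x = \<one>\<^sub>C H \<longleftrightarrow> x \<in> ?D ` units U" for x
      proof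
        assume x: "x \<in> units U \<and> ind H U x = \<one>\<^sub>C H"
        then have xc: "x \<in> cc U" by (simp add: mem_units)
        obtain w where w: "w \<in> cc U" "v U w = \<one>\<^bsub>W\<^esub>" "con \<psi> U w = x \<cdot>\<^bsub>U\<^esub> w"
          using hilbert90[OF sp unr \<psi> xc] x by blast
        then have "?D w = x" using con_eq xc by (simp add: CU.m_assoc)
        then show "x \<in> ?D ` units U" using w mem_units by blast
      next
        assume "x \<in> ?D ` units U"
        then obtain w where w: "w \<in> units U" "x = ?D w" by blast
        then have wc: "w \<in> cc U" by (simp add: mem_units)
        interpret i: group_hom "mobj C U" "mobj C H" "ind H U" by (rule ind_ghom[OF U(1-3)])
        have "ind H U (con \<phi> U w) = con \<phi> H (ind H U w)"
          using act_ind[OF sp sp_refl[OF U(1)] U(3) \<phi>H wc] by simp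
        also have "\<dots> = ind H U w" by (rule M.mcon_refl[OF U(1) \<phi>H]) (use wc U in simp)
        finally have "ind H U x = \<one>\<^sub>C H" using w wc act_closed[OF sp \<phi>H wc] by simp
        then show "x \<in> units U \<and> ind H U x = \<one>\<^sub>C H" using Dunit wc w by simp
      qed
      then show ?thesis by (auto simp: kernel_def unit_group_def)
    qed
    have k4: "kernel (UG H) (singleton_group (\<one>\<^sub>C H)) (\<lambda>_. \<one>\<^sub>C H) = ind H U ` carrier (UG U)"
      using img by (auto simp: kernel_def unit_group_def singleton_group_def)
    note g = UG_group[OF U(1)] UG_group[OF U(2)]
    show "exact_seq ([singleton_group (\<one>\<^sub>C H), UG H, UG U, UG U, UG H, singleton_group (\<one>\<^sub>C H)],
            [\<lambda>_. \<one>\<^sub>C H, ind H U, ?D, res U H, \<lambda>_. \<one>\<^sub>C H])"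
      using h1 h2 h3 h4 h5 k1 k2 k3 k4 g
      by (intro exact_seq.extension exact_seq.unity)
        (simp_all add: group_hom_def group_hom_axioms_def)
  qed
qed

end

section \<open>The group of \<open>P\<close>-adic integers\<close>

lemma padic_carrierD:
  assumes "z \<in> padic_carrier p" "p > 0"
  shows "0 \<le> z k" "z k < int (p ^ k)" "z (k + a) mod int (p ^ k) = z k"
proof -
  have r: "0 \<le> z k \<and> z k < int (p ^ k)" for k
    using assms by (auto simp: padic_carrier_def PiE_def Pi_def carrier_integer_mod_group split: if_splits)
  show "0 \<le> z k" "z k < int (p ^ k)" using r by auto
  show "z (k + a) mod int (p ^ k) = z k"
  proof (induction a)
    case 0 show ?case using r by simp
  next
    case (Suc a)
    have "z (Suc (k + a)) mod int (p ^ (k + a)) = z (k + a)" using assms by (simp add: padic_carrier_def)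
    moreover have "int (p ^ k) dvd int (p ^ (k + a))" by (simp add: le_imp_power_dvd)
    ultimately have "z (Suc (k + a)) mod int (p ^ k) = z (k + a) mod int (p ^ k)"
      by (metis mod_mod_cancel)
    then show ?case using Suc by simp
  qed
qed

text \<open>Write \<open>n = p ^ a * q\<close> with \<open>q\<close> prime to \<open>p\<close>. The
  hypothesis at level \<open>k + a\<close> loses \<open>a\<close> powers of \<open>p\<close> and
  still gives divisibility by \<open>p ^ k\<close>, which determines the coordinate at level
  \<open>k\<close>.\<close>

lemma padic_torsion_free:
  assumes z: "z \<in> padic_carrier p" and p: "prime p" and n: "n > 0"
    and zero: "\<And>k. int n * z k mod int (p ^ k) = 0"
  shows "z k = 0"
proof -
  have p0: "p > 0" using prime_gt_0_nat[OF p] .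
  define q where "q = n div p ^ multiplicity p n"
  have q: "n = p ^ multiplicity p n * q" "\<not> p dvd q"
    using multiplicity_decompose[of n p] n prime_gt_1_nat[OF p] by (simp_all add: q_def multiplicity_dvd)
  define a where "a = multiplicity p n"
  have "int (p ^ (a + k)) dvd int n * z (k + a)" using zero[of "k + a"] by (simp add: mod_eq_0_iff_dvd add.commute)
  then have "int (p ^ a) * int (p ^ k) dvd int (p ^ a) * (int q * z (k + a))"
    using arg_cong[OF q(1), of int] by (simp add: a_def[symmetric] power_add mult.assoc)
  then have "int (p ^ k) dvd int q * z (k + a)" using p0 by simp
  moreover have "coprime (int (p ^ k)) (int q)"
    using q(2) p by (simp add: prime_imp_coprime)
  ultimately have "int (p ^ k) dvd z (k + a)" using coprime_dvd_mult_right_iff by blast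
  then show ?thesis using padic_carrierD(3)[OF z p0, of k a] by simp
qed

context
  fixes P :: "nat set" and W :: "'w monoid" and \<psi>
  assumes P: "\<And>p. p \<in> P \<Longrightarrow> prime p" and W: "group W"
    and iso: "\<psi> \<in> iso W (ZP_group P)"
begin

interpretation W: group W by (rule W)

lemma ZP_carrier: "x \<in> carrier W \<Longrightarrow> p \<in> P \<Longrightarrow> \<psi> x p \<in> padic_carrier p"
  using iso by (auto simp: iso_def hom_def ZP_group_def padic_group_def PiE_def Pi_def)

lemma ZP_mult:
  assumes "x \<in> carrier W" "y \<in> carrier W" "p \<in> P"
  shows "\<psi> (x \<otimes>\<^bsub>W\<^esub> y) p k = (\<psi> x p k + \<psi> y p k) mod int (p ^ k)"
proof -
  have "\<psi> (x \<otimes>\<^bsub>W\<^esub> y) = \<psi> x \<otimes>\<^bsub>ZP_group P\<^esub> \<psi> y" using iso assms by (auto simp: iso_def hom_def)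
  then show ?thesis using assms by (simp add: ZP_group_def padic_group_def product_group_def)
qed

lemma ZP_eqI:
  assumes "x \<in> carrier W" "y \<in> carrier W" "\<And>p k. p \<in> P \<Longrightarrow> \<psi> x p k = \<psi> y p k"
  shows "x = y"
proof -
  have inj: "inj_on \<psi> (carrier W)" using iso by (auto simp: iso_def bij_betw_def)
  have "\<psi> x \<in> carrier (ZP_group P)" "\<psi> y \<in> carrier (ZP_group P)" using iso assms by (auto simp: iso_def hom_def)
  then have "\<psi> x \<in> extensional P" "\<psi> y \<in> extensional P" by (auto simp: ZP_group_def PiE_def)
  then have "\<psi> x = \<psi> y" by (rule extensionalityI) (use assms in auto)
  then show ?thesis using inj_onD[OF inj] assms by blast
qed

lemma ZP_pow:
  assumes "x \<in> carrier W" "p \<in> P"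
  shows "\<psi> (x [^]\<^bsub>W\<^esub> n) p k = int n * \<psi> x p k mod int (p ^ k)"
proof (induction n)
  case 0
  have p0: "p > 0" using P[OF assms(2)] prime_gt_0_nat by blast
  note b = padic_carrierD[OF ZP_carrier[OF W.one_closed assms(2)] p0]
  \<comment> \<open>The coordinate of the unit is idempotent for addition modulo
    \<open>p ^ k\<close>, hence 0.\<close>
  have "\<psi> \<one>\<^bsub>W\<^esub> p k = (\<psi> \<one>\<^bsub>W\<^esub> p k + \<psi> \<one>\<^bsub>W\<^esub> p k) mod int (p ^ k)" using ZP_mult[of "\<one>\<^bsub>W\<^esub>" "\<one>\<^bsub>W\<^esub>"] assms by simp
  then have "(\<psi> \<one>\<^bsub>W\<^esub> p k + \<psi> \<one>\<^bsub>W\<^esub> p k) mod int (p ^ k) = \<psi> \<one>\<^bsub>W\<^esub> p k mod int (p ^ k)" using b(1,2)[of k] by simp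
  then have "int (p ^ k) dvd \<psi> \<one>\<^bsub>W\<^esub> p k" by (simp add: mod_eq_dvd_iff)
  then have "\<psi> \<one>\<^bsub>W\<^esub> p k = 0" using b(1,2)[of k] by (metis zdvd_not_zless order_le_less)
  then show ?case by simp
next
  case (Suc n)
  have "\<psi> (x [^]\<^bsub>W\<^esub> Suc n) p k = (int n * \<psi> x p k mod int (p ^ k) + \<psi> x p k) mod int (p ^ k)"
    using ZP_mult[of "x [^]\<^bsub>W\<^esub> n" x] assms Suc by simp
  then show ?case by (simp add: mod_simps distrib_right add.commute)
qed

lemma ZP_comm: "comm_group W"
proof (rule W.group_comm_groupI)
  fix x y assume "x \<in> carrier W" "y \<in> carrier W"
  then show "x \<otimes>\<^bsub>W\<^esub> y = y \<otimes>\<^bsub>W\<^esub> x" by (intro ZP_eqI) (auto simp: ZP_mult add.commute)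
qed

lemma ZP_torsion_free:
  assumes "x \<in> carrier W" "n > 0" "x [^]\<^bsub>W\<^esub> (n::nat) = \<one>\<^bsub>W\<^esub>" shows "x = \<one>\<^bsub>W\<^esub>"
proof (rule ZP_eqI)
  fix p k assume p: "p \<in> P"
  have one: "\<psi> \<one>\<^bsub>W\<^esub> p k = 0" for k using ZP_pow[OF assms(1) p, of 0 k] by simp
  have "\<psi> x p k = 0"
  proof (rule padic_torsion_free[OF ZP_carrier[OF assms(1) p] P[OF p] assms(2)])
    show "int n * \<psi> x p k mod int (p ^ k) = 0" for k using ZP_pow[OF assms(1) p, of n k] assms one by simp
  qed
  then show "\<psi> x p k = \<psi> \<one>\<^bsub>W\<^esub> p k" using one by simp
qed (use assms in auto)

text \<open>The element with all coordinates 1 is not 0 modulo \<open>p\<close>, whereas a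
  \<open>p\<close>-th power is.\<close>

lemma ZP_not_divisible:
  assumes p: "p \<in> P" shows "(\<lambda>x. x [^]\<^bsub>W\<^esub> p) ` carrier W \<noteq> carrier W"
proof
  assume eq: "(\<lambda>x. x [^]\<^bsub>W\<^esub> p) ` carrier W = carrier W"
  define e where "e = (\<lambda>q\<in>P. \<lambda>k. 1 mod int (q ^ k))"
  have "(\<lambda>k. 1 mod int (q ^ k)) \<in> padic_carrier q" if "q \<in> P" for q
  proof -
    have q: "q > 0" using P[OF that] prime_gt_0_nat by blast
    have "1 mod int (q ^ Suc n) mod int (q ^ n) = 1 mod int (q ^ n)" for n
      by (rule mod_mod_cancel) simp
    then show ?thesis using q by (auto simp: padic_carrier_def carrier_integer_mod_group PiE_iff)
  qed
  then have "e \<in> carrier (ZP_group P)" by (auto simp: ZP_group_def padic_group_def e_def)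
  moreover have "\<psi> ` carrier W = carrier (ZP_group P)" using iso by (simp add: iso_def bij_betw_def)
  ultimately obtain x where x: "x \<in> carrier W" "\<psi> x = e" by (metis imageE)
  obtain y where y: "y \<in> carrier W" "x = y [^]\<^bsub>W\<^esub> p" using eq x by (metis imageE)
  have "\<psi> x p 1 = 0" using ZP_pow[OF y(1) p, of p 1] y by simp
  moreover have "\<psi> x p 1 = 1" using x p prime_gt_1_nat[OF P[OF p]] by (simp add: e_def)
  ultimately show False by simp
qed

end

lemma ZP_Hausdorff:
  assumes homeo: "homeomorphic_map S (ZP_topology P) \<psi>" shows "Hausdorff_space S"
proof -
  have "Hausdorff_space (padic_topology p)" for p
    unfolding padic_topology_def by (intro Hausdorff_space_subtopology) (simp add: Hausdorff_space_product_topology)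
  then have "Hausdorff_space (ZP_topology P)" by (simp add: ZP_topology_def Hausdorff_space_product_topology)
  then show ?thesis using homeomorphic_Hausdorff_space homeomorphic_map_imp_homeomorphic_space[OF homeo] by blast
qed

section \<open>Class field theory\<close>

context degree_map
begin

text \<open>The laws of the source functor are transported along the bijection from those of the target,
  so that no identity for transfers has to be verified by hand.\<close>

lemma spectrum_isomorphism_transport:
  assumes \<Psi>: "spectrum_functor G T \<Psi>"
    and cg: "\<And>H U. sp H U \<Longrightarrow> comm_group (sobj \<Phi> H U)"
    and hom: "\<And>H U. sp H U \<Longrightarrow> \<eta> H U \<in> hom (sobj \<Phi> H U) (sobj \<Psi> H U)"
    and bij: "\<And>H U. sp H U \<Longrightarrow> bij_betw (\<eta> H U) (carrier (sobj \<Phi> H U)) (carrier (sobj \<Psi> H U))"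
    and res: "\<And>H U I x. sp H U \<Longrightarrow> sp I U \<Longrightarrow> I \<subseteq> H \<Longrightarrow> x \<in> carrier (sobj \<Phi> H U) \<Longrightarrow>
        sres \<Phi> I H U x \<in> carrier (sobj \<Phi> I U) \<and> \<eta> I U (sres \<Phi> I H U x) = sres \<Psi> I H U (\<eta> H U x)"
    and ind: "\<And>H U I V x. sp H U \<Longrightarrow> sp I V \<Longrightarrow> I \<subseteq> H \<Longrightarrow> V \<subseteq> U \<Longrightarrow> x \<in> carrier (sobj \<Phi> I V) \<Longrightarrow>
        sind \<Phi> H U I V x \<in> carrier (sobj \<Phi> H U) \<and> \<eta> H U (sind \<Phi> H U I V x) = sind \<Psi> H U I V (\<eta> I V x)"
    and con: "\<And>H U g x. sp H U \<Longrightarrow> g \<in> carrier G \<Longrightarrow> x \<in> carrier (sobj \<Phi> H U) \<Longrightarrow>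
        scon \<Phi> g H U x \<in> carrier (sobj \<Phi> (conj_set G g H) (conj_set G g U)) \<and>
        \<eta> (conj_set G g H) (conj_set G g U) (scon \<Phi> g H U x) = scon \<Psi> g H U (\<eta> H U x)"
  shows "spectrum_isomorphism G T \<Phi> \<Psi> \<eta>"
proof -
  interpret \<Psi>: spectrum_functor G T \<Psi> by (rule \<Psi>)
  have inj: "x = y" if "sp H U" "x \<in> carrier (sobj \<Phi> H U)" "y \<in> carrier (sobj \<Phi> H U)" "\<eta> H U x = \<eta> H U y" for H U x y
    using bij[OF that(1)] that(2-) by (auto simp: bij_betw_def dest: inj_onD)
  have cl: "\<eta> H U x \<in> carrier (sobj \<Psi> H U)" if "sp H U" "x \<in> carrier (sobj \<Phi> H U)" for H U x
    using hom[OF that(1)] that(2) by (auto simp: hom_def)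
  have mult: "\<eta> H U (x \<otimes>\<^bsub>sobj \<Phi> H U\<^esub> y) = \<eta> H U x \<otimes>\<^bsub>sobj \<Psi> H U\<^esub> \<eta> H U y"
    if "sp H U" "x \<in> carrier (sobj \<Phi> H U)" "y \<in> carrier (sobj \<Phi> H U)" for H U x y
    using hom[OF that(1)] that(2-) by (auto simp: hom_def)
  have mcl: "x \<otimes>\<^bsub>sobj \<Phi> H U\<^esub> y \<in> carrier (sobj \<Phi> H U)"
    if "sp H U" "x \<in> carrier (sobj \<Phi> H U)" "y \<in> carrier (sobj \<Phi> H U)" for H U x y
    using comm_groupE(1)[OF cg[OF that(1)]] that by blast
  have self: "conj_set G h H = H \<and> conj_set G h U = U" if "sp H U" "h \<in> H" for H U h
    using opn_conj_set_self[OF spD(1)[OF that(1)] that(2)] sp_conj_set[OF that] by simp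
  have cconj: "conj_set G g' (conj_set G g H) = conj_set G (g' \<otimes> g) H" if "opn H" "g \<in> carrier G" "g' \<in> carrier G" for g g' H
    using conj_set_conj_set[OF opn_subset[OF that(1)] that(3,2)] .
  \<comment> \<open>A map corresponding to a homomorphism under \<open>\<eta>\<close> is one, by
    injectivity; the remaining laws are transferred in the same manner.\<close>
  have homI: "F \<in> hom (sobj \<Phi> H U) (sobj \<Phi> I V)"
    if s1: "sp H U" and s2: "sp I V" and F': "F' \<in> hom (sobj \<Psi> H U) (sobj \<Psi> I V)"
      and F: "\<And>x. x \<in> carrier (sobj \<Phi> H U) \<Longrightarrow> F x \<in> carrier (sobj \<Phi> I V) \<and> \<eta> I V (F x) = F' (\<eta> H U x)"
    for F F' H U I V
  proof -
    have "F (x \<otimes>\<^bsub>sobj \<Phi> H U\<^esub> y) = F x \<otimes>\<^bsub>sobj \<Phi> I V\<^esub> F y" if xy: "x \<in> carrier (sobj \<Phi> H U)" "y \<in> carrier (sobj \<Phi> H U)" for x y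
    proof (rule inj[OF s2])
      have "F' (\<eta> H U x \<otimes>\<^bsub>sobj \<Psi> H U\<^esub> \<eta> H U y) = F' (\<eta> H U x) \<otimes>\<^bsub>sobj \<Psi> I V\<^esub> F' (\<eta> H U y)"
        using F' cl[OF s1] xy by (auto simp: hom_def)
      then show "\<eta> I V (F (x \<otimes>\<^bsub>sobj \<Phi> H U\<^esub> y)) = \<eta> I V (F x \<otimes>\<^bsub>sobj \<Phi> I V\<^esub> F y)"
        using xy F mcl[OF s1] mult[OF s1] mult[OF s2] by simp
    qed (use xy F mcl[OF s1] mcl[OF s2] in auto)
    then show ?thesis using F by (auto simp: hom_def)
  qed
  have \<Phi>: "spectrum_functor G T \<Phi>"
  proof (rule spectrum_functor.intro)
    show "comm_group (sobj \<Phi> H U)" if "sp H U" for H U by (rule cg[OF that])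
    show "sres \<Phi> I H U \<in> hom (sobj \<Phi> H U) (sobj \<Phi> I U)" if "sp H U" "sp I U" "I \<subseteq> H" for H U I
      by (rule homI[OF that(1,2) \<Psi>.sres_hom[OF that] res[OF that]])
    show "sind \<Phi> H U I V \<in> hom (sobj \<Phi> I V) (sobj \<Phi> H U)" if "sp H U" "sp I V" "I \<subseteq> H" "V \<subseteq> U" for H U I V
      by (rule homI[OF that(2,1) \<Psi>.sind_hom[OF that] ind[OF that]])
    show "scon \<Phi> g H U \<in> hom (sobj \<Phi> H U) (sobj \<Phi> (conj_set G g H) (conj_set G g U))" if "sp H U" "g \<in> carrier G" for H U g
      by (rule homI[OF that(1) sp_conj[OF that] \<Psi>.scon_hom[OF that] con[OF that]])
    show "sres \<Phi> H H U x = x" if "sp H U" "x \<in> carrier (sobj \<Phi> H U)" for H U x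
      using res[OF that(1,1) subset_refl that(2)] \<Psi>.sres_refl[OF that(1) cl[OF that]] inj[OF that(1) _ that(2)] by simp
    show "sind \<Phi> H U H U x = x" if "sp H U" "x \<in> carrier (sobj \<Phi> H U)" for H U x
      using ind[OF that(1,1) subset_refl subset_refl that(2)] \<Psi>.sind_refl[OF that(1) cl[OF that]] inj[OF that(1) _ that(2)] by simp
    show "scon \<Phi> h H U x = x" if "sp H U" "h \<in> H" "x \<in> carrier (sobj \<Phi> H U)" for H U h x
      using con[OF that(1) opn_carrier[OF spD(1)[OF that(1)] that(2)] that(3)] self[OF that(1,2)]
        \<Psi>.scon_refl[OF that(1,2) cl[OF that(1,3)]] inj[OF that(1) _ that(3)] by simp
    show "sres \<Phi> J I U (sres \<Phi> I H U x) = sres \<Phi> J H U x"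
      if s: "sp H U" "sp I U" "sp J U" "J \<subseteq> I" "I \<subseteq> H" "x \<in> carrier (sobj \<Phi> H U)" for H U I J x
    proof -
      note r1 = res[OF s(1,2,5,6)]
      note r2 = res[OF s(2,3,4) conjunct1[OF r1]]
      note r3 = res[OF s(1,3) subset_trans[OF s(4,5)] s(6)]
      show ?thesis using r1 r2 r3 \<Psi>.sres_trans[OF s(1-5) cl[OF s(1,6)]] by (intro inj[OF s(3)]) simp_all
    qed
    show "sind \<Phi> H U I V (sind \<Phi> I V J Wa x) = sind \<Phi> H U J Wa x"
      if s: "sp H U" "sp I V" "sp J Wa" "J \<subseteq> I" "I \<subseteq> H" "Wa \<subseteq> V" "V \<subseteq> U" "x \<in> carrier (sobj \<Phi> J Wa)"
      for H U I V J Wa x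
    proof -
      note r1 = ind[OF s(2,3,4,6,8)]
      note r2 = ind[OF s(1,2,5,7) conjunct1[OF r1]]
      note r3 = ind[OF s(1,3) subset_trans[OF s(4,5)] subset_trans[OF s(6,7)] s(8)]
      show ?thesis using r1 r2 r3 \<Psi>.sind_trans[OF s(1-7) cl[OF s(3,8)]] by (intro inj[OF s(1)]) simp_all
    qed
    show "scon \<Phi> g' (conj_set G g H) (conj_set G g U) (scon \<Phi> g H U x) = scon \<Phi> (g' \<otimes> g) H U x"
      if s: "sp H U" "g \<in> carrier G" "g' \<in> carrier G" "x \<in> carrier (sobj \<Phi> H U)" for H U g g' x
    proof -
      note r1 = con[OF s(1,2,4)]
      note r2 = con[OF sp_conj[OF s(1,2)] s(3) conjunct1[OF r1]]
      note r3 = con[OF s(1) m_closed[OF s(3,2)] s(4)]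
      note cc = cconj[OF spD(1)[OF s(1)] s(2,3)] cconj[OF spD(2)[OF s(1)] s(2,3)]
      show ?thesis using r1 r2 r3 \<Psi>.scon_trans[OF s(1-3) cl[OF s(1,4)]]
        by (intro inj[OF sp_conj[OF s(1) m_closed[OF s(3,2)]]]) (simp_all add: cc)
    qed
    show "scon \<Phi> g I U (sres \<Phi> I H U x) = sres \<Phi> (conj_set G g I) (conj_set G g H) (conj_set G g U) (scon \<Phi> g H U x)"
      if s: "sp H U" "sp I U" "I \<subseteq> H" "g \<in> carrier G" "x \<in> carrier (sobj \<Phi> H U)" for H U I g x
    proof -
      note r1 = res[OF s(1,2,3,5)]
      note r2 = con[OF s(2,4) conjunct1[OF r1]]
      note r3 = con[OF s(1,4,5)]
      note r4 = res[OF sp_conj[OF s(1,4)] sp_conj[OF s(2,4)] conj_set_mono[OF s(3)] conjunct1[OF r3]]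
      show ?thesis using r1 r2 r3 r4 \<Psi>.scon_sres[OF s(1-4) cl[OF s(1,5)]]
        by (intro inj[OF sp_conj[OF s(2,4)]]) simp_all
    qed
    show "scon \<Phi> g H U (sind \<Phi> H U I V x) =
        sind \<Phi> (conj_set G g H) (conj_set G g U) (conj_set G g I) (conj_set G g V) (scon \<Phi> g I V x)"
      if s: "sp H U" "sp I V" "I \<subseteq> H" "V \<subseteq> U" "g \<in> carrier G" "x \<in> carrier (sobj \<Phi> I V)" for H U I V g x
    proof -
      note r1 = ind[OF s(1-4,6)]
      note r2 = con[OF s(1,5) conjunct1[OF r1]]
      note r3 = con[OF s(2,5,6)]
      note r4 = ind[OF sp_conj[OF s(1,5)] sp_conj[OF s(2,5)] conj_set_mono[OF s(3)] conj_set_mono[OF s(4)] conjunct1[OF r3]]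
      show ?thesis using r1 r2 r3 r4 \<Psi>.scon_sind[OF s(1-5) cl[OF s(2,6)]]
        by (intro inj[OF sp_conj[OF s(1,5)]]) simp_all
    qed
  qed
  define \<theta> where "\<theta> H U = the_inv_into (carrier (sobj \<Phi> H U)) (\<eta> H U)" for H U
  have \<theta>\<eta>: "\<theta> H U (\<eta> H U x) = x" if "sp H U" "x \<in> carrier (sobj \<Phi> H U)" for H U x
    unfolding \<theta>_def by (rule the_inv_into_f_f) (use bij[OF that(1)] that(2) in \<open>auto simp: bij_betw_def\<close>)
  have \<eta>\<theta>: "\<eta> H U (\<theta> H U y) = y" if "sp H U" "y \<in> carrier (sobj \<Psi> H U)" for H U y
    unfolding \<theta>_def by (rule f_the_inv_into_f_bij_betw[OF bij[OF that(1)]]) (use that(2) in simp)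
  have \<theta>cl: "\<theta> H U y \<in> carrier (sobj \<Phi> H U)" if "sp H U" "y \<in> carrier (sobj \<Psi> H U)" for H U y
    unfolding \<theta>_def using bij_betw_the_inv_into[OF bij[OF that(1)]] that(2) by (auto simp: bij_betw_def)
  have "spectrum_morphism G T \<Phi> \<Psi> \<eta>" unfolding spectrum_morphism_def
    using \<Phi> \<Psi> hom res ind con by blast
  moreover have "spectrum_morphism G T \<Psi> \<Phi> \<theta>" unfolding spectrum_morphism_def
  proof (intro conjI allI impI ballI \<Phi> \<Psi>)
    show "\<theta> H U \<in> hom (sobj \<Psi> H U) (sobj \<Phi> H U)" if s: "sp H U" for H U
    proof -
      interpret A: comm_group "sobj \<Psi> H U" by (rule \<Psi>.comm_group_sobj[OF s])
      have "\<theta> H U (x \<otimes>\<^bsub>sobj \<Psi> H U\<^esub> y) = \<theta> H U x \<otimes>\<^bsub>sobj \<Phi> H U\<^esub> \<theta> H U y"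
        if "x \<in> carrier (sobj \<Psi> H U)" "y \<in> carrier (sobj \<Psi> H U)" for x y
        using that by (intro inj[OF s]) (simp_all add: \<theta>cl[OF s] mcl[OF s] mult[OF s] \<eta>\<theta>[OF s])
      then show ?thesis using \<theta>cl[OF s] by (auto simp: hom_def)
    qed
    show "\<theta> I U (sres \<Psi> I H U x) = sres \<Phi> I H U (\<theta> H U x)"
      if s: "sp H U \<and> sp I U \<and> I \<subseteq> H" "x \<in> carrier (sobj \<Psi> H U)" for H U I x
    proof -
      have s': "sp H U" "sp I U" "I \<subseteq> H" using s by auto
      note r = res[OF s' \<theta>cl[OF s'(1) s(2)]]
      show ?thesis using \<theta>\<eta>[OF s'(2) conjunct1[OF r]] conjunct2[OF r] \<eta>\<theta>[OF s'(1) s(2)] by simp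
    qed
    show "\<theta> H U (sind \<Psi> H U I V x) = sind \<Phi> H U I V (\<theta> I V x)"
      if s: "sp H U \<and> sp I V \<and> I \<subseteq> H \<and> V \<subseteq> U" "x \<in> carrier (sobj \<Psi> I V)" for H U I V x
    proof -
      have s': "sp H U" "sp I V" "I \<subseteq> H" "V \<subseteq> U" using s by auto
      note r = ind[OF s' \<theta>cl[OF s'(2) s(2)]]
      show ?thesis using \<theta>\<eta>[OF s'(1) conjunct1[OF r]] conjunct2[OF r] \<eta>\<theta>[OF s'(2) s(2)] by simp
    qed
    show "\<theta> (conj_set G g H) (conj_set G g U) (scon \<Psi> g H U x) = scon \<Phi> g H U (\<theta> H U x)"
      if s: "sp H U \<and> g \<in> carrier G" "x \<in> carrier (sobj \<Psi> H U)" for H U g x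
    proof -
      have s': "sp H U" "g \<in> carrier G" using s by auto
      note r = con[OF s' \<theta>cl[OF s'(1) s(2)]]
      show ?thesis using \<theta>\<eta>[OF sp_conj[OF s'] conjunct1[OF r]] conjunct2[OF r] \<eta>\<theta>[OF s'(1) s(2)] by simp
    qed
  qed
  ultimately show ?thesis unfolding spectrum_isomorphism_def using \<theta>\<eta> \<eta>\<theta> by blast
qed

end

section \<open>The Tate functor on the spectrum\<close>

context cft
begin

abbreviation "nc \<equiv> norm_class C"
abbreviation "tate \<equiv> tate_functor G C"

lemma tate_sobj: "sobj tate H U = mobj C H Mod Nm H U"
  by (simp add: tate_functor_def)

lemma pi_sobj: "sobj (pi_functor G) H U = Ab H U"
  by (simp add: pi_functor_def)

lemma tate_comm: assumes sp: "sp H U" shows "comm_group (sobj tate H U)"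
  unfolding tate_sobj using comm_group.abelian_FactGroup[OF cg Nm_subgroup] spD[OF sp] by blast

lemma tate_carrier: "carrier (sobj tate H U) = nc H U ` cc H"
  unfolding tate_sobj carrier_FactGroup norm_class_def ..

lemma nc_mult:
  assumes sp: "sp H U" and "x \<in> cc H" "y \<in> cc H"
  shows "nc H U (x \<cdot>\<^bsub>H\<^esub> y) = nc H U x \<otimes>\<^bsub>sobj tate H U\<^esub> nc H U y"
proof -
  note U = spD[OF sp]
  interpret N: normal "Nm H U" "mobj C H"
    by (rule comm_group.subgroup_imp_normal[OF cg[OF U(1)] Nm_subgroup[OF U(1-3)]])
  show ?thesis using N.r_coset_hom_Mod assms(2,3) unfolding norm_class_def tate_sobj hom_def by blast
qed

text \<open>\<open>F\<close> sends a whole class modulo norms into one class, so the set under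
  \<open>the_elem\<close> is a singleton. The three structure maps of the target functor are
  instances.\<close>

lemma the_elem_class:
  assumes U: "sp H U" and V: "sp I V" and F: "F \<in> hom (mobj C H) (mobj C I)" and N: "\<And>\<nu>. \<nu> \<in> Nm H U \<Longrightarrow> F \<nu> \<in> Nm I V"
    and y: "y \<in> cc H"
  shows "the_elem ((\<lambda>x. nc I V (F x)) ` nc H U y) = nc I V (F y)"
proof -
  note HU = spD[OF U] and IV = spD[OF V]
  interpret H: comm_group "mobj C H" by (rule cg[OF HU(1)])
  interpret I: comm_group "mobj C I" by (rule cg[OF IV(1)])
  have Fc: "F x \<in> cc I" if "x \<in> cc H" for x using F that by (auto simp: hom_def)
  have "nc I V (F x) = nc I V (F y)" if x: "x \<in> nc H U y" for x
  proof -
    obtain \<nu> where \<nu>: "\<nu> \<in> Nm H U" "x = \<nu> \<cdot>\<^bsub>H\<^esub> y" using x by (auto simp: norm_class_def r_coset_def)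
    have \<nu>c: "\<nu> \<in> cc H" using Nm_carrier[OF HU(1-3) \<nu>(1)] .
    have "F x = F \<nu> \<cdot>\<^bsub>I\<^esub> F y" using F \<nu> \<nu>c y by (auto simp: hom_def)
    then have "F x \<cdot>\<^bsub>I\<^esub> invC I (F y) = F \<nu>" using Fc \<nu>c y by (simp add: I.m_assoc)
    then show ?thesis using norm_class_eq_iff[OF IV(1-3), of "F x" "F y"] Fc \<nu>c \<nu> y N by auto
  qed
  moreover have "y \<in> nc H U y" unfolding norm_class_def
    using H.rcos_self[OF y Nm_subgroup[OF HU(1-3)]] .
  ultimately have "(\<lambda>x. nc I V (F x)) ` nc H U y = {nc I V (F y)}" by blast
  then show ?thesis by simp
qed

lemma tate_res: "sp H U \<Longrightarrow> sp I U \<Longrightarrow> I \<subseteq> H \<Longrightarrow> y \<in> cc H \<Longrightarrow> sres tate I H U (nc H U y) = nc I U (res I H y)"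
  using the_elem_class[of H U I U "res I H" y] M.mres_hom[of H I] Nm_res[of H U I] spD
  by (simp add: tate_functor_def)

lemma tate_ind: "sp H U \<Longrightarrow> sp I V \<Longrightarrow> I \<subseteq> H \<Longrightarrow> V \<subseteq> U \<Longrightarrow> y \<in> cc I \<Longrightarrow>
    sind tate H U I V (nc I V y) = nc H U (ind H I y)"
  using the_elem_class[of I V H U "ind H I" y] M.mind_hom[of H I] Nm_ind[of H I U V] spD
  by (simp add: tate_functor_def)

lemma tate_con: "sp H U \<Longrightarrow> g \<in> carrier G \<Longrightarrow> y \<in> cc H \<Longrightarrow>
    scon tate g H U (nc H U y) = nc (conj_set G g H) (conj_set G g U) (con g H y)"
  using the_elem_class[OF _ sp_conj, of H U H U g "con g H" y] M.mcon_hom[of H g] Nm_con[of H U g] spD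
  by (simp add: tate_functor_def)

lemma tate_hom:
  assumes U: "sp H U" and V: "sp I V" and F: "F \<in> hom (mobj C H) (mobj C I)"
    and t: "\<And>y. y \<in> cc H \<Longrightarrow> t (nc H U y) = nc I V (F y)"
  shows "t \<in> hom (sobj tate H U) (sobj tate I V)"
  unfolding hom_def mem_Collect_eq
proof (intro conjI ballI funcsetI)
  have Fc: "F x \<in> cc I" if "x \<in> cc H" for x using F that by (auto simp: hom_def)
  show "t X \<in> carrier (sobj tate I V)" if "X \<in> carrier (sobj tate H U)" for X
    using that t Fc by (auto simp: tate_carrier)
  fix X Y assume "X \<in> carrier (sobj tate H U)" "Y \<in> carrier (sobj tate H U)"
  then obtain x y where x: "x \<in> cc H" "X = nc H U x" "y \<in> cc H" "Y = nc H U y" by (auto simp: tate_carrier)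
  have "t (X \<otimes>\<^bsub>sobj tate H U\<^esub> Y) = nc I V (F (x \<cdot>\<^bsub>H\<^esub> y))"
    unfolding x(2,4) nc_mult[OF U x(1,3), symmetric] using x by (intro t C_closed(1)[OF spD(1)[OF U]])
  also have "F (x \<cdot>\<^bsub>H\<^esub> y) = F x \<cdot>\<^bsub>I\<^esub> F y" using F x by (auto simp: hom_def)
  finally show "t (X \<otimes>\<^bsub>sobj tate H U\<^esub> Y) = t X \<otimes>\<^bsub>sobj tate I V\<^esub> t Y"
    using x t nc_mult[OF V Fc Fc] by simp
qed

lemma tate_functor: "spectrum_functor G T tate"
proof (rule spectrum_functor.intro)
  show "comm_group (sobj tate H U)" if "sp H U" for H U by (rule tate_comm[OF that])
  show "sres tate I H U \<in> hom (sobj tate H U) (sobj tate I U)" if s: "sp H U" "sp I U" "I \<subseteq> H" for H U I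
    by (rule tate_hom[OF s(1,2) M.mres_hom[OF spD(1)[OF s(1)] spD(1)[OF s(2)] s(3)] tate_res[OF s]])
  show "sind tate H U I V \<in> hom (sobj tate I V) (sobj tate H U)" if s: "sp H U" "sp I V" "I \<subseteq> H" "V \<subseteq> U" for H U I V
    by (rule tate_hom[OF s(2,1) M.mind_hom[OF spD(1)[OF s(1)] spD(1)[OF s(2)] s(3)] tate_ind[OF s]])
  show "scon tate g H U \<in> hom (sobj tate H U) (sobj tate (conj_set G g H) (conj_set G g U))"
    if s: "sp H U" "g \<in> carrier G" for H U g
    by (rule tate_hom[OF s(1) sp_conj[OF s] M.mcon_hom[OF spD(1)[OF s(1)] s(2)] tate_con[OF s]])
  show "sres tate H H U X = X" if s: "sp H U" "X \<in> carrier (sobj tate H U)" for H U X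
    using s tate_res[OF s(1,1)] M.mres_refl spD(1)[OF s(1)] by (auto simp: tate_carrier)
  show "sind tate H U H U X = X" if s: "sp H U" "X \<in> carrier (sobj tate H U)" for H U X
    using s tate_ind[OF s(1,1)] M.mind_refl spD(1)[OF s(1)] by (auto simp: tate_carrier)
  show "scon tate h H U X = X" if s: "sp H U" "h \<in> H" "X \<in> carrier (sobj tate H U)" for H U h X
    using s tate_con[OF s(1)] M.mcon_refl spD(1)[OF s(1)] opn_carrier[OF spD(1)[OF s(1)] s(2)]
      opn_conj_set_self[OF spD(1)[OF s(1)] s(2)] sp_conj_set[OF s(1,2)] by (auto simp: tate_carrier)
  show "sres tate J I U (sres tate I H U X) = sres tate J H U X"
    if s: "sp H U" "sp I U" "sp J U" "J \<subseteq> I" "I \<subseteq> H" "X \<in> carrier (sobj tate H U)" for H U I J X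
  proof -
    note o = spD(1)[OF s(1)] spD(1)[OF s(2)] spD(1)[OF s(3)]
    obtain x where x: "x \<in> cc H" "X = nc H U x" using s by (auto simp: tate_carrier)
    show ?thesis using tate_res[OF s(1,2,5) x(1)] tate_res[OF s(2,3,4) res_closed[OF o(1,2) s(5) x(1)]]
      tate_res[OF s(1,3) subset_trans[OF s(4,5)] x(1)] M.mres_trans[OF o s(4,5) x(1)] x(2) by simp
  qed
  show "sind tate H U I V (sind tate I V J Wa X) = sind tate H U J Wa X"
    if s: "sp H U" "sp I V" "sp J Wa" "J \<subseteq> I" "I \<subseteq> H" "Wa \<subseteq> V" "V \<subseteq> U" "X \<in> carrier (sobj tate J Wa)"
    for H U I V J Wa X
  proof -
    note o = spD(1)[OF s(1)] spD(1)[OF s(2)] spD(1)[OF s(3)]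
    obtain x where x: "x \<in> cc J" "X = nc J Wa x" using s by (auto simp: tate_carrier)
    show ?thesis using tate_ind[OF s(2,3,4,6) x(1)] tate_ind[OF s(1,2,5,7) ind_closed[OF o(2,3) s(4) x(1)]]
      tate_ind[OF s(1,3) subset_trans[OF s(4,5)] subset_trans[OF s(6,7)] x(1)] M.mind_trans[OF o s(4,5) x(1)] x(2) by simp
  qed
  show "scon tate g' (conj_set G g H) (conj_set G g U) (scon tate g H U X) = scon tate (g' \<otimes> g) H U X"
    if s: "sp H U" "g \<in> carrier G" "g' \<in> carrier G" "X \<in> carrier (sobj tate H U)" for H U g g' X
  proof -
    note U = spD[OF s(1)]
    obtain x where x: "x \<in> cc H" "X = nc H U x" using s by (auto simp: tate_carrier)
    show ?thesis using tate_con[OF s(1,2) x(1)] tate_con[OF sp_conj[OF s(1,2)] s(3) con_closed[OF U(1) s(2) x(1)]]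
      tate_con[OF s(1) m_closed[OF s(3,2)] x(1)] M.mcon_trans[OF U(1) s(2,3) x(1)]
      conj_set_conj_set[OF opn_subset[OF U(1)] s(3,2)] conj_set_conj_set[OF opn_subset[OF U(2)] s(3,2)] x(2) by simp
  qed
  show "scon tate g I U (sres tate I H U X) = sres tate (conj_set G g I) (conj_set G g H) (conj_set G g U) (scon tate g H U X)"
    if s: "sp H U" "sp I U" "I \<subseteq> H" "g \<in> carrier G" "X \<in> carrier (sobj tate H U)" for H U I g X
  proof -
    note o = spD(1)[OF s(1)] spD(1)[OF s(2)]
    obtain x where x: "x \<in> cc H" "X = nc H U x" using s by (auto simp: tate_carrier)
    show ?thesis using tate_res[OF s(1-3) x(1)] tate_con[OF s(2,4) res_closed[OF o s(3) x(1)]]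
      tate_con[OF s(1,4) x(1)] tate_res[OF sp_conj[OF s(1,4)] sp_conj[OF s(2,4)] conj_set_mono[OF s(3)] con_closed[OF o(1) s(4) x(1)]]
      M.mcon_mres[OF o s(3,4) x(1)] x(2) by simp
  qed
  show "scon tate g H U (sind tate H U I V X) =
      sind tate (conj_set G g H) (conj_set G g U) (conj_set G g I) (conj_set G g V) (scon tate g I V X)"
    if s: "sp H U" "sp I V" "I \<subseteq> H" "V \<subseteq> U" "g \<in> carrier G" "X \<in> carrier (sobj tate I V)" for H U I V g X
  proof -
    note o = spD(1)[OF s(1)] spD(1)[OF s(2)]
    obtain x where x: "x \<in> cc I" "X = nc I V x" using s by (auto simp: tate_carrier)
    show ?thesis using tate_ind[OF s(1-4) x(1)] tate_con[OF s(1,5) ind_closed[OF o s(3) x(1)]]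
      tate_con[OF s(2,5) x(1)] tate_ind[OF sp_conj[OF s(1,5)] sp_conj[OF s(2,5)] conj_set_mono[OF s(3)] conj_set_mono[OF s(4)] con_closed[OF o(2) s(5) x(1)]]
      M.mcon_mind[OF o s(3,5) x(1)] x(2) by simp
  qed
qed

end

section \<open>The isomorphism of functors and the lattice of norm groups\<close>

context cft_injective
begin

lemma FN_closed: assumes "sp H U" "X \<in> carrier (Ab H U)" shows "FN H U X \<in> carrier (sobj tate H U)"
proof -
  obtain h where h: "h \<in> H" "X = pic H U h" using assms Ab_carrier[OF assms(1)] by auto
  obtain y where y: "rec H U h y" using rec_ex[OF assms(1) h(1)] by blast
  then show ?thesis using FN_value[OF assms(1) y] rec_closed[OF assms(1) y] h by (simp add: tate_carrier)
qed

lemma FN_hom: assumes sp: "sp H U" shows "FN H U \<in> hom (Ab H U) (sobj tate H U)"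
  unfolding hom_def mem_Collect_eq
proof (intro conjI ballI funcsetI)
  show "FN H U X \<in> carrier (sobj tate H U)" if "X \<in> carrier (Ab H U)" for X by (rule FN_closed[OF sp that])
  fix X Y assume "X \<in> carrier (Ab H U)" "Y \<in> carrier (Ab H U)"
  then obtain h k where h: "h \<in> H" "X = pic H U h" "k \<in> H" "Y = pic H U k" using Ab_carrier[OF sp] by auto
  obtain y z where y: "rec H U h y" "rec H U k z" using rec_ex[OF sp] h by metis
  have "FN H U (X \<otimes>\<^bsub>Ab H U\<^esub> Y) = nc H U (y \<cdot>\<^bsub>H\<^esub> z)"
    using FN_value[OF sp rec_mult[OF sp y]] pic_mult[OF sp h(1,3)] h by simp
  then show "FN H U (X \<otimes>\<^bsub>Ab H U\<^esub> Y) = FN H U X \<otimes>\<^bsub>sobj tate H U\<^esub> FN H U Y"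
    using nc_mult[OF sp] rec_closed[OF sp] y FN_value[OF sp] h by simp
qed

lemma FN_inj: assumes sp: "sp H U" shows "inj_on (FN H U) (carrier (Ab H U))"
proof (rule inj_onI)
  fix X Y assume XY: "X \<in> carrier (Ab H U)" "Y \<in> carrier (Ab H U)" "FN H U X = FN H U Y"
  note U = spD[OF sp]
  interpret A: comm_group "Ab H U" by (rule Ab_comm[OF sp])
  obtain h k where h: "h \<in> H" "X = pic H U h" "k \<in> H" "Y = pic H U k" using Ab_carrier[OF sp] XY by auto
  obtain y z where y: "rec H U h y" "rec H U k z" using rec_ex[OF sp] h by metis
  have "nc H U y = nc H U z" using FN_value[OF sp] y XY h by simp
  then have "y \<cdot>\<^bsub>H\<^esub> invC H z \<in> Nm H U" using norm_class_eq_iff[OF U(1-3)] rec_closed[OF sp] y by simp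
  then have "pic H U (h \<otimes> inv k) = \<one>\<^bsub>Ab H U\<^esub>"
    by (rule rec_kernel[OF sp rec_mult[OF sp y(1) rec_inv[OF sp y(2)]]])
  then have "X \<otimes>\<^bsub>Ab H U\<^esub> inv\<^bsub>Ab H U\<^esub> Y = \<one>\<^bsub>Ab H U\<^esub>" using h U(1) pic_mult[OF sp] pic_inv[OF sp] by simp
  then show "X = Y" using XY(1,2) by (metis A.inv_closed A.inv_equality A.inv_inv)
qed

lemma FN_bij: assumes sp: "sp H U" shows "bij_betw (FN H U) (carrier (Ab H U)) (carrier (sobj tate H U))"
  unfolding bij_betw_def
proof (intro conjI FN_inj[OF sp] equalityI)
  show "FN H U ` carrier (Ab H U) \<subseteq> carrier (sobj tate H U)" using FN_closed[OF sp] by blast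
  show "carrier (sobj tate H U) \<subseteq> FN H U ` carrier (Ab H U)"
  proof
    fix Y assume "Y \<in> carrier (sobj tate H U)"
    then obtain y where y: "y \<in> cc H" "Y = nc H U y" by (auto simp: tate_carrier)
    then obtain h where h: "rec H U h y" using rsurj[OF sp] by (auto simp: rsurj_def)
    then show "Y \<in> FN H U ` carrier (Ab H U)"
      using FN_value[OF sp h] pic_closed[OF sp rec_mem[OF sp h]] y by (metis imageI)
  qed
qed

lemma pic_eqI: assumes sp: "sp H U" and "rec H U h y" "rec H U k y" shows "pic H U h = pic H U k"
  using inj_onD[OF FN_inj[OF sp]] FN_value[OF sp] assms pic_closed[OF sp] rec_mem[OF sp] by metis

text \<open>All elements of a class share a reciprocity value, and injectivity at the target makes
  their images equal. So the set under \<open>the_elem\<close> is a singleton, by reciprocity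
  instead of a computation in quotients.\<close>

lemma pi_ind:
  assumes s: "sp H U" "sp I V" "I \<subseteq> H" "V \<subseteq> U" and h: "h \<in> I"
  shows "sind (pi_functor G) H U I V (pic I V h) = pic H U h"
proof -
  obtain y where y: "rec I V h y" using rec_ex[OF s(2) h] by blast
  have "pic H U k = pic H U h" if "k \<in> \<Union> (pic I V h)" for k
  proof -
    have "k \<in> I" "pic I V h = pic I V k" using that mem_Union_pic[OF s(2) h] by auto
    then have "rec I V k y" by (rule rec_pic[OF s(2) y])
    then show ?thesis using pic_eqI[OF s(1) rec_ind[OF s] rec_ind[OF s y]] by blast
  qed
  moreover have "h \<in> \<Union> (pic I V h)" using mem_Union_pic[OF s(2) h] h by simp
  ultimately have "pic H U ` \<Union> (pic I V h) = {pic H U h}" by blast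
  then show ?thesis by (simp add: pi_functor_def)
qed

lemma pi_con:
  assumes s: "sp H U" "g \<in> carrier G" and h: "h \<in> H"
  shows "scon (pi_functor G) g H U (pic H U h) = pic (conj_set G g H) (conj_set G g U) (g \<otimes> h \<otimes> inv g)"
proof -
  let ?p = "\<lambda>h. pic (conj_set G g H) (conj_set G g U) (g \<otimes> h \<otimes> inv g)"
  obtain y where y: "rec H U h y" using rec_ex[OF s(1) h] by blast
  have "?p k = ?p h" if "k \<in> \<Union> (pic H U h)" for k
  proof -
    have "k \<in> H" "pic H U h = pic H U k" using that mem_Union_pic[OF s(1) h] by auto
    then have "rec H U k y" by (rule rec_pic[OF s(1) y])
    then show ?thesis using pic_eqI[OF sp_conj[OF s] rec_con[OF s] rec_con[OF s y]] by blast
  qed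
  moreover have "h \<in> \<Union> (pic H U h)" using mem_Union_pic[OF s(1) h] h by simp
  ultimately have "?p ` \<Union> (pic H U h) = {?p h}" by blast
  then show ?thesis by (simp add: pi_functor_def)
qed

text \<open>As in \<open>pi_ind\<close>: the transfer is constant on a class because each of its
  values there corresponds to the restriction of the same \<open>y\<close>.\<close>

lemma pi_res:
  assumes s: "sp H U" "sp I U" "I \<subseteq> H" and y: "rec H U h y"
  shows "\<exists>k. rec I U k (res I H y) \<and> sres (pi_functor G) I H U (pic H U h) = pic I U k"
proof -
  have h: "h \<in> H" by (rule rec_mem[OF s(1) y])
  obtain k where k: "rec I U k (res I H y)" using transfer_rec[OF s y] by blast
  let ?t = "group_transfer (Q H U) (carrier (Q I U))"
  have "?t X = pic I U k" if X: "X \<in> pic H U h" for X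
  proof -
    interpret D: normal "derived (Q H U) (carrier (Q H U))" "Q H U" by (rule Q_derived_normal[OF s(1)])
    have "U #> h \<in> carrier (Q H U)" using h Q_carrier[OF s(1)] by auto
    then have "X \<in> carrier (Q H U)"
      using X D.r_coset_subset_G[OF D.subset] unfolding pi_class_def ab_proj_def by blast
    then obtain x where x: "x \<in> H" "X = U #> x" using Q_carrier[OF s(1)] by auto
    have "x \<in> X" using x opn_carrier[OF spD(1)[OF s(1)]] rcos_self opnD(1)[OF spD(2)[OF s(1)]] by blast
    then have "x \<in> \<Union> (pic H U h)" using X by blast
    then have "pic H U h = pic H U x" using mem_Union_pic[OF s(1) h] by simp
    then have "rec H U x y" by (rule rec_pic[OF s(1) y x(1)])
    then obtain k' where k': "?t X = pic I U k'" "rec I U k' (res I H y)" using transfer_rec[OF s] x by blast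
    then show ?thesis using pic_eqI[OF s(2) k'(2) k] by simp
  qed
  moreover have "pic H U h \<noteq> {}" using mem_Union_pic[OF s(1) h, of h] h by auto
  ultimately have "?t ` pic H U h = {pic I U k}" by (auto simp: image_iff)
  then show ?thesis using k by (auto simp: pi_functor_def)
qed

lemma isomorphism: "spectrum_isomorphism G T (pi_functor G) tate FN"
proof (rule spectrum_isomorphism_transport[OF tate_functor]; unfold pi_sobj)
  show "comm_group (Ab H U)" if "sp H U" for H U by (rule Ab_comm[OF that])
  show "FN H U \<in> hom (Ab H U) (sobj tate H U)" if "sp H U" for H U by (rule FN_hom[OF that])
  show "bij_betw (FN H U) (carrier (Ab H U)) (carrier (sobj tate H U))" if "sp H U" for H U by (rule FN_bij[OF that])
  show "sres (pi_functor G) I H U X \<in> carrier (Ab I U) \<and> FN I U (sres (pi_functor G) I H U X) = sres tate I H U (FN H U X)"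
    if s: "sp H U" "sp I U" "I \<subseteq> H" "X \<in> carrier (Ab H U)" for H U I X
  proof -
    obtain h where h: "h \<in> H" "X = pic H U h" using s Ab_carrier[OF s(1)] by auto
    obtain y where y: "rec H U h y" using rec_ex[OF s(1) h(1)] by blast
    obtain k where k: "rec I U k (res I H y)" "sres (pi_functor G) I H U X = pic I U k" using pi_res[OF s(1-3) y] h by blast
    show ?thesis using k FN_value[OF s(2) k(1)] FN_value[OF s(1) y] tate_res[OF s(1-3) rec_closed[OF s(1) y]] h
        pic_closed[OF s(2) rec_mem[OF s(2) k(1)]] by simp
  qed
  show "sind (pi_functor G) H U I V X \<in> carrier (Ab H U) \<and> FN H U (sind (pi_functor G) H U I V X) = sind tate H U I V (FN I V X)"
    if s: "sp H U" "sp I V" "I \<subseteq> H" "V \<subseteq> U" "X \<in> carrier (Ab I V)" for H U I V X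
  proof -
    obtain h where h: "h \<in> I" "X = pic I V h" using s Ab_carrier[OF s(2)] by auto
    obtain y where y: "rec I V h y" using rec_ex[OF s(2) h(1)] by blast
    have "h \<in> H" using h s by blast
    then show ?thesis using pi_ind[OF s(1-4) h(1)] FN_value[OF s(2) y] FN_value[OF s(1) rec_ind[OF s(1-4) y]]
        tate_ind[OF s(1-4) rec_closed[OF s(2) y]] h pic_closed[OF s(1)] by simp
  qed
  show "scon (pi_functor G) g H U X \<in> carrier (Ab (conj_set G g H) (conj_set G g U)) \<and>
      FN (conj_set G g H) (conj_set G g U) (scon (pi_functor G) g H U X) = scon tate g H U (FN H U X)"
    if s: "sp H U" "g \<in> carrier G" "X \<in> carrier (Ab H U)" for H U g X
  proof -
    obtain h where h: "h \<in> H" "X = pic H U h" using s Ab_carrier[OF s(1)] by auto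
    obtain y where y: "rec H U h y" using rec_ex[OF s(1) h(1)] by blast
    show ?thesis using pi_con[OF s(1,2) h(1)] FN_value[OF s(1) y] FN_value[OF sp_conj[OF s(1,2)] rec_con[OF s(1,2) y]]
        tate_con[OF s(1,2) rec_closed[OF s(1) y]] h pic_closed[OF sp_conj[OF s(1,2)] conj_setI[OF h(1)]] by simp
  qed
qed

text \<open>An element of \<open>U\<close> is compared through the common refinement
  \<open>U \<inter> V\<close>: its value there is a norm from \<open>U\<close>, hence from
  \<open>V\<close>, and injectivity for \<open>V\<close> applies.\<close>

lemma Nm_mono_iff:
  assumes U: "sp H U" "comm_group (Q H U)" and V: "sp H V" "comm_group (Q H V)" and sub: "Nm H U \<subseteq> Nm H V"
  shows "U \<subseteq> V"
proof
  fix u assume u: "u \<in> U"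
  have UV: "sp H (U \<inter> V)" by (rule sp_Int[OF U(1) V(1)])
  obtain a where a: "rec H (U \<inter> V) u a" using rec_ex[OF UV] u spD(3)[OF U(1)] by blast
  have "a \<in> Nm H V" using rec_Nm[OF U(1) rec_coarsen[OF U(1) UV _ a] u] sub by blast
  then show "u \<in> V" using rbij_abelian[OF V] rec_coarsen[OF V(1) UV _ a] unfolding rinj_def by blast
qed

lemma Nm_Int:
  assumes U: "sp H U" "comm_group (Q H U)" and V: "sp H V" "comm_group (Q H V)"
  shows "Nm H (U \<inter> V) = Nm H U \<inter> Nm H V"
proof
  note u = spD[OF U(1)] and v = spD[OF V(1)]
  have UV: "sp H (U \<inter> V)" by (rule sp_Int[OF U(1) V(1)])
  show "Nm H (U \<inter> V) \<subseteq> Nm H U \<inter> Nm H V"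
    using Nm_trans[OF u(1,2) spD(2)[OF UV] _ u(3)] Nm_trans[OF v(1,2) spD(2)[OF UV] _ v(3)] by blast
  show "Nm H U \<inter> Nm H V \<subseteq> Nm H (U \<inter> V)"
  proof
    fix a assume a: "a \<in> Nm H U \<inter> Nm H V"
    then have "a \<in> cc H" using Nm_carrier[OF u(1-3)] by blast
    \<comment> \<open>Surjectivity at the level of the intersection turns the common norm into a
      lift, which then has to lie in both subgroups.\<close>
    then obtain h where h: "rec H (U \<inter> V) h a" using rsurj[OF UV] by (auto simp: rsurj_def)
    have "h \<in> U" using rbij_abelian[OF U] rec_coarsen[OF U(1) UV _ h] a unfolding rinj_def by blast
    moreover have "h \<in> V" using rbij_abelian[OF V] rec_coarsen[OF V(1) UV _ h] a unfolding rinj_def by blast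
    ultimately show "a \<in> Nm H (U \<inter> V)" using rec_Nm[OF UV h] by blast
  qed
qed

text \<open>At the level of \<open>U \<inter> V\<close>, a norm from the product is a value of some
  \<open>h = x \<otimes> y\<close>. The values of \<open>x\<close> and \<open>y\<close> are norms
  from \<open>U\<close> and \<open>V\<close>, and the error is a norm from the intersection.\<close>

lemma Nm_prod:
  assumes U: "sp H U" and V: "sp H V" and UVp: "sp H (U <#> V)" "comm_group (Q H (U <#> V))"
  shows "Nm H (U <#> V) = Nm H U <#>\<^bsub>mobj C H\<^esub> Nm H V"
proof
  note u = spD[OF U] and v = spD[OF V] and p = spD[OF UVp(1)]
  note c = opn_carrier[OF u(1)]
  interpret H: comm_group "mobj C H" by (rule cg[OF u(1)])
  have UV: "sp H (U \<inter> V)" by (rule sp_Int[OF U V])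
  have sub: "U \<subseteq> U <#> V" "V \<subseteq> U <#> V"
  proof -
    have mem: "x \<otimes> y \<in> U <#> V" if "x \<in> U" "y \<in> V" for x y using that by (auto simp: set_mult_def)
    have "x \<in> U <#> V" if "x \<in> U" for x
      using mem[OF that opn_closed(1)[OF v(2)]] opn_carrier[OF u(2) that] by simp
    then show "U \<subseteq> U <#> V" by blast
    have "x \<in> U <#> V" if "x \<in> V" for x
      using mem[OF opn_closed(1)[OF u(2)] that] opn_carrier[OF v(2) that] by simp
    then show "V \<subseteq> U <#> V" by blast
  qed
  have N: "Nm H U \<subseteq> Nm H (U <#> V)" "Nm H V \<subseteq> Nm H (U <#> V)"
    using Nm_trans[OF u(1) p(2) u(2) sub(1) p(3)] Nm_trans[OF u(1) p(2) v(2) sub(2) p(3)] .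
  show "Nm H U <#>\<^bsub>mobj C H\<^esub> Nm H V \<subseteq> Nm H (U <#> V)"
    using N Nm_mult[OF u(1) p(2,3)] by (auto simp: set_mult_def)
  show "Nm H (U <#> V) \<subseteq> Nm H U <#>\<^bsub>mobj C H\<^esub> Nm H V"
  proof
    fix a assume a: "a \<in> Nm H (U <#> V)"
    then have ac: "a \<in> cc H" using Nm_carrier[OF u(1) p(2,3)] by blast
    then obtain h where h: "rec H (U \<inter> V) h a" using rsurj[OF UV] by (auto simp: rsurj_def)
    have "h \<in> U <#> V"
      using rbij_abelian[OF UVp] rec_coarsen[OF UVp(1) UV _ h] a sub unfolding rinj_def by blast
    then obtain x y where x: "x \<in> U" "y \<in> V" "h = x \<otimes> y" by (auto simp: set_mult_def)
    obtain ax ay where r: "rec H (U \<inter> V) x ax" "rec H (U \<inter> V) y ay"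
      using rec_ex[OF UV] x u(3) v(3) by (meson subsetD)
    have axU: "ax \<in> Nm H U" using rec_Nm[OF U rec_coarsen[OF U UV _ r(1)] x(1)] by blast
    have ayV: "ay \<in> Nm H V" using rec_Nm[OF V rec_coarsen[OF V UV _ r(2)] x(2)] by blast
    have xyc: "ax \<in> cc H" "ay \<in> cc H" using rec_closed[OF UV] r by auto
    define n where "n = a \<cdot>\<^bsub>H\<^esub> invC H (ax \<cdot>\<^bsub>H\<^esub> ay)"
    have "n \<in> Nm H (U \<inter> V)" unfolding n_def using rec_unique[OF UV h] rec_mult[OF UV r] x(3) by simp
    then have nV: "n \<in> Nm H V" using Nm_trans[OF v(1,2) spD(2)[OF UV] _ v(3)] by blast
    have nc: "n \<in> cc H" using ac xyc by (simp add: n_def)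
    have "a = n \<cdot>\<^bsub>H\<^esub> (ax \<cdot>\<^bsub>H\<^esub> ay)" using ac xyc by (simp add: n_def H.m_assoc)
    then have "a = ax \<cdot>\<^bsub>H\<^esub> (ay \<cdot>\<^bsub>H\<^esub> n)" using nc xyc by (simp add: H.m_ac)
    moreover have "ay \<cdot>\<^bsub>H\<^esub> n \<in> Nm H V" using ayV nV Nm_mult[OF v(1-3)] by blast
    ultimately show "a \<in> Nm H U <#>\<^bsub>mobj C H\<^esub> Nm H V" using axU unfolding set_mult_def by blast
  qed
qed

lemma class_field_theory: "class_field_theory G T C FN"
  unfolding class_field_theory_def
proof (intro conjI allI impI isomorphism)
  fix H L
  assume L: "opn H \<and> (\<forall>U\<in>L. sp H U \<and> comm_group (Q H U)) \<and> (\<forall>U\<in>L. \<forall>V\<in>L. U <#> V \<in> L \<and> U \<inter> V \<in> L)"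
  then have LU: "sp H U" "comm_group (Q H U)" if "U \<in> L" for U using that by auto
  show "inj_on (Nm H) L"
  proof (rule inj_onI)
    fix U V assume "U \<in> L" "V \<in> L" "Nm H U = Nm H V"
    then show "U = V" using Nm_mono_iff[OF LU[of U] LU[of V]] Nm_mono_iff[OF LU[of V] LU[of U]]
      by (simp add: subset_antisym)
  qed
  show "\<forall>U\<in>L. subgroup (Nm H U) (mobj C H)"
  proof
    fix U assume "U \<in> L"
    note U = spD[OF LU(1)[OF this]]
    show "subgroup (Nm H U) (mobj C H)" by (rule Nm_subgroup[OF U(1-3)])
  qed
  show "\<forall>U\<in>L. \<forall>V\<in>L. Nm H (U <#> V) = Nm H U <#>\<^bsub>mobj C H\<^esub> Nm H V \<and> Nm H (U \<inter> V) = Nm H U \<inter> Nm H V"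
  proof (intro ballI conjI)
    fix U V assume UV: "U \<in> L" "V \<in> L"
    then have "U <#> V \<in> L" using L by simp
    then show "Nm H (U <#> V) = Nm H U <#>\<^bsub>mobj C H\<^esub> Nm H V"
      using Nm_prod[OF LU(1)[OF UV(1)] LU(1)[OF UV(2)]] LU by simp
    show "Nm H (U \<inter> V) = Nm H U \<inter> Nm H V" by (rule Nm_Int[OF LU[OF UV(1)] LU[OF UV(2)]])
  qed
qed

end

theorem corollary4p4p20:
  fixes P :: "nat set"
    and G :: "'g monoid" and T :: "'g topology"
    and \<Omega> :: "'w monoid" and S :: "'w topology" and \<omega> :: 'w
    and d :: "'g \<Rightarrow> 'w"
    and C :: "('g, 'c) mackey" and v :: "'g set \<Rightarrow> 'c \<Rightarrow> 'w"
  assumes "P \<noteq> {}" and "\<And>p. p \<in> P \<Longrightarrow> prime p"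
    and "pro_P_group P G T"
    and "topological_group \<Omega> S"
    and "topologically_isomorphic \<Omega> S (ZP_group P) (ZP_topology P)"
    and "topological_generator \<Omega> S \<omega>"
    and "d \<in> hom G \<Omega>" and "d ` carrier G = carrier \<Omega>" and "continuous_map T S d"
    and "cohomological_mackey_functor G T C"
    and "v \<in> valuations G T \<Omega> \<omega> d C (generate \<Omega> {\<omega>})"
    and cfa_unramified: "\<And>H U. \<lbrakk>spectrum_pair G T H U; inertia G \<Omega> d H \<subseteq> U\<rbrakk>
      \<Longrightarrow> class_field_axiom G C H U"
    and cfa_ramified: "\<And>H U. \<lbrakk>spectrum_pair G T H U; cyclic_group (subgrp G H Mod U);
        prime (order (subgrp G H Mod U)); res_degree \<Omega> d H U = 1\<rbrakk>
      \<Longrightarrow> class_field_axiom G C H U"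
    and descent: "\<And>H U. \<lbrakk>spectrum_pair G T H U; inertia G \<Omega> d H \<subseteq> U\<rbrakk>
      \<Longrightarrow> galois_descent C H U"
    and injective: "\<And>H U. \<lbrakk>spectrum_pair G T H U; cyclic_group (subgrp G H Mod U);
        prime (order (subgrp G H Mod U)); res_degree \<Omega> d H U = 1\<rbrakk>
      \<Longrightarrow> inj_on (fesenko_neukirch_morphism P G T \<Omega> \<omega> d C v H U)
            (carrier (abelianization (subgrp G H Mod U)))"
  shows "fesenko_neukirch_datum G T \<Omega> \<omega> d C v \<and>
    class_field_theory G T C (fesenko_neukirch_morphism P G T \<Omega> \<omega> d C v)"
proof -
  obtain \<psi> where \<psi>: "\<psi> \<in> iso \<Omega> (ZP_group P)" "homeomorphic_map S (ZP_topology P) \<psi>"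
    using assms(5) by (auto simp: topologically_isomorphic_def)
  have pf: "profinite_group G T" using assms(3) by (simp add: pro_P_group_def)
  have G: "group G" "topological_group G T" "compact_space T"
    using pf by (auto simp: profinite_group_def topological_group_def)
  have W: "group \<Omega>" using assms(4) by (simp add: topological_group_def)
  \<comment> \<open>Here the topological isomorphism with the P-adic integers is consumed: it yields
    commutativity, torsion-freeness, failure of \<open>p\<close>-divisibility and the Hausdorff
    property of the value group.\<close>
  have dm: "degree_map G T \<Omega> S P \<omega> d"
  proof (intro degree_map.intro degree_map_axioms.intro compact_group.intro compact_group_axioms.intro
      topo_group.intro topo_group_axioms.intro grp.intro)
    show "prime_factors (order (G Mod U)) \<subseteq> P" if "open_subgroup G T U" "U \<lhd> G" for U
      using assms(3) that by (auto simp: pro_P_group_def)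
    show "x = \<one>\<^bsub>\<Omega>\<^esub>" if "x \<in> carrier \<Omega>" "n > 0" "x [^]\<^bsub>\<Omega>\<^esub> (n::nat) = \<one>\<^bsub>\<Omega>\<^esub>" for x n
      using ZP_torsion_free[OF assms(2) W \<psi>(1) that] .
    show "(\<lambda>x. x [^]\<^bsub>\<Omega>\<^esub> p) ` carrier \<Omega> \<noteq> carrier \<Omega>" if "p \<in> P" for p
      using ZP_not_divisible[OF assms(2) W \<psi>(1) that] .
    show "comm_group \<Omega>" using ZP_comm[OF assms(2) W \<psi>(1)] .
    show "Hausdorff_space S" using ZP_Hausdorff[OF \<psi>(2)] .
  qed (use assms G W in auto)
  have cft: "cft_injective G T \<Omega> S P \<omega> d C v"
    by (intro cft_injective.intro cft.intro dm assms(10) cft_axioms.intro cft_injective_axioms.intro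
        assms(11) cfa_unramified cfa_ramified descent injective)
  show ?thesis
    using cft.datum[OF cft_injective.axioms(1)[OF cft]] cft_injective.class_field_theory[OF cft]
    by (rule conjI)
qed

end
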